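(* Let $T>0$, $l>0$, $0<\alpha<1$, and let $p\in C^1[0,l]$ with $p(x)>0$ on $[0,l]$ and $q\in C[0,l]$ with $q(x)\ge 0$ on $[0,l]$. Let $\varphi\in C^1[0,l]$ with $\varphi(0)=\varphi(l)=0$, let $h\in C^1[0,l]$ with $h(0)=h(l)=0$ and $h\not\equiv 0$ on $[0,l]$, and let $g\in AC^2[0,T]$. Let $X_n$, $n\in\mathbb N$, be the orthonormal eigenfunctions described in the context, put $\varphi_n=\int_0^l\varphi(x)X_n(x)\,dx$ and $h_n=\int_0^l h(x)X_n(x)\,dx$, and assume $$\int_0^l \varphi(x)h(x)\,dx=g(0)=\sum_{n=1}^\infty h_n\varphi_n .$$ Then there exists exactly one function $f\in AC[0,T]$ that solves the following inverse problem: the solution $u\in C^{\alpha,2}_{t,x}(\Omega_T)\cap C(\overline{\Omega_T})$ of the initial-boundary value problem $$\partial_t^\alpha u-\frac{\partial}{\partial x}\Big(p(x)\frac{\partial u}{\partial x}\Big)+q(x)u=f(t)h(x)\quad\text{in }\Omega_T,$$ $$u(0,x)=\varphi(x),\ 0\le x\le l,\qquad u(t,0)=u(t,l)=0,\ 0\le t\le T,$$ satisfies the overdetermination condition $$\int_0^l h(x)u(t,x)\,dx=g(t),\qquad 0\le t\le T.$$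
   Context: $\Omega_T=\{(t,x): 0<t\le T,\ 0<x<l\}$, and $\overline{\Omega_T}=[0,T]\times[0,l]$ is its closure. For $0<\alpha<1$, $\partial_t^\alpha$ is the Caputo fractional derivative in $t$: $$\partial_t^\alpha u(t,x)=I_{0+}^{1-\alpha}u_t(t,x)=\frac1{\Gamma(1-\alpha)}\int_0^t\frac{u_\tau(\tau,x)}{(t-\tau)^\alpha}\,d\tau,$$ where $I_{0+}^{\alpha}u(t,x)=\frac{1}{\Gamma(\alpha)}\int_0^t (t-\tau)^{\alpha-1}u(\tau,x)\,d\tau$ is the Riemann–Liouville fractional integral in $t$. $C^{\alpha,2}_{t,x}(\Omega_T)=\{v\in C(\Omega_T):\ \partial_t^\alpha v,\ v_{xx}\in C(\Omega_T)\}$. $AC[0,T]$ is the class of absolutely continuous functions on $[0,T]$. For $n\ge 1$, $AC^n[0,T]$ is the class of functions that are continuously differentiable on $[0,T]$ up to order $n-1$ and whose $(n-1)$-th derivative belongs to $AC[0,T]$. $(X_n)_{n\ge1}$ is the complete orthonormal system in $L^2(0,l)$ of eigenfunctions of the Sturm–Liouville problem $(p(x)X'(x))'-q(x)X(x)=-\lambda X(x)$ on $(0,l)$, $X(0)=X(l)=0$, with corresponding eigenvalues $0<\lambda_1<\lambda_2<\cdots$, $\lambda_n\to\infty$. *)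

theory Defs
  imports "HOL-Analysis.Analysis"
begin

definition abs_continuous_on :: "real \<Rightarrow> real \<Rightarrow> (real \<Rightarrow> real) \<Rightarrow> bool" where
  "abs_continuous_on a b f \<longleftrightarrow>
     (\<forall>\<epsilon>>0. \<exists>\<delta>>0. \<forall>D :: (real \<times> real) set.
        finite D \<longrightarrow> D \<subseteq> {(s, t). a \<le> s \<and> s \<le> t \<and> t \<le> b} \<longrightarrow>
        disjoint_family_on (\<lambda>(s, t). {s<..<t}) D \<longrightarrow>
        (\<Sum>(s, t)\<in>D. t - s) < \<delta> \<longrightarrow>
        (\<Sum>(s, t)\<in>D. \<bar>f t - f s\<bar>) < \<epsilon>)"

text \<open>Derivatives on \<open>[a, b]\<close> are one-sided at the endpoints, so nothing depends on the values
  of a function outside the interval. \<open>F k\<close> is the \<open>k\<close>-th derivative.\<close>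

definition derivatives_on :: "nat \<Rightarrow> real \<Rightarrow> real \<Rightarrow> (real \<Rightarrow> real) \<Rightarrow> (nat \<Rightarrow> real \<Rightarrow> real) \<Rightarrow> bool" where
  "derivatives_on n a b f F \<longleftrightarrow>
     (\<forall>x\<in>{a..b}. F 0 x = f x) \<and>
     (\<forall>k<n. \<forall>x\<in>{a..b}. (F k has_real_derivative F (Suc k) x) (at x within {a..b}))"

definition Ck_on :: "nat \<Rightarrow> real \<Rightarrow> real \<Rightarrow> (real \<Rightarrow> real) \<Rightarrow> bool" where
  "Ck_on n a b f \<longleftrightarrow> (\<exists>F. derivatives_on n a b f F \<and> continuous_on {a..b} (F n))"

text \<open>The class \<open>AC\<^sup>n[a, b]\<close>, for \<open>n \<ge> 1\<close>.\<close>

definition ACn_on :: "nat \<Rightarrow> real \<Rightarrow> real \<Rightarrow> (real \<Rightarrow> real) \<Rightarrow> bool" where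
  "ACn_on n a b f \<longleftrightarrow>
     (\<exists>F. derivatives_on (n - 1) a b f F \<and> continuous_on {a..b} (F (n - 1)) \<and>
          abs_continuous_on a b (F (n - 1)))"

text \<open>Riemann--Liouville integral at the point \<open>t\<close>. The integrals are Lebesgue integrals with respect
  to the completed measure; the predicate says that the integral converges (absolutely).\<close>

definition RL_integrable :: "real \<Rightarrow> (real \<Rightarrow> real) \<Rightarrow> real \<Rightarrow> bool" where
  "RL_integrable \<beta> w t \<longleftrightarrow>
     integrable (lebesgue_on {0..t}) (\<lambda>\<tau>. (t - \<tau>) powr (\<beta> - 1) * w \<tau>)"

definition RL_integral :: "real \<Rightarrow> (real \<Rightarrow> real) \<Rightarrow> real \<Rightarrow> real" where
  "RL_integral \<beta> w t =
     1 / Gamma \<beta> * (\<integral>\<tau>. (t - \<tau>) powr (\<beta> - 1) * w \<tau> \<partial>lebesgue_on {0..t})"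

definition caputo :: "real \<Rightarrow> (real \<Rightarrow> real) \<Rightarrow> real \<Rightarrow> real" where
  "caputo \<alpha> v t = RL_integral (1 - \<alpha>) (deriv v) t"

text \<open>Existence of the Caputo derivative at \<open>t > 0\<close>: the derivative of \<open>v\<close> is understood almost
  everywhere, for \<open>v\<close> locally absolutely continuous on \<open>(0, t]\<close> (mere differentiability almost
  everywhere would give every Cantor-type function a vanishing Caputo derivative), and the singular
  integral must converge. Any \<open>v\<close> that is differentiable everywhere on \<open>(0, t]\<close> with
  convergent integral qualifies.\<close>

definition caputo_exists :: "real \<Rightarrow> (real \<Rightarrow> real) \<Rightarrow> real \<Rightarrow> bool" where
  "caputo_exists \<alpha> v t \<longleftrightarrow>
     (\<forall>s\<in>{0<..<t}. abs_continuous_on s t v) \<and> RL_integrable (1 - \<alpha>) (deriv v) t"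

text \<open>\<open>\<Omega>\<^sub>T\<close> contains the final time \<open>T\<close>. Functions of time and space are curried, time first.\<close>

definition Omega :: "real \<Rightarrow> real \<Rightarrow> (real \<times> real) set" where
  "Omega T l = {0<..T} \<times> {0<..<l}"

definition Omega_closed :: "real \<Rightarrow> real \<Rightarrow> (real \<times> real) set" where
  "Omega_closed T l = {0..T} \<times> {0..l}"

definition C_alpha_2 :: "real \<Rightarrow> real \<Rightarrow> real \<Rightarrow> (real \<Rightarrow> real \<Rightarrow> real) \<Rightarrow> bool" where
  "C_alpha_2 \<alpha> T l v \<longleftrightarrow>
     continuous_on (Omega T l) (\<lambda>(t, x). v t x) \<and>
     (\<forall>(t, x)\<in>Omega T l. caputo_exists \<alpha> (\<lambda>s. v s x) t) \<and>
     continuous_on (Omega T l) (\<lambda>(t, x). caputo \<alpha> (\<lambda>s. v s x) t) \<and>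
     (\<forall>(t, x)\<in>Omega T l. v t field_differentiable at x \<and> deriv (v t) field_differentiable at x) \<and>
     continuous_on (Omega T l) (\<lambda>(t, x). deriv (deriv (v t)) x)"

definition ibvp_solution ::
  "real \<Rightarrow> real \<Rightarrow> real \<Rightarrow> (real \<Rightarrow> real) \<Rightarrow> (real \<Rightarrow> real) \<Rightarrow> (real \<Rightarrow> real) \<Rightarrow> (real \<Rightarrow> real) \<Rightarrow>
   (real \<Rightarrow> real) \<Rightarrow> (real \<Rightarrow> real \<Rightarrow> real) \<Rightarrow> bool" where
  "ibvp_solution \<alpha> T l p q \<phi> h f u \<longleftrightarrow>
     C_alpha_2 \<alpha> T l u \<and>
     continuous_on (Omega_closed T l) (\<lambda>(t, x). u t x) \<and>
     (\<forall>(t, x)\<in>Omega T l.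
        caputo \<alpha> (\<lambda>s. u s x) t - deriv (\<lambda>y. p y * deriv (u t) y) x + q x * u t x = f t * h x) \<and>
     (\<forall>x\<in>{0..l}. u 0 x = \<phi> x) \<and>
     (\<forall>t\<in>{0..T}. u t 0 = 0 \<and> u t l = 0)"

text \<open>\<open>f\<close> solves the inverse problem: the problem with source \<open>f(t) h(x)\<close> has a solution, unique as
  a function on the closed rectangle, and this solution satisfies the overdetermination condition.\<close>

definition solves_inverse_problem ::
  "real \<Rightarrow> real \<Rightarrow> real \<Rightarrow> (real \<Rightarrow> real) \<Rightarrow> (real \<Rightarrow> real) \<Rightarrow> (real \<Rightarrow> real) \<Rightarrow> (real \<Rightarrow> real) \<Rightarrow>
   (real \<Rightarrow> real) \<Rightarrow> (real \<Rightarrow> real) \<Rightarrow> bool" where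
  "solves_inverse_problem \<alpha> T l p q \<phi> h g f \<longleftrightarrow>
     (\<exists>u. ibvp_solution \<alpha> T l p q \<phi> h f u \<and>
          (\<forall>v. ibvp_solution \<alpha> T l p q \<phi> h f v \<longrightarrow> (\<forall>(t, x)\<in>Omega_closed T l. v t x = u t x)) \<and>
          (\<forall>t\<in>{0..T}. (\<integral>x. h x * u t x \<partial>lebesgue_on {0..l}) = g t))"

definition SL_eigenfunction ::
  "real \<Rightarrow> (real \<Rightarrow> real) \<Rightarrow> (real \<Rightarrow> real) \<Rightarrow> real \<Rightarrow> (real \<Rightarrow> real) \<Rightarrow> bool" where
  "SL_eigenfunction l p q \<mu> X \<longleftrightarrow>
     continuous_on {0..l} X \<and>
     (\<forall>x\<in>{0<..<l}.
        X field_differentiable at x \<and>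
        (\<lambda>y. p y * deriv X y) field_differentiable at x \<and>
        deriv (\<lambda>y. p y * deriv X y) x - q x * X x = - \<mu> * X x) \<and>
     X 0 = 0 \<and> X l = 0 \<and> (\<exists>x\<in>{0..l}. X x \<noteq> 0)"

definition complete_orthonormal_L2 :: "real \<Rightarrow> (nat \<Rightarrow> real \<Rightarrow> real) \<Rightarrow> bool" where
  "complete_orthonormal_L2 l X \<longleftrightarrow>
     (\<forall>n. X n \<in> borel_measurable (lebesgue_on {0..l}) \<and>
          integrable (lebesgue_on {0..l}) (\<lambda>x. (X n x)\<^sup>2)) \<and>
     (\<forall>m n. (\<integral>x. X m x * X n x \<partial>lebesgue_on {0..l}) = (if m = n then 1 else 0)) \<and>
     (\<forall>v. v \<in> borel_measurable (lebesgue_on {0..l}) \<longrightarrow>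
          integrable (lebesgue_on {0..l}) (\<lambda>x. (v x)\<^sup>2) \<longrightarrow>
          (\<forall>n. (\<integral>x. v x * X n x \<partial>lebesgue_on {0..l}) = 0) \<longrightarrow>
          (AE x in lebesgue_on {0..l}. v x = 0))"

text \<open>Eigenfunctions and eigenvalues are indexed from \<open>0\<close>.\<close>

definition SL_eigensystem ::
  "real \<Rightarrow> (real \<Rightarrow> real) \<Rightarrow> (real \<Rightarrow> real) \<Rightarrow> (nat \<Rightarrow> real) \<Rightarrow> (nat \<Rightarrow> real \<Rightarrow> real) \<Rightarrow> bool" where
  "SL_eigensystem l p q ev X \<longleftrightarrow>
     (\<forall>n. SL_eigenfunction l p q (ev n) (X n)) \<and>
     0 < ev 0 \<and> strict_mono ev \<and> filterlim ev at_top sequentially \<and>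
     complete_orthonormal_L2 l X"

end

theory Submission
  imports Defs
begin

text \<open>Expanding in eigenfunctions, the solution of the initial-boundary value problem is
  \<open>u = \<Sum>n. (\<phi>\<^sub>n E\<^sub>n + h\<^sub>n k\<^sub>n * f) X\<^sub>n\<close>, where \<open>E\<^sub>n\<close> and \<open>k\<^sub>n\<close> are the Mittag-Leffler relaxation
  functions for \<open>\<lambda>\<^sub>n\<close>. For \<open>f = f(0) + \<integral> w\<close> with \<open>w\<close> integrable, the positivity of \<open>k\<^sub>n\<close> bounds the
  coefficients, and the energy form of the operator, by Bessel's inequality for \<open>\<Sum>n. \<lambda>\<^sub>n \<psi>\<^sub>n\<^sup>2\<close>
  and the bound on \<open>\<Sum>n. X\<^sub>n(x)\<^sup>2 / \<lambda>\<^sub>n\<close>, yields uniform convergence. A maximum principle for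
  the Caputo derivative makes \<open>u\<close> unique.

  The overdetermination condition becomes \<open>K * f = g - \<Sum>n. \<phi>\<^sub>n h\<^sub>n E\<^sub>n\<close> with
  \<open>K = \<Sum>n. h\<^sub>n\<^sup>2 k\<^sub>n\<close>, a Volterra equation of the first kind. Convolving with the Abel kernel of
  order \<open>1 - \<alpha>\<close> and differentiating turns it into the second-kind equation
  \<open>\<parallel>h\<parallel>\<^sup>2 f = \<partial>\<^sup>\<alpha> g + \<Sum>n. \<lambda>\<^sub>n \<phi>\<^sub>n h\<^sub>n E\<^sub>n + L * f\<close> with
  \<open>L = \<Sum>n. \<lambda>\<^sub>n h\<^sub>n\<^sup>2 k\<^sub>n\<close> integrable, which has exactly one solution; it is absolutely continuous
  since \<open>g\<close> is \<open>AC\<^sup>2\<close>.\<close>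

subsection \<open>Absolutely continuous functions and their densities\<close>

text \<open>In \<open>caputo_exists\<close> derivatives are understood almost everywhere: it asks
  for local absolute continuity away from 0 and a convergent singular integral. Hence the real
  analysis at the start. An absolutely continuous function has an integrable density (Radon-Nikodym)
  and is differentiable almost everywhere with that derivative (Lebesgue), so a Caputo derivative
  becomes the convolution of \<open>gk (1 - \<alpha>)\<close> with a density.

  The data lie only in the energy space: \<open>ev n * (coeff v n)\<^sup>2\<close> is summable,
  while \<open>ev n * coeff v n\<close> need not be square summable. Every further factor
  \<open>ev n\<close> has to be paid for by the kernels: \<open>ev n * ml\<close> has integral at
  most 1 for all n, and \<open>ev n * ml0\<close> is bounded by a multiple of t powr (- \<alpha>).
  The second estimate degenerates at t = 0, so the equation is obtained for t > 0 while u is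
  continuous up to t = 0.

  The initial value of f is not free. At t = 0 the fractional derivative of g and the memory term
  vanish and the relaxation functions equal 1, which leaves f(0) = \<open>A0 / N\<close>.\<close>

definition interval_family :: "real \<Rightarrow> real \<Rightarrow> (real \<times> real) set \<Rightarrow> bool" where
  "interval_family x y D \<longleftrightarrow> finite D \<and> D \<subseteq> {(s, t). x \<le> s \<and> s \<le> t \<and> t \<le> y} \<and>
     disjoint_family_on (\<lambda>(s, t). {s<..<t}) D"

definition family_variation :: "(real \<Rightarrow> real) \<Rightarrow> (real \<times> real) set \<Rightarrow> real" where
  "family_variation f D = (\<Sum>(s, t)\<in>D. \<bar>f t - f s\<bar>)"

lemma abs_continuous_on_alt:
  "abs_continuous_on a b f \<longleftrightarrow>
     (\<forall>\<epsilon>>0. \<exists>\<delta>>0. \<forall>D. interval_family a b D \<longrightarrow> (\<Sum>(s, t)\<in>D. t - s) < \<delta> \<longrightarrow> family_variation f D < \<epsilon>)"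
  unfolding abs_continuous_on_def interval_family_def family_variation_def imp_conjL by (rule refl)

lemma abs_continuous_onE:
  assumes "abs_continuous_on a b f" "0 < \<epsilon>"
  obtains \<delta> where "0 < \<delta>"
    "\<And>D. interval_family a b D \<Longrightarrow> (\<Sum>(s, t)\<in>D. t - s) < \<delta> \<Longrightarrow> family_variation f D < \<epsilon>"
proof -
  have "\<exists>\<delta>>0. \<forall>D. interval_family a b D \<longrightarrow> (\<Sum>(s, t)\<in>D. t - s) < \<delta> \<longrightarrow> family_variation f D < \<epsilon>"
    using assms unfolding abs_continuous_on_alt by simp
  then show thesis
    by (elim exE conjE) (rule that, assumption, elim allE impE, assumption+)
qed

lemma abs_continuous_onI:
  assumes "\<And>\<epsilon>. 0 < \<epsilon> \<Longrightarrow> \<exists>\<delta>>0. \<forall>D. interval_family a b D \<longrightarrow> (\<Sum>(s, t)\<in>D. t - s) < \<delta> \<longrightarrow> family_variation f D < \<epsilon>"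
  shows "abs_continuous_on a b f"
  unfolding abs_continuous_on_alt by (intro allI impI) (rule assms)

lemma interval_family_empty [simp]: "interval_family x y {}"
  by (simp add: interval_family_def disjoint_family_on_def)

lemma interval_family_mono: "interval_family x y D \<Longrightarrow> x' \<le> x \<Longrightarrow> y \<le> y' \<Longrightarrow> interval_family x' y' D"
  unfolding interval_family_def by (auto; fastforce)

text \<open>Absolute continuity is phrased with sets of pairs, so an indexed family could lose terms
  when it is collapsed to a set. Nondegenerate disjoint intervals are distinct, hence nothing is
  lost among them; degenerate ones contribute 0 to both sums and are left out of
  \<open>J\<close>.\<close>

lemma indexed_interval_family:
  assumes "finite I" and st: "\<And>i. i \<in> I \<Longrightarrow> x \<le> s i \<and> s i \<le> t i \<and> t i \<le> y"
    and dj: "disjoint_family_on (\<lambda>i. {s i<..<t i}) I"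
  obtains D where "interval_family x y D"
    "\<And>f. family_variation f D = (\<Sum>i\<in>I. \<bar>f (t i) - f (s i)\<bar>)" "(\<Sum>(s, t)\<in>D. t - s) = (\<Sum>i\<in>I. t i - s i)"
proof -
  define J where "J = {i\<in>I. s i < t i}"
  define D where "D = (\<lambda>i. (s i, t i)) ` J"
  have J: "finite J" "J \<subseteq> I" using assms by (auto simp: J_def)
  have "inj_on (\<lambda>i. (s i, t i)) J"
  proof (rule inj_onI, rule ccontr)
    fix i j assume ij: "i \<in> J" "j \<in> J" "(s i, t i) = (s j, t j)" "i \<noteq> j"
    then have "{s i<..<t i} \<inter> {s j<..<t j} = {}"
      using dj J unfolding disjoint_family_on_def by blast
    moreover have "(s i + t i)/2 \<in> {s i<..<t i}" using ij by (auto simp: J_def)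
    ultimately show False using ij by auto
  qed
  then have sums: "(\<Sum>p\<in>D. h (fst p) (snd p)) = (\<Sum>i\<in>J. h (s i) (t i))" for h :: "real \<Rightarrow> real \<Rightarrow> real"
    unfolding D_def by (subst sum.reindex) auto
  have ext: "(\<Sum>i\<in>J. h (s i) (t i)) = (\<Sum>i\<in>I. h (s i) (t i))" if "\<And>a. h a a = 0" for h :: "real \<Rightarrow> real \<Rightarrow> real"
  proof (rule sum.mono_neutral_left)
    show "\<forall>i\<in>I - J. h (s i) (t i) = 0"
    proof
      fix i assume "i \<in> I - J"
      then have "s i = t i" using st[of i] by (auto simp: J_def)
      then show "h (s i) (t i) = 0" using that by simp
    qed
  qed (use assms J in auto)
  show thesis
  proof
    show "interval_family x y D"
      unfolding interval_family_def
    proof (intro conjI)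
      show "disjoint_family_on (\<lambda>(s, t). {s<..<t}) D"
        unfolding disjoint_family_on_def
      proof (intro ballI impI)
        fix m n assume mn: "m \<in> D" "n \<in> D" "m \<noteq> n"
        then obtain i j where ij: "i \<in> J" "j \<in> J" "m = (s i, t i)" "n = (s j, t j)" by (auto simp: D_def)
        then have "i \<noteq> j" using mn by auto
        then have "{s i<..<t i} \<inter> {s j<..<t j} = {}"
          using dj J ij unfolding disjoint_family_on_def by blast
        then show "(case m of (s, t) \<Rightarrow> {s<..<t}) \<inter> (case n of (s, t) \<Rightarrow> {s<..<t}) = {}" using ij by simp
      qed
      show "finite D" using J by (simp add: D_def)
      show "D \<subseteq> {(s, t). x \<le> s \<and> s \<le> t \<and> t \<le> y}"
        using st J by (auto simp: D_def)
    qed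
    show "family_variation f D = (\<Sum>i\<in>I. \<bar>f (t i) - f (s i)\<bar>)" for f
      using sums[of "\<lambda>a b. \<bar>f b - f a\<bar>"] ext[of "\<lambda>a b. \<bar>f b - f a\<bar>"]
      by (simp add: family_variation_def case_prod_unfold)
    show "(\<Sum>(s, t)\<in>D. t - s) = (\<Sum>i\<in>I. t i - s i)"
      using sums[of "\<lambda>a b. b - a"] ext[of "\<lambda>a b. b - a"] by (simp add: case_prod_unfold)
  qed
qed

lemma interval_family_length:
  assumes "interval_family x y D" "x \<le> y"
  shows "(\<Sum>(s, t)\<in>D. t - s) \<le> y - x"
proof -
  have D: "finite D" "D \<subseteq> {(s, t). x \<le> s \<and> s \<le> t \<and> t \<le> y}" "disjoint_family_on (\<lambda>(s, t). {s<..<t}) D"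
    using assms by (auto simp: interval_family_def)
  have "(\<Sum>(s, t)\<in>D. t - s) = (\<Sum>p\<in>D. measure lborel (case p of (s, t) \<Rightarrow> {s<..<t}))"
    using D by (intro sum.cong) auto
  also have "\<dots> = measure lborel (\<Union>p\<in>D. (case p of (s, t) \<Rightarrow> {s<..<t}))"
    using D by (intro measure_finite_Union[symmetric]) (auto split: prod.splits)
  also have "\<dots> \<le> measure lborel {x..y}"
    using D assms by (intro measure_mono_fmeasurable) (auto simp: fmeasurable_def split: prod.splits)
  finally show ?thesis using assms by simp
qed

text \<open>Every interval is clipped at \<open>y\<close> from both sides, by \<open>min y\<close>
  and by \<open>max y\<close>. Clipping shrinks the open intervals, so disjointness survives, and
  for an interval that straddles \<open>y\<close> the triangle inequality gives the bound.\<close>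

lemma interval_family_split:
  assumes D: "interval_family x z D" and "x \<le> y" "y \<le> z"
  obtains D1 D2 where "interval_family x y D1" "interval_family y z D2"
    "family_variation f D \<le> family_variation f D1 + family_variation f D2"
proof -
  have fin: "finite D" and D': "\<And>p. p \<in> D \<Longrightarrow> x \<le> fst p \<and> fst p \<le> snd p \<and> snd p \<le> z"
    and dj: "disjoint_family_on (\<lambda>p. {fst p<..<snd p}) D"
    using D by (auto simp: interval_family_def case_prod_unfold)
  have djm: "disjoint_family_on (\<lambda>p. {g (fst p)<..<g (snd p)}) D"
    if "\<And>p u. g (fst p) < u \<Longrightarrow> u < g (snd p) \<Longrightarrow> fst p < u \<and> u < snd p" for g
    unfolding disjoint_family_on_def
  proof (intro ballI impI)
    fix p q assume pq: "p \<in> D" "q \<in> D" "p \<noteq> q"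
    have "{g (fst p)<..<g (snd p)} \<subseteq> {fst p<..<snd p}" "{g (fst q)<..<g (snd q)} \<subseteq> {fst q<..<snd q}"
      using that[of p] that[of q] by (metis greaterThanLessThan_iff subsetI)+
    moreover have "{fst p<..<snd p} \<inter> {fst q<..<snd q} = {}"
      using dj pq unfolding disjoint_family_on_def by blast
    ultimately show "{g (fst p)<..<g (snd p)} \<inter> {g (fst q)<..<g (snd q)} = {}" by blast
  qed
  obtain D1 where D1: "interval_family x y D1"
    "\<And>f. family_variation f D1 = (\<Sum>p\<in>D. \<bar>f (min y (snd p)) - f (min y (fst p))\<bar>)"
    apply (rule indexed_interval_family[of D x "\<lambda>p. min y (fst p)" "\<lambda>p. min y (snd p)" y])
    subgoal by (rule fin)
    subgoal using D' \<open>x \<le> y\<close> by (fastforce)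
    subgoal by (rule djm) (auto simp: min_def split: if_splits)
    by blast
  obtain D2 where D2: "interval_family y z D2"
    "\<And>f. family_variation f D2 = (\<Sum>p\<in>D. \<bar>f (max y (snd p)) - f (max y (fst p))\<bar>)"
    apply (rule indexed_interval_family[of D y "\<lambda>p. max y (fst p)" "\<lambda>p. max y (snd p)" z])
    subgoal by (rule fin)
    subgoal using D' \<open>y \<le> z\<close> by (fastforce)
    subgoal by (rule djm) (auto simp: max_def split: if_splits)
    by blast
  have "family_variation f D = (\<Sum>p\<in>D. \<bar>f (snd p) - f (fst p)\<bar>)"
    by (simp add: family_variation_def case_prod_unfold)
  also have "\<dots> \<le> (\<Sum>p\<in>D. \<bar>f (min y (snd p)) - f (min y (fst p))\<bar> + \<bar>f (max y (snd p)) - f (max y (fst p))\<bar>)"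
    by (intro sum_mono) (use D' in \<open>force simp: min_def max_def\<close>)
  finally have "family_variation f D \<le> family_variation f D1 + family_variation f D2"
    by (simp add: sum.distrib D1 D2)
  with D1 D2 show thesis using that by blast
qed

text \<open>Take \<delta> for the tolerance 1. Pieces of length \<delta>/2 carry variation below 1
  each, and finitely many of them cover \<open>[a, b]\<close>; the induction on \<open>n\<close>
  cuts off the last piece \<open>[y, x]\<close>.\<close>

lemma abs_continuous_on_bounded_variation:
  assumes "abs_continuous_on a b f" "a \<le> b"
  shows "bdd_above (family_variation f ` {D. interval_family a b D})"
proof -
  obtain \<delta> where "\<delta> > 0" and \<delta>: "\<And>D. interval_family a b D \<Longrightarrow> (\<Sum>(s, t)\<in>D. t - s) < \<delta> \<Longrightarrow> family_variation f D < 1"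
    by (rule abs_continuous_onE[OF assms(1) zero_less_one]) blast
  have *: "family_variation f D \<le> real n"
    if "interval_family a x D" "a \<le> x" "x \<le> b" "x \<le> a + real n * (\<delta>/2)" for n x D
    using that
  proof (induction n arbitrary: x D)
    case 0
    then have "interval_family a b D" "(\<Sum>(s, t)\<in>D. t - s) = 0"
      using interval_family_mono[of a x D a b] by (auto simp: interval_family_def intro!: sum.neutral)
    have "\<bar>f t - f s\<bar> = 0" if "(s, t) \<in> D" for s t
    proof -
      have "a \<le> s \<and> s \<le> t \<and> t \<le> x" using 0(1) that by (auto simp: interval_family_def)
      then have "s = t" using 0 by simp
      then show ?thesis by simp
    qed
    then show ?case unfolding family_variation_def by (auto intro!: eq_refl sum.neutral)
  next
    case (Suc n)
    define y where "y = min x (a + real n * (\<delta>/2))"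
    have y: "a \<le> y" "y \<le> x" "x - y < \<delta>" "y \<le> a + real n * (\<delta>/2)"
    proof -
      define m where "m = real n * (\<delta>/2)"
      have "real (Suc n) * (\<delta>/2) = \<delta>/2 + m" by (simp add: m_def algebra_simps)
      then have "x \<le> a + (\<delta>/2 + m)" using Suc.prems(4) by metis
      moreover have "0 \<le> m" using \<open>\<delta> > 0\<close> by (simp add: m_def)
      moreover have "y = min x (a + m)" by (simp only: y_def m_def)
      ultimately have "a \<le> y \<and> y \<le> x \<and> x - y < \<delta> \<and> y \<le> a + m"
        using Suc.prems(2) \<open>\<delta> > 0\<close> by (auto simp: min_def)
      then show "a \<le> y" "y \<le> x" "x - y < \<delta>" "y \<le> a + real n * (\<delta>/2)" by (auto simp: m_def)
    qed
    obtain D1 D2 where D: "interval_family a y D1" "interval_family y x D2"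
      "family_variation f D \<le> family_variation f D1 + family_variation f D2"
      by (rule interval_family_split[OF Suc.prems(1) y(1,2)])
    have "family_variation f D2 < 1"
      using interval_family_length[OF D(2)] y D(2) Suc.prems
      by (intro \<delta>) (auto intro: interval_family_mono)
    moreover have "family_variation f D1 \<le> real n"
      using D y Suc.prems by (intro Suc.IH[of y]) auto
    ultimately show ?case using D by simp
  qed
  obtain n where "b \<le> a + real n * (\<delta>/2)"
    using reals_Archimedean3[of "\<delta>/2"] \<open>\<delta> > 0\<close>
    by (metis diff_le_eq add.commute half_gt_zero less_eq_real_def)
  then show ?thesis using *[where x=b and n=n] assms by (auto intro!: bdd_aboveI)
qed

text \<open>The total variation function V. It serves to write f as V - (V - f) with both terms
  nondecreasing.\<close>

definition variation_upto :: "real \<Rightarrow> (real \<Rightarrow> real) \<Rightarrow> real \<Rightarrow> real" where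
  "variation_upto a f x = (SUP D\<in>{D. interval_family a x D}. family_variation f D)"

context
  fixes a b :: real and f :: "real \<Rightarrow> real"
  assumes ac: "abs_continuous_on a b f" and ab: "a \<le> b"
begin

lemma variation_bdd: "x \<le> b \<Longrightarrow> bdd_above (family_variation f ` {D. interval_family a x D})"
  by (rule bdd_above_mono[OF abs_continuous_on_bounded_variation[OF ac ab]])
     (auto intro: interval_family_mono)

lemma variation_upper: "x \<le> b \<Longrightarrow> interval_family a x D \<Longrightarrow> family_variation f D \<le> variation_upto a f x"
  unfolding variation_upto_def by (rule cSUP_upper) (auto intro: variation_bdd)

lemma variation_least: "(\<And>D. interval_family a x D \<Longrightarrow> family_variation f D \<le> c) \<Longrightarrow> variation_upto a f x \<le> c"
  unfolding variation_upto_def by (rule cSUP_least) (use interval_family_empty in blast)+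

lemma variation_increment:
  assumes "a \<le> x" "x \<le> y" "y \<le> b"
    and c: "\<And>D. interval_family x y D \<Longrightarrow> family_variation f D \<le> c"
  shows "variation_upto a f y \<le> variation_upto a f x + c"
proof (rule variation_least)
  fix D assume D: "interval_family a y D"
  obtain D1 D2 where "interval_family a x D1" "interval_family x y D2"
      "family_variation f D \<le> family_variation f D1 + family_variation f D2"
    by (rule interval_family_split[OF D assms(1,2)])
  then show "family_variation f D \<le> variation_upto a f x + c"
    using c[of D2] variation_upper[of x D1] assms by linarith
qed

text \<open>Any family on \<open>[a, x]\<close> may be enlarged by the interval from
  \<open>x\<close> to \<open>y\<close>. The inequality makes both V and V - f nondecreasing.\<close>

lemma variation_dominates:
  assumes "a \<le> x" "x \<le> y" "y \<le> b"
  shows "variation_upto a f x + \<bar>f y - f x\<bar> \<le> variation_upto a f y"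
proof (cases "x = y")
  case False
  have "variation_upto a f x \<le> variation_upto a f y - \<bar>f y - f x\<bar>"
  proof (rule variation_least)
    fix D assume D: "interval_family a x D"
    have n: "(x, y) \<notin> D" using D False assms by (auto simp: interval_family_def)
    have "interval_family a y (insert (x, y) D)"
      using D assms by (fastforce simp: interval_family_def disjoint_family_on_def)
    then have "family_variation f (insert (x, y) D) \<le> variation_upto a f y"
      using assms by (intro variation_upper) auto
    moreover have "family_variation f (insert (x, y) D) = \<bar>f y - f x\<bar> + family_variation f D"
      using n D by (simp add: family_variation_def interval_family_def)
    ultimately show "family_variation f D \<le> variation_upto a f y - \<bar>f y - f x\<bar>" by simp
  qed
  then show ?thesis by simp
qed simp

text \<open>Each interval of a short family is refined by a family inside it that nearly attains the
  increment of V there. All refinements together form one family for f whose total length is no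
  larger, so the \<delta> of f for \<epsilon>/2 serves for V.\<close>

lemma variation_abs_continuous: "abs_continuous_on a b (variation_upto a f)"
  unfolding abs_continuous_on_alt
proof (intro allI impI)
  fix \<epsilon> :: real assume "\<epsilon> > 0"
  then obtain \<delta> where "\<delta> > 0" and \<delta>: "\<And>D. interval_family a b D \<Longrightarrow> (\<Sum>(s, t)\<in>D. t - s) < \<delta> \<Longrightarrow> family_variation f D < \<epsilon>/2"
    by (rule abs_continuous_onE[OF ac half_gt_zero]) blast
  let ?V = "variation_upto a f"
  have "family_variation ?V D < \<epsilon>" if D: "interval_family a b D" "(\<Sum>(s, t)\<in>D. t - s) < \<delta>" for D
  proof -
    \<comment> \<open>The error \<eta> is made once per interval, in all at most \<epsilon>/2; the
      added 1 covers an empty D.\<close>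
    define \<eta> where "\<eta> = \<epsilon> / (2 * (real (card D) + 1))"
    have "\<eta> > 0" using \<open>\<epsilon> > 0\<close> by (simp add: \<eta>_def)
    have fin: "finite D" and D': "\<And>p. p \<in> D \<Longrightarrow> a \<le> fst p \<and> fst p \<le> snd p \<and> snd p \<le> b"
      and dj: "disjoint_family_on (\<lambda>p. {fst p<..<snd p}) D"
      using D by (auto simp: interval_family_def case_prod_unfold)
    have "\<exists>E. interval_family (fst p) (snd p) E \<and> \<bar>?V (snd p) - ?V (fst p)\<bar> \<le> family_variation f E + \<eta>"
      if "p \<in> D" for p
    proof (rule ccontr)
      assume "\<nexists>E. interval_family (fst p) (snd p) E \<and> \<bar>?V (snd p) - ?V (fst p)\<bar> \<le> family_variation f E + \<eta>"
      then have "\<And>E. interval_family (fst p) (snd p) E \<Longrightarrow> family_variation f E \<le> \<bar>?V (snd p) - ?V (fst p)\<bar> - \<eta>"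
        by (metis le_diff_eq linorder_not_less order_less_imp_le)
      then have "?V (snd p) \<le> ?V (fst p) + (\<bar>?V (snd p) - ?V (fst p)\<bar> - \<eta>)"
        using D'[OF that] by (intro variation_increment) auto
      moreover have "?V (fst p) \<le> ?V (snd p)" using variation_dominates[of "fst p" "snd p"] D'[OF that] by auto
      ultimately show False using \<open>\<eta> > 0\<close> by simp
    qed
    then obtain E where E: "\<And>p. p \<in> D \<Longrightarrow> interval_family (fst p) (snd p) (E p)"
      "\<And>p. p \<in> D \<Longrightarrow> \<bar>?V (snd p) - ?V (fst p)\<bar> \<le> family_variation f (E p) + \<eta>"
      by metis
    have finE: "finite (E p)" if "p \<in> D" for p using E(1)[OF that] by (simp add: interval_family_def)
    have E': "fst p \<le> fst q \<and> fst q \<le> snd q \<and> snd q \<le> snd p" if "p \<in> D" "q \<in> E p" for p q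
      using E(1)[OF that(1)] that by (auto simp: interval_family_def)
    have djE: "disjoint_family_on (\<lambda>q. {fst q<..<snd q}) (E p)" if "p \<in> D" for p
      using E(1)[OF that] by (simp add: interval_family_def case_prod_unfold)
    obtain G where G: "interval_family a b G"
      "\<And>f. family_variation f G = (\<Sum>i\<in>Sigma D E. \<bar>f (snd (snd i)) - f (fst (snd i))\<bar>)"
      "(\<Sum>(s, t)\<in>G. t - s) = (\<Sum>i\<in>Sigma D E. snd (snd i) - fst (snd i))"
    proof (rule indexed_interval_family[of "Sigma D E" a "\<lambda>i. fst (snd i)" "\<lambda>i. snd (snd i)" b])
      show "finite (Sigma D E)" using fin finE by auto
      show "a \<le> fst (snd i) \<and> fst (snd i) \<le> snd (snd i) \<and> snd (snd i) \<le> b" if "i \<in> Sigma D E" for i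
        using that D' E' by fastforce
      show "disjoint_family_on (\<lambda>i. {fst (snd i)<..<snd (snd i)}) (Sigma D E)"
        unfolding disjoint_family_on_def
      proof (intro ballI impI)
        fix i j assume i: "i \<in> Sigma D E" and j: "j \<in> Sigma D E" and ne: "i \<noteq> j"
        show "{fst (snd i)<..<snd (snd i)} \<inter> {fst (snd j)<..<snd (snd j)} = {}"
        proof (cases "fst i = fst j")
          case True
          then have "snd i \<noteq> snd j" using ne by (auto simp: prod_eq_iff)
          moreover have "snd i \<in> E (fst i)" "snd j \<in> E (fst i)" "fst i \<in> D" using i j True by auto
          ultimately show ?thesis using djE[of "fst i"] unfolding disjoint_family_on_def by blast
        next
          case False
          then have "{fst (fst i)<..<snd (fst i)} \<inter> {fst (fst j)<..<snd (fst j)} = {}"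
            using dj mem_Sigma_iff[of "fst i" "snd i" D E] mem_Sigma_iff[of "fst j" "snd j" D E] i j
            unfolding disjoint_family_on_def by (metis prod.collapse)
          moreover have "{fst (snd i)<..<snd (snd i)} \<subseteq> {fst (fst i)<..<snd (fst i)}"
            "{fst (snd j)<..<snd (snd j)} \<subseteq> {fst (fst j)<..<snd (fst j)}"
            using E'[of "fst i" "snd i"] E'[of "fst j" "snd j"] i j by auto
          ultimately show ?thesis by blast
        qed
      qed
    qed blast
    have "(\<Sum>(s, t)\<in>G. t - s) = (\<Sum>p\<in>D. \<Sum>q\<in>E p. snd q - fst q)"
      unfolding G by (subst sum.Sigma) (use fin finE in \<open>auto simp: case_prod_unfold\<close>)
    also have "\<dots> \<le> (\<Sum>p\<in>D. snd p - fst p)"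
      using interval_family_length[OF E(1)] D' by (intro sum_mono) (auto simp: case_prod_unfold)
    finally have "(\<Sum>(s, t)\<in>G. t - s) < \<delta>" using D by (simp add: case_prod_unfold)
    then have "family_variation f G < \<epsilon>/2" using \<delta> G by blast
    moreover have "family_variation f G = (\<Sum>p\<in>D. family_variation f (E p))"
      unfolding G(2) unfolding family_variation_def
      by (subst sum.Sigma) (use fin finE in \<open>auto simp: case_prod_unfold\<close>)
    moreover have "family_variation ?V D \<le> (\<Sum>p\<in>D. family_variation f (E p) + \<eta>)"
      unfolding family_variation_def[of ?V] by (auto intro!: sum_mono dest: E(2) simp: case_prod_unfold)
    moreover have "real (card D) * \<eta> \<le> \<epsilon>/2"
    proof -
      have "real (card D) * \<eta> = (real (card D) / (real (card D) + 1)) * (\<epsilon>/2)"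
        by (simp add: \<eta>_def)
      also have "\<dots> \<le> 1 * (\<epsilon>/2)" using \<open>\<epsilon> > 0\<close> by (intro mult_right_mono) auto
      finally show ?thesis by simp
    qed
    ultimately show ?thesis by (simp add: sum.distrib)
  qed
  with \<open>\<delta> > 0\<close> show "\<exists>\<delta>>0. \<forall>D. interval_family a b D \<longrightarrow> (\<Sum>(s, t)\<in>D. t - s) < \<delta> \<longrightarrow> family_variation ?V D < \<epsilon>"
    by blast
qed

end

lemma abs_continuous_on_diff:
  assumes "abs_continuous_on a b f" "abs_continuous_on a b g"
  shows "abs_continuous_on a b (\<lambda>x. f x - g x)"
  unfolding abs_continuous_on_alt
proof (intro allI impI)
  fix \<epsilon> :: real assume "\<epsilon> > 0"
  then have "\<epsilon>/2 > 0" by simp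
  obtain d1 where d1: "d1 > 0" "\<And>D. interval_family a b D \<Longrightarrow> (\<Sum>(s, t)\<in>D. t - s) < d1 \<Longrightarrow> family_variation f D < \<epsilon>/2"
    by (rule abs_continuous_onE[OF assms(1) \<open>\<epsilon>/2 > 0\<close>]) blast
  obtain d2 where d2: "d2 > 0" "\<And>D. interval_family a b D \<Longrightarrow> (\<Sum>(s, t)\<in>D. t - s) < d2 \<Longrightarrow> family_variation g D < \<epsilon>/2"
    by (rule abs_continuous_onE[OF assms(2) \<open>\<epsilon>/2 > 0\<close>]) blast
  have le: "family_variation (\<lambda>x. f x - g x) D \<le> family_variation f D + family_variation g D" for D
    unfolding family_variation_def sum.distrib[symmetric] by (intro sum_mono) auto
  show "\<exists>\<delta>>0. \<forall>D. interval_family a b D \<longrightarrow> (\<Sum>(s, t)\<in>D. t - s) < \<delta> \<longrightarrow> family_variation (\<lambda>x. f x - g x) D < \<epsilon>"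
  proof (intro exI[of _ "min d1 d2"] conjI allI impI)
    fix D assume "interval_family a b D" "(\<Sum>(s, t)\<in>D. t - s) < min d1 d2"
    then show "family_variation (\<lambda>x. f x - g x) D < \<epsilon>"
      using d1(2)[of D] d2(2)[of D] le[of D] by simp
  qed (use d1 d2 in auto)
qed

lemma abs_continuous_on_cong:
  assumes "\<And>x. x \<in> {a..b} \<Longrightarrow> f x = g x"
  shows "abs_continuous_on a b f \<longleftrightarrow> abs_continuous_on a b g"
proof -
  have "family_variation f D = family_variation g D" if "interval_family a b D" for D
    unfolding family_variation_def using that assms by (intro sum.cong) (fastforce simp: interval_family_def)+
  then show ?thesis unfolding abs_continuous_on_alt by (simp cong: imp_cong)
qed

lemma abs_continuous_on_continuous:
  assumes "abs_continuous_on a b f"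
  shows "continuous_on {a..b} f"
  unfolding continuous_on_iff
proof (intro ballI allI impI)
  fix x \<epsilon> :: real assume x: "x \<in> {a..b}" "\<epsilon> > 0"
  obtain d where d: "d > 0" "\<And>D. interval_family a b D \<Longrightarrow> (\<Sum>(s, t)\<in>D. t - s) < d \<Longrightarrow> family_variation f D < \<epsilon>"
    by (rule abs_continuous_onE[OF assms \<open>\<epsilon> > 0\<close>]) blast
  show "\<exists>d>0. \<forall>x'\<in>{a..b}. dist x' x < d \<longrightarrow> dist (f x') (f x) < \<epsilon>"
  proof (intro exI[of _ d] conjI ballI impI)
    fix y assume y: "y \<in> {a..b}" "dist y x < d"
    have "family_variation f {(min x y, max x y)} < \<epsilon>"
      using x y by (intro d(2)) (auto simp: interval_family_def disjoint_family_on_def dist_real_def)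
    then show "dist (f y) (f x) < \<epsilon>"
      by (auto simp: family_variation_def dist_real_def min_def max_def split: if_splits)
  qed (use d in auto)
qed

section \<open>Densities of absolutely continuous functions\<close>

lemma set_integrable_lborel:
  fixes w :: "real \<Rightarrow> real"
  assumes "integrable lborel w" "B \<in> sets borel"
  shows "set_integrable lborel B w"
  unfolding set_integrable_def by (rule integrable_mult_indicator) (use assms in auto)

text \<open>A null set has an open neighbourhood of small Lebesgue measure, and the covering lemma
  exhausts the set by countably many nonoverlapping intervals inside it. Finite subfamilies have
  small total length, hence small variation of G, and this bound passes to the union.\<close>

lemma abs_continuous_outer_measure:
  assumes G: "mono G" "continuous_on UNIV G" and ac: "abs_continuous_on a b G" and "a < b"
    and S: "S \<in> null_sets lborel" "S \<subseteq> {a..b}"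
  shows "emeasure (interval_measure G) S = 0"
proof -
  let ?N = "interval_measure G"
  have bound: "emeasure ?N S \<le> ennreal \<epsilon>" if "\<epsilon> > 0" for \<epsilon> :: real
  proof -
    obtain \<delta> where "\<delta> > 0" and \<delta>: "\<And>D. interval_family a b D \<Longrightarrow> (\<Sum>(s, t)\<in>D. t - s) < \<delta> \<Longrightarrow> family_variation G D < \<epsilon>"
      by (rule abs_continuous_onE[OF ac \<open>\<epsilon> > 0\<close>]) blast
    have Sl: "S \<in> null_sets lebesgue" using S by (simp add: null_sets_completionI)
    then obtain T where T: "open T" "S \<subseteq> T" "T - S \<in> lmeasurable" "emeasure lebesgue (T - S) < ennreal \<delta>"
      using sets_lebesgue_outer_open[of S \<delta>] \<open>\<delta> > 0\<close> by (metis null_setsD2)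
    have "emeasure lebesgue T = emeasure lebesgue ((T - S) \<union> S)" using T by (simp add: Un_absorb2)
    also have "\<dots> = emeasure lebesgue (T - S)"
      using Sl T by (intro emeasure_Un_null_set) auto
    finally have T': "emeasure lborel T < ennreal \<delta>" using T by simp
    \<comment> \<open>The covering lemma tags each interval with a point of S, and S lies in T, so
      this gauge forces every interval into T.\<close>
    have \<gamma>: "gauge (\<lambda>x. if x \<in> T then T else ball x 1)" using T by (auto simp: gauge_def)
    have ab: "S \<subseteq> cbox a b" "box a b \<noteq> {}" using S(2) \<open>a < b\<close> by auto
    obtain \<D> where \<D>: "countable \<D>" "\<Union>\<D> \<subseteq> cbox a b"
      "\<And>K. K \<in> \<D> \<Longrightarrow> interior K \<noteq> {} \<and> (\<exists>c d. K = cbox c d)"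
      "pairwise (\<lambda>A B. interior A \<inter> interior B = {}) \<D>"
      "\<And>K. K \<in> \<D> \<Longrightarrow> \<exists>x \<in> S \<inter> K. K \<subseteq> (if x \<in> T then T else ball x 1)" "S \<subseteq> \<Union>\<D>"
      by (rule covering_lemma[OF ab \<gamma>]) (rule that, assumption+)
    have KT: "K \<subseteq> T" if KD: "K \<in> \<D>" for K
    proof -
      obtain x where "x \<in> S" "K \<subseteq> (if x \<in> T then T else ball x 1)" using \<D>(5)[OF KD] by blast
      then show ?thesis using T(2) by (simp add: subset_iff)
    qed
    have Kf: "K = {Inf K..Sup K} \<and> Inf K < Sup K \<and> interior K = {Inf K<..<Sup K} \<and> a \<le> Inf K \<and> Sup K \<le> b"
      if "K \<in> \<D>" for K
    proof -
      obtain c d where K: "K = cbox c d" "interior K \<noteq> {}" using \<D>(3)[OF \<open>K \<in> \<D>\<close>] by blast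
      then have cd: "c < d" by (simp add: interior_cbox)
      have "{c..d} \<subseteq> {a..b}" using that \<D>(2) K(1) by (metis Union_upper box_real(2) subset_trans)
      moreover have "Inf K = c" "Sup K = d" "K = {c..d}" "interior K = {c<..<d}" using cd K by (simp_all add: interior_cbox)
      ultimately show ?thesis using cd by simp
    qed
    have sub: "{Inf K<..<Sup K} \<subseteq> K" if "K \<in> \<D>" for K
      using Kf[OF that] by (metis interior_subset)
    have meas: "K \<in> sets borel" if "K \<in> \<D>" for K using Kf[OF that] by (metis atLeastAtMost_borel)
    have fin_bound: "emeasure ?N (\<Union>\<E>) \<le> ennreal \<epsilon>" if \<E>: "finite \<E>" "\<E> \<subseteq> \<D>" for \<E>
    proof -
      have dj: "disjoint_family_on (\<lambda>K. {Inf K<..<Sup K}) \<E>"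
        unfolding disjoint_family_on_def
      proof (intro ballI impI)
        fix A B assume AB: "A \<in> \<E>" "B \<in> \<E>" "A \<noteq> B"
        then have "interior A \<inter> interior B = {}" using \<D>(4) \<E>(2) by (auto simp: pairwise_def)
        then show "{Inf A<..<Sup A} \<inter> {Inf B<..<Sup B} = {}" using Kf AB \<E>(2) by (metis subsetD)
      qed
      obtain D where D: "interval_family a b D"
        "\<And>f. family_variation f D = (\<Sum>K\<in>\<E>. \<bar>f (Sup K) - f (Inf K)\<bar>)" "(\<Sum>(s, t)\<in>D. t - s) = (\<Sum>K\<in>\<E>. Sup K - Inf K)"
      proof (rule indexed_interval_family[of \<E> a Inf Sup b])
        show "finite \<E>" by (rule \<E>)
        show "a \<le> Inf K \<and> Inf K \<le> Sup K \<and> Sup K \<le> b" if "K \<in> \<E>" for K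
          using Kf[of K] that \<E>(2) by auto
      qed (rule dj, blast)
      have "ennreal (\<Sum>K\<in>\<E>. Sup K - Inf K) = (\<Sum>K\<in>\<E>. emeasure lborel {Inf K<..<Sup K})"
        using Kf \<E> by (subst sum_ennreal[symmetric]) (auto intro!: sum.cong simp: less_imp_le subset_eq)
      also have "\<dots> = emeasure lborel (\<Union>K\<in>\<E>. {Inf K<..<Sup K})"
        using dj \<E> by (intro sum_emeasure) auto
      also have "\<dots> \<le> emeasure lborel T"
      proof (rule emeasure_mono)
        show "(\<Union>K\<in>\<E>. {Inf K<..<Sup K}) \<subseteq> T"
          using sub KT \<E>(2) by blast
      qed (use T in auto)
      finally have "ennreal (\<Sum>K\<in>\<E>. Sup K - Inf K) < ennreal \<delta>" using T' by simp
      then have "(\<Sum>(s, t)\<in>D. t - s) < \<delta>" using D by (simp add: ennreal_less_iff sum_nonneg Kf[THEN conjunct2, THEN conjunct1, THEN less_imp_le] \<E>(2)[THEN subsetD])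
      then have "family_variation G D < \<epsilon>" by (intro \<delta> D)
      then have lt: "(\<Sum>K\<in>\<E>. \<bar>G (Sup K) - G (Inf K)\<bar>) < \<epsilon>" by (simp add: D)
      \<comment> \<open>The closed intervals may share endpoints, so subadditivity replaces
        additivity; the formula for the mass of a closed interval rests on the continuity of
        G.\<close>
      have "emeasure ?N (\<Union>\<E>) \<le> (\<Sum>K\<in>\<E>. emeasure ?N K)"
        using \<E> emeasure_subadditive_finite[of \<E> "\<lambda>x. x" ?N] meas by auto
      also have "\<dots> = (\<Sum>K\<in>\<E>. ennreal \<bar>G (Sup K) - G (Inf K)\<bar>)"
      proof (rule sum.cong[OF refl])
        fix K assume "K \<in> \<E>"
        then have "K \<in> \<D>" using \<E> by blast
        note K = Kf[OF this, THEN conjunct1] Kf[OF this, THEN conjunct2, THEN conjunct1]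
        have eK: "emeasure ?N K = emeasure ?N {Inf K..Sup K}" using K(1) by (rule arg_cong)
        have "emeasure ?N {Inf K..Sup K} = ennreal (G (Sup K) - G (Inf K))"
          by (rule emeasure_interval_measure_Icc[OF less_imp_le[OF K(2)] monoD[OF G(1)] G(2)])
        moreover have "G (Inf K) \<le> G (Sup K)" by (rule monoD[OF G(1) less_imp_le[OF K(2)]])
        ultimately show "emeasure ?N K = ennreal \<bar>G (Sup K) - G (Inf K)\<bar>" by (simp add: eK)
      qed
      also have "\<dots> = ennreal (\<Sum>K\<in>\<E>. \<bar>G (Sup K) - G (Inf K)\<bar>)" by (rule sum_ennreal) auto
      also have "\<dots> \<le> ennreal \<epsilon>" using lt by (intro ennreal_leI) auto
      finally show ?thesis .
    qed
    show ?thesis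
    proof (cases "\<D> = {}")
      case True then show ?thesis using \<D>(6) by simp
    next
      case False
      let ?U = "\<lambda>n. \<Union>(from_nat_into \<D> ` {..n})"
      have subD: "from_nat_into \<D> ` {..n} \<subseteq> \<D>" for n using from_nat_into[OF False] by auto
      have Um: "?U n \<in> sets borel" for n using meas subD by (intro sets.finite_Union) auto
      have UD: "(\<Union>n. ?U n) = \<Union>\<D>"
      proof
        show "(\<Union>n. ?U n) \<subseteq> \<Union>\<D>" using subD by blast
        show "\<Union>\<D> \<subseteq> (\<Union>n. ?U n)"
        proof
          fix x assume "x \<in> \<Union>\<D>"
          then obtain K where "x \<in> K" "K \<in> \<D>" by blast
          moreover obtain n where "from_nat_into \<D> n = K" using from_nat_into_surj[OF \<D>(1) \<open>K \<in> \<D>\<close>] by blast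
          ultimately show "x \<in> (\<Union>n. ?U n)" by blast
        qed
      qed
      have "emeasure ?N S \<le> emeasure ?N (\<Union>n. ?U n)"
        using \<D>(6) UD Um by (intro emeasure_mono sets.countable_UN) auto
      also have "\<dots> = (SUP n. emeasure ?N (?U n))"
      proof (rule SUP_emeasure_incseq[symmetric])
        show "incseq ?U" by (intro incseq_SucI Union_mono image_mono) auto
      qed (use Um in auto)
      also have "\<dots> \<le> ennreal \<epsilon>"
        by (rule SUP_least) (rule fin_bound, use subD in auto)
      finally show ?thesis .
    qed
  qed
  have "emeasure ?N S \<le> 0"
  proof (rule ennreal_le_epsilon)
    fix e :: real assume "0 < e"
    then have "emeasure ?N S \<le> ennreal e" by (rule bound)
    then show "emeasure ?N S \<le> 0 + ennreal e" by simp
  qed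
  then show ?thesis by simp
qed

text \<open>By the previous lemma the Stieltjes measure of F, restricted to the half-open interval
  from a to b, vanishes on Lebesgue null sets; the density is its Radon-Nikodym derivative.\<close>

lemma monotone_abs_continuous_density:
  fixes F :: "real \<Rightarrow> real"
  assumes "a < b" "mono_on {a..b} F" and ac: "abs_continuous_on a b F"
  obtains w :: "real \<Rightarrow> real" where "integrable lborel w"
    "\<And>x. x \<in> {a..b} \<Longrightarrow> F x - F a = (LINT s:{a..x}|lborel. w s)"
proof -
  \<comment> \<open>\<open>interval_measure\<close> needs a function on the whole line, so the
    argument is clamped to \<open>[a, b]\<close>.\<close>
  define G where "G x = F (max a (min b x))" for x
  have Geq: "G x = F x" if "x \<in> {a..b}" for x using that by (simp add: G_def)
  have "mono G"
  proof (rule monoI)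
    fix x y :: real assume "x \<le> y"
    then show "G x \<le> G y" unfolding G_def using \<open>a < b\<close> by (intro mono_onD[OF assms(2)]) auto
  qed
  have cont: "continuous_on UNIV G"
    unfolding G_def
    by (rule continuous_on_compose2[OF abs_continuous_on_continuous[OF ac]]) (use \<open>a < b\<close> in \<open>auto intro!: continuous_intros\<close>)
  have acG: "abs_continuous_on a b G" using ac abs_continuous_on_cong[of a b G F] Geq by simp
  define M where "M = density (interval_measure G) (indicator {a<..b})"
  have M: "emeasure M A = emeasure (interval_measure G) (A \<inter> {a<..b})" if "A \<in> sets borel" for A :: "real set"
    using that by (simp add: M_def emeasure_density Int_commute flip: indicator_inter_arith)
  have "absolutely_continuous lborel M"
    unfolding absolutely_continuous_def
  proof
    fix A :: "real set" assume A: "A \<in> null_sets lborel"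
    have "A \<inter> {a<..b} \<in> null_sets lborel" using A by (intro null_set_Int2) auto
    then have "emeasure (interval_measure G) (A \<inter> {a<..b}) = 0"
      by (rule abs_continuous_outer_measure[OF \<open>mono G\<close> cont acG \<open>a < b\<close>]) auto
    then show "A \<in> null_sets M" using A M by (auto simp: null_sets_def M_def)
  qed
  then obtain \<nu> where \<nu>: "\<nu> \<in> borel_measurable lborel" "density lborel \<nu> = M"
    using sigma_finite_measure.Radon_Nikodym[OF sigma_finite_lborel, of M] by (auto simp: M_def)
  have nn: "(\<integral>\<^sup>+s. \<nu> s * indicator {a..x} s \<partial>lborel) = ennreal (F x - F a)" if "x \<in> {a..b}" for x
  proof -
    have "(\<integral>\<^sup>+s. \<nu> s * indicator {a..x} s \<partial>lborel) = emeasure M {a..x}"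
      using \<nu> by (simp add: emeasure_density flip: \<nu>(2))
    also have "\<dots> = emeasure (interval_measure G) {a<..x}"
    proof -
      have "{a..x} \<inter> {a<..b} = {a<..x}" using that by auto
      then show ?thesis using M[of "{a..x}"] by simp
    qed
    also have "\<dots> = ennreal (G x - G a)"
    proof (rule emeasure_interval_measure_Ioc)
      show "a \<le> x" using that by simp
      show "G u \<le> G v" if "u \<le> v" for u v using \<open>mono G\<close> that by (rule monoD)
      show "continuous (at_right u) G" for u
        using cont by (simp add: continuous_on_eq_continuous_at continuous_at_imp_continuous_within)
    qed
    finally show ?thesis using Geq that \<open>a < b\<close> by simp
  qed
  have tot: "(\<integral>\<^sup>+s. \<nu> s \<partial>lborel) = ennreal (F b - F a)"
  proof -
    have "(\<integral>\<^sup>+s. \<nu> s \<partial>lborel) = emeasure M UNIV"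
      using \<nu> by (simp add: emeasure_density flip: \<nu>(2))
    also have "\<dots> = emeasure M {a..b}"
    proof -
      have "{a..b} \<inter> {a<..b} = {a<..b}" by auto
      then show ?thesis using M[of UNIV] M[of "{a..b}"] by simp
    qed
    also have "\<dots> = (\<integral>\<^sup>+s. \<nu> s * indicator {a..b} s \<partial>lborel)"
      using \<nu> by (simp add: emeasure_density flip: \<nu>(2))
    finally show ?thesis using nn[of b] \<open>a < b\<close> by simp
  qed
  \<comment> \<open>The total mass \<open>F b - F a\<close> is finite, so \<nu> is finite almost
    everywhere and passing to real values changes it on a null set only.\<close>
  define w where "w s = enn2real (\<nu> s)" for s
  have [measurable]: "\<nu> \<in> borel_measurable borel" using \<nu> by simp
  have wm[measurable]: "w \<in> borel_measurable borel" unfolding w_def by measurable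
  have "AE s in lborel. \<nu> s \<noteq> \<infinity>"
    using tot by (intro nn_integral_noteq_infinite) auto
  then have ae: "AE s in lborel. ennreal (w s) = \<nu> s"
    by eventually_elim (auto simp: w_def ennreal_enn2real_if)
  have "integrable lborel w"
  proof (rule integrableI_nonneg)
    have "(\<integral>\<^sup>+s. ennreal (w s) \<partial>lborel) = (\<integral>\<^sup>+s. \<nu> s \<partial>lborel)" by (rule nn_integral_cong_AE) (rule ae)
    then show "(\<integral>\<^sup>+s. ennreal (w s) \<partial>lborel) < \<infinity>" using tot by simp
  qed (auto simp: w_def)
  moreover have "F x - F a = (LINT s:{a..x}|lborel. w s)" if "x \<in> {a..b}" for x
  proof -
    have "(LINT s:{a..x}|lborel. w s) = enn2real (\<integral>\<^sup>+s. ennreal (indicator {a..x} s *\<^sub>R w s) \<partial>lborel)"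
      unfolding set_lebesgue_integral_def by (rule integral_eq_nn_integral) (auto simp: w_def)
    also have "(\<integral>\<^sup>+s. ennreal (indicator {a..x} s *\<^sub>R w s) \<partial>lborel) = (\<integral>\<^sup>+s. \<nu> s * indicator {a..x} s \<partial>lborel)"
      by (rule nn_integral_cong_AE) (use ae in eventually_elim, auto simp: indicator_def)
    finally show ?thesis using nn[OF that] mono_onD[OF assms(2), of a x] that by simp
  qed
  ultimately show thesis using that by blast
qed

text \<open>Jordan decomposition: the monotone case applies to V and to V - f.\<close>

lemma abs_continuous_density:
  assumes "a < b" and ac: "abs_continuous_on a b f"
  obtains w :: "real \<Rightarrow> real" where "integrable lborel w"
    "\<And>x. x \<in> {a..b} \<Longrightarrow> f x = f a + (LINT s:{a..x}|lborel. w s)"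
proof -
  let ?V = "variation_upto a f"
  have dom: "\<And>x y. a \<le> x \<Longrightarrow> x \<le> y \<Longrightarrow> y \<le> b \<Longrightarrow> ?V x + \<bar>f y - f x\<bar> \<le> ?V y"
    using variation_dominates[OF ac] \<open>a < b\<close> by simp
  have acV: "abs_continuous_on a b ?V" using variation_abs_continuous[OF ac] \<open>a < b\<close> by simp
  have "mono_on {a..b} ?V"
  proof (rule mono_onI)
    fix x y assume "x \<in> {a..b}" "y \<in> {a..b}" "x \<le> y"
    then show "?V x \<le> ?V y" using dom[of x y] by simp
  qed
  then obtain w1 where w1: "integrable lborel w1"
    "\<And>x. x \<in> {a..b} \<Longrightarrow> ?V x - ?V a = (LINT s:{a..x}|lborel. w1 s)"
    by (rule monotone_abs_continuous_density[OF \<open>a < b\<close> _ acV]) blast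
  have "mono_on {a..b} (\<lambda>x. ?V x - f x)"
  proof (rule mono_onI)
    fix x y assume "x \<in> {a..b}" "y \<in> {a..b}" "x \<le> y"
    then show "?V x - f x \<le> ?V y - f y" using dom[of x y] by simp
  qed
  then obtain w2 where w2: "integrable lborel w2"
    "\<And>x. x \<in> {a..b} \<Longrightarrow> (?V x - f x) - (?V a - f a) = (LINT s:{a..x}|lborel. w2 s)"
    by (rule monotone_abs_continuous_density[OF \<open>a < b\<close> _ abs_continuous_on_diff[OF acV ac]]) blast
  show thesis
  proof
    show "integrable lborel (\<lambda>s. w1 s - w2 s)" using w1 w2 by simp
    show "f x = f a + (LINT s:{a..x}|lborel. w1 s - w2 s)" if "x \<in> {a..b}" for x
      using w1(2)[OF that] w2(2)[OF that] w1(1) w2(1)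
      by (subst set_integral_diff) (auto intro!: set_integrable_lborel)
  qed
qed

section \<open>The Lebesgue differentiation theorem on the line\<close>

lemma integral_uniformly_small:
  fixes w :: "real \<Rightarrow> real"
  assumes w: "integrable lborel w" and "0 < \<epsilon>"
  obtains \<delta> where "0 < \<delta>"
    "\<And>A. A \<in> sets borel \<Longrightarrow> emeasure lborel A < ennreal \<delta> \<Longrightarrow> (LINT x:A|lborel. \<bar>w x\<bar>) < \<epsilon>"
proof -
  have [measurable]: "w \<in> borel_measurable borel" using w by auto
  \<comment> \<open>The part of \<open>w\<close> above height n has an integral that tends to 0;
    below that height the integral over A is at most n times the measure of A.\<close>
  have "(\<lambda>n. LINT x|lborel. indicator {x. \<bar>w x\<bar> > real n} x * \<bar>w x\<bar>) \<longlonglongrightarrow> (LINT x|lborel. (\<lambda>_::real. 0::real) x)"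
  proof (rule integral_dominated_convergence)
    show "AE x in lborel. (\<lambda>n. indicator {x. \<bar>w x\<bar> > real n} x * \<bar>w x\<bar>) \<longlonglongrightarrow> 0"
    proof (rule AE_I2)
      fix x
      obtain N where "\<bar>w x\<bar> \<le> real N" using real_arch_simple by blast
      then have "eventually (\<lambda>n. indicator {x. \<bar>w x\<bar> > real n} x * \<bar>w x\<bar> = 0) sequentially"
        by (intro eventually_sequentiallyI[of N]) (auto simp: indicator_def)
      then show "(\<lambda>n. indicator {x. \<bar>w x\<bar> > real n} x * \<bar>w x\<bar>) \<longlonglongrightarrow> 0"
        by (rule tendsto_eventually)
    qed
    show "integrable lborel (\<lambda>x. \<bar>w x\<bar>)" using w by simp
  qed (auto simp: indicator_def)
  then have "eventually (\<lambda>n. (LINT x|lborel. indicator {x. \<bar>w x\<bar> > real n} x * \<bar>w x\<bar>) < \<epsilon>/2) sequentially"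
    using \<open>0 < \<epsilon>\<close> by (intro order_tendstoD) auto
  then obtain n where n: "(LINT x|lborel. indicator {x. \<bar>w x\<bar> > real n} x * \<bar>w x\<bar>) < \<epsilon>/2"
    by (auto simp: eventually_sequentially)
  define \<delta> where "\<delta> = \<epsilon> / (2 * (real n + 1))"
  have "\<delta> > 0" using \<open>0 < \<epsilon>\<close> by (simp add: \<delta>_def)
  have "(LINT x:A|lborel. \<bar>w x\<bar>) < \<epsilon>" if A: "A \<in> sets borel" "emeasure lborel A < ennreal \<delta>" for A
  proof -
    have Af: "emeasure lborel A < \<infinity>" using A(2) by (metis ennreal_less_top order_less_trans infinity_ennreal_def)
    have iA: "integrable lborel (\<lambda>x. real n * indicator A x)" using A Af by (intro integrable_mult_right integrable_real_indicator) auto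
    have iw: "integrable lborel (\<lambda>x. indicator {x. \<bar>w x\<bar> > real n} x * \<bar>w x\<bar>)"
      by (rule Bochner_Integration.integrable_bound[OF integrable_abs[OF w]]) (auto simp: indicator_def)
    have "(LINT x:A|lborel. \<bar>w x\<bar>) \<le> (LINT x|lborel. real n * indicator A x + indicator {x. \<bar>w x\<bar> > real n} x * \<bar>w x\<bar>)"
      unfolding set_lebesgue_integral_def
    proof (rule integral_mono)
      show "integrable lborel (\<lambda>x. indicator A x *\<^sub>R \<bar>w x\<bar>)"
        using set_integrable_lborel[OF integrable_abs[OF w], of A] A by (simp add: set_integrable_def)
      show "integrable lborel (\<lambda>x. real n * indicator A x + indicator {x. \<bar>w x\<bar> > real n} x * \<bar>w x\<bar>)"
        using iA iw by simp
    qed (auto simp: indicator_def)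
    also have "\<dots> = real n * measure lborel A + (LINT x|lborel. indicator {x. \<bar>w x\<bar> > real n} x * \<bar>w x\<bar>)"
      using iA iw A by (subst Bochner_Integration.integral_add) auto
    also have "measure lborel A \<le> \<delta>"
      using A(2) \<open>\<delta> > 0\<close> by (metis enn2real_leI less_imp_le measure_def)
    then have "real n * measure lborel A \<le> real n * \<delta>" by (intro mult_left_mono) auto
    also have "real n * \<delta> \<le> \<epsilon>/2"
    proof -
      have "real n * \<delta> = (real n / (real n + 1)) * (\<epsilon>/2)" by (simp add: \<delta>_def)
      also have "\<dots> \<le> 1 * (\<epsilon>/2)" using \<open>\<epsilon> > 0\<close> by (intro mult_right_mono) auto
      finally show ?thesis by simp
    qed
    finally show ?thesis using n by simp
  qed
  with \<open>\<delta> > 0\<close> that show thesis by blast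
qed

lemma set_integral_split_Icc:
  fixes w :: "real \<Rightarrow> real"
  assumes "integrable lborel w" "a \<le> u" "u \<le> v"
  shows "(LINT s:{a..v}|lborel. w s) - (LINT s:{a..u}|lborel. w s) = (LINT s:{u..v}|lborel. w s)"
proof -
  have "(LINT s:{a..v}|lborel. w s) = (LINT s:{a..u} \<union> {u<..v}|lborel. w s)"
    using assms by (simp add: ivl_disj_un)
  also have "\<dots> = (LINT s:{a..u}|lborel. w s) + (LINT s:{u<..v}|lborel. w s)"
    using assms by (intro set_integral_Un) (auto intro!: set_integrable_lborel)
  also have "(LINT s:{u<..v}|lborel. w s) = (LINT s:{u..v}|lborel. w s)"
    unfolding set_lebesgue_integral_def
    by (rule integral_cong_AE)
       (use assms AE_lborel_singleton[of u] in \<open>auto simp: indicator_def elim!: eventually_mono\<close>)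
  finally show ?thesis by simp
qed

text \<open>Vitali covering argument. Up to a null set, a bounded part of the set is covered by
  disjoint intervals with mean above s, all inside an open set that barely exceeds \<open>A\<close>,
  where w < r. On a finite union U of them s |U| <= r |U| + 2 \<eta>, so |U| is small.\<close>

lemma upper_density_negligible:
  fixes w :: "real \<Rightarrow> real"
  assumes w: "integrable lborel w" and "r < s"
  shows "negligible {x. w x < r \<and> (\<forall>d>0. \<exists>u v. u \<le> x \<and> x \<le> v \<and> u < v \<and> v - u < d \<and>
           s * (v - u) < (LINT y:{u..v}|lborel. w y))}" (is "negligible ?E")
proof -
  have [measurable]: "w \<in> borel_measurable borel" using w by auto
  have "negligible (?E \<inter> {-real n<..<real n})" for n
    unfolding negligible_outer_le
  proof (intro allI impI)
    fix e :: real assume "e > 0"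
    \<comment> \<open>Chosen so that the final estimate (s - r) |U| <= 2 \<eta> reads |U| <=
      e.\<close>
    define \<eta> where "\<eta> = e * (s - r) / 2"
    have "\<eta> > 0" using \<open>e > 0\<close> \<open>r < s\<close> by (simp add: \<eta>_def)
    obtain \<delta>' where \<delta>': "\<delta>' > 0"
      "\<And>A. A \<in> sets borel \<Longrightarrow> emeasure lborel A < ennreal \<delta>' \<Longrightarrow> (LINT x:A|lborel. \<bar>w x\<bar>) < \<eta>"
      by (rule integral_uniformly_small[OF w \<open>\<eta> > 0\<close>]) blast
    \<comment> \<open>On the excess over A both the integral of \<open>w\<close> and |r| times the
      measure have to stay below \<eta>; this accounts for the two copies of \<eta> in the
      estimate.\<close>
    define \<delta> where "\<delta> = min \<delta>' (\<eta> / (\<bar>r\<bar> + 1))"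
    have "\<delta> > 0" using \<delta>' \<open>\<eta> > 0\<close> by (simp add: \<delta>_def)
    define A where "A = {x. w x < r} \<inter> {-real n<..<real n}"
    have A[measurable]: "A \<in> sets borel" unfolding A_def by measurable
    then have "A \<in> sets lebesgue" by (simp add: sets_completionI_sets)
    then obtain T where T: "open T" "A \<subseteq> T" "T - A \<in> lmeasurable" "emeasure lebesgue (T - A) < ennreal \<delta>"
      using sets_lebesgue_outer_open[of A \<delta>] \<open>\<delta> > 0\<close> by metis
    define T' where "T' = T \<inter> {-real n<..<real n}"
    have oT': "open T'" using T by (auto simp: T'_def)
    have [measurable]: "T' \<in> sets borel" using oT' by simp
    have AT: "A \<subseteq> T'" using T by (auto simp: T'_def A_def)
    have TA: "emeasure lborel (T' - A) < ennreal \<delta>"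
    proof -
      have "emeasure lborel (T' - A) = emeasure lebesgue (T' - A)" by simp
      also have "\<dots> \<le> emeasure lebesgue (T - A)" using T(3) by (intro emeasure_mono) (auto simp: T'_def)
      finally show ?thesis using T by simp
    qed
    have ub: "(s - r) * measure lebesgue U \<le> 2 * \<eta>"
      if U[measurable]: "U \<in> sets borel" and "U \<subseteq> T'" and sU: "s * measure lborel U \<le> (LINT y:U|lborel. w y)" for U
    proof -
      have fU: "U \<in> fmeasurable lborel"
      proof (rule fmeasurableI2[of "{-real n..real n}"])
        show "U \<subseteq> {- real n..real n}" using \<open>U \<subseteq> T'\<close> by (auto simp: T'_def)
      qed (auto simp: fmeasurable_def)
      have si: "set_integrable lborel B w" if "B \<in> sets borel" for B
        using w that by (rule set_integrable_lborel)
      have small: "emeasure lborel (U - A) < ennreal \<delta>"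
        using TA emeasure_mono[of "U - A" "T' - A" lborel] \<open>U \<subseteq> T'\<close> by (auto intro: order.strict_trans1)
      have e1: "emeasure lborel (U - A) < ennreal \<delta>'"
        using small by (rule order.strict_trans2) (auto simp: \<delta>_def intro: ennreal_leI)
      have "(LINT y:U - A|lborel. w y) \<le> (LINT y:U - A|lborel. \<bar>w y\<bar>)"
        using si[of "U - A"] by (intro set_integral_mono) (auto simp: set_integrable_abs)
      also have "\<dots> < \<eta>" by (rule \<delta>'(2)) (use e1 in auto)
      finally have a: "(LINT y:U - A|lborel. w y) \<le> \<eta>" by simp
      have fUA: "U \<inter> A \<in> fmeasurable lborel" "U - A \<in> fmeasurable lborel"
        by (rule fmeasurableI2[OF fU]; use A U in force)+
      have "(LINT y:U \<inter> A|lborel. w y) \<le> (LINT y:U \<inter> A|lborel. r)"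
        using si[of "U \<inter> A"] fUA
        by (intro set_integral_mono) (auto simp: A_def set_integrable_def fmeasurable_def intro!: integrable_real_indicator)
      also have "\<dots> = r * measure lborel (U \<inter> A)"
        by (simp add: set_lebesgue_integral_def)
      also have "measure lborel (U \<inter> A) = measure lborel U - measure lborel (U - A)"
      proof -
        have "U \<inter> A \<inter> (U - A) = {}" by auto
        then have "measure lborel (U \<inter> A \<union> (U - A)) = measure lborel (U \<inter> A) + measure lborel (U - A)"
          using fUA by (subst measure_Un3) (auto simp: Int_Diff)
        then show ?thesis by (simp add: Int_Diff_Un)
      qed
      also have "r * (measure lborel U - measure lborel (U - A)) \<le> r * measure lborel U + \<bar>r\<bar> * measure lborel (U - A)"
        using mult_right_mono[OF abs_ge_minus_self[of r] measure_nonneg[of lborel "U - A"]]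
        by (simp add: right_diff_distrib)
      also have "measure lborel (U - A) \<le> \<eta> / (\<bar>r\<bar> + 1)"
      proof -
        have "measure lborel (U - A) \<le> \<delta>"
          using small \<open>\<delta> > 0\<close> by (metis enn2real_leI less_imp_le measure_def)
        then show ?thesis by (simp add: \<delta>_def)
      qed
      then have "r * measure lborel U + \<bar>r\<bar> * measure lborel (U - A) \<le> r * measure lborel U + \<bar>r\<bar> * (\<eta> / (\<bar>r\<bar> + 1))"
        by (intro add_left_mono mult_left_mono) auto
      also have "\<bar>r\<bar> * (\<eta> / (\<bar>r\<bar> + 1)) \<le> \<eta>"
      proof -
        have "\<bar>r\<bar> * (\<eta> / (\<bar>r\<bar> + 1)) = (\<bar>r\<bar> / (\<bar>r\<bar> + 1)) * \<eta>" by simp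
        also have "\<dots> \<le> 1 * \<eta>" using \<open>\<eta> > 0\<close> by (intro mult_right_mono) auto
        finally show ?thesis by simp
      qed
      finally have b: "(LINT y:U \<inter> A|lborel. w y) \<le> r * measure lborel U + \<eta>" by simp
      have "(LINT y:U|lborel. w y) = (LINT y:(U \<inter> A) \<union> (U - A)|lborel. w y)" by (simp add: Int_Diff_Un)
      also have "\<dots> = (LINT y:U \<inter> A|lborel. w y) + (LINT y:U - A|lborel. w y)"
        using si by (intro set_integral_Un) auto
      finally have "s * measure lborel U \<le> r * measure lborel U + 2 * \<eta>" using a b sU by simp
      then show ?thesis by (simp add: algebra_simps)
    qed
    \<comment> \<open>The Vitali theorem speaks of balls, so an interval is stored as centre and
      radius; the point to be covered need not be the centre.\<close>
    define K where "K = {(c, \<rho>). 0 < \<rho> \<and> cball c \<rho> \<subseteq> T' \<and>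
       s * measure lborel (cball c \<rho>) \<le> (LINT y:cball c \<rho>|lborel. w y)}"
    let ?B = "\<lambda>i. cball (fst i) (snd i)"
    obtain C where C: "countable C" "C \<subseteq> K" "pairwise (\<lambda>i j. disjnt (?B i) (?B j)) C"
      "negligible (?E \<inter> {-real n<..<real n} - (\<Union>i\<in>C. ?B i))"
    proof (rule Vitali_covering_theorem_cballs[of K snd "?E \<inter> {-real n<..<real n}" fst])
      show "0 < snd i" if "i \<in> K" for i using that by (auto simp: K_def)
      show "\<exists>i. i \<in> K \<and> x \<in> ?B i \<and> snd i < d" if x: "x \<in> ?E \<inter> {-real n<..<real n}" and "0 < d" for x d
      proof -
        have "x \<in> T'" using x AT by (auto simp: A_def)
        then obtain e where e: "e > 0" "ball x e \<subseteq> T'" using oT' by (auto simp: open_contains_ball)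
        have "min d e > 0" using e \<open>0 < d\<close> by simp
        then obtain u v where uv: "u \<le> x" "x \<le> v" "u < v" "v - u < min d e" "s * (v - u) < (LINT y:{u..v}|lborel. w y)"
          using x by blast
        have cb: "cball ((u + v)/2) ((v - u)/2) = {u..v}"
          by (simp add: cball_eq_atLeastAtMost field_simps)
        have "{u..v} \<subseteq> ball x e" using uv by (auto simp: dist_real_def)
        then have "((u + v)/2, (v - u)/2) \<in> K" using uv e by (auto simp: K_def cb)
        moreover have "(v - u)/2 < d" using uv by simp
        ultimately show ?thesis using uv cb by (intro exI[of _ "((u + v)/2, (v - u)/2)"]) auto
      qed
    qed blast
    have fin: "measure lebesgue (\<Union>\<E>) \<le> e" if \<E>: "finite \<E>" "\<E> \<subseteq> ?B ` C" for \<E>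
    proof -
      obtain C' where C': "finite C'" "C' \<subseteq> C" "\<E> = ?B ` C'" using finite_subset_image[OF \<E>] by blast
      let ?U = "\<Union>i\<in>C'. ?B i"
      have dj: "disjoint_family_on ?B C'"
        using C(3) C'(2) unfolding disjoint_family_on_def pairwise_def disjnt_def by blast
      have fB: "?B i \<in> sets lborel" "emeasure lborel (?B i) \<noteq> \<infinity>" for i
        using emeasure_bounded_finite[OF bounded_cball, of "fst i" "snd i"] by auto
      have "measure lborel ?U = (\<Sum>i\<in>C'. measure lborel (?B i))"
        by (rule measure_finite_Union) (use C' dj fB in auto)
      then have "s * measure lborel ?U = (\<Sum>i\<in>C'. s * measure lborel (?B i))"
        by (simp add: sum_distrib_left)
      also have "\<dots> \<le> (\<Sum>i\<in>C'. LINT y:?B i|lborel. w y)"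
        using C' C(2) by (intro sum_mono) (auto simp: K_def)
      also have "\<dots> = (LINT y:?U|lborel. w y)"
        using dj C' w by (intro set_integral_finite_Union[symmetric]) (auto intro!: set_integrable_lborel)
      finally have "(s - r) * measure lebesgue ?U \<le> 2 * \<eta>"
      proof (intro ub)
        show "?U \<subseteq> T'" using C' C(2) unfolding K_def by fastforce
      qed (use C' in auto)
      also have "\<dots> = (s - r) * e" by (simp add: \<eta>_def)
      finally show ?thesis using \<open>r < s\<close> C' by simp
    qed
    have cnt: "countable (?B ` C)" using C by simp
    have lm: "K \<in> lmeasurable" if "K \<in> ?B ` C" for K using that by auto
    have UC: "(\<Union>(?B ` C)) \<in> lmeasurable" "measure lebesgue (\<Union>(?B ` C)) \<le> e"
      using fmeasurable_Union_bound[OF cnt lm fin] measure_Union_bound[OF cnt lm fin] by auto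
    let ?N = "?E \<inter> {-real n<..<real n} - (\<Union>i\<in>C. ?B i)"
    show "\<exists>T. ?E \<inter> {- real n<..<real n} \<subseteq> T \<and> T \<in> lmeasurable \<and> measure lebesgue T \<le> e"
    proof (intro exI[of _ "(\<Union>(?B ` C)) \<union> ?N"] conjI)
      show "(\<Union>(?B ` C)) \<union> ?N \<in> lmeasurable"
        using UC C(4) by (intro fmeasurable.Un) (auto simp: negligible_imp_measurable)
      have "measure lebesgue ((\<Union>(?B ` C)) \<union> ?N) = measure lebesgue (\<Union>(?B ` C))"
        using UC C(4) by (intro measure_Un_null_set) (auto simp: negligible_iff_null_sets)
      then show "measure lebesgue ((\<Union>(?B ` C)) \<union> ?N) \<le> e" using UC by simp
    qed auto
  qed
  then have "negligible (\<Union>n. ?E \<inter> {-real n<..<real n})" by (intro negligible_Union_nat) auto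
  moreover have "(\<Union>n. ?E \<inter> {-real n<..<real n}) = ?E"
  proof -
    have "\<exists>n. x \<in> {-real n<..<real n}" for x :: real
      using reals_Archimedean2[of "\<bar>x\<bar>"] by (auto simp: abs_less_iff) (metis minus_less_iff)
    then show ?thesis by blast
  qed
  ultimately show ?thesis by simp
qed

text \<open>An upper derivative of the integral above \<open>w x\<close> is separated from
  \<open>w x\<close> by rationals r < s, so countably many negligible sets exclude it; the same for
  -w excludes a lower derivative below \<open>w x\<close>. The intervals only have to contain x,
  which serves one-sided difference quotients on either side.\<close>

lemma lebesgue_differentiation:
  fixes w :: "real \<Rightarrow> real"
  assumes w: "integrable lborel w"
  shows "AE x in lebesgue. \<forall>\<epsilon>>0. \<exists>d>0. \<forall>u v. u \<le> x \<and> x \<le> v \<and> u < v \<and> v - u < d \<longrightarrow>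
           \<bar>(LINT y:{u..v}|lborel. w y) - w x * (v - u)\<bar> \<le> \<epsilon> * (v - u)"
proof -
  let ?E = "\<lambda>w r s. {x. w x < r \<and> (\<forall>d>0. \<exists>u v. u \<le> x \<and> x \<le> v \<and> u < v \<and> v - u < d \<and>
           s * (v - u) < (LINT y:{u..v}|lborel. w y))}"
  let ?Q = "{p \<in> \<rat> \<times> \<rat>. fst p < (snd p :: real)}"
  have cQ: "countable ?Q" by (rule countable_subset[of _ "\<rat> \<times> \<rat>"]) (auto simp: countable_rat)
  have ae: "AE x in lebesgue. \<forall>p\<in>?Q. x \<notin> ?E w (fst p) (snd p)" if "integrable lborel w" for w
  proof (rule AE_ball_countable'[OF _ cQ])
    fix p assume "p \<in> ?Q"
    then have "negligible (?E w (fst p) (snd p))" using upper_density_negligible[OF that, of "fst p" "snd p"] by auto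
    then show "AE x in lebesgue. x \<notin> ?E w (fst p) (snd p)"
      by (intro AE_not_in) (simp add: negligible_iff_null_sets)
  qed
  have unit_step: "\<exists>d>0. \<forall>u v. u \<le> x \<and> x \<le> v \<and> u < v \<and> v - u < d \<longrightarrow> (LINT y:{u..v}|lborel. w y) \<le> (w x + \<epsilon>) * (v - u)"
    if x: "\<forall>p\<in>?Q. x \<notin> ?E w (fst p) (snd p)" and "\<epsilon> > 0" for w x \<epsilon>
  proof -
    obtain r where r: "r \<in> \<rat>" "w x < r" "r < w x + \<epsilon>" using Rats_dense_in_real[of "w x" "w x + \<epsilon>"] \<open>\<epsilon> > 0\<close> by auto
    obtain s where s: "s \<in> \<rat>" "r < s" "s < w x + \<epsilon>" using Rats_dense_in_real[of r "w x + \<epsilon>"] r by auto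
    have "(r, s) \<in> ?Q" using r s by auto
    from bspec[OF x this] have "x \<notin> ?E w r s" by (simp only: fst_conv snd_conv not_False_eq_True)
    then have nx: "\<not> (\<forall>d>0. \<exists>u v. u \<le> x \<and> x \<le> v \<and> u < v \<and> v - u < d \<and> s * (v - u) < (LINT y:{u..v}|lborel. w y))"
      using r by simp
    have "\<exists>d>0. \<forall>u v. u \<le> x \<longrightarrow> x \<le> v \<longrightarrow> u < v \<longrightarrow> v - u < d \<longrightarrow> (LINT y:{u..v}|lborel. w y) \<le> s * (v - u)"
    proof (rule ccontr)
      assume contra: "\<not> ?thesis"
      have "\<exists>u v. u \<le> x \<and> x \<le> v \<and> u < v \<and> v - u < d \<and> s * (v - u) < (LINT y:{u..v}|lborel. w y)" if "d > 0" for d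
      proof -
        have "\<not> (\<forall>u v. u \<le> x \<longrightarrow> x \<le> v \<longrightarrow> u < v \<longrightarrow> v - u < d \<longrightarrow> (LINT y:{u..v}|lborel. w y) \<le> s * (v - u))"
          using contra that by blast
        then show ?thesis by (simp only: not_all not_imp not_le)
      qed
      with nx show False by blast
    qed
    then obtain d where d: "d > 0" and *: "\<And>u v. u \<le> x \<Longrightarrow> x \<le> v \<Longrightarrow> u < v \<Longrightarrow> v - u < d \<Longrightarrow> (LINT y:{u..v}|lborel. w y) \<le> s * (v - u)"
      by blast
    have "(LINT y:{u..v}|lborel. w y) \<le> (w x + \<epsilon>) * (v - u)" if "u \<le> x" "x \<le> v" "u < v" "v - u < d" for u v
    proof -
      have "s * (v - u) \<le> (w x + \<epsilon>) * (v - u)" using s that by (intro mult_right_mono) auto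
      then show ?thesis using *[OF that] by linarith
    qed
    with d show ?thesis by blast
  qed
  have w': "integrable lborel (\<lambda>x. - w x)" using w by simp
  show ?thesis
    using ae[OF w] ae[OF w']
  proof eventually_elim
    case (elim x)
    show ?case
    proof (intro allI impI)
      fix \<epsilon> :: real assume "\<epsilon> > 0"
      obtain d1 where d1: "d1 > 0" "\<forall>u v. u \<le> x \<and> x \<le> v \<and> u < v \<and> v - u < d1 \<longrightarrow> (LINT y:{u..v}|lborel. w y) \<le> (w x + \<epsilon>) * (v - u)"
        using unit_step[of x w, OF elim(1) \<open>\<epsilon> > 0\<close>] by blast
      obtain d2 where d2: "d2 > 0" "\<forall>u v. u \<le> x \<and> x \<le> v \<and> u < v \<and> v - u < d2 \<longrightarrow> (LINT y:{u..v}|lborel. - w y) \<le> (- w x + \<epsilon>) * (v - u)"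
        using unit_step[of x "\<lambda>x. - w x", OF elim(2) \<open>\<epsilon> > 0\<close>] by blast
      show "\<exists>d>0. \<forall>u v. u \<le> x \<and> x \<le> v \<and> u < v \<and> v - u < d \<longrightarrow>
           \<bar>(LINT y:{u..v}|lborel. w y) - w x * (v - u)\<bar> \<le> \<epsilon> * (v - u)"
      proof (intro exI[of _ "min d1 d2"] conjI allI impI)
        fix u v assume uv: "u \<le> x \<and> x \<le> v \<and> u < v \<and> v - u < min d1 d2"
        then have "(LINT y:{u..v}|lborel. w y) \<le> (w x + \<epsilon>) * (v - u)" using d1(2) by simp
        moreover have "(LINT y:{u..v}|lborel. - w y) \<le> (- w x + \<epsilon>) * (v - u)" using d2(2) uv by simp
        moreover have "(LINT y:{u..v}|lborel. - w y) = - (LINT y:{u..v}|lborel. w y)"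
          by (simp add: set_lebesgue_integral_def)
        ultimately show "\<bar>(LINT y:{u..v}|lborel. w y) - w x * (v - u)\<bar> \<le> \<epsilon> * (v - u)"
          by (simp add: abs_le_iff algebra_simps)
      qed (use d1 d2 in auto)
    qed
  qed
qed

lemma indefinite_integral_derivative_AE:
  fixes w :: "real \<Rightarrow> real"
  assumes w: "integrable lborel w"
    and f: "\<And>u v. a < u \<Longrightarrow> u \<le> v \<Longrightarrow> v < b \<Longrightarrow> f v - f u = (LINT y:{u..v}|lborel. w y)"
  shows "AE x in lebesgue. a < x \<and> x < b \<longrightarrow> (f has_real_derivative w x) (at x)"
  using lebesgue_differentiation[OF w]
proof eventually_elim
  case (elim x)
  show ?case
  proof
    assume x: "a < x \<and> x < b"
    show "(f has_real_derivative w x) (at x)"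
      unfolding has_field_derivative_def has_derivative_at_alt
    proof (intro conjI allI impI)
      show "bounded_linear ((*) (w x))" by (rule bounded_linear_mult_right)
      fix \<epsilon> :: real assume "\<epsilon> > 0"
      then obtain d where d: "d > 0" "\<forall>u v. u \<le> x \<and> x \<le> v \<and> u < v \<and> v - u < d \<longrightarrow>
           \<bar>(LINT y:{u..v}|lborel. w y) - w x * (v - u)\<bar> \<le> \<epsilon> * (v - u)" using elim by blast
      show "\<exists>d>0. \<forall>y. norm (y - x) < d \<longrightarrow> norm (f y - f x - w x * (y - x)) \<le> \<epsilon> * norm (y - x)"
      proof (intro exI[of _ "min d (min (x - a) (b - x))"] conjI allI impI)
        fix y assume y: "norm (y - x) < min d (min (x - a) (b - x))"
        consider "y = x" | "x < y" | "y < x" by linarith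
        then show "norm (f y - f x - w x * (y - x)) \<le> \<epsilon> * norm (y - x)"
        proof cases
          case 2
          then have "f y - f x = (LINT z:{x..y}|lborel. w z)" using x y by (intro f) auto
          moreover have "\<bar>(LINT z:{x..y}|lborel. w z) - w x * (y - x)\<bar> \<le> \<epsilon> * (y - x)"
            using d(2) 2 y by auto
          ultimately show ?thesis using 2 by simp
        next
          case 3
          then have "f x - f y = (LINT z:{y..x}|lborel. w z)" using x y by (intro f) auto
          moreover have "\<bar>(LINT z:{y..x}|lborel. w z) - w x * (x - y)\<bar> \<le> \<epsilon> * (x - y)"
            using d(2) 3 y by auto
          ultimately have "\<bar>(f x - f y) - w x * (x - y)\<bar> \<le> \<epsilon> * (x - y)" by simp
          moreover have "f y - f x - w x * (y - x) = - ((f x - f y) - w x * (x - y))" by (simp add: algebra_simps)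
          ultimately show ?thesis using 3 by (simp only: real_norm_def abs_minus_cancel) simp
        qed simp
      qed (use d x in auto)
    qed
  qed
qed

lemma abs_continuous_indefinite_integral:
  fixes w :: "real \<Rightarrow> real"
  assumes w: "integrable lborel w"
    and f: "\<And>u v. a \<le> u \<Longrightarrow> u \<le> v \<Longrightarrow> v \<le> b \<Longrightarrow> f v - f u = (LINT y:{u..v}|lborel. w y)"
  shows "abs_continuous_on a b f"
proof (rule abs_continuous_onI)
  fix \<epsilon> :: real assume "\<epsilon> > 0"
  obtain \<delta> where \<delta>: "\<delta> > 0"
      "\<And>A. A \<in> sets borel \<Longrightarrow> emeasure lborel A < ennreal \<delta> \<Longrightarrow> (LINT x:A|lborel. \<bar>w x\<bar>) < \<epsilon>"
    by (rule integral_uniformly_small[OF w \<open>\<epsilon> > 0\<close>]) blast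
  have aw: "integrable lborel (\<lambda>x. \<bar>w x\<bar>)" using w by simp
  have open_closed: "(LINT y:{u..v}|lborel. \<bar>w y\<bar>) = (LINT y:{u<..<v}|lborel. \<bar>w y\<bar>)" for u v
    unfolding set_lebesgue_integral_def
    by (rule integral_cong_AE)
       (use aw AE_lborel_singleton[of u] AE_lborel_singleton[of v] in \<open>auto simp: indicator_def elim!: eventually_elim2\<close>)
  have "family_variation f D < \<epsilon>" if D: "interval_family a b D" "(\<Sum>(s, t)\<in>D. t - s) < \<delta>" for D
  proof -
    have fin: "finite D" and D': "\<And>p. p \<in> D \<Longrightarrow> a \<le> fst p \<and> fst p \<le> snd p \<and> snd p \<le> b"
      and dj: "disjoint_family_on (\<lambda>p. {fst p<..<snd p}) D"
      using D by (auto simp: interval_family_def case_prod_unfold)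
    let ?U = "\<Union>p\<in>D. {fst p<..<snd p}"
    have "emeasure lborel ?U = (\<Sum>p\<in>D. emeasure lborel {fst p<..<snd p})"
      using dj fin by (intro sum_emeasure[symmetric]) auto
    also have "\<dots> = (\<Sum>p\<in>D. ennreal (snd p - fst p))" using D' by (intro sum.cong) auto
    also have "\<dots> = ennreal (\<Sum>p\<in>D. snd p - fst p)" using D' by (intro sum_ennreal) auto
    also have "\<dots> < ennreal \<delta>" using D(2) \<delta>(1) by (simp add: case_prod_unfold ennreal_lessI)
    finally have "(LINT x:?U|lborel. \<bar>w x\<bar>) < \<epsilon>" by (intro \<delta>(2) borel_open) auto
    moreover have "(LINT x:?U|lborel. \<bar>w x\<bar>) = (\<Sum>p\<in>D. LINT x:{fst p<..<snd p}|lborel. \<bar>w x\<bar>)"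
      using dj fin aw by (intro set_integral_finite_Union) (auto intro!: set_integrable_lborel)
    moreover have "family_variation f D \<le> (\<Sum>p\<in>D. LINT x:{fst p<..<snd p}|lborel. \<bar>w x\<bar>)"
      unfolding family_variation_def case_prod_unfold
    proof (rule sum_mono)
      fix p assume "p \<in> D"
      then have "f (snd p) - f (fst p) = (LINT y:{fst p..snd p}|lborel. w y)" using D' by (intro f) auto
      also have "\<bar>\<dots>\<bar> \<le> (LINT y:{fst p..snd p}|lborel. \<bar>w y\<bar>)"
        using set_integral_norm_bound[of lborel "{fst p..snd p}" w] w by (simp add: set_integrable_lborel)
      finally show "\<bar>f (snd p) - f (fst p)\<bar> \<le> (LINT x:{fst p<..<snd p}|lborel. \<bar>w x\<bar>)"
        by (simp add: open_closed)
    qed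
    ultimately show ?thesis by simp
  qed
  with \<delta>(1) show "\<exists>\<delta>>0. \<forall>D. interval_family a b D \<longrightarrow> (\<Sum>(s, t)\<in>D. t - s) < \<delta> \<longrightarrow> family_variation f D < \<epsilon>"
    by blast
qed

subsection \<open>Causal convolution\<close>

text \<open>Monotone convergence for the absolute values, then dominated convergence. Interchanges
  of a series with a convolution are reduced to summability of L^1 norms by this lemma.\<close>

lemma integrable_series:
  fixes f :: "nat \<Rightarrow> 'a \<Rightarrow> real"
  assumes i: "\<And>i. integrable M (f i)" and s: "summable (\<lambda>i. \<integral>x. \<bar>f i x\<bar> \<partial>M)"
  shows "AE x in M. summable (\<lambda>i. \<bar>f i x\<bar>)"
    and "integrable M (\<lambda>x. \<Sum>i. f i x)"
    and "(\<lambda>i. integral\<^sup>L M (f i)) sums (\<integral>x. (\<Sum>i. f i x) \<partial>M)"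
proof -
  have [measurable]: "f i \<in> borel_measurable M" for i using i by auto
  have "(\<integral>\<^sup>+x. (\<Sum>i. ennreal \<bar>f i x\<bar>) \<partial>M) = (\<Sum>i. \<integral>\<^sup>+x. ennreal \<bar>f i x\<bar> \<partial>M)"
    by (rule nn_integral_suminf) simp
  also have "\<dots> = (\<Sum>i. ennreal (\<integral>x. \<bar>f i x\<bar> \<partial>M))"
    using i by (intro suminf_cong nn_integral_eq_integral) auto
  also have "\<dots> \<noteq> \<infinity>"
    using s by (simp add: suminf_ennreal_eq[OF _ summable_sums])
  finally have "AE x in M. (\<Sum>i. ennreal \<bar>f i x\<bar>) \<noteq> \<infinity>"
    by (intro nn_integral_noteq_infinite) auto
  then show ae: "AE x in M. summable (\<lambda>i. \<bar>f i x\<bar>)"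
    by eventually_elim (rule summable_suminf_not_top, auto)
  show "integrable M (\<lambda>x. \<Sum>i. f i x)" by (rule integrable_suminf) (use i s ae in auto)
  show "(\<lambda>i. integral\<^sup>L M (f i)) sums (\<integral>x. (\<Sum>i. f i x) \<partial>M)" by (rule sums_integral) (use i s ae in auto)
qed

definition cnv :: "(real \<Rightarrow> real) \<Rightarrow> (real \<Rightarrow> real) \<Rightarrow> real \<Rightarrow> real" where
  "cnv a b t = (LINT s|lborel. a (t - s) * b s)"

definition truncate_at :: "real \<Rightarrow> (real \<Rightarrow> real) \<Rightarrow> real \<Rightarrow> real" where
  "truncate_at T a s = (if s \<le> T then a s else 0)"

text \<open>Functions of time are extended by \<open>0\<close> to \<open>t \<le> 0\<close>, so that integrals over \<open>(0, t)\<close> become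
  convolutions over the whole line. Where \<open>cnv_exists\<close> fails, \<open>cnv\<close> is \<open>0\<close>.\<close>

definition causal_loc :: "(real \<Rightarrow> real) \<Rightarrow> bool" where
  "causal_loc a \<longleftrightarrow> a \<in> borel_measurable borel \<and> (\<forall>t\<le>0. a t = 0) \<and>
     (\<forall>T. integrable lborel (truncate_at T a))"

definition cnv_exists :: "(real \<Rightarrow> real) \<Rightarrow> (real \<Rightarrow> real) \<Rightarrow> real \<Rightarrow> bool" where
  "cnv_exists a b t \<longleftrightarrow> integrable lborel (\<lambda>s. a (t - s) * b s)"

lemma causal_locD:
  assumes "causal_loc a"
  shows causal_loc_measurable: "a \<in> borel_measurable borel"
    and causal_loc_nonpos: "t \<le> 0 \<Longrightarrow> a t = 0"
    and causal_loc_integrable: "integrable lborel (truncate_at T a)"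
  using assms by (auto simp: causal_loc_def)

lemma causal_locI:
  assumes "a \<in> borel_measurable borel" "\<And>t. t \<le> 0 \<Longrightarrow> a t = 0"
    "\<And>T. 0 < T \<Longrightarrow> integrable lborel (truncate_at T a)"
  shows "causal_loc a"
proof -
  have "integrable lborel (truncate_at T a)" for T
  proof (cases "0 < T")
    case False
    then have "truncate_at T a = (\<lambda>s. 0)" using assms(2) by (auto simp: truncate_at_def)
    then show ?thesis by simp
  qed (rule assms)
  then show ?thesis using assms by (auto simp: causal_loc_def)
qed

lemma cnv_commute: "cnv a b t = cnv b a t"
proof -
  have "cnv a b t = \<bar>-1\<bar> *\<^sub>R (LINT x|lborel. a (t - (t + - 1 * x)) * b (t + - 1 * x))"
    unfolding cnv_def by (rule lborel_integral_real_affine) simp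
  also have "\<dots> = cnv b a t" unfolding cnv_def by (simp add: mult.commute)
  finally show ?thesis .
qed

lemma cnv_exists_commute: "cnv_exists a b t \<Longrightarrow> cnv_exists b a t"
  unfolding cnv_exists_def
  using lborel_integrable_real_affine[of "\<lambda>s. a (t - s) * b s" "-1" t] by (simp add: mult.commute)

lemma cnv_zero:
  assumes "\<And>s. s < t \<Longrightarrow> b s = 0" "\<And>s. s \<le> 0 \<Longrightarrow> a s = 0"
  shows "cnv a b t = 0"
proof -
  have "a (t - s) * b s = 0" for s
    using assms(1)[of s] assms(2)[of "t - s"] by (cases "s < t") auto
  then have "(\<lambda>s. a (t - s) * b s) = (\<lambda>s. 0)" by blast
  then show ?thesis by (simp add: cnv_def)
qed

lemma cnv_local:
  fixes a b a' b' :: "real \<Rightarrow> real"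
  assumes "\<And>s. s \<le> 0 \<Longrightarrow> a s = 0" "\<And>s. s \<le> 0 \<Longrightarrow> b s = 0" "\<And>s. s \<le> 0 \<Longrightarrow> a' s = 0" "\<And>s. s \<le> 0 \<Longrightarrow> b' s = 0"
    and "\<And>s. 0 < s \<Longrightarrow> s < t \<Longrightarrow> a s = a' s" "\<And>s. 0 < s \<Longrightarrow> s < t \<Longrightarrow> b s = b' s"
  shows "a (t - s) * b s = a' (t - s) * b' s"
proof -
  consider "s \<le> 0" | "t - s \<le> 0" | "0 < s" "s < t" by linarith
  then show ?thesis by cases (use assms in auto)
qed

lemma cnv_cong:
  assumes "\<And>s. s \<le> 0 \<Longrightarrow> a s = 0" "\<And>s. s \<le> 0 \<Longrightarrow> b s = 0" "\<And>s. s \<le> 0 \<Longrightarrow> a' s = 0" "\<And>s. s \<le> 0 \<Longrightarrow> b' s = 0"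
    and "\<And>s. 0 < s \<Longrightarrow> s < t \<Longrightarrow> a s = a' s" "\<And>s. 0 < s \<Longrightarrow> s < t \<Longrightarrow> b s = b' s"
  shows "cnv a b t = cnv a' b' t" "cnv_exists a b t \<longleftrightarrow> cnv_exists a' b' t"
proof -
  have "(\<lambda>s. a (t - s) * b s) = (\<lambda>s. a' (t - s) * b' s)"
    using cnv_local[of a b a' b' t] assms by blast
  then show "cnv a b t = cnv a' b' t" "cnv_exists a b t \<longleftrightarrow> cnv_exists a' b' t"
    by (simp_all add: cnv_def cnv_exists_def)
qed

lemma cnv_nonneg: "(\<And>s. 0 \<le> a s) \<Longrightarrow> (\<And>s. 0 \<le> b s) \<Longrightarrow> 0 \<le> cnv a b t"
  unfolding cnv_def by (rule integral_nonneg_AE) auto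

lemma cnv_add_right:
  assumes "cnv_exists a b t" "cnv_exists a c t"
  shows "cnv a (\<lambda>s. b s + c s) t = cnv a b t + cnv a c t" "cnv_exists a (\<lambda>s. b s + c s) t"
  using assms unfolding cnv_def cnv_exists_def by (auto simp: distrib_left)

lemma cnv_diff_right:
  assumes "cnv_exists a b t" "cnv_exists a c t"
  shows "cnv a (\<lambda>s. b s - c s) t = cnv a b t - cnv a c t" "cnv_exists a (\<lambda>s. b s - c s) t"
  using assms unfolding cnv_def cnv_exists_def by (auto simp: right_diff_distrib)

lemma cnv_cmult_right: "cnv a (\<lambda>s. k * b s) t = k * cnv a b t"
  unfolding cnv_def by (simp add: mult.left_commute[of _ k])

lemma cnv_exists_cmult_right: "cnv_exists a b t \<Longrightarrow> cnv_exists a (\<lambda>s. k * b s) t"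
  unfolding cnv_exists_def by (simp add: mult.left_commute[of _ k])

lemma cnv_mono:
  assumes "cnv_exists a b t" "cnv_exists a' b' t" "\<And>s. a (t - s) * b s \<le> a' (t - s) * b' s"
  shows "cnv a b t \<le> cnv a' b' t"
  using assms unfolding cnv_def cnv_exists_def by (intro integral_mono) auto

lemma cnv_exists_bound:
  assumes "cnv_exists a b t" "a' \<in> borel_measurable borel" "b' \<in> borel_measurable borel"
    "\<And>s. \<bar>a' (t - s) * b' s\<bar> \<le> \<bar>a (t - s) * b s\<bar>"
  shows "cnv_exists a' b' t"
proof -
  have [measurable]: "a' \<in> borel_measurable borel" "b' \<in> borel_measurable borel" by fact+
  show ?thesis unfolding cnv_exists_def
    by (rule Bochner_Integration.integrable_bound[OF assms(1)[unfolded cnv_exists_def]]) (use assms in auto)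
qed

lemma cnv_abs_le: "\<bar>cnv a b t\<bar> \<le> cnv (\<lambda>s. \<bar>a s\<bar>) (\<lambda>s. \<bar>b s\<bar>) t"
  unfolding cnv_def abs_mult[symmetric] by (rule integral_abs_bound)

lemma integrable_cnv_pair:
  fixes a b :: "real \<Rightarrow> real"
  assumes a: "integrable lborel a" and b: "integrable lborel b"
  shows "integrable (lborel \<Otimes>\<^sub>M lborel) (\<lambda>(t, s). a (t - s) * b s)"
proof -
  have [measurable]: "a \<in> borel_measurable borel" "b \<in> borel_measurable borel" using a b by auto
  have sh: "integrable lborel (\<lambda>t. a (t - s))" for s
    using lborel_integrable_real_affine[OF a, of 1 "-s"] by (simp add: add.commute)
  have shi: "(LINT t|lborel. \<bar>a (t - s)\<bar>) = (LINT t|lborel. \<bar>a t\<bar>)" for s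
    using lborel_integral_real_affine[of 1 "\<lambda>t. \<bar>a t\<bar>" "-s"] by (simp add: add.commute)
  have "integrable (lborel \<Otimes>\<^sub>M lborel) (\<lambda>(s, t). a (t - s) * b s)"
  proof (rule lborel_pair.Fubini_integrable)
    show "(\<lambda>(s, t). a (t - s) * b s) \<in> borel_measurable (lborel \<Otimes>\<^sub>M lborel)" by measurable
    show "integrable lborel (\<lambda>x. LINT y|lborel. norm (case (x, y) of (s, t) \<Rightarrow> a (t - s) * b s))"
      using b by (simp add: abs_mult shi)
    show "AE x in lborel. integrable lborel (\<lambda>y. case (x, y) of (s, t) \<Rightarrow> a (t - s) * b s)"
      using sh by simp
  qed
  from lborel_pair.integrable_product_swap[OF this] show ?thesis by simp
qed

text \<open>Young's inequality for L^1, by Fubini for the integrand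
  \<open>a (t - s) * b s\<close>.\<close>

lemma integrable_cnv:
  assumes a: "integrable lborel a" and b: "integrable lborel b"
  shows "integrable lborel (cnv a b)" "AE t in lborel. cnv_exists a b t"
    "(LINT t|lborel. \<bar>cnv a b t\<bar>) \<le> (LINT t|lborel. \<bar>a t\<bar>) * (LINT t|lborel. \<bar>b t\<bar>)"
proof -
  note i = integrable_cnv_pair[OF a b]
  show int: "integrable lborel (cnv a b)"
    using lborel_pair.integrable_fst'[OF i] by (simp add: cnv_def[abs_def])
  show "AE t in lborel. cnv_exists a b t"
    using lborel_pair.AE_integrable_fst'[OF i] by (simp add: cnv_exists_def)
  have a': "integrable lborel (\<lambda>t. \<bar>a t\<bar>)" and b': "integrable lborel (\<lambda>t. \<bar>b t\<bar>)" using a b by auto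
  note i' = integrable_cnv_pair[OF a' b']
  have shi: "(LINT t|lborel. \<bar>a (t - s)\<bar>) = (LINT t|lborel. \<bar>a t\<bar>)" for s
    using lborel_integral_real_affine[of 1 "\<lambda>t. \<bar>a t\<bar>" "-s"] by (simp add: add.commute)
  have int': "integrable lborel (cnv (\<lambda>t. \<bar>a t\<bar>) (\<lambda>t. \<bar>b t\<bar>))"
    using lborel_pair.integrable_fst'[OF i'] by (simp add: cnv_def[abs_def])
  have "(LINT t|lborel. \<bar>cnv a b t\<bar>) \<le> (LINT t|lborel. cnv (\<lambda>t. \<bar>a t\<bar>) (\<lambda>t. \<bar>b t\<bar>) t)"
    by (rule integral_mono) (use int int' cnv_abs_le in auto)
  also have "\<dots> = (LINT s|lborel. LINT t|lborel. \<bar>a (t - s)\<bar> * \<bar>b s\<bar>)"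
    unfolding cnv_def using lborel_pair.Fubini_integral[of "\<lambda>t s. \<bar>a (t - s)\<bar> * \<bar>b s\<bar>"] i' by simp
  also have "\<dots> = (LINT t|lborel. \<bar>a t\<bar>) * (LINT t|lborel. \<bar>b t\<bar>)"
    by (simp add: shi)
  finally show "(LINT t|lborel. \<bar>cnv a b t\<bar>) \<le> (LINT t|lborel. \<bar>a t\<bar>) * (LINT t|lborel. \<bar>b t\<bar>)" .
qed

text \<open>Causality: up to time T a convolution does not see the factors after T. So the L^1
  theory on the line carries over to factors that are only locally integrable.\<close>

lemma cnv_truncate:
  assumes "causal_loc a" "causal_loc b" "t \<le> T"
  shows "cnv (truncate_at T a) (truncate_at T b) t = cnv a b t"
    "cnv_exists (truncate_at T a) (truncate_at T b) t \<longleftrightarrow> cnv_exists a b t"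
proof -
  have "\<And>s. s \<le> 0 \<Longrightarrow> a s = 0" "\<And>s. s \<le> 0 \<Longrightarrow> b s = 0"
    using assms by (auto simp: causal_loc_def)
  note cc = cnv_cong[of "truncate_at T a" "truncate_at T b" a b t]
  show "cnv (truncate_at T a) (truncate_at T b) t = cnv a b t"
    by (rule cc(1)) (use \<open>t \<le> T\<close> \<open>\<And>s. s \<le> 0 \<Longrightarrow> a s = 0\<close> \<open>\<And>s. s \<le> 0 \<Longrightarrow> b s = 0\<close> in \<open>auto simp: truncate_at_def\<close>)
  show "cnv_exists (truncate_at T a) (truncate_at T b) t \<longleftrightarrow> cnv_exists a b t"
    by (rule cc(2)) (use \<open>t \<le> T\<close> \<open>\<And>s. s \<le> 0 \<Longrightarrow> a s = 0\<close> \<open>\<And>s. s \<le> 0 \<Longrightarrow> b s = 0\<close> in \<open>auto simp: truncate_at_def\<close>)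
qed

lemma borel_measurable_cnv [measurable]:
  assumes [measurable]: "a \<in> borel_measurable borel" "b \<in> borel_measurable borel"
  shows "cnv a b \<in> borel_measurable borel"
  unfolding cnv_def[abs_def] by measurable

lemma borel_measurable_truncate_at [measurable]:
  assumes [measurable]: "a \<in> borel_measurable borel"
  shows "truncate_at T a \<in> borel_measurable borel"
  unfolding truncate_at_def[abs_def] by measurable

lemma integrable_truncate_at: "integrable lborel f \<Longrightarrow> integrable lborel (truncate_at T f)"
  by (rule Bochner_Integration.integrable_bound[of _ f]) (auto simp: truncate_at_def)

lemma causal_loc_cnv:
  assumes a: "causal_loc a" and b: "causal_loc b"
  shows "causal_loc (cnv a b)"
proof (rule causal_locI)
  show "cnv a b \<in> borel_measurable borel"
    using assms by (intro borel_measurable_cnv) (auto simp: causal_loc_def)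
  show "cnv a b t = 0" if "t \<le> 0" for t
    using assms that by (intro cnv_zero) (auto simp: causal_loc_def)
  fix T :: real
  have "truncate_at T (cnv a b) = truncate_at T (cnv (truncate_at T a) (truncate_at T b))"
    using cnv_truncate[OF a b] by (auto simp: truncate_at_def[of T "cnv _ _"])
  then show "integrable lborel (truncate_at T (cnv a b))"
    by (simp only:) (intro integrable_truncate_at integrable_cnv causal_loc_integrable a b)
qed

lemma cnv_exists_AE:
  assumes a: "causal_loc a" and b: "causal_loc b"
  shows "AE t in lborel. cnv_exists a b t"
proof -
  have "AE t in lborel. \<forall>n::nat. cnv_exists (truncate_at (real n) a) (truncate_at (real n) b) t"
    unfolding AE_all_countable using assms by (auto intro!: integrable_cnv causal_loc_integrable)
  then show ?thesis
  proof eventually_elim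
    case (elim t)
    obtain n :: nat where "t \<le> real n" using real_arch_simple by blast
    then show ?case using elim cnv_truncate(2)[OF a b, of t "real n"] by blast
  qed
qed

lemma causal_loc_abs: "causal_loc a \<Longrightarrow> causal_loc (\<lambda>s. \<bar>a s\<bar>)"
proof -
  assume a: "causal_loc a"
  have "truncate_at T (\<lambda>s. \<bar>a s\<bar>) = (\<lambda>s. \<bar>truncate_at T a s\<bar>)" for T
    by (auto simp: truncate_at_def)
  then show ?thesis using a by (auto simp: causal_loc_def)
qed

lemma causal_loc_cmult: "causal_loc a \<Longrightarrow> causal_loc (\<lambda>s. k * a s)"
proof -
  assume a: "causal_loc a"
  have "truncate_at T (\<lambda>s. k * a s) = (\<lambda>s. k * truncate_at T a s)" for T
    by (auto simp: truncate_at_def)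
  then show ?thesis using a by (auto simp: causal_loc_def)
qed

lemma causal_loc_add: "causal_loc a \<Longrightarrow> causal_loc b \<Longrightarrow> causal_loc (\<lambda>s. a s + b s)"
proof -
  assume a: "causal_loc a" and b: "causal_loc b"
  have "truncate_at T (\<lambda>s. a s + b s) = (\<lambda>s. truncate_at T a s + truncate_at T b s)" for T
    by (auto simp: truncate_at_def)
  then show ?thesis using a b by (auto simp: causal_loc_def)
qed

lemma causal_loc_diff: "causal_loc a \<Longrightarrow> causal_loc b \<Longrightarrow> causal_loc (\<lambda>s. a s - b s)"
  using causal_loc_add[of a "\<lambda>s. -1 * b s"] causal_loc_cmult[of b "-1"] by simp

lemma causal_loc_bound:
  assumes "causal_loc a" "b \<in> borel_measurable borel" "\<And>t. t \<le> 0 \<Longrightarrow> b t = 0" "\<And>t. 0 < t \<Longrightarrow> \<bar>b t\<bar> \<le> \<bar>a t\<bar>"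
  shows "causal_loc b"
proof (rule causal_locI)
  have [measurable]: "b \<in> borel_measurable borel" by fact
  show "integrable lborel (truncate_at T b)" for T
  proof (rule Bochner_Integration.integrable_bound[OF causal_loc_integrable[OF assms(1), of T]])
    have "\<bar>b s\<bar> \<le> \<bar>a s\<bar>" for s using assms(3)[of s] assms(4)[of s] by (cases "0 < s") auto
    then show "AE s in lborel. norm (truncate_at T b s) \<le> norm (truncate_at T a s)"
      by (simp add: truncate_at_def)
  qed simp
qed (use assms in auto)

text \<open>Pointwise associativity; for \<open>causal_loc\<close> functions it may fail on a null set only.\<close>

lemma cnv_assoc:
  assumes a: "causal_loc a" and b: "causal_loc b" and c: "causal_loc c"
    and ex: "cnv_exists (\<lambda>s. \<bar>a s\<bar>) (cnv (\<lambda>s. \<bar>b s\<bar>) (\<lambda>s. \<bar>c s\<bar>)) t"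
  shows "cnv a (cnv b c) t = cnv (cnv a b) c t" "cnv_exists (cnv a b) c t"
proof -
  have [measurable]: "a \<in> borel_measurable borel" "b \<in> borel_measurable borel" "c \<in> borel_measurable borel"
    using a b c by (auto simp: causal_loc_def)
  let ?F = "\<lambda>(s, r). a (t - s) * (b (s - r) * c r)"
  have i: "integrable (lborel \<Otimes>\<^sub>M lborel) ?F"
  proof (rule lborel_pair.Fubini_integrable)
    show "?F \<in> borel_measurable (lborel \<Otimes>\<^sub>M lborel)" by measurable
    show "integrable lborel (\<lambda>s. LINT r|lborel. norm (?F (s, r)))"
      using ex by (simp add: cnv_exists_def cnv_def abs_mult)
    show "AE s in lborel. integrable lborel (\<lambda>r. ?F (s, r))"
      using cnv_exists_AE[OF b c] by eventually_elim (simp add: cnv_exists_def)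
  qed
  have inner: "(LINT s|lborel. a (t - s) * (b (s - r) * c r)) = cnv a b (t - r) * c r" for r
  proof -
    have "(LINT s|lborel. a (t - s) * (b (s - r) * c r)) = (LINT s|lborel. a (t - s) * b (s - r)) * c r"
      by (simp add: mult.assoc[symmetric])
    also have "(LINT s|lborel. a (t - s) * b (s - r)) = cnv a b (t - r)"
      using lborel_integral_real_affine[of 1 "\<lambda>s. a (t - s) * b (s - r)" r]
      by (simp add: cnv_def algebra_simps)
    finally show ?thesis .
  qed
  have "cnv a (cnv b c) t = (LINT s|lborel. LINT r|lborel. ?F (s, r))"
    by (simp add: cnv_def)
  also have "\<dots> = (LINT r|lborel. LINT s|lborel. ?F (s, r))"
    using lborel_pair.Fubini_integral[of "\<lambda>s r. a (t - s) * (b (s - r) * c r)"] i by simp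
  also have "\<dots> = cnv (cnv a b) c t" by (simp add: inner cnv_def[of "cnv a b"])
  finally show "cnv a (cnv b c) t = cnv (cnv a b) c t" .
  have "integrable lborel (\<lambda>r. LINT s|lborel. ?F (s, r))"
    using lborel_pair.integrable_fst'[OF lborel_pair.integrable_product_swap[OF i]] by simp
  then show "cnv_exists (cnv a b) c t" by (simp add: inner cnv_exists_def)
qed

text \<open>Reversing the order of the three factors moves the hypothesis to the other bracketing.
  This form suits the case in which the inner convolution of the first two factors is a known
  kernel.\<close>

lemma cnv_assoc_rev:
  assumes a: "causal_loc a" and b: "causal_loc b" and c: "causal_loc c"
    and ex: "cnv_exists (cnv (\<lambda>s. \<bar>a s\<bar>) (\<lambda>s. \<bar>b s\<bar>)) (\<lambda>s. \<bar>c s\<bar>) t"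
  shows "cnv a (cnv b c) t = cnv (cnv a b) c t" "cnv_exists a (cnv b c) t"
proof -
  have comm: "cnv f g = cnv g f" for f g by (rule ext) (rule cnv_commute)
  have "cnv_exists (\<lambda>s. \<bar>c s\<bar>) (cnv (\<lambda>s. \<bar>b s\<bar>) (\<lambda>s. \<bar>a s\<bar>)) t"
    unfolding comm[of "\<lambda>s. \<bar>b s\<bar>" "\<lambda>s. \<bar>a s\<bar>"] by (rule cnv_exists_commute[OF ex])
  note * = cnv_assoc[OF c b a this]
  have "cnv a (cnv b c) t = cnv (cnv c b) a t"
    unfolding comm[of b c] by (rule cnv_commute)
  also have "\<dots> = cnv c (cnv b a) t" by (rule *(1)[symmetric])
  also have "\<dots> = cnv (cnv a b) c t"
    unfolding comm[of b a] by (rule cnv_commute)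
  finally show "cnv a (cnv b c) t = cnv (cnv a b) c t" .
  show "cnv_exists a (cnv b c) t"
    unfolding comm[of b c] by (rule cnv_exists_commute[OF *(2)])
qed

text \<open>A bounded factor makes the convolution exist at every \<open>t\<close>, where
  \<open>cnv_exists_AE\<close> allows a null set of exceptions.\<close>

lemma cnv_exists_bounded:
  assumes a: "causal_loc a" and [measurable]: "x \<in> borel_measurable borel"
    and x: "\<And>s. s \<le> 0 \<Longrightarrow> x s = 0" "\<And>s. 0 < s \<Longrightarrow> s < t \<Longrightarrow> \<bar>x s\<bar> \<le> B"
  shows "cnv_exists a x t" "\<bar>cnv a x t\<bar> \<le> B * (LINT s|lborel. \<bar>truncate_at t a s\<bar>)"
proof -
  have [measurable]: "a \<in> borel_measurable borel" using a by (auto simp: causal_loc_def)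
  have i: "integrable lborel (\<lambda>s. B * \<bar>truncate_at t a (t - s)\<bar>)"
    using lborel_integrable_real_affine[OF causal_loc_integrable[OF a], of "-1" t t] by simp
  have le: "\<bar>a (t - s) * x s\<bar> \<le> B * \<bar>truncate_at t a (t - s)\<bar>" if "0 \<le> B" for s
  proof -
    consider "s \<le> 0" | "t - s \<le> 0" | "0 < s" "s < t" by linarith
    then show ?thesis
    proof cases
      case 3
      then have "\<bar>x s\<bar> \<le> B" using x by auto
      then have "\<bar>x s\<bar> * \<bar>a (t - s)\<bar> \<le> B * \<bar>a (t - s)\<bar>" by (rule mult_right_mono) simp
      then show ?thesis using 3 by (simp add: truncate_at_def abs_mult mult.commute)
    qed (use x that causal_loc_nonpos[OF a] in auto)
  qed
  have "cnv_exists a x t \<and> \<bar>cnv a x t\<bar> \<le> B * (LINT s|lborel. \<bar>truncate_at t a s\<bar>)"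
  proof (cases "0 \<le> B")
    case True
    have ex: "cnv_exists a x t"
      unfolding cnv_exists_def by (rule Bochner_Integration.integrable_bound[OF i]) (use order_trans[OF le[OF True] abs_ge_self] in \<open>auto simp: abs_mult\<close>)
    have "\<bar>cnv a x t\<bar> \<le> (LINT s|lborel. \<bar>a (t - s) * x s\<bar>)"
      unfolding cnv_def by (rule integral_abs_bound)
    also have "\<dots> \<le> (LINT s|lborel. B * \<bar>truncate_at t a (t - s)\<bar>)"
      by (rule integral_mono) (use i le[OF True] ex in \<open>auto simp: cnv_exists_def\<close>)
    also have "\<dots> = B * (LINT s|lborel. \<bar>truncate_at t a s\<bar>)"
      using lborel_integral_real_affine[of "-1" "\<lambda>s. \<bar>truncate_at t a s\<bar>" t] by simp
    finally show ?thesis using ex by simp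
  next
    \<comment> \<open>A negative bound B can hold only if no s lies between 0 and t, that is for t
      <= 0.\<close>
    case False
    have "t \<le> 0"
    proof (rule ccontr)
      assume "\<not> t \<le> 0"
      then have "\<bar>x (t/2)\<bar> \<le> B" by (intro x(2)) auto
      then show False using False by simp
    qed
    have z: "(\<lambda>s. a (t - s) * x s) = (\<lambda>s. 0)"
    proof
      fix s show "a (t - s) * x s = 0"
        using x(1)[of s] causal_loc_nonpos[OF a, of "t - s"] \<open>t \<le> 0\<close> by (cases "s \<le> 0") auto
    qed
    have "truncate_at t a = (\<lambda>s. 0)" using causal_loc_nonpos[OF a] \<open>t \<le> 0\<close> by (auto simp: truncate_at_def)
    then show ?thesis by (simp add: cnv_exists_def cnv_def z)
  qed
  then show "cnv_exists a x t" "\<bar>cnv a x t\<bar> \<le> B * (LINT s|lborel. \<bar>truncate_at t a s\<bar>)" by auto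
qed

section \<open>Integration from 0 as convolution with the Heaviside function\<close>

definition unit_step :: "real \<Rightarrow> real" where "unit_step t = (if 0 < t then 1 else 0)"

lemma causal_loc_one: "causal_loc unit_step"
proof (rule causal_locI)
  show "unit_step \<in> borel_measurable borel" unfolding unit_step_def[abs_def] by measurable
  show "integrable lborel (truncate_at T unit_step)" if "0 < T" for T
  proof -
    have "truncate_at T unit_step = indicator {0<..T}" by (auto simp: truncate_at_def unit_step_def indicator_def)
    then show ?thesis using that by (simp add: emeasure_lborel_Ioc)
  qed
qed (auto simp: unit_step_def)

lemma cnv_one:
  assumes b: "causal_loc b"
  shows "cnv unit_step b t = (LINT s|lborel. truncate_at t b s)" "cnv_exists unit_step b t"
proof -
  have [measurable]: "b \<in> borel_measurable borel" using b by (auto simp: causal_loc_def)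
  have [measurable]: "unit_step \<in> borel_measurable borel" using causal_loc_one by (auto simp: causal_loc_def)
  have ae: "AE s in lborel. unit_step (t - s) * b s = truncate_at t b s"
    using AE_lborel_singleton[of t] by eventually_elim (auto simp: unit_step_def truncate_at_def)
  show "cnv unit_step b t = (LINT s|lborel. truncate_at t b s)"
    unfolding cnv_def by (rule integral_cong_AE) (use ae in auto)
  show "cnv_exists unit_step b t"
    unfolding cnv_exists_def
    by (subst integrable_cong_AE[OF _ _ ae]) (auto intro: causal_loc_integrable[OF b])
qed

lemma cnv_one_set_integral:
  assumes b: "causal_loc b"
  shows "cnv unit_step b t = (LINT s:{0..t}|lborel. b s)"
  unfolding cnv_one[OF b] set_lebesgue_integral_def
  by (rule Bochner_Integration.integral_cong) (use causal_loc_nonpos[OF b] in \<open>auto simp: truncate_at_def indicator_def\<close>)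

lemma cnv_one_assoc:
  assumes "causal_loc b" "causal_loc c"
  shows "cnv unit_step (cnv b c) t = cnv (cnv unit_step b) c t"
proof (rule cnv_assoc(1)[OF causal_loc_one assms])
  have "(\<lambda>s. \<bar>unit_step s\<bar>) = unit_step" by (auto simp: unit_step_def)
  then show "cnv_exists (\<lambda>s. \<bar>unit_step s\<bar>) (cnv (\<lambda>s. \<bar>b s\<bar>) (\<lambda>s. \<bar>c s\<bar>)) t"
    using cnv_one(2)[OF causal_loc_cnv[OF causal_loc_abs[OF assms(1)] causal_loc_abs[OF assms(2)]]] by simp
qed

lemma cnv_one_bound:
  assumes b: "causal_loc b"
  shows "\<bar>cnv unit_step b t\<bar> \<le> (LINT s|lborel. \<bar>truncate_at t b s\<bar>)"
  unfolding cnv_one[OF b] by (rule integral_abs_bound)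

text \<open>The continuous factor is given the shifted argument, so that dominated convergence
  applies. It may jump at 0; after the shift this concerns the single point s = t.\<close>

lemma continuous_on_cnv:
  assumes a: "causal_loc a" and [measurable]: "x \<in> borel_measurable borel"
    and x: "\<And>s. s \<le> 0 \<Longrightarrow> x s = 0" "\<And>s. 0 < s \<Longrightarrow> s \<le> T \<Longrightarrow> \<bar>x s\<bar> \<le> B"
    and cont: "continuous_on {0<..T} x"
  shows "continuous_on {0..T} (cnv a x)"
proof (cases "0 < T")
  case False
  then have "{0..T} \<subseteq> {0}" by auto
  then show ?thesis using continuous_on_subset continuous_on_sing by blast
next
  case True
  have [measurable]: "a \<in> borel_measurable borel" using a by (auto simp: causal_loc_def)
  have B: "0 \<le> B" using x(2)[of T] True by auto
  show ?thesis
    unfolding continuous_on_sequentially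
  proof (intro allI ballI impI, elim conjE)
    fix u t assume t: "t \<in> {0..T}" and u: "\<forall>n. u n \<in> {0..T}" and lim: "u \<longlonglongrightarrow> t"
    have "(\<lambda>n. LINT s|lborel. x (u n - s) * a s) \<longlonglongrightarrow> (LINT s|lborel. x (t - s) * a s)"
    proof (rule integral_dominated_convergence[where w = "\<lambda>s. B * \<bar>truncate_at T a s\<bar>"])
      show "integrable lborel (\<lambda>s. B * \<bar>truncate_at T a s\<bar>)" using causal_loc_integrable[OF a] by simp
      show "AE s in lborel. norm (x (u n - s) * a s) \<le> B * \<bar>truncate_at T a s\<bar>" for n
      proof (rule AE_I2)
        fix s
        have un: "u n \<le> T" using u by auto
        consider "s \<le> 0" | "u n - s \<le> 0" | "0 < s" "s < u n" by linarith
        then show "norm (x (u n - s) * a s) \<le> B * \<bar>truncate_at T a s\<bar>"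
        proof cases
          case 3
          then have "\<bar>x (u n - s)\<bar> \<le> B" using un by (intro x) auto
          then have "\<bar>x (u n - s)\<bar> * \<bar>a s\<bar> \<le> B * \<bar>a s\<bar>" by (rule mult_right_mono) simp
          then show ?thesis using 3 un by (simp add: truncate_at_def abs_mult)
        qed (use causal_loc_nonpos[OF a] x B in auto)
      qed
      show "AE s in lborel. (\<lambda>n. x (u n - s) * a s) \<longlonglongrightarrow> x (t - s) * a s"
        using AE_lborel_singleton[of t]
      proof eventually_elim
        case (elim s)
        have lim': "(\<lambda>n. u n - s) \<longlonglongrightarrow> t - s" using lim by (intro tendsto_intros)
        consider "s \<le> 0" | "t - s < 0" | "0 < s" "s < t" using elim by linarith
        then show ?case
        proof cases
          case 1 then show ?thesis using causal_loc_nonpos[OF a] by simp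
        next
          case 2
          then have "eventually (\<lambda>n. u n - s < 0) sequentially" using lim' by (intro order_tendstoD) auto
          then have "eventually (\<lambda>n. x (u n - s) * a s = x (t - s) * a s) sequentially"
            by eventually_elim (use 2 x(1) in auto)
          then show ?thesis by (rule tendsto_eventually)
        next
          case 3
          have ev: "eventually (\<lambda>n. u n - s \<in> {0<..T}) sequentially"
          proof -
            have "eventually (\<lambda>n. 0 < u n - s) sequentially" using order_tendstoD(1)[OF lim', of 0] 3 by simp
            then show ?thesis
            proof eventually_elim
              case (elim n)
              have "u n \<le> T" using u by auto
              then show ?case using elim 3 by auto
            qed
          qed
          have "t - s \<in> {0<..T}" using 3 t by auto
          then have "(\<lambda>n. x (u n - s)) \<longlonglongrightarrow> x (t - s)"
            by (intro continuous_on_tendsto_compose[OF cont lim' _ ev])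
          then show ?thesis by (rule tendsto_mult_right)
        qed
      qed
    qed measurable
    then show "((\<lambda>s. cnv a x s) \<circ> u) \<longlonglongrightarrow> cnv a x t"
      unfolding comp_def cnv_commute[of a x] by (simp add: cnv_def)
  qed
qed

text \<open>By Lebesgue differentiation the integral of \<open>b\<close> has derivative
  \<open>b\<close> almost everywhere, and on the open interval it is constant.\<close>

lemma cnv_one_eq_zero_AE:
  assumes b: "causal_loc b" and z: "\<And>t. 0 < t \<Longrightarrow> t \<le> T \<Longrightarrow> cnv unit_step b t = 0"
  shows "AE t in lborel. t < T \<longrightarrow> b t = 0"
proof -
  define w where "w = truncate_at T b"
  have w: "integrable lborel w" unfolding w_def by (rule causal_loc_integrable[OF b])
  have eq: "cnv unit_step b t = (LINT s:{0..t}|lborel. w s)" if "t \<le> T" for t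
    unfolding cnv_one_set_integral[OF b] set_lebesgue_integral_def w_def
    by (rule Bochner_Integration.integral_cong) (use that in \<open>auto simp: truncate_at_def indicator_def\<close>)
  have "AE x in lebesgue. 0 < x \<and> x < T \<longrightarrow> (cnv unit_step b has_real_derivative w x) (at x)"
  proof (rule indefinite_integral_derivative_AE[OF w])
    fix u v :: real assume "0 < u" "u \<le> v" "v < T"
    then show "cnv unit_step b v - cnv unit_step b u = (LINT y:{u..v}|lborel. w y)"
      using eq[of u] eq[of v] set_integral_split_Icc[OF w, of 0 u v] by simp
  qed
  then have "AE x in lebesgue. x < T \<longrightarrow> b x = 0"
  proof eventually_elim
    case (elim x)
    show ?case
    proof
      assume "x < T"
      show "b x = 0"
      proof (cases "0 < x")
        case True
        have "(cnv unit_step b has_real_derivative w x) (at x)" using elim True \<open>x < T\<close> by simp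
        moreover have "(cnv unit_step b has_real_derivative 0) (at x)"
        proof (rule has_field_derivative_transform_within_open[of "\<lambda>_. 0" _ _ "{0<..<T}"])
          show "0 = cnv unit_step b y" if "y \<in> {0<..<T}" for y using z[of y] that by simp
        qed (use True \<open>x < T\<close> in auto)
        ultimately have "w x = 0" by (rule DERIV_unique)
        then show ?thesis using \<open>x < T\<close> by (simp add: w_def truncate_at_def)
      qed (use causal_loc_nonpos[OF b] in auto)
    qed
  qed
  then show ?thesis by (simp add: AE_completion_iff)
qed

subsection \<open>Abel kernels and Mittag-Leffler functions\<close>

definition gk :: "real \<Rightarrow> real \<Rightarrow> real" where
  "gk \<beta> t = (if 0 < t then t powr (\<beta> - 1) / Gamma \<beta> else 0)"

lemma gk_nonneg: "0 < \<beta> \<Longrightarrow> 0 \<le> gk \<beta> t"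
  by (simp add: gk_def Gamma_real_pos less_imp_le)

lemma gk_pos: "0 < \<beta> \<Longrightarrow> 0 < t \<Longrightarrow> 0 < gk \<beta> t"
  by (simp add: gk_def Gamma_real_pos)

lemma gk_one: "gk 1 = unit_step"
  by (auto simp: gk_def unit_step_def)

lemma borel_measurable_gk [measurable]: "gk \<beta> \<in> borel_measurable borel"
  unfolding gk_def[abs_def] by measurable

lemma Beta_lborel:
  fixes a b :: real
  assumes "0 < a" "0 < b"
  shows "integrable lborel (\<lambda>x. indicator {0..1} x * (x powr (a - 1) * (1 - x) powr (b - 1)))"
    "(LINT x|lborel. indicator {0..1} x * (x powr (a - 1) * (1 - x) powr (b - 1))) = Beta a b"
proof -
  have i: "set_integrable lborel {0..1} (\<lambda>x. x powr (a - 1) * (1 - x) powr (b - 1))"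
    by (rule integrable_Beta[OF assms])
  then show "integrable lborel (\<lambda>x. indicator {0..1} x * (x powr (a - 1) * (1 - x) powr (b - 1)))"
    by (simp add: set_integrable_def)
  show "(LINT x|lborel. indicator {0..1} x * (x powr (a - 1) * (1 - x) powr (b - 1))) = Beta a b"
    using set_borel_integral_eq_integral(2)[OF i] integral_unique[OF has_integral_Beta_real[OF assms]]
    by (simp add: set_lebesgue_integral_def)
qed

lemma gk_scaled:
  assumes "0 < t" "0 < a" "0 < b"
  shows "gk a (t - t * x) * gk b (t * x) =
    (t powr (a + b - 2) / (Gamma a * Gamma b)) * (indicator {0..1} x * (x powr (b - 1) * (1 - x) powr (a - 1)))"
proof (cases "0 < x \<and> x < 1")
  case True
  then have "0 < t - t * x" using assms by simp
  have eq: "t - t * x = t * (1 - x)" by (simp add: algebra_simps)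
  have "(t - t * x) powr (a - 1) = t powr (a - 1) * (1 - x) powr (a - 1)"
    unfolding eq using True assms by (intro powr_mult)
  moreover have "(t * x) powr (b - 1) = t powr (b - 1) * x powr (b - 1)"
    using True assms by (intro powr_mult)
  moreover have "t powr (a + b - 2) = t powr (a - 1) * t powr (b - 1)"
    by (simp add: powr_add[symmetric] algebra_simps)
  ultimately show ?thesis
    using True \<open>0 < t - t * x\<close> assms by (simp add: gk_def indicator_def)
next
  case False
  have "gk a (t - t * x) * gk b (t * x) = 0"
    using False assms by (auto simp: gk_def zero_less_mult_iff)
  moreover have "indicator {0..1} x * (x powr (b - 1) * (1 - x) powr (a - 1)) = 0"
    using False by (auto simp: indicator_def)
  ultimately show ?thesis by (simp only: mult_zero_right)
qed

text \<open>Semigroup law of the Riemann-Liouville kernels: the substitution s = t x turns the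
  integral into a Beta function.\<close>

lemma cnv_gk:
  assumes a: "0 < a" and b: "0 < b"
  shows "cnv_exists (gk a) (gk b) t" "cnv (gk a) (gk b) t = gk (a + b) t"
proof -
  have "cnv_exists (gk a) (gk b) t \<and> cnv (gk a) (gk b) t = gk (a + b) t"
  proof (cases "0 < t")
    case True
    let ?f = "\<lambda>s. gk a (t - s) * gk b s"
    let ?c = "t powr (a + b - 2) / (Gamma a * Gamma b)"
    have eq: "(\<lambda>x. ?f (0 + t * x)) = (\<lambda>x. ?c * (indicator {0..1} x * (x powr (b - 1) * (1 - x) powr (a - 1))))"
      using gk_scaled[OF True a b] by auto
    have "integrable lborel (\<lambda>x. ?f (0 + t * x))"
      unfolding eq by (intro integrable_mult_right Beta_lborel b a)
    then have ex: "integrable lborel ?f"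
      using True by (subst (asm) lborel_integrable_real_affine_iff) auto
    have "(LINT s|lborel. ?f s) = \<bar>t\<bar> *\<^sub>R (LINT x|lborel. ?f (0 + t * x))"
      using True by (intro lborel_integral_real_affine) auto
    also have "\<dots> = t * (?c * Beta b a)"
      unfolding eq using True Beta_lborel(2)[OF b a] by simp
    also have "\<dots> = (t * t powr (a + b - 2)) * (Beta b a / (Gamma a * Gamma b))" by simp
    also have "t * t powr (a + b - 2) = t powr (a + b - 1)"
      using True powr_add[of t 1 "a + b - 2"] by (simp add: algebra_simps)
    also have "Beta b a / (Gamma a * Gamma b) = 1 / Gamma (a + b)"
    proof -
      have "Gamma a \<noteq> 0" "Gamma b \<noteq> 0" using Gamma_real_pos[OF a] Gamma_real_pos[OF b] by auto
      then show ?thesis by (simp add: Beta_def add.commute)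
    qed
    finally show ?thesis using ex True by (simp add: cnv_exists_def cnv_def gk_def)
  next
    case False
    have "(\<lambda>s. gk a (t - s) * gk b s) = (\<lambda>s. 0)" using False by (auto simp: gk_def)
    then show ?thesis using False by (simp add: cnv_exists_def cnv_def gk_def)
  qed
  then show "cnv_exists (gk a) (gk b) t" "cnv (gk a) (gk b) t = gk (a + b) t" by auto
qed

lemma causal_loc_gk:
  assumes b: "0 < b"
  shows "causal_loc (gk b)"
proof (rule causal_locI)
  fix T :: real assume "0 < T"
  let ?f = "truncate_at T (gk b)"
  have "(\<lambda>s. gk 1 (T - s) * gk b s) = (\<lambda>s. unit_step (T - s) * gk b s)" by (simp add: gk_one)
  then have i: "integrable lborel (\<lambda>s. unit_step (T - s) * gk b s)"
    using cnv_gk(1)[of 1 b T] b by (simp add: cnv_exists_def)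
  have [measurable]: "unit_step \<in> borel_measurable borel" using causal_loc_one by (auto simp: causal_loc_def)
  have ae: "AE s in lborel. unit_step (T - s) * gk b s = ?f s"
    using AE_lborel_singleton[of T] by eventually_elim (auto simp: unit_step_def truncate_at_def)
  show "integrable lborel ?f"
    using i by (subst (asm) integrable_cong_AE[OF _ _ ae]) auto
qed (auto simp: gk_def)

text \<open>Divided by \<open>Gamma \<alpha>\<close> this is the quotient of consecutive
  Mittag-Leffler coefficients, so the limit gives the ratio test for arguments of any size.
  Dominated convergence in the Beta integral takes the place of Stirling's formula.\<close>

lemma Beta_tendsto_0:
  assumes "0 < \<alpha>"
  shows "(\<lambda>j. Beta (\<alpha> * real (Suc j)) \<alpha>) \<longlonglongrightarrow> 0"
proof -
  let ?f = "\<lambda>j x. indicator {0..1} x * (x powr (\<alpha> * real (Suc j) - 1) * (1 - x) powr (\<alpha> - 1))"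
  have "(\<lambda>j. LINT x|lborel. ?f j x) \<longlonglongrightarrow> (LINT x|lborel. (\<lambda>_::real. 0::real) x)"
  proof (rule integral_dominated_convergence[where w = "?f 0"])
    show "integrable lborel (?f 0)" using Beta_lborel(1)[of \<alpha> \<alpha>] assms by simp
    show "AE x in lborel. (\<lambda>j. ?f j x) \<longlonglongrightarrow> 0"
      using AE_lborel_singleton[of "1::real"]
    proof eventually_elim
      case (elim x)
      show ?case
      proof (cases "0 < x \<and> x < 1")
        case True
        have e: "?f j x = (x powr \<alpha>) ^ j * (x powr (\<alpha> - 1) * (1 - x) powr (\<alpha> - 1))" for j
        proof -
          have "x powr (\<alpha> * real (Suc j) - 1) = x powr (\<alpha> * real j + (\<alpha> - 1))"
            by (simp add: algebra_simps)
          also have "\<dots> = (x powr \<alpha>) powr real j * x powr (\<alpha> - 1)"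
            by (simp add: powr_add powr_powr)
          also have "(x powr \<alpha>) powr real j = (x powr \<alpha>) ^ j" using True by (simp add: powr_realpow)
          finally show ?thesis using True by (simp add: indicator_def)
        qed
        have "x powr \<alpha> < 1" using True assms powr_less_mono2[of \<alpha> x 1] by simp
        then have "(\<lambda>j. (x powr \<alpha>) ^ j) \<longlonglongrightarrow> 0" by (intro LIMSEQ_realpow_zero) auto
        then show ?thesis unfolding e by (rule tendsto_mult_left_zero)
      next
        case False
        then have "indicator {0..1} x * (x powr b * (1 - x) powr (\<alpha> - 1)) = (0::real)" for b
          using elim by (auto simp: indicator_def)
        then show ?thesis by (simp only: tendsto_const)
      qed
    qed
    show "AE x in lborel. norm (?f j x) \<le> ?f 0 x" for j
    proof (rule AE_I2)
      fix x :: real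
      have "\<alpha> - 1 \<le> \<alpha> * real (Suc j) - 1" using assms by (simp add: algebra_simps)
      then have "x powr (\<alpha> * real (Suc j) - 1) \<le> x powr (\<alpha> - 1)" if "0 \<le> x" "x \<le> 1"
        using that by (intro powr_mono') auto
      then show "norm (?f j x) \<le> ?f 0 x" by (auto simp: indicator_def mult_right_mono)
    qed
  qed auto
  then show ?thesis using Beta_lborel(2)[of "\<alpha> * real (Suc _)" \<alpha>] assms by simp
qed

lemma gk_power:
  assumes "0 < t"
  shows "gk (\<alpha> * real (Suc j)) t = t powr (\<alpha> - 1) * (t powr \<alpha>) ^ j / Gamma (\<alpha> * real (Suc j))"
proof -
  have "t powr (\<alpha> * real (Suc j) - 1) = t powr (\<alpha> * real j + (\<alpha> - 1))"
    by (simp add: algebra_simps)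
  also have "\<dots> = (t powr \<alpha>) powr real j * t powr (\<alpha> - 1)"
    by (simp add: powr_add powr_powr)
  also have "(t powr \<alpha>) powr real j = (t powr \<alpha>) ^ j" using assms by (simp add: powr_realpow)
  finally show ?thesis using assms by (simp add: gk_def)
qed

lemma summable_mittag_leffler_coeffs:
  fixes z :: real
  assumes "0 < \<alpha>"
  shows "summable (\<lambda>j. z ^ j / Gamma (\<alpha> * real (Suc j)))"
proof -
  have "(\<lambda>j. \<bar>z\<bar> / Gamma \<alpha> * Beta (\<alpha> * real (Suc j)) \<alpha>) \<longlonglongrightarrow> \<bar>z\<bar> / Gamma \<alpha> * 0"
    by (intro tendsto_intros Beta_tendsto_0 assms)
  then have "eventually (\<lambda>j. \<bar>z\<bar> / Gamma \<alpha> * Beta (\<alpha> * real (Suc j)) \<alpha> < 1/2) sequentially"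
    by (intro order_tendstoD) auto
  then obtain N where N: "\<And>j. j \<ge> N \<Longrightarrow> \<bar>z\<bar> / Gamma \<alpha> * Beta (\<alpha> * real (Suc j)) \<alpha> < 1/2"
    by (auto simp: eventually_sequentially)
  show ?thesis
  proof (rule summable_ratio_test[of "1/2" N])
    fix j assume "N \<le> j"
    let ?x = "\<alpha> * real (Suc j)"
    have pos: "0 < Gamma ?x" "0 < Gamma \<alpha>" "0 < Gamma (\<alpha> * real (Suc (Suc j)))"
      using assms by (intro Gamma_real_pos; simp)+
    have e: "\<alpha> * real (Suc (Suc j)) = ?x + \<alpha>" by (simp add: algebra_simps)
    have "norm (z ^ Suc j / Gamma (\<alpha> * real (Suc (Suc j)))) = (\<bar>z\<bar> / Gamma \<alpha> * Beta ?x \<alpha>) * norm (z ^ j / Gamma ?x)"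
      using pos unfolding e Beta_def by (simp add: abs_mult power_abs)
    also have "\<dots> \<le> 1/2 * norm (z ^ j / Gamma ?x)"
      using N[OF \<open>N \<le> j\<close>] by (intro mult_right_mono) auto
    finally show "norm (z ^ Suc j / Gamma (\<alpha> * real (Suc (Suc j)))) \<le> 1/2 * norm (z ^ j / Gamma ?x)" .
  qed simp
qed

lemma summable_gk:
  assumes "0 < \<alpha>"
  shows "summable (\<lambda>j. c ^ j * gk (\<alpha> * real (Suc j)) t)"
proof (cases "0 < t")
  case True
  have "(\<lambda>j. c ^ j * gk (\<alpha> * real (Suc j)) t) =
    (\<lambda>j. t powr (\<alpha> - 1) * ((c * t powr \<alpha>) ^ j / Gamma (\<alpha> * real (Suc j))))"
    using True by (simp add: gk_power power_mult_distrib mult.left_commute del: of_nat_Suc)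
  then show ?thesis using summable_mittag_leffler_coeffs[OF assms] by (simp only: summable_mult)
qed (simp add: gk_def)

text \<open>\<open>ml \<alpha> \<mu> t = t powr (\<alpha> - 1) * E\<^sub>\<alpha>\<^sub>,\<^sub>\<alpha>(- \<mu> * t powr \<alpha>)\<close> and
  \<open>ml0 \<alpha> \<mu> t = E\<^sub>\<alpha>(- \<mu> * t powr \<alpha>)\<close> for \<open>t > 0\<close>, in terms of the Mittag-Leffler functions.\<close>

definition ml :: "real \<Rightarrow> real \<Rightarrow> real \<Rightarrow> real" where
  "ml \<alpha> \<mu> t = (\<Sum>j. (- \<mu>) ^ j * gk (\<alpha> * real (Suc j)) t)"

definition ml0 :: "real \<Rightarrow> real \<Rightarrow> real \<Rightarrow> real" where
  "ml0 \<alpha> \<mu> = cnv (gk (1 - \<alpha>)) (ml \<alpha> \<mu>)"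

text \<open>The quotient \<open>ml \<alpha> \<mu> / gk \<alpha>\<close>, continuous up to \<open>t = 0\<close> where \<open>ml\<close> itself is singular.\<close>

definition ml_ratio :: "real \<Rightarrow> real \<Rightarrow> real \<Rightarrow> real" where
  "ml_ratio \<alpha> \<mu> t = Gamma \<alpha> * (\<Sum>j. (- \<mu>) ^ j / Gamma (\<alpha> * real (Suc j)) * (t powr \<alpha>) ^ j)"

context
  fixes \<alpha> \<mu> :: real
  assumes \<alpha>: "0 < \<alpha>" "\<alpha> < 1" and \<mu>: "0 \<le> \<mu>"
begin

lemma ml_nonpos: "t \<le> 0 \<Longrightarrow> ml \<alpha> \<mu> t = 0"
  by (simp add: ml_def gk_def)

lemma borel_measurable_ml [measurable]: "ml \<alpha> \<mu> \<in> borel_measurable borel"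
  unfolding ml_def[abs_def] by measurable

lemma continuous_on_ml_ratio: "continuous_on {0..T} (ml_ratio \<alpha> \<mu>)"
proof -
  have s: "summable (\<lambda>j. (- \<mu>) ^ j / Gamma (\<alpha> * real (Suc j)) * z ^ j)" for z
    using summable_mittag_leffler_coeffs[OF \<alpha>(1), of "- \<mu> * z"] by (simp only: power_mult_distrib times_divide_eq_left)
  have "continuous_on UNIV (\<lambda>z. \<Sum>j. (- \<mu>) ^ j / Gamma (\<alpha> * real (Suc j)) * z ^ j)"
    using isCont_powser_converges_everywhere[OF s] by (simp add: continuous_on_eq_continuous_at)
  moreover have "continuous_on {0..T} (\<lambda>t. t powr \<alpha>)"
    using \<alpha> by (intro continuous_on_powr') (auto intro!: continuous_intros)
  ultimately have "continuous_on {0..T} (\<lambda>t. \<Sum>j. (- \<mu>) ^ j / Gamma (\<alpha> * real (Suc j)) * (t powr \<alpha>) ^ j)"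
    by (rule continuous_on_compose2) auto
  then show ?thesis unfolding ml_ratio_def[abs_def] by (intro continuous_intros)
qed

lemma ml_eq: "0 < t \<Longrightarrow> ml \<alpha> \<mu> t = gk \<alpha> t * ml_ratio \<alpha> \<mu> t"
proof -
  assume t: "0 < t"
  have "Gamma \<alpha> > 0" using \<alpha> by (simp add: Gamma_real_pos)
  have s: "summable (\<lambda>j. (- \<mu>) ^ j / Gamma (\<alpha> * real (Suc j)) * (t powr \<alpha>) ^ j)"
    using summable_mittag_leffler_coeffs[OF \<alpha>(1), of "- \<mu> * t powr \<alpha>"] by (simp only: power_mult_distrib times_divide_eq_left)
  have "ml \<alpha> \<mu> t = (\<Sum>j. t powr (\<alpha> - 1) * ((- \<mu>) ^ j / Gamma (\<alpha> * real (Suc j)) * (t powr \<alpha>) ^ j))"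
    unfolding ml_def using t by (simp add: gk_power mult.left_commute mult.assoc del: of_nat_Suc)
  also have "\<dots> = t powr (\<alpha> - 1) * (\<Sum>j. (- \<mu>) ^ j / Gamma (\<alpha> * real (Suc j)) * (t powr \<alpha>) ^ j)"
    by (rule suminf_mult[OF s])
  finally show ?thesis using t \<open>Gamma \<alpha> > 0\<close> by (simp add: gk_def ml_ratio_def)
qed

lemma causal_loc_ml: "causal_loc (ml \<alpha> \<mu>)"
proof (rule causal_locI)
  fix T :: real assume "0 < T"
  have "compact (ml_ratio \<alpha> \<mu> ` {0..T})"
    by (intro compact_continuous_image continuous_on_ml_ratio) auto
  then obtain C where C: "\<And>t. t \<in> {0..T} \<Longrightarrow> \<bar>ml_ratio \<alpha> \<mu> t\<bar> \<le> C"
    using compact_imp_bounded by (metis bounded_iff image_eqI real_norm_def)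
  show "integrable lborel (truncate_at T (ml \<alpha> \<mu>))"
  proof (rule Bochner_Integration.integrable_bound)
    show "integrable lborel (\<lambda>t. C * truncate_at T (gk \<alpha>) t)"
      using causal_loc_integrable[OF causal_loc_gk[OF \<alpha>(1)]] by simp
    show "AE t in lborel. norm (truncate_at T (ml \<alpha> \<mu>) t) \<le> norm (C * truncate_at T (gk \<alpha>) t)"
    proof (rule AE_I2)
      fix t
      show "norm (truncate_at T (ml \<alpha> \<mu>) t) \<le> norm (C * truncate_at T (gk \<alpha>) t)"
      proof (cases "0 < t \<and> t \<le> T")
        case True
        then have "\<bar>ml_ratio \<alpha> \<mu> t\<bar> \<le> \<bar>C\<bar>" using C[of t] by auto
        then have "\<bar>gk \<alpha> t\<bar> * \<bar>ml_ratio \<alpha> \<mu> t\<bar> \<le> \<bar>gk \<alpha> t\<bar> * \<bar>C\<bar>" by (rule mult_left_mono) simp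
        then show ?thesis using True by (simp add: truncate_at_def ml_eq abs_mult mult.commute)
      next
        case False
        then show ?thesis using ml_nonpos by (auto simp: truncate_at_def)
      qed
    qed
  qed auto
qed (auto simp: ml_nonpos)

text \<open>The resolvent equation of the kernel \<open>gk \<alpha>\<close>: by the semigroup law,
  convolution with \<open>gk \<alpha>\<close> shifts the defining series by one term.\<close>

lemma ml_integral_equation:
  shows "ml \<alpha> \<mu> t = gk \<alpha> t - \<mu> * cnv (gk \<alpha>) (ml \<alpha> \<mu>) t" "cnv_exists (gk \<alpha>) (ml \<alpha> \<mu>) t"
proof -
  let ?f = "\<lambda>j s. gk \<alpha> (t - s) * ((- \<mu>) ^ j * gk (\<alpha> * real (Suc j)) s)"
  let ?G = "\<lambda>j. gk (\<alpha> * real (Suc j)) t"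
  have p: "0 < \<alpha> * real (Suc j)" for j using \<alpha> by simp
  have e: "\<alpha> + \<alpha> * real (Suc j) = \<alpha> * real (Suc (Suc j))" for j by (simp add: algebra_simps)
  note cg = cnv_gk[OF \<alpha>(1) p, unfolded e]
  have int: "(LINT s|lborel. ?f j s) = (- \<mu>) ^ j * ?G (Suc j)" for j
    using cg(2)[of j t] cnv_cmult_right[of "gk \<alpha>" "(- \<mu>) ^ j" "gk (\<alpha> * real (Suc j))" t] by (simp add: cnv_def)
  have iabs: "(LINT s|lborel. \<bar>?f j s\<bar>) = \<mu> ^ j * ?G (Suc j)" for j
  proof -
    have "\<bar>?f j s\<bar> = gk \<alpha> (t - s) * (\<mu> ^ j * gk (\<alpha> * real (Suc j)) s)" for s
      using gk_nonneg[OF \<alpha>(1)] gk_nonneg[OF p] \<mu> by (simp add: abs_mult power_abs)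
    then show ?thesis
      using cg(2)[of j t] cnv_cmult_right[of "gk \<alpha>" "\<mu> ^ j" "gk (\<alpha> * real (Suc j))" t] by (simp add: cnv_def)
  qed
  have i: "integrable lborel (?f j)" for j
    using cnv_exists_cmult_right[OF cg(1)] by (simp add: cnv_exists_def)
  have "summable (\<lambda>j. \<mu> ^ j * ?G j)" by (rule summable_gk[OF \<alpha>(1)])
  have sS: "summable (\<lambda>j. (-\<mu>) ^ j * ?G j)" by (rule summable_gk[OF \<alpha>(1)])
  \<comment> \<open>This is the shifted series divided by \<mu>; for \<mu> = 0 only the term j = 0
    is left.\<close>
  have sm: "summable (\<lambda>j. \<mu> ^ j * ?G (Suc j))"
  proof (cases "\<mu> = 0")
    case True
    then have "(\<lambda>j. \<mu> ^ j * ?G (Suc j)) = (\<lambda>j. if j = 0 then ?G (Suc 0) else 0)"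
      by (auto simp: fun_eq_iff)
    then show ?thesis by (simp only:) (rule summable_single)
  next
    case False
    have "summable (\<lambda>j. \<mu> ^ Suc j * ?G (Suc j))"
      using \<open>summable (\<lambda>j. \<mu> ^ j * ?G j)\<close> by (subst summable_Suc_iff)
    then have "summable (\<lambda>j. (1/\<mu>) * (\<mu> ^ Suc j * ?G (Suc j)))" by (rule summable_mult)
    then show ?thesis using False by (simp del: of_nat_Suc)
  qed
  have s1: "summable (\<lambda>j. LINT s|lborel. \<bar>?f j s\<bar>)" using sm iabs by simp
  note ser = integrable_series[of lborel ?f, OF i s1]
  have fs: "(\<Sum>j. ?f j s) = gk \<alpha> (t - s) * ml \<alpha> \<mu> s" for s
    unfolding ml_def by (rule suminf_mult[OF summable_gk[OF \<alpha>(1)]])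
  show "cnv_exists (gk \<alpha>) (ml \<alpha> \<mu>) t" using ser(2) by (simp only: fs cnv_exists_def)
  have "(\<lambda>j. (- \<mu>) ^ j * ?G (Suc j)) sums cnv (gk \<alpha>) (ml \<alpha> \<mu>) t"
    using ser(3) by (simp only: int fs cnv_def)
  then have "(\<lambda>j. - \<mu> * ((- \<mu>) ^ j * ?G (Suc j))) sums (- \<mu> * cnv (gk \<alpha>) (ml \<alpha> \<mu>) t)"
    by (rule sums_mult)
  then have "(\<lambda>j. (- \<mu>) ^ Suc j * ?G (Suc j)) sums (- \<mu> * cnv (gk \<alpha>) (ml \<alpha> \<mu>) t)"
    by (simp only: power_Suc mult.assoc)
  then have "(\<lambda>j. (- \<mu>) ^ j * ?G j) sums (- \<mu> * cnv (gk \<alpha>) (ml \<alpha> \<mu>) t + (- \<mu>) ^ 0 * ?G 0)"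
    by (rule sums_Suc)
  then show "ml \<alpha> \<mu> t = gk \<alpha> t - \<mu> * cnv (gk \<alpha>) (ml \<alpha> \<mu>) t"
    unfolding ml_def by (simp add: sums_iff)
qed

section \<open>Positivity, monotonicity and decay of the Mittag-Leffler functions\<close>

lemma gk_antimono: "0 < s \<Longrightarrow> s \<le> t \<Longrightarrow> gk \<alpha> t \<le> gk \<alpha> s"
  using \<alpha> Gamma_real_pos[of \<alpha>] by (auto simp: gk_def intro!: divide_right_mono powr_mono2')

lemma cnv_gk_one: "cnv (gk \<alpha>) unit_step t = gk (\<alpha> + 1) t"
  using cnv_gk(2)[of \<alpha> 1 t] \<alpha> by (simp add: gk_one)

text \<open>At a first zero \<open>t\<^sub>0\<close> of the ratio \<open>r\<close>, monotonicity of \<open>gk \<alpha> (t - s) / gk \<alpha> t\<close> in \<open>t\<close> bounds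
  \<open>r(t) = r(t) - r(t\<^sub>0)\<close> by \<open>\<epsilon>(t) max r\<close>, the maximum over \<open>[t, t\<^sub>0]\<close>, with
  \<open>\<epsilon>(t) \<rightarrow> 0\<close>; a point where the maximum is attained gives the contradiction.\<close>

lemma ml_ratio_pos:
  assumes "0 \<le> t1"
  shows "0 < ml_ratio \<alpha> \<mu> t1"
proof (rule ccontr)
  assume neg: "\<not> 0 < ml_ratio \<alpha> \<mu> t1"
  let ?r = "ml_ratio \<alpha> \<mu>" and ?g = "gk \<alpha>" and ?k = "ml \<alpha> \<mu>"
  have gpos: "0 < t \<Longrightarrow> 0 < ?g t" for t using gk_pos \<alpha> by simp
  have r0: "?r 0 = 1"
  proof -
    have "(\<lambda>j. (- \<mu>) ^ j / Gamma (\<alpha> * real (Suc j)) * (0 powr \<alpha>) ^ j) sums (1 / Gamma \<alpha>)"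
      using sums_single[of 0 "\<lambda>j. (- \<mu>) ^ j / Gamma (\<alpha> * real (Suc j)) * (0 powr \<alpha>) ^ j"]
      by (simp add: power_0_left if_distrib[of "\<lambda>x. _ * x"] cong: if_cong)
    then show ?thesis using Gamma_real_pos[OF \<alpha>(1)] by (simp add: ml_ratio_def sums_iff)
  qed
  define S where "S = {0..t1} \<inter> ?r -` {..0}"
  have "closed S" unfolding S_def by (intro continuous_closed_preimage continuous_on_ml_ratio) auto
  moreover have "bounded S" unfolding S_def by (rule bounded_subset[of "{0..t1}"]) auto
  ultimately have "compact S" by (simp add: compact_eq_bounded_closed)
  moreover have "S \<noteq> {}" using neg assms by (auto simp: S_def)
  ultimately have "\<exists>s\<in>S. \<forall>t\<in>S. s \<le> t" by (rule compact_attains_inf)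
  then obtain t0 where t0: "t0 \<in> S" "\<forall>t\<in>S. t0 \<le> t" by (elim bexE)
  have rt0: "?r t0 \<le> 0" "0 \<le> t0" "t0 \<le> t1" using t0(1) unfolding S_def by simp_all
  then have "t0 \<noteq> 0" using r0 by auto
  then have "0 < t0" using rt0 by simp
  have rpos: "0 < ?r t" if "0 \<le> t" "t < t0" for t
  proof (rule ccontr)
    assume "\<not> 0 < ?r t"
    then have "t \<in> S" using that rt0 by (simp add: S_def)
    then show False using bspec[OF t0(2)] that by fastforce
  qed
  have kpos: "0 \<le> ?k s" if "s < t0" for s
    using rpos[of s] gpos[of s] ml_nonpos[of s] that by (cases "0 < s") (auto simp: ml_eq)
  have key: "?r t \<le> \<mu> * (?g t / ?g t0) * gk (\<alpha> + 1) (t0 - t) * M"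
    if t: "0 < t" "t < t0" and M: "\<And>s. t \<le> s \<Longrightarrow> s \<le> t0 \<Longrightarrow> ?r s \<le> M" "0 \<le> M" for t M
  proof -
    have eqr: "?r s = 1 - \<mu> * cnv ?g ?k s / ?g s" if "0 < s" for s
      using ml_integral_equation(1)[of s] ml_eq[OF that] gpos[OF that] by (simp add: field_simps)
    have exs: "integrable lborel (\<lambda>x. ?g (s - x) * ?k x)" for s
      using ml_integral_equation(2)[of s] by (simp add: cnv_exists_def)
    have one_ex: "integrable lborel (\<lambda>x. ?g (t0 - x) * unit_step (x - t))"
      and one_int: "(LINT x|lborel. ?g (t0 - x) * unit_step (x - t)) = gk (\<alpha> + 1) (t0 - t)"
    proof -
      have "cnv_exists ?g unit_step (t0 - t)" using cnv_gk(1)[of \<alpha> 1] \<alpha> by (simp add: gk_one)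
      then have "integrable lborel (\<lambda>x. ?g (t0 - t - x) * unit_step x)" by (simp add: cnv_exists_def)
      from lborel_integrable_real_affine[OF this, of 1 "-t"]
      show "integrable lborel (\<lambda>x. ?g (t0 - x) * unit_step (x - t))" by (simp add: algebra_simps)
      show "(LINT x|lborel. ?g (t0 - x) * unit_step (x - t)) = gk (\<alpha> + 1) (t0 - t)"
        using lborel_integral_real_affine[of 1 "\<lambda>x. ?g (t0 - t - x) * unit_step x" "-t"] cnv_gk_one[of "t0 - t"]
        by (simp add: cnv_def algebra_simps)
    qed
    \<comment> \<open>For x below t the difference of the two weights is nonpositive; only the
      stretch from t to t0 contributes, and there \<open>ml\<close> is \<open>gk \<alpha>\<close>
      times the ratio, at most \<open>gk \<alpha> t * M\<close>.\<close>
    have pw: "?g (t0 - x) * ?k x / ?g t0 - ?g (t - x) * ?k x / ?g t \<le> (?g t / ?g t0 * M) * (?g (t0 - x) * unit_step (x - t))"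
      if "x \<noteq> t" for x
    proof -
      consider "x \<le> 0" | "0 < x" "x < t" | "t < x" "x < t0" | "t0 \<le> x" using \<open>x \<noteq> t\<close> by linarith
      then show ?thesis
      proof cases
        case 1 then show ?thesis using ml_nonpos[of x] t by (simp add: unit_step_def)
      next
        case 2
        \<comment> \<open>The quotient on the right is (1 - x/t) powr (\<alpha> - 1): the base grows
          with t and the exponent is negative.\<close>
        have "?g (t0 - x) / ?g t0 \<le> ?g (t - x) / ?g t"
        proof -
          have G: "Gamma \<alpha> > 0" using \<alpha> by (simp add: Gamma_real_pos)
          have "((t0 - x) / t0) powr (\<alpha> - 1) \<le> ((t - x) / t) powr (\<alpha> - 1)"
          proof (rule powr_mono2')
            show "\<alpha> - 1 \<le> 0" using \<alpha> by simp
            show "0 < (t - x) / t" using 2 by simp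
            have "x / t0 \<le> x / t" using 2 t by (intro divide_left_mono) auto
            then show "(t - x) / t \<le> (t0 - x) / t0" using t by (simp add: diff_divide_distrib)
          qed
          then show ?thesis using 2 t G by (simp add: gk_def powr_divide)
        qed
        then have "?g (t0 - x) / ?g t0 * ?k x \<le> ?g (t - x) / ?g t * ?k x"
          using kpos[of x] 2 t by (intro mult_right_mono) auto
        then show ?thesis using 2 by (simp add: unit_step_def)
      next
        case 3
        have z: "?g (t - x) = 0" using 3 by (simp add: gk_def)
        have "?k x \<le> ?g t * M"
        proof -
          have "?k x = ?g x * ?r x" using 3 t by (intro ml_eq) auto
          also have "\<dots> \<le> ?g t * M"
            using 3 t M(1)[of x] rpos[of x] gpos[of t] gk_antimono[of t x] by (intro mult_mono) auto
          finally show ?thesis .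
        qed
        then have "?g (t0 - x) / ?g t0 * ?k x \<le> ?g (t0 - x) / ?g t0 * (?g t * M)"
          using gpos[of t0] \<open>0 < t0\<close> gk_nonneg[OF \<alpha>(1)] by (intro mult_left_mono) auto
        then show ?thesis using 3 z by (simp add: unit_step_def mult.commute mult.left_commute)
      next
        case 4
        then have "?g (t0 - x) = 0" "?g (t - x) = 0" using t by (auto simp: gk_def)
        then show ?thesis by simp
      qed
    qed
    have "?r t \<le> ?r t - ?r t0" using rt0 by simp
    also have "\<dots> = \<mu> * (cnv ?g ?k t0 / ?g t0 - cnv ?g ?k t / ?g t)"
      using eqr[OF \<open>0 < t\<close>] eqr[OF \<open>0 < t0\<close>] by (simp add: algebra_simps)
    also have "cnv ?g ?k t0 / ?g t0 - cnv ?g ?k t / ?g t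
      = (LINT x|lborel. ?g (t0 - x) * ?k x / ?g t0 - ?g (t - x) * ?k x / ?g t)"
      unfolding cnv_def using exs[of t0] exs[of t] by simp
    also have "\<mu> * \<dots> \<le> \<mu> * (LINT x|lborel. (?g t / ?g t0 * M) * (?g (t0 - x) * unit_step (x - t)))"
    proof (rule mult_left_mono[OF integral_mono_AE \<mu>])
      show "integrable lborel (\<lambda>x. ?g (t0 - x) * ?k x / ?g t0 - ?g (t - x) * ?k x / ?g t)"
        using exs[of t0] exs[of t] by simp
      show "integrable lborel (\<lambda>x. (?g t / ?g t0 * M) * (?g (t0 - x) * unit_step (x - t)))"
        using one_ex by simp
      show "AE x in lborel. ?g (t0 - x) * ?k x / ?g t0 - ?g (t - x) * ?k x / ?g t \<le> (?g t / ?g t0 * M) * (?g (t0 - x) * unit_step (x - t))"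
        using AE_lborel_singleton[of t] by eventually_elim (rule pw)
    qed
    also have "\<dots> = \<mu> * (?g t / ?g t0) * gk (\<alpha> + 1) (t0 - t) * M"
      using one_int by simp
    finally show ?thesis .
  qed
  have "((\<lambda>t. \<mu> * (?g t / ?g t0) * gk (\<alpha> + 1) (t0 - t)) \<longlongrightarrow> \<mu> * (?g t0 / ?g t0) * (0 powr \<alpha> / Gamma (\<alpha> + 1))) (at_left t0)"
  proof (intro tendsto_intros)
    have "((\<lambda>t. t powr (\<alpha> - 1) / Gamma \<alpha>) \<longlongrightarrow> t0 powr (\<alpha> - 1) / Gamma \<alpha>) (at_left t0)"
      using \<open>0 < t0\<close> Gamma_real_pos[OF \<alpha>(1)] by (auto intro!: tendsto_intros)
    moreover have "eventually (\<lambda>t. t powr (\<alpha> - 1) / Gamma \<alpha> = ?g t) (at_left t0)"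
      using eventually_at_left_real[OF \<open>0 < t0\<close>] by eventually_elim (simp add: gk_def)
    ultimately show "(?g \<longlongrightarrow> ?g t0) (at_left t0)"
      using \<open>0 < t0\<close> by (simp add: gk_def[of \<alpha> t0] Lim_transform_eventually)
    show "?g t0 \<noteq> 0" using gpos[OF \<open>0 < t0\<close>] by simp
    have "((\<lambda>t. (t0 - t) powr \<alpha> / Gamma (\<alpha> + 1)) \<longlongrightarrow> (t0 - t0) powr \<alpha> / Gamma (\<alpha> + 1)) (at_left t0)"
    proof (intro tendsto_intros tendsto_powr')
      have "0 < Gamma (\<alpha> + 1)" using \<alpha> by (intro Gamma_real_pos) simp
      then show "Gamma (\<alpha> + 1) \<noteq> 0" by simp
    qed (use \<alpha> in \<open>auto simp: eventually_at_filter\<close>)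
    moreover have "eventually (\<lambda>t. (t0 - t) powr \<alpha> / Gamma (\<alpha> + 1) = gk (\<alpha> + 1) (t0 - t)) (at_left t0)"
      using eventually_at_left_real[OF \<open>0 < t0\<close>] by eventually_elim (simp add: gk_def)
    ultimately show "((\<lambda>t. gk (\<alpha> + 1) (t0 - t)) \<longlongrightarrow> 0 powr \<alpha> / Gamma (\<alpha> + 1)) (at_left t0)"
      by (simp add: Lim_transform_eventually)
  qed
  \<comment> \<open>As t tends to t0 the factor \<open>gk (\<alpha> + 1) (t0 - t)\<close> tends to
    0, so the coefficient in \<open>key\<close> drops below 1 near t0.\<close>
  then have "eventually (\<lambda>t. \<mu> * (?g t / ?g t0) * gk (\<alpha> + 1) (t0 - t) < 1) (at_left t0)"
    by (rule order_tendstoD) simp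
  then obtain \<tau> where \<tau>: "\<tau> < t0" "\<And>t. \<tau> < t \<Longrightarrow> t < t0 \<Longrightarrow> \<mu> * (?g t / ?g t0) * gk (\<alpha> + 1) (t0 - t) < 1"
    unfolding eventually_at_left_field by blast
  define \<tau>' where "\<tau>' = (max 0 \<tau> + t0) / 2"
  have \<tau>': "0 < \<tau>'" "\<tau> < \<tau>'" "\<tau>' < t0" using \<tau>(1) \<open>0 < t0\<close> by (auto simp: \<tau>'_def max_def)
  have "continuous_on {\<tau>'..t0} ?r"
    using continuous_on_subset[OF continuous_on_ml_ratio[of t0]] \<tau>' by force
  then obtain ts where ts: "ts \<in> {\<tau>'..t0}" "\<And>t. t \<in> {\<tau>'..t0} \<Longrightarrow> ?r t \<le> ?r ts"
    using continuous_attains_sup[of "{\<tau>'..t0}" ?r] \<tau>' by auto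
  have "0 < ?r \<tau>'" using rpos \<tau>' by simp
  then have rts: "0 < ?r ts" using ts(2)[of \<tau>'] \<tau>' by simp
  then have "ts \<noteq> t0" using rt0 by auto
  then have ts': "0 < ts" "\<tau> < ts" "ts < t0" using ts(1) \<tau>' by auto
  have "?r ts \<le> \<mu> * (?g ts / ?g t0) * gk (\<alpha> + 1) (t0 - ts) * ?r ts"
    using ts ts' rts by (intro key) auto
  also have "\<dots> < 1 * ?r ts" using \<tau>(2)[OF ts'(2,3)] rts by (rule mult_strict_right_mono)
  finally show False by simp
qed

lemma ml_nonneg: "0 \<le> ml \<alpha> \<mu> t"
  using ml_ratio_pos[of t] gk_pos[OF \<alpha>(1), of t] ml_nonpos[of t] by (cases "0 < t") (auto simp: ml_eq)

lemma ml_le_gk: "ml \<alpha> \<mu> t \<le> gk \<alpha> t"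
  using ml_integral_equation(1)[of t] cnv_nonneg[of "gk \<alpha>" "ml \<alpha> \<mu>" t] ml_nonneg gk_nonneg[OF \<alpha>(1)] \<mu>
  by simp

lemma causal_loc_ml0: "causal_loc (ml0 \<alpha> \<mu>)"
  unfolding ml0_def using \<alpha> by (intro causal_loc_cnv causal_loc_gk causal_loc_ml) auto

lemma ml0_nonneg: "0 \<le> ml0 \<alpha> \<mu> t"
  unfolding ml0_def using \<alpha> ml_nonneg gk_nonneg by (intro cnv_nonneg) auto

text \<open>Convolving \<open>ml_integral_equation\<close> with \<open>gk (1 - \<alpha>)\<close>
  turns each \<open>gk \<alpha>\<close> into \<open>unit_step\<close>. Existence at every point
  comes from the bound \<open>gk (\<alpha> + \<alpha>)\<close> for the inner convolution.\<close>

lemma ml0_eq: "ml0 \<alpha> \<mu> t = unit_step t - \<mu> * cnv unit_step (ml \<alpha> \<mu>) t"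
proof -
  let ?g = "gk \<alpha>" and ?g' = "gk (1 - \<alpha>)" and ?k = "ml \<alpha> \<mu>"
  have p: "0 < 1 - \<alpha>" using \<alpha> by simp
  have l: "causal_loc ?g" "causal_loc ?g'" using \<alpha> by (auto intro: causal_loc_gk)
  have abs: "(\<lambda>s. \<bar>?g s\<bar>) = ?g" "(\<lambda>s. \<bar>?g' s\<bar>) = ?g'" "(\<lambda>s. \<bar>?k s\<bar>) = ?k"
    using gk_nonneg[OF \<alpha>(1)] gk_nonneg[OF p] ml_nonneg by auto
  have le: "cnv ?g ?k s \<le> gk (\<alpha> + \<alpha>) s" for s
    using cnv_mono[OF ml_integral_equation(2) cnv_gk(1)[OF \<alpha>(1) \<alpha>(1)]]
      mult_left_mono[OF ml_le_gk gk_nonneg[OF \<alpha>(1)]] cnv_gk(2)[OF \<alpha>(1) \<alpha>(1)] by metis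
  have nn: "0 \<le> cnv ?g ?k s" for s using gk_nonneg[OF \<alpha>(1)] ml_nonneg by (intro cnv_nonneg) auto
  have ex: "cnv_exists ?g' (cnv ?g ?k) t"
  proof (rule cnv_exists_bound[of ?g' "gk (\<alpha> + \<alpha>)"])
    show "cnv_exists ?g' (gk (\<alpha> + \<alpha>)) t" using \<alpha> by (intro cnv_gk) auto
    show "\<bar>?g' (t - s) * cnv ?g ?k s\<bar> \<le> \<bar>?g' (t - s) * gk (\<alpha> + \<alpha>) s\<bar>" for s
      using le[of s] nn[of s] gk_nonneg[OF p] by (auto simp: abs_mult intro!: mult_left_mono)
  qed auto
  have "cnv ?g' (cnv ?g ?k) t = cnv (cnv ?g' ?g) ?k t"
    by (rule cnv_assoc(1)) (use ex abs l causal_loc_ml in auto)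
  also have "cnv ?g' ?g = unit_step"
  proof
    show "cnv ?g' ?g x = unit_step x" for x using cnv_gk(2)[of "1 - \<alpha>" \<alpha> x] \<alpha> by (simp add: gk_one)
  qed
  finally have as: "cnv ?g' (cnv ?g ?k) t = cnv unit_step ?k t" .
  have "ml0 \<alpha> \<mu> t = cnv ?g' (\<lambda>s. ?g s - \<mu> * cnv ?g ?k s) t"
    unfolding ml0_def by (rule arg_cong[of _ _ "\<lambda>k. cnv ?g' k t"]) (rule ext, rule ml_integral_equation(1))
  also have "\<dots> = cnv ?g' ?g t - cnv ?g' (\<lambda>s. \<mu> * cnv ?g ?k s) t"
    using \<alpha> ex by (intro cnv_diff_right cnv_gk cnv_exists_cmult_right) auto
  also have "\<dots> = unit_step t - \<mu> * cnv unit_step ?k t"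
    using as cnv_gk(2)[of "1 - \<alpha>" \<alpha> t] \<alpha> by (simp add: gk_one cnv_cmult_right)
  finally show ?thesis .
qed

lemma cnv_one_ml_nonneg: "0 \<le> cnv unit_step (ml \<alpha> \<mu>) t"
  using ml_nonneg by (intro cnv_nonneg) (auto simp: unit_step_def)

lemma ml0_le_one: "ml0 \<alpha> \<mu> t \<le> unit_step t"
  using ml0_eq[of t] cnv_one_ml_nonneg[of t] \<mu> by simp

lemma ml0_le_1: "ml0 \<alpha> \<mu> t \<le> 1"
  using ml0_le_one[of t] by (auto simp: unit_step_def split: if_splits)

text \<open>The mass of \<open>\<mu> * ml\<close> is at most 1 for every \<mu>. This pays for one
  factor \<mu> in L^1 norms, and \<open>ml0_decay\<close> rests on it.\<close>

lemma cnv_one_ml_bound: "\<mu> * cnv unit_step (ml \<alpha> \<mu>) t \<le> 1"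
  using ml0_eq[of t] ml0_nonneg[of t] by (auto simp: unit_step_def split: if_splits)

lemma ml0_antimono:
  assumes "0 < s" "s \<le> t"
  shows "ml0 \<alpha> \<mu> t \<le> ml0 \<alpha> \<mu> s"
proof -
  have "cnv unit_step (ml \<alpha> \<mu>) s \<le> cnv unit_step (ml \<alpha> \<mu>) t"
    unfolding cnv_one(1)[OF causal_loc_ml]
  proof (rule integral_mono)
    show "truncate_at s (ml \<alpha> \<mu>) x \<le> truncate_at t (ml \<alpha> \<mu>) x" for x
      using assms ml_nonneg[of x] by (simp add: truncate_at_def)
  qed (intro causal_loc_integrable causal_loc_ml)+
  then have "\<mu> * cnv unit_step (ml \<alpha> \<mu>) s \<le> \<mu> * cnv unit_step (ml \<alpha> \<mu>) t" using \<mu> by (rule mult_left_mono)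
  then show ?thesis using assms by (simp add: ml0_eq unit_step_def)
qed

text \<open>Since \<open>ml0\<close> is nonincreasing, its value at t times the integral of
  \<open>gk \<alpha>\<close> over (0, t) is at most the convolution of \<open>gk \<alpha>\<close>
  with \<open>ml0\<close>. That convolution is the integral of \<open>ml\<close>, and \<mu> times it
  is at most 1.\<close>

lemma ml0_decay: "0 < t \<Longrightarrow> \<mu> * ml0 \<alpha> \<mu> t \<le> Gamma (\<alpha> + 1) * t powr (- \<alpha>)"
proof -
  assume t: "0 < t"
  let ?g = "gk \<alpha>" and ?g' = "gk (1 - \<alpha>)" and ?k = "ml \<alpha> \<mu>" and ?E = "ml0 \<alpha> \<mu>"
  have p: "0 < 1 - \<alpha>" using \<alpha> by simp
  have l: "causal_loc ?g" "causal_loc ?g'" using \<alpha> by (auto intro: causal_loc_gk)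
  have abs: "(\<lambda>s. \<bar>?g s\<bar>) = ?g" "(\<lambda>s. \<bar>?g' s\<bar>) = ?g'" "(\<lambda>s. \<bar>?k s\<bar>) = ?k"
    using gk_nonneg[OF \<alpha>(1)] gk_nonneg[OF p] ml_nonneg by auto
  have ex: "cnv_exists ?g ?E t"
    by (rule cnv_exists_bounded(1)[where B = 1])
       (use l causal_loc_ml0 ml0_nonneg ml0_le_1 in \<open>auto simp: causal_loc_def\<close>)
  have "cnv ?g ?E t = cnv (cnv ?g ?g') ?k t"
    unfolding ml0_def by (rule cnv_assoc(1)) (use ex abs l causal_loc_ml in \<open>auto simp: ml0_def\<close>)
  also have "cnv ?g ?g' = unit_step"
  proof
    show "cnv ?g ?g' x = unit_step x" for x using cnv_gk(2)[of \<alpha> "1 - \<alpha>" x] \<alpha> by (simp add: gk_one)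
  qed
  finally have eq: "cnv ?g ?E t = cnv unit_step ?k t" .
  have ex1: "cnv_exists ?g unit_step t" using cnv_gk(1)[of \<alpha> 1] \<alpha> by (simp add: gk_one)
  have "?E t * gk (\<alpha> + 1) t = cnv ?g (\<lambda>s. ?E t * unit_step s) t"
    by (simp add: cnv_cmult_right cnv_gk_one)
  also have "\<dots> \<le> cnv ?g ?E t"
  proof (rule cnv_mono[OF cnv_exists_cmult_right[OF ex1] ex])
    fix s
    consider "s \<le> 0" | "t \<le> s" | "0 < s" "s < t" by linarith
    then show "?g (t - s) * (?E t * unit_step s) \<le> ?g (t - s) * ?E s"
    proof cases
      case 3 then show ?thesis using ml0_antimono[of s t] gk_nonneg[OF \<alpha>(1)]
        by (intro mult_left_mono) (auto simp: unit_step_def)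
    qed (use causal_loc_nonpos[OF causal_loc_ml0] in \<open>auto simp: unit_step_def gk_def\<close>)
  qed
  finally have "\<mu> * (?E t * gk (\<alpha> + 1) t) \<le> \<mu> * cnv unit_step ?k t"
    unfolding eq using \<mu> by (rule mult_left_mono)
  also have "\<dots> \<le> 1" by (rule cnv_one_ml_bound)
  finally have "\<mu> * ?E t * gk (\<alpha> + 1) t \<le> 1" by (simp add: mult.assoc)
  moreover have "gk (\<alpha> + 1) t = t powr \<alpha> / Gamma (\<alpha> + 1)" using t by (simp add: gk_def)
  moreover have "0 < Gamma (\<alpha> + 1)" "0 < t powr \<alpha>" using \<alpha> t by (auto intro!: Gamma_real_pos)
  ultimately show ?thesis by (simp add: powr_minus field_simps)
qed

text \<open>For an integrable \<open>w\<close> the convolution with the singular \<open>ml\<close>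
  may fail to exist on a null set. Grouped around the bounded \<open>ml0\<close>, the triple
  convolution exists at every \<open>t\<close>.\<close>

lemma cnv_gk_cnv_ml:
  assumes w: "causal_loc w"
  shows "cnv_exists (gk (1 - \<alpha>)) (cnv (ml \<alpha> \<mu>) w) t"
    "cnv (gk (1 - \<alpha>)) (cnv (ml \<alpha> \<mu>) w) t = cnv (ml0 \<alpha> \<mu>) w t"
    "cnv_exists (ml0 \<alpha> \<mu>) w t" "\<bar>cnv (ml0 \<alpha> \<mu>) w t\<bar> \<le> (LINT s|lborel. \<bar>truncate_at t w s\<bar>)"
proof -
  have p: "0 < 1 - \<alpha>" using \<alpha> by simp
  have abs: "(\<lambda>s. \<bar>gk (1 - \<alpha>) s\<bar>) = gk (1 - \<alpha>)" "(\<lambda>s. \<bar>ml \<alpha> \<mu> s\<bar>) = ml \<alpha> \<mu>"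
    using gk_nonneg[OF p] ml_nonneg by auto
  have b: "\<bar>ml0 \<alpha> \<mu> s\<bar> \<le> 1" for s using ml0_nonneg ml0_le_1 by simp
  note eb = cnv_exists_bounded[of _ "ml0 \<alpha> \<mu>" t 1, OF _ causal_loc_measurable[OF causal_loc_ml0] causal_loc_nonpos[OF causal_loc_ml0] b]
  show "cnv_exists (ml0 \<alpha> \<mu>) w t" by (rule cnv_exists_commute[OF eb(1)[OF w]])
  show "\<bar>cnv (ml0 \<alpha> \<mu>) w t\<bar> \<le> (LINT s|lborel. \<bar>truncate_at t w s\<bar>)"
    unfolding cnv_commute[of "ml0 \<alpha> \<mu>"] using eb(2)[OF w] by simp
  have ex: "cnv_exists (cnv (\<lambda>s. \<bar>gk (1 - \<alpha>) s\<bar>) (\<lambda>s. \<bar>ml \<alpha> \<mu> s\<bar>)) (\<lambda>s. \<bar>w s\<bar>) t"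
    unfolding abs using cnv_exists_commute[OF eb(1)[OF causal_loc_abs[OF w]]] by (simp add: ml0_def)
  show "cnv (gk (1 - \<alpha>)) (cnv (ml \<alpha> \<mu>) w) t = cnv (ml0 \<alpha> \<mu>) w t"
    unfolding ml0_def by (rule cnv_assoc_rev(1)[OF causal_loc_gk[OF p] causal_loc_ml w ex])
  show "cnv_exists (gk (1 - \<alpha>)) (cnv (ml \<alpha> \<mu>) w) t"
    by (rule cnv_assoc_rev(2)[OF causal_loc_gk[OF p] causal_loc_ml w ex])
qed

end

subsection \<open>Volterra equations of the second kind\<close>

text \<open>Multiplication by exp (- \<sigma> s) is compatible with convolution, and a large
  \<sigma> makes the L^1 norm of a kernel on (0, T) as small as desired. A Volterra equation thus
  becomes a contraction on the whole interval at once.\<close>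

lemma exponential_weight_small:
  assumes a: "causal_loc a" and "0 < \<epsilon>"
  obtains \<sigma> :: real where "0 \<le> \<sigma>" "integrable lborel (\<lambda>s. exp (- \<sigma> * s) * truncate_at T a s)"
    "(LINT s|lborel. \<bar>exp (- \<sigma> * s) * truncate_at T a s\<bar>) \<le> \<epsilon>"
proof -
  have [measurable]: "a \<in> borel_measurable borel" using a by (simp add: causal_loc_def)
  have bd: "\<bar>exp (- real n * s) * truncate_at T a s\<bar> \<le> \<bar>truncate_at T a s\<bar>" for n :: nat and s
  proof (cases "0 < s")
    case True
    then have "exp (- real n * s) \<le> 1" by simp
    then show ?thesis by (simp add: abs_mult mult_left_le_one_le)
  qed (use causal_loc_nonpos[OF a] in \<open>auto simp: truncate_at_def\<close>)
  have ia: "integrable lborel (\<lambda>s. \<bar>truncate_at T a s\<bar>)" using causal_loc_integrable[OF a] by simp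
  have i: "integrable lborel (\<lambda>s. exp (- real n * s) * truncate_at T a s)" for n
    by (rule Bochner_Integration.integrable_bound[OF ia]) (use bd in auto)
  have "(\<lambda>n. LINT s|lborel. \<bar>exp (- real n * s) * truncate_at T a s\<bar>) \<longlonglongrightarrow> (LINT s|lborel. (\<lambda>_::real. 0::real) s)"
  proof (rule integral_dominated_convergence[OF _ _ ia])
    show "AE s in lborel. (\<lambda>n. \<bar>exp (- real n * s) * truncate_at T a s\<bar>) \<longlonglongrightarrow> 0"
    proof (rule AE_I2)
      fix s
      show "(\<lambda>n. \<bar>exp (- real n * s) * truncate_at T a s\<bar>) \<longlonglongrightarrow> 0"
      proof (cases "0 < s")
        case True
        have e: "exp (- real n * s) = exp (- s) ^ n" for n
          by (simp add: exp_of_nat_mult[symmetric])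
        have "(\<lambda>n. exp (- s) ^ n) \<longlonglongrightarrow> 0" using True by (intro LIMSEQ_realpow_zero) auto
        then show ?thesis unfolding e abs_mult by (intro tendsto_mult_left_zero tendsto_rabs_zero)
      qed (use causal_loc_nonpos[OF a] in \<open>auto simp: truncate_at_def\<close>)
    qed
    show "AE s in lborel. norm \<bar>exp (- real n * s) * truncate_at T a s\<bar> \<le> \<bar>truncate_at T a s\<bar>" for n
      using bd by simp
  qed auto
  then have "eventually (\<lambda>n. (LINT s|lborel. \<bar>exp (- real n * s) * truncate_at T a s\<bar>) < \<epsilon>) sequentially"
    using \<open>0 < \<epsilon>\<close> by (intro order_tendstoD) auto
  then obtain n where "(LINT s|lborel. \<bar>exp (- real n * s) * truncate_at T a s\<bar>) < \<epsilon>"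
    by (auto simp: eventually_sequentially)
  then show thesis using that[of "real n"] i[of n] by simp
qed

text \<open>Neumann series: \<open>c n\<close> arises from B by n convolutions with A, and its L^1
  norm decreases like 2^(-n).\<close>

lemma contraction_volterra_exists:
  assumes A: "integrable lborel A" and half: "(LINT s|lborel. \<bar>A s\<bar>) \<le> 1/2" and B: "integrable lborel B"
    and causal: "\<And>s. s \<le> 0 \<Longrightarrow> A s = 0" "\<And>s. s \<le> 0 \<Longrightarrow> B s = 0"
  obtains W where "integrable lborel W" "\<And>s. s \<le> 0 \<Longrightarrow> W s = 0" "AE t in lborel. W t = B t + cnv A W t"
proof -
  define c where "c = rec_nat B (\<lambda>_ f. cnv A f)"
  have c0: "c 0 = B" and cS: "c (Suc n) = cnv A (c n)" for n by (simp_all add: c_def)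
  have ci: "integrable lborel (c n)" for n by (induction n) (use B A in \<open>auto simp: c0 cS intro: integrable_cnv\<close>)
  have cz: "c n s = 0" if "s \<le> 0" for n s
    using that by (induction n arbitrary: s) (use causal in \<open>auto simp: c0 cS intro!: cnv_zero\<close>)
  have half0: "0 \<le> (LINT s|lborel. \<bar>A s\<bar>)" by (rule integral_nonneg_AE) simp
  have step: "(LINT s|lborel. \<bar>A s\<bar>) * x \<le> 1/2 * x" if "0 \<le> x" for x using half that by (rule mult_right_mono)
  have cn: "(LINT s|lborel. \<bar>c n s\<bar>) \<le> (1/2) ^ n * (LINT s|lborel. \<bar>B s\<bar>)" for n
  proof (induction n)
    case (Suc n)
    have "(LINT s|lborel. \<bar>c (Suc n) s\<bar>) \<le> (LINT s|lborel. \<bar>A s\<bar>) * (LINT s|lborel. \<bar>c n s\<bar>)"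
      unfolding cS by (rule integrable_cnv(3)[OF A ci])
    also have "\<dots> \<le> 1/2 * (LINT s|lborel. \<bar>c n s\<bar>)" by (rule step) (rule integral_nonneg_AE, simp)
    also have "\<dots> \<le> 1/2 * ((1/2) ^ n * (LINT s|lborel. \<bar>B s\<bar>))" using Suc by simp
    finally show ?case by simp
  qed (simp add: c0)
  have geo: "summable (\<lambda>n. (1/2::real) ^ n * (LINT s|lborel. \<bar>B s\<bar>))"
    by (intro summable_mult2 summable_geometric) simp
  have sc: "summable (\<lambda>n. LINT s|lborel. \<bar>c n s\<bar>)"
    by (rule summable_comparison_test'[OF geo]) (use cn in \<open>auto simp: integral_nonneg_AE\<close>)
  note ser = integrable_series[OF ci sc]
  define W where "W s = (\<Sum>n. c n s)" for s
  have Wi: "integrable lborel W" using ser(2) by (simp add: W_def[abs_def])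
  let ?g = "\<lambda>n. cnv (\<lambda>s. \<bar>A s\<bar>) (\<lambda>s. \<bar>c n s\<bar>)"
  have Aa: "integrable lborel (\<lambda>s. \<bar>A s\<bar>)" and ca: "integrable lborel (\<lambda>s. \<bar>c n s\<bar>)" for n using A ci by auto
  have gi: "integrable lborel (?g n)" for n by (rule integrable_cnv(1)[OF Aa ca])
  have gn: "(LINT t|lborel. \<bar>?g n t\<bar>) \<le> 1/2 * (LINT s|lborel. \<bar>c n s\<bar>)" for n
  proof -
    have "(LINT t|lborel. \<bar>?g n t\<bar>) \<le> (LINT s|lborel. \<bar>A s\<bar>) * (LINT s|lborel. \<bar>c n s\<bar>)"
      using integrable_cnv(3)[OF Aa ca[of n]] by simp
    also have "\<dots> \<le> 1/2 * (LINT s|lborel. \<bar>c n s\<bar>)" by (rule step) (rule integral_nonneg_AE, simp)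
    finally show ?thesis .
  qed
  have sg: "summable (\<lambda>n. LINT t|lborel. \<bar>?g n t\<bar>)"
    by (rule summable_comparison_test'[OF summable_mult[OF sc, of "1/2"]]) (use gn in \<open>auto simp: integral_nonneg_AE\<close>)
  have aeg: "AE t in lborel. summable (\<lambda>n. \<bar>?g n t\<bar>)" by (rule integrable_series(1)[OF gi sg])
  have aee: "AE t in lborel. \<forall>n. cnv_exists A (c n) t"
    unfolding AE_all_countable using integrable_cnv(2)[OF A ci] by blast
  \<comment> \<open>At almost every t the convolutions of the absolute values are summable, which
    allows the sum to be taken out of the convolution.\<close>
  have "AE t in lborel. W t = B t + cnv A W t"
    using ser(1) aeg aee
  proof eventually_elim
    case (elim t)
    have fi: "integrable lborel (\<lambda>s. A (t - s) * c n s)" for n using elim(3) by (simp add: cnv_exists_def)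
    have fs: "summable (\<lambda>n. LINT s|lborel. \<bar>A (t - s) * c n s\<bar>)"
    proof -
      have "\<bar>?g n t\<bar> = (LINT s|lborel. \<bar>A (t - s) * c n s\<bar>)" for n
        unfolding cnv_def abs_mult[symmetric] by (simp add: integral_nonneg_AE)
      then show ?thesis using elim(2) by simp
    qed
    note serf = integrable_series[OF fi fs]
    have [measurable]: "A \<in> borel_measurable borel" "W \<in> borel_measurable borel" "c n \<in> borel_measurable borel" for n
      using A Wi ci by auto
    have "(LINT s|lborel. (\<Sum>n. A (t - s) * c n s)) = (LINT s|lborel. A (t - s) * W s)"
    proof (rule integral_cong_AE)
      show "AE s in lborel. (\<Sum>n. A (t - s) * c n s) = A (t - s) * W s"
        using ser(1) by eventually_elim (simp add: W_def suminf_mult summable_rabs_cancel)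
    qed measurable
    then have "(\<lambda>n. cnv A (c n) t) sums cnv A W t"
      using serf(3) by (simp add: cnv_def)
    then have "(\<lambda>n. c (Suc n) t) sums cnv A W t" by (simp add: cS)
    then have "(\<lambda>n. c n t) sums (cnv A W t + c 0 t)" by (rule sums_Suc)
    then show ?case by (simp add: W_def sums_iff c0)
  qed
  moreover have "W s = 0" if "s \<le> 0" for s using cz[OF that] by (simp add: W_def)
  ultimately show thesis using that Wi by blast
qed

lemma volterra_exists:
  assumes a: "causal_loc a" and b: "causal_loc b"
  obtains w where "causal_loc w" "integrable lborel w" "AE t in lborel. t \<le> T \<longrightarrow> w t = b t + cnv a w t"
proof -
  obtain \<sigma> where \<sigma>: "0 \<le> \<sigma>" "integrable lborel (\<lambda>s. exp (- \<sigma> * s) * truncate_at T a s)"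
    "(LINT s|lborel. \<bar>exp (- \<sigma> * s) * truncate_at T a s\<bar>) \<le> 1/2"
    by (rule exponential_weight_small[OF a, of "1/2" T]) auto
  have [measurable]: "a \<in> borel_measurable borel" "b \<in> borel_measurable borel" using a b by (simp_all add: causal_loc_def)
  have "integrable lborel (\<lambda>s. exp (- \<sigma> * s) * truncate_at T b s)"
  proof (rule Bochner_Integration.integrable_bound[OF causal_loc_integrable[OF b, of T]])
    have "\<bar>exp (- \<sigma> * s) * truncate_at T b s\<bar> \<le> \<bar>truncate_at T b s\<bar>" for s
    proof (cases "0 < s")
      case True
      then have "exp (- \<sigma> * s) \<le> 1" using \<sigma> by simp
      then show ?thesis by (simp add: abs_mult mult_left_le_one_le)
    qed (use causal_loc_nonpos[OF b] in \<open>auto simp: truncate_at_def\<close>)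
    then show "AE s in lborel. norm (exp (- \<sigma> * s) * truncate_at T b s) \<le> norm (truncate_at T b s)" by simp
  qed auto
  then obtain W where W: "integrable lborel W" "\<And>s. s \<le> 0 \<Longrightarrow> W s = 0"
    "AE t in lborel. W t = exp (- \<sigma> * t) * truncate_at T b t + cnv (\<lambda>s. exp (- \<sigma> * s) * truncate_at T a s) W t"
    by (rule contraction_volterra_exists[OF \<sigma>(2,3)])
       (auto simp: truncate_at_def causal_loc_nonpos[OF a] causal_loc_nonpos[OF b])
  \<comment> \<open>The weight is undone and the function is cut at T, which keeps it integrable on
    the line.\<close>
  define w where "w t = truncate_at T (\<lambda>t. exp (\<sigma> * t) * W t) t" for t
  have [measurable]: "W \<in> borel_measurable borel" using W by auto
  have [measurable]: "w \<in> borel_measurable borel" unfolding w_def[abs_def] by measurable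
  have wi: "integrable lborel w"
  proof (rule Bochner_Integration.integrable_bound)
    show "integrable lborel (\<lambda>t. exp (\<sigma> * T) * W t)" using W by simp
    have "\<bar>w t\<bar> \<le> \<bar>exp (\<sigma> * T) * W t\<bar>" for t
    proof (cases "t \<le> T")
      case True
      then have "exp (\<sigma> * t) \<le> exp (\<sigma> * T)" using \<sigma> by (simp add: mult_left_mono)
      then show ?thesis by (auto simp: w_def truncate_at_def abs_mult intro!: mult_right_mono)
    qed (simp add: w_def truncate_at_def)
    then show "AE t in lborel. norm (w t) \<le> norm (exp (\<sigma> * T) * W t)" by simp
  qed auto
  have w0: "w t = 0" if "t \<le> 0" for t using W(2)[OF that] by (simp add: w_def truncate_at_def)
  have "causal_loc w" by (rule causal_locI) (auto simp: w0 intro: integrable_truncate_at wi)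
  moreover have "AE t in lborel. t \<le> T \<longrightarrow> w t = b t + cnv a w t"
    using W(3)
  proof eventually_elim
    case (elim t)
    show ?case
    proof
      assume t: "t \<le> T"
      have "exp (\<sigma> * t) * (exp (- \<sigma> * (t - s)) * truncate_at T a (t - s) * W s) = a (t - s) * w s" for s
      proof -
        consider "s \<le> 0" | "t - s \<le> 0" | "0 < s" "s < t" by linarith
        then show ?thesis
        proof cases
          case 3
          have "exp (\<sigma> * t) * exp (- \<sigma> * (t - s)) = exp (\<sigma> * s)"
            by (simp add: exp_add[symmetric] algebra_simps)
          then show ?thesis using 3 t by (simp add: truncate_at_def w_def mult.assoc[symmetric]) 
        qed (use W(2) w0 causal_loc_nonpos[OF a] in \<open>auto simp: truncate_at_def\<close>)
      qed
      then have "exp (\<sigma> * t) * cnv (\<lambda>s. exp (- \<sigma> * s) * truncate_at T a s) W t = cnv a w t"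
        unfolding cnv_def integral_mult_right_zero[symmetric] by presburger
      moreover have "exp (\<sigma> * t) * (exp (- \<sigma> * t) * truncate_at T b t) = b t"
        using t by (simp add: truncate_at_def mult.assoc[symmetric] exp_add[symmetric])
      moreover have "w t = exp (\<sigma> * t) * W t" using t by (simp add: w_def truncate_at_def)
      ultimately show "w t = b t + cnv a w t" using elim by (simp add: distrib_left)
    qed
  qed
  ultimately show thesis using that wi by blast
qed

text \<open>Each application of the weighted equation halves the supremum bound.\<close>

lemma volterra_unique:
  assumes a: "causal_loc a" and [measurable]: "d \<in> borel_measurable borel" and d0: "\<And>t. t \<le> 0 \<Longrightarrow> d t = 0"
    and bd: "\<And>t. 0 < t \<Longrightarrow> t \<le> T \<Longrightarrow> \<bar>d t\<bar> \<le> B"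
    and eq: "\<And>t. 0 < t \<Longrightarrow> t \<le> T \<Longrightarrow> d t = cnv a d t"
    and t: "0 < t" "t \<le> T"
  shows "d t = 0"
proof -
  obtain \<sigma> where \<sigma>: "0 \<le> \<sigma>" "integrable lborel (\<lambda>s. exp (- \<sigma> * s) * truncate_at T a s)"
    "(LINT s|lborel. \<bar>exp (- \<sigma> * s) * truncate_at T a s\<bar>) \<le> 1/2"
    by (rule exponential_weight_small[OF a, of "1/2" T]) auto
  have [measurable]: "a \<in> borel_measurable borel" using a by (simp add: causal_loc_def)
  define A where "A s = exp (- \<sigma> * s) * truncate_at T a s" for s
  define x where "x s = exp (- \<sigma> * s) * d s" for s
  have [measurable]: "A \<in> borel_measurable borel" "x \<in> borel_measurable borel"
    unfolding A_def[abs_def] x_def[abs_def] by measurable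
  have "causal_loc A"
    by (rule causal_locI)
       (use \<sigma>(2) causal_loc_nonpos[OF a] in \<open>auto simp: A_def[abs_def] truncate_at_def[of T a] intro!: integrable_truncate_at\<close>)
  have B0: "0 \<le> B" using bd[OF t] by linarith
  have "\<forall>t. 0 < t \<longrightarrow> t \<le> T \<longrightarrow> \<bar>x t\<bar> \<le> B * (1/2) ^ n" for n
  proof (induction n)
    case 0
    show ?case
    proof (intro allI impI)
      fix t assume t: "0 < t" "t \<le> T"
      have "exp (- \<sigma> * t) \<le> 1" using \<sigma> t by simp
      then have "\<bar>x t\<bar> \<le> \<bar>d t\<bar>" by (simp add: x_def abs_mult mult_left_le_one_le)
      then show "\<bar>x t\<bar> \<le> B * (1/2) ^ 0" using bd[OF t] by simp
    qed
  next
    case (Suc n)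
    show ?case
    proof (intro allI impI)
      fix t assume t: "0 < t" "t \<le> T"
      have "exp (- \<sigma> * t) * (a (t - s) * d s) = A (t - s) * x s" for s
      proof (cases "0 < s")
        case True
        have "exp (- \<sigma> * t) = exp (- \<sigma> * (t - s)) * exp (- \<sigma> * s)"
          by (simp add: exp_add[symmetric] algebra_simps)
        then show ?thesis using True t by (simp add: A_def x_def truncate_at_def)
      qed (simp add: x_def d0)
      then have "exp (- \<sigma> * t) * cnv a d t = cnv A x t"
        unfolding cnv_def integral_mult_right_zero[symmetric] by presburger
      then have "x t = cnv A x t" using eq[OF t] by (simp add: x_def)
      also have "\<bar>\<dots>\<bar> \<le> (B * (1/2) ^ n) * (LINT s|lborel. \<bar>truncate_at t A s\<bar>)"
        by (rule cnv_exists_bounded(2)[OF \<open>causal_loc A\<close>]) (use Suc t d0 in \<open>auto simp: x_def\<close>)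
      also have "\<dots> \<le> (B * (1/2) ^ n) * (1/2)"
      proof (rule mult_left_mono)
        have iA: "integrable lborel A" using \<sigma>(2) by (simp add: A_def[abs_def])
        have "(LINT s|lborel. \<bar>truncate_at t A s\<bar>) \<le> (LINT s|lborel. \<bar>A s\<bar>)"
          by (rule integral_mono; (intro integrable_abs integrable_truncate_at iA)?) (simp add: truncate_at_def)
        also have "\<dots> \<le> 1/2" using \<sigma>(3) by (simp add: A_def)
        finally show "(LINT s|lborel. \<bar>truncate_at t A s\<bar>) \<le> 1/2" .
      qed (use B0 in simp)
      finally show "\<bar>x t\<bar> \<le> B * (1/2) ^ Suc n" by simp
    qed
  qed
  then have le: "\<bar>x t\<bar> \<le> B * (1/2) ^ n" for n using t by blast
  have "(\<lambda>n. B * (1/2::real) ^ n) \<longlonglongrightarrow> B * 0" by (intro tendsto_intros LIMSEQ_realpow_zero) auto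
  then have "\<bar>x t\<bar> \<le> B * 0" by (rule LIMSEQ_le_const) (use le in blast)
  then show ?thesis by (simp add: x_def)
qed

section \<open>A single mode of the fractional equation\<close>

context
  fixes \<alpha> \<mu> :: real
  assumes \<alpha>: "0 < \<alpha>" "\<alpha> < 1" and \<mu>: "0 \<le> \<mu>"
begin

lemma causal_loc_cnv_one:
  assumes w: "causal_loc w"
  shows "causal_loc (cnv unit_step w)"
  by (intro causal_loc_cnv causal_loc_one w)

text \<open>The integration in \<open>cnv unit_step w\<close> is moved to the kernel, where \<mu>
  times the integral of \<open>ml\<close> is 1 - \<open>ml0\<close>. The factor \<mu> is thus
  absorbed at the price of one derivative of the source; here its absolute continuity
  enters.\<close>

lemma cnv_ml_cnv_one:
  assumes w: "causal_loc w"
  shows "cnv_exists (ml \<alpha> \<mu>) (cnv unit_step w) t"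
    "cnv (ml \<alpha> \<mu>) (cnv unit_step w) t = cnv unit_step (cnv (ml \<alpha> \<mu>) w) t"
    "\<mu> * cnv (ml \<alpha> \<mu>) (cnv unit_step w) t = cnv unit_step w t - cnv (ml0 \<alpha> \<mu>) w t"
proof -
  let ?k = "ml \<alpha> \<mu>"
  note lk = causal_loc_ml[OF \<alpha> \<mu>]
  have bd: "\<bar>cnv unit_step v s\<bar> \<le> (LINT s|lborel. \<bar>truncate_at t v s\<bar>)" if v: "causal_loc v" and "s < t" for v s
  proof -
    have "\<bar>cnv unit_step v s\<bar> \<le> (LINT x|lborel. \<bar>truncate_at s v x\<bar>)" by (rule cnv_one_bound[OF v])
    also have "\<dots> \<le> (LINT x|lborel. \<bar>truncate_at t v x\<bar>)"
      by (rule integral_mono; (intro integrable_abs causal_loc_integrable v)?) (use \<open>s < t\<close> in \<open>simp add: truncate_at_def\<close>)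
    finally show ?thesis .
  qed
  have ex: "cnv_exists ?k (cnv unit_step v) t" if v: "causal_loc v" for v
    by (rule cnv_exists_bounded(1)[OF lk _ _ bd[OF v]])
       (use causal_loc_cnv_one[OF v] in \<open>auto simp: causal_loc_def\<close>)
  show "cnv_exists ?k (cnv unit_step w) t" by (rule ex[OF w])
  have abs: "(\<lambda>s. \<bar>ml \<alpha> \<mu> s\<bar>) = ml \<alpha> \<mu>" "(\<lambda>s. \<bar>unit_step s\<bar>) = unit_step"
    using ml_nonneg[OF \<alpha> \<mu>] by (auto simp: unit_step_def)
  have "cnv ?k (cnv unit_step w) t = cnv (cnv ?k unit_step) w t"
    by (rule cnv_assoc(1)[OF lk causal_loc_one w]) (simp only: abs ex[OF causal_loc_abs[OF w]])
  also have "cnv ?k unit_step = cnv unit_step ?k" by (rule ext) (rule cnv_commute)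
  finally have e: "cnv ?k (cnv unit_step w) t = cnv (cnv unit_step ?k) w t" .
  then show "cnv ?k (cnv unit_step w) t = cnv unit_step (cnv ?k w) t"
    using cnv_one_assoc[OF lk w] by simp
  have "\<mu> * cnv ?k (cnv unit_step w) t = cnv w (\<lambda>s. \<mu> * cnv unit_step ?k s) t"
    unfolding e cnv_cmult_right by (simp add: cnv_commute[of w])
  also have "(\<lambda>s. \<mu> * cnv unit_step ?k s) = (\<lambda>s. unit_step s - ml0 \<alpha> \<mu> s)"
    using ml0_eq[OF \<alpha> \<mu>] by (auto simp: fun_eq_iff)
  also have "cnv w (\<lambda>s. unit_step s - ml0 \<alpha> \<mu> s) t = cnv w unit_step t - cnv w (ml0 \<alpha> \<mu>) t"
    by (intro cnv_diff_right cnv_exists_commute[OF cnv_one(2)[OF w]] cnv_exists_commute[OF cnv_gk_cnv_ml(3)[OF \<alpha> \<mu> w]])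
  finally show "\<mu> * cnv ?k (cnv unit_step w) t = cnv unit_step w t - cnv (ml0 \<alpha> \<mu>) w t"
    by (simp add: cnv_commute[of w])
qed

text \<open>\<open>mode \<phi> h f\<^sub>0 w\<close> solves \<open>\<partial>\<^sup>\<alpha> v + \<mu> v = h f\<close>, \<open>v(0) = \<phi>\<close> for \<open>f = f\<^sub>0 + \<integral> w\<close>;
  \<open>mode_deriv\<close> is its density.\<close>

definition mode :: "real \<Rightarrow> real \<Rightarrow> (real \<Rightarrow> real) \<Rightarrow> real \<Rightarrow> real" where
  "mode \<phi> h f t = \<phi> * ml0 \<alpha> \<mu> t + h * cnv (ml \<alpha> \<mu>) f t"

definition mode_deriv :: "real \<Rightarrow> real \<Rightarrow> real \<Rightarrow> (real \<Rightarrow> real) \<Rightarrow> real \<Rightarrow> real" where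
  "mode_deriv \<phi> h f0 w t = (- \<phi> * \<mu>) * ml \<alpha> \<mu> t + h * (f0 * ml \<alpha> \<mu> t + cnv (ml \<alpha> \<mu>) w t)"

text \<open>This is \<open>ml0\<close> convolved with the measure df, whose atom \<open>f0\<close>
  sits at time 0.\<close>

definition mode_source :: "real \<Rightarrow> (real \<Rightarrow> real) \<Rightarrow> real \<Rightarrow> real" where
  "mode_source f0 w t = f0 * ml0 \<alpha> \<mu> t + cnv (ml0 \<alpha> \<mu>) w t"

context
  fixes w :: "real \<Rightarrow> real" and f0 :: real and f :: "real \<Rightarrow> real"
  assumes w: "causal_loc w" and f: "f = (\<lambda>t. f0 * unit_step t + cnv unit_step w t)"
begin

lemma cnv_ml_source:
  "cnv_exists (ml \<alpha> \<mu>) f t"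
  "\<mu> * cnv (ml \<alpha> \<mu>) f t = f t - mode_source f0 w t"
  "cnv (ml \<alpha> \<mu>) f t = cnv unit_step (\<lambda>s. f0 * ml \<alpha> \<mu> s + cnv (ml \<alpha> \<mu>) w s) t"
proof -
  let ?k = "ml \<alpha> \<mu>"
  note lk = causal_loc_ml[OF \<alpha> \<mu>]
  have ex1: "cnv_exists ?k (\<lambda>s. f0 * unit_step s) t"
    by (intro cnv_exists_cmult_right cnv_exists_commute[OF cnv_one(2)[OF lk]])
  note ex2 = cnv_ml_cnv_one(1)[OF w]
  show "cnv_exists ?k f t" unfolding f by (intro cnv_add_right ex1 ex2)
  have eq: "cnv ?k f t = f0 * cnv unit_step ?k t + cnv ?k (cnv unit_step w) t"
    unfolding f by (subst cnv_add_right(1)[OF ex1 ex2]) (simp add: cnv_cmult_right cnv_commute[of ?k unit_step])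
  have "\<mu> * cnv ?k f t = f0 * (\<mu> * cnv unit_step ?k t) + \<mu> * cnv ?k (cnv unit_step w) t"
    unfolding eq by (simp add: algebra_simps)
  also have "\<mu> * cnv unit_step ?k t = unit_step t - ml0 \<alpha> \<mu> t" using ml0_eq[OF \<alpha> \<mu>, of t] by simp
  finally show "\<mu> * cnv ?k f t = f t - mode_source f0 w t"
    unfolding cnv_ml_cnv_one(3)[OF w] f mode_source_def by (simp add: algebra_simps)
  have "cnv unit_step (\<lambda>s. f0 * ?k s + cnv ?k w s) t = f0 * cnv unit_step ?k t + cnv unit_step (cnv ?k w) t"
    by (subst cnv_add_right(1))
       (intro cnv_one(2) causal_loc_cmult causal_loc_cnv lk w, intro cnv_one(2) causal_loc_cnv lk w, simp add: cnv_cmult_right)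
  then show "cnv ?k f t = cnv unit_step (\<lambda>s. f0 * ?k s + cnv ?k w s) t"
    unfolding eq cnv_ml_cnv_one(2)[OF w] by simp
qed

lemma causal_loc_mode_deriv: "causal_loc (mode_deriv \<phi> h f0 w)"
  unfolding mode_deriv_def[abs_def]
  by (intro causal_loc_add causal_loc_cmult causal_loc_cnv causal_loc_ml \<alpha> \<mu> w)

lemma mode_eq_integral:
  assumes t: "0 < t"
  shows "mode \<phi> h f t = \<phi> + cnv unit_step (mode_deriv \<phi> h f0 w) t"
proof -
  let ?k = "ml \<alpha> \<mu>"
  note lk = causal_loc_ml[OF \<alpha> \<mu>]
  have "cnv unit_step (mode_deriv \<phi> h f0 w) t
    = cnv unit_step (\<lambda>s. (- \<phi> * \<mu>) * ?k s) t + cnv unit_step (\<lambda>s. h * (f0 * ?k s + cnv ?k w s)) t"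
    unfolding mode_deriv_def[abs_def]
    by (intro cnv_add_right cnv_one(2) causal_loc_add causal_loc_cmult causal_loc_cnv lk w)
  also have "\<dots> = - \<phi> * (\<mu> * cnv unit_step ?k t) + h * cnv ?k f t"
    by (simp only: cnv_cmult_right cnv_ml_source(3) mult.assoc)
  also have "\<mu> * cnv unit_step ?k t = 1 - ml0 \<alpha> \<mu> t" using ml0_eq[OF \<alpha> \<mu>, of t] t by (simp add: unit_step_def)
  finally show ?thesis by (simp add: mode_def algebra_simps)
qed

text \<open>The second equation serves for estimates, since \<mu> occurs there only together with
  the decaying \<open>ml0\<close>; the third is the differential equation of the mode.\<close>

lemma cnv_gk_mode_deriv:
  "cnv_exists (gk (1 - \<alpha>)) (mode_deriv \<phi> h f0 w) t"
  "cnv (gk (1 - \<alpha>)) (mode_deriv \<phi> h f0 w) t = - \<phi> * (\<mu> * ml0 \<alpha> \<mu> t) + h * mode_source f0 w t"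
  "cnv (gk (1 - \<alpha>)) (mode_deriv \<phi> h f0 w) t = h * f t - \<mu> * mode \<phi> h f t"
proof -
  let ?k = "ml \<alpha> \<mu>" and ?g = "gk (1 - \<alpha>)"
  have p: "0 < 1 - \<alpha>" using \<alpha> by simp
  have exk: "cnv_exists ?g ?k t"
  proof (rule cnv_exists_bound[OF cnv_gk(1)[OF p \<alpha>(1)]])
    show "\<bar>?g (t - s) * ?k s\<bar> \<le> \<bar>?g (t - s) * gk \<alpha> s\<bar>" for s
      using ml_nonneg[OF \<alpha> \<mu>, of s] ml_le_gk[OF \<alpha> \<mu>, of s] gk_nonneg[OF p]
      by (auto simp: abs_mult intro!: mult_left_mono)
  qed (use borel_measurable_ml[OF \<alpha> \<mu>] in auto)
  note ex = cnv_exists_cmult_right[OF exk] cnv_gk_cnv_ml(1)[OF \<alpha> \<mu> w]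
  have ex2: "cnv_exists ?g (\<lambda>s. h * (f0 * ?k s + cnv ?k w s)) t"
    by (intro cnv_exists_cmult_right cnv_add_right(2) ex)
  show "cnv_exists ?g (mode_deriv \<phi> h f0 w) t"
    unfolding mode_deriv_def[abs_def] by (intro cnv_add_right(2) ex ex2)
  have "cnv ?g (mode_deriv \<phi> h f0 w) t
    = cnv ?g (\<lambda>s. (- \<phi> * \<mu>) * ?k s) t + cnv ?g (\<lambda>s. h * (f0 * ?k s + cnv ?k w s)) t"
    unfolding mode_deriv_def[abs_def] by (intro cnv_add_right(1) ex ex2)
  also have "cnv ?g (\<lambda>s. h * (f0 * ?k s + cnv ?k w s)) t = h * (cnv ?g (\<lambda>s. f0 * ?k s) t + cnv ?g (cnv ?k w) t)"
    unfolding cnv_cmult_right[of _ h] by (subst cnv_add_right(1)[OF ex]) simp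
  also have "cnv ?g (\<lambda>s. f0 * ?k s) t = f0 * ml0 \<alpha> \<mu> t" by (simp add: cnv_cmult_right ml0_def)
  also have "cnv ?g (cnv ?k w) t = cnv (ml0 \<alpha> \<mu>) w t" by (rule cnv_gk_cnv_ml(2)[OF \<alpha> \<mu> w])
  also have "cnv ?g (\<lambda>s. (- \<phi> * \<mu>) * ?k s) t = - \<phi> * \<mu> * ml0 \<alpha> \<mu> t" by (simp only: cnv_cmult_right ml0_def)
  finally show e: "cnv ?g (mode_deriv \<phi> h f0 w) t = - \<phi> * (\<mu> * ml0 \<alpha> \<mu> t) + h * mode_source f0 w t"
    by (simp add: mode_source_def mult.assoc)
  have "mode_source f0 w t = f t - \<mu> * cnv ?k f t" using cnv_ml_source(2)[of t] by simp
  then have "h * mode_source f0 w t = h * f t - \<mu> * (h * cnv ?k f t)" by (simp only: right_diff_distrib mult.left_commute)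
  then show "cnv ?g (mode_deriv \<phi> h f0 w) t = h * f t - \<mu> * mode \<phi> h f t"
    unfolding e by (simp add: mode_def algebra_simps)
qed

end

end

subsection \<open>Sturm--Liouville expansions\<close>

lemma Ck_on_1D:
  assumes "Ck_on 1 a b f"
  obtains f' where "\<And>x. x \<in> {a..b} \<Longrightarrow> (f has_real_derivative f' x) (at x within {a..b})" "continuous_on {a..b} f'"
proof -
  obtain F where F: "\<forall>x\<in>{a..b}. F 0 x = f x"
    "\<forall>x\<in>{a..b}. (F 0 has_real_derivative F (Suc 0) x) (at x within {a..b})" "continuous_on {a..b} (F (Suc 0))"
    using assms by (auto simp: Ck_on_def derivatives_on_def)
  have "(f has_real_derivative F (Suc 0) x) (at x within {a..b})" if "x \<in> {a..b}" for x
    by (rule has_field_derivative_transform_within[of "F 0" _ _ _ 1]) (use F that in auto)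
  then show thesis using that F by blast
qed

lemma lebesgue_integral_continuous_Icc:
  fixes f :: "real \<Rightarrow> real"
  assumes "continuous_on {a..b} f"
  shows "integrable (lebesgue_on {a..b}) f" "(LINT x|lebesgue_on {a..b}. f x) = integral {a..b} f"
proof -
  show "integrable (lebesgue_on {a..b}) f" by (rule continuous_imp_integrable_real[OF assms])
  then show "(LINT x|lebesgue_on {a..b}. f x) = integral {a..b} f"
    by (rule lebesgue_integral_eq_integral) auto
qed

locale sturm_liouville =
  fixes l :: real and p p' q :: "real \<Rightarrow> real" and ev :: "nat \<Rightarrow> real" and X :: "nat \<Rightarrow> real \<Rightarrow> real"
  assumes l_pos: "0 < l"
    and p_deriv: "\<And>x. x \<in> {0..l} \<Longrightarrow> (p has_real_derivative p' x) (at x within {0..l})"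
    and p'_cont: "continuous_on {0..l} p'"
    and p_pos: "\<And>x. x \<in> {0..l} \<Longrightarrow> 0 < p x"
    and q_cont: "continuous_on {0..l} q"
    and q_nonneg: "\<And>x. x \<in> {0..l} \<Longrightarrow> 0 \<le> q x"
    and eigensystem: "SL_eigensystem l p q ev X"
begin

lemma p_cont: "continuous_on {0..l} p"
  using p_deriv by (rule DERIV_continuous_on)

lemma p_deriv_at: "x \<in> {0<..<l} \<Longrightarrow> (p has_real_derivative p' x) (at x)"
  using p_deriv[of x] at_within_Icc_at[of 0 x l] by simp

lemma eigenfunction: "SL_eigenfunction l p q (ev n) (X n)"
  using eigensystem by (simp add: SL_eigensystem_def)

lemma X_cont: "continuous_on {0..l} (X n)" and X_0: "X n 0 = 0" and X_l: "X n l = 0"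
  using eigenfunction[of n] by (auto simp: SL_eigenfunction_def)

lemma ev_pos: "0 < ev n"
proof -
  have "0 < ev 0" "strict_mono ev" using eigensystem by (auto simp: SL_eigensystem_def)
  then show ?thesis using strict_mono_less_eq[of ev 0 n] by simp
qed

lemma ev_nz: "ev n \<noteq> 0" using ev_pos[of n] by simp

lemma ev_ge: "ev 0 \<le> ev n"
proof -
  have "strict_mono ev" using eigensystem by (auto simp: SL_eigensystem_def)
  then show ?thesis using strict_mono_less_eq[of ev 0 n] by simp
qed

lemma orthonormal: "integral {0..l} (\<lambda>x. X m x * X n x) = (if m = n then 1 else 0)"
proof -
  have "(LINT x|lebesgue_on {0..l}. X m x * X n x) = (if m = n then 1 else 0)"
    using eigensystem unfolding SL_eigensystem_def complete_orthonormal_L2_def by blast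
  then show ?thesis
    using lebesgue_integral_continuous_Icc(2)[of 0 l "\<lambda>x. X m x * X n x"] X_cont by (simp add: continuous_on_mult)
qed

text \<open>\<open>SL_eigenfunction\<close> says nothing about derivatives at the endpoints. On the
  open interval p X' differs by a constant from the integral of its derivative, which is continuous
  up to the endpoints, and this integral extends the flux to \<open>[0, l]\<close>.\<close>

lemma flux_exists:
  "\<exists>Y. (\<forall>x\<in>{0..l}. (Y has_real_derivative (q x - ev n) * X n x) (at x within {0..l})) \<and>
       (\<forall>x\<in>{0<..<l}. (X n has_real_derivative Y x / p x) (at x))"
proof -
  let ?Q = "\<lambda>x. (q x - ev n) * X n x"
  have Qc: "continuous_on {0..l} ?Q" by (intro continuous_intros q_cont X_cont)
  have dX: "X n field_differentiable at x" "(\<lambda>y. p y * deriv (X n) y) field_differentiable at x"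
    "deriv (\<lambda>y. p y * deriv (X n) y) x = ?Q x" if "x \<in> {0<..<l}" for x
    using eigenfunction[of n] that unfolding SL_eigenfunction_def by (auto simp: algebra_simps)
  define I where "I x = integral {0..x} ?Q" for x
  have dI: "(I has_real_derivative ?Q x) (at x within {0..l})" if "x \<in> {0..l}" for x
    unfolding I_def[abs_def] by (rule integral_has_real_derivative[OF Qc that])
  have "\<exists>c. \<forall>x\<in>{0<..<l}. p x * deriv (X n) x - I x = c"
  proof (rule has_field_derivative_zero_constant)
    fix x assume x: "x \<in> {0<..<l}"
    have "((\<lambda>y. p y * deriv (X n) y) has_real_derivative ?Q x) (at x)"
      using dX[OF x] by (simp add: DERIV_deriv_iff_field_differentiable[symmetric])
    moreover have "(I has_real_derivative ?Q x) (at x)"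
      using dI[of x] x at_within_Icc_at[of 0 x l] by simp
    ultimately have "((\<lambda>x. p x * deriv (X n) x - I x) has_real_derivative ?Q x - ?Q x) (at x)"
      by (rule DERIV_diff)
    then show "((\<lambda>x. p x * deriv (X n) x - I x) has_real_derivative 0) (at x within {0<..<l})"
      by (simp add: has_field_derivative_at_within)
  qed simp
  then obtain c where c: "\<And>x. x \<in> {0<..<l} \<Longrightarrow> p x * deriv (X n) x - I x = c" by blast
  show ?thesis
  proof (intro exI[of _ "\<lambda>x. I x + c"] conjI ballI)
    show "((\<lambda>x. I x + c) has_real_derivative ?Q x) (at x within {0..l})" if "x \<in> {0..l}" for x
      using DERIV_add[OF dI[OF that] DERIV_const[of c]] by simp
    show "(X n has_real_derivative (I x + c) / p x) (at x)" if x: "x \<in> {0<..<l}" for x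
    proof -
      have "deriv (X n) x = (I x + c) / p x" using c[OF x] p_pos[of x] x by (simp add: field_simps)
      then show ?thesis using dX(1)[OF x] by (simp add: DERIV_deriv_iff_field_differentiable[symmetric])
    qed
  qed
qed

definition flux :: "nat \<Rightarrow> real \<Rightarrow> real" where
  "flux n = (SOME Y. (\<forall>x\<in>{0..l}. (Y has_real_derivative (q x - ev n) * X n x) (at x within {0..l})) \<and>
       (\<forall>x\<in>{0<..<l}. (X n has_real_derivative Y x / p x) (at x)))"

lemma flux_deriv: "x \<in> {0..l} \<Longrightarrow> (flux n has_real_derivative (q x - ev n) * X n x) (at x within {0..l})"
  and X_deriv: "x \<in> {0<..<l} \<Longrightarrow> (X n has_real_derivative flux n x / p x) (at x)"
  using someI_ex[OF flux_exists[of n]] unfolding flux_def[symmetric] by auto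

lemma flux_cont: "continuous_on {0..l} (flux n)"
  using flux_deriv by (rule DERIV_continuous_on)

text \<open>The derivative of \<open>X n\<close>, continuous up to the endpoints, where
  \<open>deriv\<close> gives no information.\<close>

definition dX :: "nat \<Rightarrow> real \<Rightarrow> real" where "dX n x = flux n x / p x"

lemma p_nz: "x \<in> {0..l} \<Longrightarrow> p x \<noteq> 0" using p_pos by force

lemma dX_cont: "continuous_on {0..l} (dX n)"
  unfolding dX_def[abs_def] using p_nz by (intro continuous_intros flux_cont p_cont) auto

definition admissible :: "(real \<Rightarrow> real) \<Rightarrow> (real \<Rightarrow> real) \<Rightarrow> bool" where
  "admissible v dv \<longleftrightarrow> continuous_on {0..l} v \<and> continuous_on {0..l} dv \<and>
     (\<forall>x\<in>{0<..<l}. (v has_real_derivative dv x) (at x)) \<and> v 0 = 0 \<and> v l = 0"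

lemma admissible_sum: "admissible (\<lambda>x. \<Sum>n\<in>N. c n * X n x) (\<lambda>x. \<Sum>n\<in>N. c n * dX n x)"
  unfolding admissible_def
proof (intro conjI ballI)
  show "((\<lambda>x. \<Sum>n\<in>N. c n * X n x) has_real_derivative (\<Sum>n\<in>N. c n * dX n x)) (at x)" if "x \<in> {0<..<l}" for x
    using X_deriv[OF that] by (intro DERIV_sum DERIV_cmult) (simp add: dX_def)
qed (auto simp: X_0 X_l intro!: continuous_intros X_cont dX_cont)

lemma admissible_diff:
  assumes "admissible v dv" "admissible w dw"
  shows "admissible (\<lambda>x. v x - w x) (\<lambda>x. dv x - dw x)"
  unfolding admissible_def
proof (intro conjI ballI)
  show "((\<lambda>x. v x - w x) has_real_derivative dv x - dw x) (at x)" if "x \<in> {0<..<l}" for x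
    using assms that by (intro DERIV_diff) (auto simp: admissible_def)
qed (use assms in \<open>auto simp: admissible_def intro!: continuous_intros\<close>)

text \<open>Integration by parts for the product \<open>flux n x * v x\<close>; the boundary terms
  vanish with \<open>v\<close>.\<close>

lemma weak_form:
  assumes v: "admissible v dv"
  shows "integral {0..l} (\<lambda>x. p x * dX n x * dv x + q x * X n x * v x) = ev n * integral {0..l} (\<lambda>x. X n x * v x)"
proof -
  have vc: "continuous_on {0..l} v" "continuous_on {0..l} dv" "v 0 = 0" "v l = 0"
    and vd: "\<And>x. x \<in> {0<..<l} \<Longrightarrow> (v has_real_derivative dv x) (at x)"
    using v by (auto simp: admissible_def)
  have "((\<lambda>x. (q x - ev n) * X n x * v x + flux n x * dv x) has_integral (flux n l * v l - flux n 0 * v 0)) {0..l}"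
  proof (rule fundamental_theorem_of_calculus_interior)
    show "continuous_on {0..l} (\<lambda>x. flux n x * v x)" by (intro continuous_intros flux_cont vc)
    fix x assume x: "x \<in> {0<..<l}"
    have "(flux n has_real_derivative (q x - ev n) * X n x) (at x)"
      using flux_deriv[of x n] x at_within_Icc_at[of 0 x l] by simp
    from DERIV_mult[OF this vd[OF x]]
    show "((\<lambda>x. flux n x * v x) has_vector_derivative (q x - ev n) * X n x * v x + flux n x * dv x) (at x)"
      unfolding has_real_derivative_iff_has_vector_derivative[symmetric] by (simp add: algebra_simps)
  qed (use l_pos in simp)
  then have h: "((\<lambda>x. (q x - ev n) * X n x * v x + flux n x * dv x) has_integral 0) {0..l}" using vc by simp
  have "(\<lambda>x. X n x * v x) integrable_on {0..l}"
    by (intro integrable_continuous_real continuous_intros X_cont vc)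
  then have h2: "((\<lambda>x. ev n * (X n x * v x)) has_integral ev n * integral {0..l} (\<lambda>x. X n x * v x)) {0..l}"
    by (intro has_integral_mult_right integrable_integral)
  have "((\<lambda>x. p x * dX n x * dv x + q x * X n x * v x) has_integral 0 + ev n * integral {0..l} (\<lambda>x. X n x * v x)) {0..l}"
    by (rule has_integral_eq[OF _ has_integral_add[OF h h2]]) (use p_nz in \<open>auto simp: dX_def algebra_simps\<close>)
  from integral_unique[OF this] show ?thesis by simp
qed

section \<open>The energy form and Bessel's inequality\<close>

definition energy :: "(real \<Rightarrow> real) \<Rightarrow> (real \<Rightarrow> real) \<Rightarrow> (real \<Rightarrow> real) \<Rightarrow> (real \<Rightarrow> real) \<Rightarrow> real" where
  "energy v dv w dw = integral {0..l} (\<lambda>x. p x * dv x * dw x + q x * v x * w x)"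

lemma energy_sum:
  assumes v: "admissible v dv" and "finite N"
  shows "energy (\<lambda>x. \<Sum>n\<in>N. c n * X n x) (\<lambda>x. \<Sum>n\<in>N. c n * dX n x) v dv =
    (\<Sum>n\<in>N. c n * (ev n * integral {0..l} (\<lambda>x. X n x * v x)))"
proof -
  have vc: "continuous_on {0..l} v" "continuous_on {0..l} dv" using v by (auto simp: admissible_def)
  have i: "(\<lambda>x. c n * (p x * dX n x * dv x + q x * X n x * v x)) integrable_on {0..l}" for n
    by (intro integrable_continuous_real continuous_intros p_cont q_cont X_cont dX_cont vc)
  have "energy (\<lambda>x. \<Sum>n\<in>N. c n * X n x) (\<lambda>x. \<Sum>n\<in>N. c n * dX n x) v dv =
    integral {0..l} (\<lambda>x. \<Sum>n\<in>N. c n * (p x * dX n x * dv x + q x * X n x * v x))"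
    unfolding energy_def
  proof (rule arg_cong[of _ _ "integral {0..l}"], rule ext)
    fix x
    have "p x * (\<Sum>n\<in>N. c n * dX n x) * dv x = (\<Sum>n\<in>N. c n * (p x * dX n x * dv x))"
      unfolding sum_distrib_left sum_distrib_right by (intro sum.cong refl) (simp add: mult_ac)
    moreover have "q x * (\<Sum>n\<in>N. c n * X n x) * v x = (\<Sum>n\<in>N. c n * (q x * X n x * v x))"
      unfolding sum_distrib_left sum_distrib_right by (intro sum.cong refl) (simp add: mult_ac)
    ultimately show "p x * (\<Sum>n\<in>N. c n * dX n x) * dv x + q x * (\<Sum>n\<in>N. c n * X n x) * v x =
      (\<Sum>n\<in>N. c n * (p x * dX n x * dv x + q x * X n x * v x))"
      by (simp only: sum.distrib distrib_left)
  qed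
  also have "\<dots> = (\<Sum>n\<in>N. integral {0..l} (\<lambda>x. c n * (p x * dX n x * dv x + q x * X n x * v x)))"
    using assms(2) i by (rule integral_sum)
  also have "\<dots> = (\<Sum>n\<in>N. c n * (ev n * integral {0..l} (\<lambda>x. X n x * v x)))"
    by (simp add: weak_form[OF v])
  finally show ?thesis .
qed

lemma energy_nonneg: "0 \<le> energy v dv v dv" 
  unfolding energy_def
proof (cases "(\<lambda>x. p x * dv x * dv x + q x * v x * v x) integrable_on {0..l}")
  case True
  then show "0 \<le> integral {0..l} (\<lambda>x. p x * dv x * dv x + q x * v x * v x)"
  proof (rule integral_nonneg)
    fix x assume "x \<in> {0..l}"
    then have "0 \<le> p x * (dv x * dv x)" "0 \<le> q x * (v x * v x)"
      using p_pos[of x] q_nonneg[of x] by (auto intro!: mult_nonneg_nonneg)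
    then show "0 \<le> p x * dv x * dv x + q x * v x * v x" by (simp add: mult.assoc)
  qed
\<comment> \<open>The value of \<open>integral\<close> is 0 when the integrand is not
  integrable.\<close>
qed (simp add: not_integrable_integral)

text \<open>Both subtracted terms carry \<open>s\<close> in the first place. For an eigenfunction
  sum \<open>s\<close> they are the ones that \<open>energy_sum\<close> evaluates.\<close>

lemma energy_diff_square:
  assumes v: "admissible v dv" and s: "admissible s ds"
  shows "energy (\<lambda>x. v x - s x) (\<lambda>x. dv x - ds x) (\<lambda>x. v x - s x) (\<lambda>x. dv x - ds x) =
    energy v dv v dv - energy s ds v dv - energy s ds (\<lambda>x. v x - s x) (\<lambda>x. dv x - ds x)"
proof -
  have c: "continuous_on {0..l} v" "continuous_on {0..l} dv" "continuous_on {0..l} s" "continuous_on {0..l} ds"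
    using v s by (auto simp: admissible_def)
  have i: "(\<lambda>x. p x * dv x * dv x + q x * v x * v x) integrable_on {0..l}"
    "(\<lambda>x. p x * ds x * dv x + q x * s x * v x) integrable_on {0..l}"
    "(\<lambda>x. p x * ds x * (dv x - ds x) + q x * s x * (v x - s x)) integrable_on {0..l}"
    by (intro integrable_continuous_real continuous_intros p_cont q_cont c)+
  show ?thesis
    unfolding energy_def integral_diff[OF i(1,2), symmetric] integral_diff[OF integrable_diff[OF i(1,2)] i(3), symmetric]
    by (rule arg_cong[of _ _ "integral {0..l}"]) (simp add: fun_eq_iff algebra_simps)
qed

definition coeff :: "(real \<Rightarrow> real) \<Rightarrow> nat \<Rightarrow> real" where
  "coeff v n = integral {0..l} (\<lambda>x. X n x * v x)"

lemma coeff_X_sum: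
  assumes "finite N"
  shows "coeff (\<lambda>x. \<Sum>n\<in>N. c n * X n x) m = (if m \<in> N then c m else 0)"
proof -
  have i: "(\<lambda>x. c n * (X m x * X n x)) integrable_on {0..l}" for n
    by (intro integrable_continuous_real continuous_intros X_cont)
  have "coeff (\<lambda>x. \<Sum>n\<in>N. c n * X n x) m = integral {0..l} (\<lambda>x. \<Sum>n\<in>N. c n * (X m x * X n x))"
    unfolding coeff_def by (rule arg_cong[of _ _ "integral {0..l}"]) (simp add: fun_eq_iff sum_distrib_left mult_ac)
  also have "\<dots> = (\<Sum>n\<in>N. integral {0..l} (\<lambda>x. c n * (X m x * X n x)))"
    using assms i by (rule integral_sum)
  also have "\<dots> = (\<Sum>n\<in>N. if m = n then c n else 0)"
    by (simp add: orthonormal if_distrib[of "\<lambda>x. _ * x"] cong: if_cong)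
  also have "\<dots> = (if m \<in> N then c m else 0)" using assms by simp
  finally show ?thesis .
qed

lemma coeff_diff:
  assumes "continuous_on {0..l} v" "continuous_on {0..l} w"
  shows "coeff (\<lambda>x. v x - w x) n = coeff v n - coeff w n"
proof -
  have "(\<lambda>x. X n x * v x) integrable_on {0..l}" "(\<lambda>x. X n x * w x) integrable_on {0..l}"
    by (intro integrable_continuous_real continuous_intros X_cont assms)+
  then show ?thesis unfolding coeff_def by (simp add: right_diff_distrib integral_diff)
qed

text \<open>By the weak form, what is orthogonal to an eigenfunction in L^2 is also orthogonal to it
  in energy. The remainder \<open>v - S\<close> is of this kind for all modes in S, so the energy of
  \<open>v\<close> exceeds that of S by the energy of the remainder.\<close>

lemma energy_bessel:
  assumes v: "admissible v dv"
  shows "(\<Sum>n<N. ev n * (coeff v n)\<^sup>2) \<le> energy v dv v dv"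
proof -
  let ?S = "\<lambda>x. \<Sum>n<N. coeff v n * X n x" and ?dS = "\<lambda>x. \<Sum>n<N. coeff v n * dX n x"
  have s: "admissible ?S ?dS" by (rule admissible_sum)
  note d = admissible_diff[OF v s]
  have vc: "continuous_on {0..l} v" "continuous_on {0..l} ?S" using v s by (auto simp: admissible_def)
  have z: "integral {0..l} (\<lambda>x. X n x * (v x - ?S x)) = 0" if "n < N" for n
    using coeff_diff[OF vc, of n] coeff_X_sum[of "{..<N}" "coeff v" n] that by (simp add: coeff_def)
  have "energy ?S ?dS v dv = (\<Sum>n<N. ev n * (coeff v n)\<^sup>2)"
    using energy_sum[OF v, of "{..<N}" "coeff v"] by (simp add: coeff_def power2_eq_square mult_ac)
  moreover have "energy ?S ?dS (\<lambda>x. v x - ?S x) (\<lambda>x. dv x - ?dS x) = 0"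
    using energy_sum[OF d, of "{..<N}" "coeff v"] z by simp
  ultimately show ?thesis
    using energy_diff_square[OF v s] energy_nonneg[of "\<lambda>x. v x - ?S x" "\<lambda>x. dv x - ?dS x"] by simp
qed

lemma summable_coeff:
  assumes v: "admissible v dv"
  shows "summable (\<lambda>n. ev n * (coeff v n)\<^sup>2)"
proof (rule bounded_imp_summable)
  show "0 \<le> ev n * (coeff v n)\<^sup>2" for n using ev_pos[of n] by simp
  show "(\<Sum>n\<le>N. ev n * (coeff v n)\<^sup>2) \<le> energy v dv v dv" for N
    using energy_bessel[OF v, of "Suc N"] by (simp add: lessThan_Suc_atMost)
qed

text \<open>One-dimensional Sobolev inequality: \<open>v x\<close> is the integral of
  \<open>dv\<close> over (0, x), and the energy controls the L^2 norm of \<open>dv\<close> through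
  the minimum \<open>m\<close> of \<open>p\<close>.\<close>

lemma pointwise_energy_bound:
  obtains K where "0 < K"
    "\<And>v dv x. admissible v dv \<Longrightarrow> x \<in> {0..l} \<Longrightarrow> (v x)\<^sup>2 \<le> K * energy v dv v dv"
proof -
  have ne: "{0..l} \<noteq> {}" using l_pos by simp
  obtain x0 where x0: "x0 \<in> {0..l}" "\<And>x. x \<in> {0..l} \<Longrightarrow> p x0 \<le> p x"
    using continuous_attains_inf[OF _ ne p_cont] by auto
  define m where "m = p x0"
  have m: "0 < m" using p_pos x0 by (simp add: m_def)
  have "(v x)\<^sup>2 \<le> (l / m) * energy v dv v dv" if v: "admissible v dv" and x: "x \<in> {0..l}" for v dv x
  proof -
    have vc: "continuous_on {0..l} v" "continuous_on {0..l} dv" "v 0 = 0"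
      and vd: "\<And>x. x \<in> {0<..<l} \<Longrightarrow> (v has_real_derivative dv x) (at x)"
      using v by (auto simp: admissible_def)
    have sub: "{0..x} \<subseteq> {0..l}" using x by auto
    have "(dv has_integral (v x - v 0)) {0..x}"
    proof (rule fundamental_theorem_of_calculus_interior)
      show "continuous_on {0..x} v" using vc sub continuous_on_subset by blast
      show "(v has_vector_derivative dv y) (at y)" if "y \<in> {0<..<x}" for y
        using vd[of y] that x by (simp add: has_real_derivative_iff_has_vector_derivative)
    qed (use x in simp)
    then have h1: "(dv has_integral v x) {0..x}" using vc by simp
    \<comment> \<open>Expanding (dv - k)^2 >= 0 takes the place of Cauchy-Schwarz. This k is the
      optimal constant for x = l, and it stays usable down to x = 0.\<close>
    define k where "k = v x / l"
    have h2: "((\<lambda>y. 2 * k * dv y - k\<^sup>2) has_integral (2 * k * v x - k\<^sup>2 * x)) {0..x}"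
      using has_integral_diff[OF has_integral_mult_right[OF h1, of "2 * k"] has_integral_const_real[of "k\<^sup>2" 0 x]] x
      by (simp add: mult.commute)
    have i3: "(\<lambda>y. (dv y)\<^sup>2) integrable_on {0..x}"
      by (intro integrable_continuous_real continuous_intros continuous_on_subset[OF vc(2) sub])
    have i4: "(\<lambda>y. (dv y)\<^sup>2) integrable_on {0..l}"
      by (intro integrable_continuous_real continuous_intros vc)
    have "2 * k * v x - k\<^sup>2 * x \<le> integral {0..x} (\<lambda>y. (dv y)\<^sup>2)"
    proof (rule has_integral_le[OF h2 integrable_integral[OF i3]])
      fix y
      have "0 \<le> (dv y - k)\<^sup>2" by simp
      then show "2 * k * dv y - k\<^sup>2 \<le> (dv y)\<^sup>2" by (simp add: power2_diff mult_ac)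
    qed
    also have "\<dots> \<le> integral {0..l} (\<lambda>y. (dv y)\<^sup>2)"
      by (rule integral_subset_le[OF sub i3 i4]) simp
    finally have a: "2 * k * v x - k\<^sup>2 * x \<le> integral {0..l} (\<lambda>y. (dv y)\<^sup>2)" .
    have "k\<^sup>2 * x \<le> k\<^sup>2 * l" using x by (intro mult_left_mono) auto
    also have "k\<^sup>2 * l = (v x)\<^sup>2 / l" using l_pos by (simp add: k_def power2_eq_square)
    finally have "2 * k * v x - (v x)\<^sup>2 / l \<le> integral {0..l} (\<lambda>y. (dv y)\<^sup>2)" using a by linarith
    moreover have "2 * k * v x = 2 * ((v x)\<^sup>2 / l)" by (simp add: k_def power2_eq_square)
    ultimately have b: "(v x)\<^sup>2 / l \<le> integral {0..l} (\<lambda>y. (dv y)\<^sup>2)" by linarith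
    have "integral {0..l} (\<lambda>y. m * (dv y)\<^sup>2) \<le> energy v dv v dv"
      unfolding energy_def
    proof (rule integral_le)
      show "(\<lambda>y. m * (dv y)\<^sup>2) integrable_on {0..l}" by (intro integrable_continuous_real continuous_intros vc)
      show "(\<lambda>x. p x * dv x * dv x + q x * v x * v x) integrable_on {0..l}"
        by (intro integrable_continuous_real continuous_intros p_cont q_cont vc)
      fix y assume y: "y \<in> {0..l}"
      have "m * (dv y)\<^sup>2 \<le> p y * (dv y)\<^sup>2" using x0(2)[OF y] by (simp add: m_def mult_right_mono)
      moreover have "0 \<le> q y * (v y * v y)" using q_nonneg[OF y] by simp
      ultimately show "m * (dv y)\<^sup>2 \<le> p y * dv y * dv y + q y * v y * v y"
        by (simp add: power2_eq_square mult.assoc)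
    qed
    then have "m * integral {0..l} (\<lambda>y. (dv y)\<^sup>2) \<le> energy v dv v dv" by simp
    moreover have "m * ((v x)\<^sup>2 / l) \<le> m * integral {0..l} (\<lambda>y. (dv y)\<^sup>2)" by (intro mult_left_mono b less_imp_le m)
    ultimately have "m * ((v x)\<^sup>2 / l) \<le> energy v dv v dv" by linarith
    then show ?thesis using m l_pos by (simp add: field_simps)
  qed
  moreover have "0 < l / m" using l_pos m by simp
  ultimately show thesis using that by blast
qed

text \<open>S is the Green function with pole \<open>x\<close>, truncated to N modes. Its value at
  \<open>x\<close> and its energy are the same number \<sigma>, so the pointwise bound reads
  \<sigma>^2 <= K \<sigma>.\<close>

lemma green_bound:
  obtains K where "0 < K" "\<And>N x. x \<in> {0..l} \<Longrightarrow> (\<Sum>n<N. (X n x)\<^sup>2 / ev n) \<le> K"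
proof -
  obtain K where K: "0 < K" "\<And>v dv x. admissible v dv \<Longrightarrow> x \<in> {0..l} \<Longrightarrow> (v x)\<^sup>2 \<le> K * energy v dv v dv"
    using pointwise_energy_bound by blast
  have "(\<Sum>n<N. (X n x)\<^sup>2 / ev n) \<le> K" if x: "x \<in> {0..l}" for N x
  proof -
    define c where "c n = X n x / ev n" for n
    let ?S = "\<lambda>y. \<Sum>n<N. c n * X n y" and ?dS = "\<lambda>y. \<Sum>n<N. c n * dX n y"
    let ?\<sigma> = "\<Sum>n<N. (X n x)\<^sup>2 / ev n"
    have s: "admissible ?S ?dS" by (rule admissible_sum)
    have "energy ?S ?dS ?S ?dS = (\<Sum>n<N. c n * (ev n * coeff ?S n))"
      using energy_sum[OF s, of "{..<N}" c] by (simp add: coeff_def)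
    also have "\<dots> = (\<Sum>n<N. c n * (ev n * c n))"
      using coeff_X_sum[of "{..<N}" c] by simp
    also have "\<dots> = ?\<sigma>"
      using ev_nz by (intro sum.cong refl) (simp add: c_def power2_eq_square)
    finally have e: "energy ?S ?dS ?S ?dS = ?\<sigma>" .
    have "?S x = ?\<sigma>" by (intro sum.cong refl) (simp add: c_def power2_eq_square)
    then have "?\<sigma>\<^sup>2 \<le> K * ?\<sigma>" using K(2)[OF s x] e by simp
    then show ?thesis
    proof (cases "?\<sigma> > 0")
      case True
      have "?\<sigma> * ?\<sigma> \<le> K * ?\<sigma>" using \<open>?\<sigma>\<^sup>2 \<le> K * ?\<sigma>\<close> by (simp add: power2_eq_square)
      then show ?thesis using True by (simp add: mult_le_cancel_right)
    qed (use K in simp)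
  qed
  with K that show thesis by blast
qed

end

text \<open>Uniformly Cauchy partial sums. This survives the energy estimates, which give no summable
  bound for the suprema of the individual terms.\<close>

definition utail :: "'z set \<Rightarrow> (nat \<Rightarrow> 'z \<Rightarrow> real) \<Rightarrow> bool" where
  "utail A F \<longleftrightarrow> (\<forall>\<epsilon>>0. \<exists>M. \<forall>m\<ge>M. \<forall>k\<ge>m. \<forall>z\<in>A. \<bar>\<Sum>n=m..<k. F n z\<bar> \<le> \<epsilon>)"

lemma utailD:
  assumes "utail A F" "0 < \<epsilon>"
  obtains M where "\<And>m k z. M \<le> m \<Longrightarrow> m \<le> k \<Longrightarrow> z \<in> A \<Longrightarrow> \<bar>\<Sum>n=m..<k. F n z\<bar> \<le> \<epsilon>"
proof -
  have "\<exists>M. \<forall>m\<ge>M. \<forall>k\<ge>m. \<forall>z\<in>A. \<bar>\<Sum>n=m..<k. F n z\<bar> \<le> \<epsilon>" using assms by (simp add: utail_def)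
  then show thesis using that by blast
qed

lemma utailI:
  assumes "\<And>\<epsilon>. 0 < \<epsilon> \<Longrightarrow> \<exists>M. \<forall>m k z. M \<le> m \<longrightarrow> m \<le> k \<longrightarrow> z \<in> A \<longrightarrow> \<bar>\<Sum>n=m..<k. F n z\<bar> \<le> \<epsilon>"
  shows "utail A F"
  unfolding utail_def
proof (intro allI impI)
  fix \<epsilon> :: real assume "0 < \<epsilon>"
  from assms[OF this] obtain M where "\<And>m k z. M \<le> m \<Longrightarrow> m \<le> k \<Longrightarrow> z \<in> A \<Longrightarrow> \<bar>\<Sum>n=m..<k. F n z\<bar> \<le> \<epsilon>" by blast
  then show "\<exists>M. \<forall>m\<ge>M. \<forall>k\<ge>m. \<forall>z\<in>A. \<bar>\<Sum>n=m..<k. F n z\<bar> \<le> \<epsilon>" by blast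
qed

lemma utail_subset: "utail A F \<Longrightarrow> B \<subseteq> A \<Longrightarrow> utail B F"
  unfolding utail_def by (meson subsetD)

lemma utail_uniform_limit:
  assumes F: "utail A F"
  shows "uniform_limit A (\<lambda>N z. \<Sum>n<N. F n z) (\<lambda>z. \<Sum>n. F n z) sequentially"
    and "\<And>z. z \<in> A \<Longrightarrow> summable (\<lambda>n. F n z)"
proof -
  have "uniformly_convergent_on A (\<lambda>N z. \<Sum>n<N. F n z)"
  proof (intro Cauchy_uniformly_convergent uniformly_Cauchy_onI')
    fix e :: real assume "0 < e"
    then have "0 < e/2" by simp
    obtain M where M: "\<And>m k z. M \<le> m \<Longrightarrow> m \<le> k \<Longrightarrow> z \<in> A \<Longrightarrow> \<bar>\<Sum>n=m..<k. F n z\<bar> \<le> e/2"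
      by (rule utailD[OF F \<open>0 < e/2\<close>]) blast
    show "\<exists>M. \<forall>x\<in>A. \<forall>m\<ge>M. \<forall>n>m. dist (\<Sum>n<m. F n x) (\<Sum>n<n. F n x) < e"
    proof (intro exI[of _ M] ballI allI impI)
      fix x and m n :: nat assume x: "x \<in> A" "M \<le> m" "m < n"
      have "(\<Sum>i<n. F i x) - (\<Sum>i<m. F i x) = (\<Sum>i=m..<n. F i x)"
        using x by (simp add: sum_diff_nat_ivl lessThan_atLeast0)
      then have "dist (\<Sum>i<m. F i x) (\<Sum>i<n. F i x) = \<bar>\<Sum>i=m..<n. F i x\<bar>"
        by (simp add: dist_real_def abs_minus_commute)
      also have "\<dots> \<le> e/2" using M x by simp
      finally show "dist (\<Sum>i<m. F i x) (\<Sum>i<n. F i x) < e" using \<open>0 < e\<close> by simp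
    qed
  qed
  then obtain g where g: "uniform_limit A (\<lambda>N z. \<Sum>n<N. F n z) g sequentially"
    by (auto simp: uniformly_convergent_on_def)
  have s: "(\<lambda>n. F n z) sums g z" if "z \<in> A" for z
    using tendsto_uniform_limitI[OF g that] by (simp add: sums_def)
  show "uniform_limit A (\<lambda>N z. \<Sum>n<N. F n z) (\<lambda>z. \<Sum>n. F n z) sequentially"
    by (rule uniform_limit_cong[THEN iffD1, OF _ _ g]) (use s in \<open>auto simp: sums_iff\<close>)
  show "summable (\<lambda>n. F n z)" if "z \<in> A" for z using s[OF that] by (rule sums_summable)
qed

lemma utail_add:
  assumes F: "utail A F" and G: "utail A G"
  shows "utail A (\<lambda>n z. F n z + G n z)"
proof (rule utailI)
  fix \<epsilon> :: real assume "0 < \<epsilon>"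
  then have e: "0 < \<epsilon>/2" by simp
  obtain M1 where M1: "\<And>m k z. M1 \<le> m \<Longrightarrow> m \<le> k \<Longrightarrow> z \<in> A \<Longrightarrow> \<bar>\<Sum>n=m..<k. F n z\<bar> \<le> \<epsilon>/2"
    by (rule utailD[OF F e]) blast
  obtain M2 where M2: "\<And>m k z. M2 \<le> m \<Longrightarrow> m \<le> k \<Longrightarrow> z \<in> A \<Longrightarrow> \<bar>\<Sum>n=m..<k. G n z\<bar> \<le> \<epsilon>/2"
    by (rule utailD[OF G e]) blast
  show "\<exists>M. \<forall>m k z. M \<le> m \<longrightarrow> m \<le> k \<longrightarrow> z \<in> A \<longrightarrow> \<bar>\<Sum>n=m..<k. F n z + G n z\<bar> \<le> \<epsilon>"
  proof (intro exI[of _ "max M1 M2"] allI impI)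
    fix m k z assume "max M1 M2 \<le> m" "m \<le> k" "z \<in> A"
    then have "\<bar>\<Sum>n=m..<k. F n z\<bar> \<le> \<epsilon>/2" "\<bar>\<Sum>n=m..<k. G n z\<bar> \<le> \<epsilon>/2" using M1 M2 by auto
    then show "\<bar>\<Sum>n=m..<k. F n z + G n z\<bar> \<le> \<epsilon>" by (simp add: sum.distrib)
  qed
qed

lemma utail_mult:
  assumes F: "utail A F" and g: "\<And>z. z \<in> A \<Longrightarrow> \<bar>g z\<bar> \<le> C"
  shows "utail A (\<lambda>n z. g z * F n z)"
proof (rule utailI)
  fix \<epsilon> :: real assume "0 < \<epsilon>"
  define C' where "C' = \<bar>C\<bar> + 1"
  have C': "0 < C'" "\<And>z. z \<in> A \<Longrightarrow> \<bar>g z\<bar> \<le> C'" using g by (force simp: C'_def)+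
  have e: "0 < \<epsilon>/C'" using \<open>0 < \<epsilon>\<close> C' by simp
  obtain M where M: "\<And>m k z. M \<le> m \<Longrightarrow> m \<le> k \<Longrightarrow> z \<in> A \<Longrightarrow> \<bar>\<Sum>n=m..<k. F n z\<bar> \<le> \<epsilon>/C'"
    by (rule utailD[OF F e]) blast
  show "\<exists>M. \<forall>m k z. M \<le> m \<longrightarrow> m \<le> k \<longrightarrow> z \<in> A \<longrightarrow> \<bar>\<Sum>n=m..<k. g z * F n z\<bar> \<le> \<epsilon>"
  proof (intro exI[of _ M] allI impI)
    fix m k z assume h: "M \<le> m" "m \<le> k" "z \<in> A"
    have "\<bar>\<Sum>n=m..<k. g z * F n z\<bar> = \<bar>g z\<bar> * \<bar>\<Sum>n=m..<k. F n z\<bar>"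
      by (simp add: sum_distrib_left[symmetric] abs_mult)
    also have "\<dots> \<le> C' * (\<epsilon>/C')" using C' M h by (intro mult_mono) auto
    finally show "\<bar>\<Sum>n=m..<k. g z * F n z\<bar> \<le> \<epsilon>" using C' by simp
  qed
qed

lemma utail_continuous:
  fixes F :: "nat \<Rightarrow> 'z::topological_space \<Rightarrow> real"
  assumes "utail A F" "\<And>n. continuous_on A (F n)"
  shows "continuous_on A (\<lambda>z. \<Sum>n. F n z)"
  by (rule uniform_limit_theorem[OF _ utail_uniform_limit(1)[OF assms(1)]])
     (auto intro!: always_eventually continuous_on_sum assms(2))

section \<open>Uniform convergence of eigenfunction series\<close>

context sturm_liouville
begin

text \<open>Cauchy-Schwarz with the weight sqrt (ev n) moved from one factor to the other: the
  coefficients give the energy sum, and the eigenfunctions give the diagonal Green sum, which is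
  bounded uniformly in x.\<close>

lemma eigen_sum_bound:
  obtains K where "0 < K"
    "\<And>c m k x. x \<in> {0..l} \<Longrightarrow> (\<Sum>n=m..<k. \<bar>c n * X n x\<bar>) \<le> sqrt (\<Sum>n=m..<k. ev n * (c n)\<^sup>2) * K"
proof -
  obtain K where K: "0 < K" "\<And>N x. x \<in> {0..l} \<Longrightarrow> (\<Sum>n<N. (X n x)\<^sup>2 / ev n) \<le> K"
    by (rule green_bound) blast
  have "(\<Sum>n=m..<k. \<bar>c n * X n x\<bar>) \<le> sqrt (\<Sum>n=m..<k. ev n * (c n)\<^sup>2) * sqrt K" if x: "x \<in> {0..l}" for c m k x
  proof -
    let ?f = "\<lambda>n. sqrt (ev n) * c n" and ?g = "\<lambda>n. X n x / sqrt (ev n)"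
    have sq: "sqrt (ev n) > 0" for n using ev_pos by simp
    have "\<bar>c n * X n x\<bar> = \<bar>?f n\<bar> * \<bar>?g n\<bar>" for n using sq[of n] by (simp add: abs_mult)
    then have "(\<Sum>n=m..<k. \<bar>c n * X n x\<bar>) = (\<Sum>n=m..<k. \<bar>?f n\<bar> * \<bar>?g n\<bar>)" by simp
    also have "\<dots> \<le> L2_set ?f {m..<k} * L2_set ?g {m..<k}" by (rule L2_set_mult_ineq)
    also have "L2_set ?f {m..<k} = sqrt (\<Sum>n=m..<k. ev n * (c n)\<^sup>2)"
    proof -
      have "(?f n)\<^sup>2 = ev n * (c n)\<^sup>2" for n using ev_pos[of n] by (simp add: power_mult_distrib)
      then show ?thesis by (simp add: L2_set_def)
    qed
    also have "L2_set ?g {m..<k} \<le> sqrt K"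
    proof -
      have g: "(?g n)\<^sup>2 = (X n x)\<^sup>2 / ev n" for n using ev_pos[of n] by (simp add: power_divide)
      have "(\<Sum>n=m..<k. (X n x)\<^sup>2 / ev n) \<le> (\<Sum>n<k. (X n x)\<^sup>2 / ev n)"
        by (intro sum_mono2 divide_nonneg_pos ev_pos zero_le_power2) auto
      also have "\<dots> \<le> K" by (rule K(2)[OF x])
      finally show ?thesis unfolding L2_set_def g by simp
    qed
    finally show ?thesis by (simp add: mult_left_mono sum_nonneg ev_pos less_imp_le)
  qed
  note bound = this
  have "0 < sqrt K" using K by simp
  then show thesis using bound by (rule that)
qed

text \<open>The decay in n comes from \<open>a\<close>, the uniformity in t from the common bound of
  \<open>b\<close>; one tail estimate of the energy sum then holds on all of
  \<open>A \<times> {0..l}\<close>.\<close>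

lemma
  fixes b :: "nat \<Rightarrow> 'z \<Rightarrow> real"
  assumes a: "summable (\<lambda>n. ev n * (a n)\<^sup>2)" and b: "\<And>n t. t \<in> A \<Longrightarrow> \<bar>b n t\<bar> \<le> B"
  shows utail_eigen: "utail (A \<times> {0..l}) (\<lambda>n z. a n * b n (fst z) * X n (snd z))"
    and summable_eigen: "\<And>t x. t \<in> A \<Longrightarrow> x \<in> {0..l} \<Longrightarrow> summable (\<lambda>n. \<bar>a n * b n t * X n x\<bar>)"
proof -
  obtain K where K: "0 < K"
    "\<And>c m k x. x \<in> {0..l} \<Longrightarrow> (\<Sum>n=m..<k. \<bar>c n * X n x\<bar>) \<le> sqrt (\<Sum>n=m..<k. ev n * (c n)\<^sup>2) * K"
    by (rule eigen_sum_bound) blast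
  define C where "C = \<bar>B\<bar> + 1"
  have C: "0 < C" "\<bar>b n t\<bar> \<le> C" if "t \<in> A" for n t
    using b[OF that, of n] by (simp_all add: C_def)
  have C0: "0 < C" by (simp add: C_def)
  have bound: "(\<Sum>n=m..<k. \<bar>a n * b n t * X n x\<bar>) \<le> C * (sqrt (\<Sum>n=m..<k. ev n * (a n)\<^sup>2) * K)"
    if t: "t \<in> A" and x: "x \<in> {0..l}" for t x m k
  proof -
    have "(\<Sum>n=m..<k. \<bar>a n * b n t * X n x\<bar>) \<le> (\<Sum>n=m..<k. C * \<bar>a n * X n x\<bar>)"
    proof (rule sum_mono)
      fix n
      have "\<bar>b n t\<bar> * \<bar>a n * X n x\<bar> \<le> C * \<bar>a n * X n x\<bar>" by (rule mult_right_mono[OF C(2)[OF t]]) simp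
      then show "\<bar>a n * b n t * X n x\<bar> \<le> C * \<bar>a n * X n x\<bar>" by (simp add: abs_mult mult_ac)
    qed
    also have "\<dots> = C * (\<Sum>n=m..<k. \<bar>a n * X n x\<bar>)" by (simp add: sum_distrib_left)
    also have "\<dots> \<le> C * (sqrt (\<Sum>n=m..<k. ev n * (a n)\<^sup>2) * K)"
      using C0 K(2)[OF x] by (intro mult_left_mono) auto
    finally show ?thesis .
  qed
  show "utail (A \<times> {0..l}) (\<lambda>n z. a n * b n (fst z) * X n (snd z))"
  proof (rule utailI)
    fix \<epsilon> :: real assume "0 < \<epsilon>"
    \<comment> \<open>The tail bound C * sqrt \<delta> * K is then exactly \<epsilon>.\<close>
    define \<delta> where "\<delta> = (\<epsilon> / (C * K))\<^sup>2"
    have "0 < \<delta>" using \<open>0 < \<epsilon>\<close> C0 K by (simp add: \<delta>_def)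
    then obtain M where M: "\<And>m n. M \<le> m \<Longrightarrow> norm (\<Sum>i=m..<n. ev i * (a i)\<^sup>2) < \<delta>"
      using a unfolding summable_Cauchy by blast
    show "\<exists>M. \<forall>m k z. M \<le> m \<longrightarrow> m \<le> k \<longrightarrow> z \<in> A \<times> {0..l} \<longrightarrow> \<bar>\<Sum>n=m..<k. a n * b n (fst z) * X n (snd z)\<bar> \<le> \<epsilon>"
    proof (intro exI[of _ M] allI impI)
      fix m k z assume h: "M \<le> m" "m \<le> k" "z \<in> A \<times> {0..l}"
      have "\<bar>\<Sum>n=m..<k. a n * b n (fst z) * X n (snd z)\<bar> \<le> (\<Sum>n=m..<k. \<bar>a n * b n (fst z) * X n (snd z)\<bar>)"
        by (rule sum_abs)
      also have "\<dots> \<le> C * (sqrt (\<Sum>n=m..<k. ev n * (a n)\<^sup>2) * K)" using h by (intro bound) auto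
      also have "sqrt (\<Sum>n=m..<k. ev n * (a n)\<^sup>2) \<le> sqrt \<delta>" using M[OF h(1), of k] by simp
      also have "sqrt \<delta> = \<epsilon> / (C * K)" using \<open>0 < \<epsilon>\<close> C0 K by (simp add: \<delta>_def)
      finally show "\<bar>\<Sum>n=m..<k. a n * b n (fst z) * X n (snd z)\<bar> \<le> \<epsilon>"
        using C0 K by (simp add: mult_left_mono mult_right_mono)
    qed
  qed
  fix t x assume t: "t \<in> A" and x: "x \<in> {0..l}"
  show "summable (\<lambda>n. \<bar>a n * b n t * X n x\<bar>)"
  proof (rule bounded_imp_summable)
    fix N
    have "(\<Sum>n\<le>N. \<bar>a n * b n t * X n x\<bar>) = (\<Sum>n=0..<Suc N. \<bar>a n * b n t * X n x\<bar>)"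
      by (simp add: atLeast0LessThan lessThan_Suc_atMost)
    also have "\<dots> \<le> C * (sqrt (\<Sum>n=0..<Suc N. ev n * (a n)\<^sup>2) * K)" by (rule bound[OF t x])
    also have "\<dots> \<le> C * (sqrt (\<Sum>n. ev n * (a n)\<^sup>2) * K)"
    proof -
      have "(\<Sum>n=0..<Suc N. ev n * (a n)\<^sup>2) \<le> (\<Sum>n. ev n * (a n)\<^sup>2)"
        using ev_pos by (intro sum_le_suminf a) (simp_all add: less_imp_le)
      then show ?thesis using C0 K by (intro mult_left_mono mult_right_mono) auto
    qed
    finally show "(\<Sum>n\<le>N. \<bar>a n * b n t * X n x\<bar>) \<le> C * (sqrt (\<Sum>n. ev n * (a n)\<^sup>2) * K)" .
  qed simp
qed

text \<open>The finite sum vanishes at both ends, so by Rolle its derivative, and with it the flux,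
  vanishes somewhere inside. From that point on the mean value theorem bounds the flux by its
  derivative.\<close>

lemma flux_sum_bound:
  assumes "finite N" and Q: "\<And>x. x \<in> {0..l} \<Longrightarrow> \<bar>\<Sum>n\<in>N. c n * ((q x - ev n) * X n x)\<bar> \<le> B" and x: "x \<in> {0..l}"
  shows "\<bar>\<Sum>n\<in>N. c n * flux n x\<bar> \<le> l * B"
proof -
  let ?S = "\<lambda>x. \<Sum>n\<in>N. c n * X n x" and ?dS = "\<lambda>x. \<Sum>n\<in>N. c n * dX n x" and ?P = "\<lambda>x. \<Sum>n\<in>N. c n * flux n x"
  have s: "admissible ?S ?dS" by (rule admissible_sum)
  obtain \<xi> where \<xi>: "0 < \<xi>" "\<xi> < l" "(?S has_real_derivative 0) (at \<xi>)"
    using Rolle[OF l_pos, of ?S] s by (fastforce simp: admissible_def real_differentiable_def)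
  have "(?S has_real_derivative ?dS \<xi>) (at \<xi>)" using s \<xi> by (simp add: admissible_def)
  then have "?dS \<xi> = 0" using \<xi>(3) by (rule DERIV_unique)
  moreover have "?P \<xi> = p \<xi> * ?dS \<xi>"
    unfolding sum_distrib_left using p_nz[of \<xi>] \<xi> by (intro sum.cong refl) (simp add: dX_def)
  ultimately have P0: "?P \<xi> = 0" by simp
  have B0: "0 \<le> B" using Q[OF x] by linarith
  have "norm (?P x - ?P \<xi>) \<le> B * norm (x - \<xi>)"
  proof (rule field_differentiable_bound[of "{0..l}"])
    show "(?P has_real_derivative (\<Sum>n\<in>N. c n * ((q z - ev n) * X n z))) (at z within {0..l})" if "z \<in> {0..l}" for z
      by (intro DERIV_sum DERIV_cmult flux_deriv that)
  qed (use Q x \<xi> in auto)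
  also have "\<dots> \<le> B * l" using x \<xi> B0 by (intro mult_left_mono) (auto simp: abs_le_iff)
  finally show ?thesis using P0 by (simp add: mult.commute)
qed

text \<open>The derivative of the flux series is \<open>q\<close> times the series \<open>S\<close>
  minus the series \<open>V\<close>, so uniform tails of these two suffice.\<close>

lemma utail_flux:
  assumes S: "utail (A \<times> {0..l}) (\<lambda>n z. c n (fst z) * X n (snd z))"
    and V: "utail (A \<times> {0..l}) (\<lambda>n z. ev n * c n (fst z) * X n (snd z))"
  shows "utail (A \<times> {0..l}) (\<lambda>n z. c n (fst z) * flux n (snd z))"
proof -
  have "compact (q ` {0..l})" by (intro compact_continuous_image q_cont) auto
  then obtain C where C: "\<And>x. x \<in> {0..l} \<Longrightarrow> \<bar>q x\<bar> \<le> C"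
    using compact_imp_bounded by (metis bounded_iff image_eqI real_norm_def)
  have "utail (A \<times> {0..l}) (\<lambda>n z. q (snd z) * (c n (fst z) * X n (snd z)) + (- 1) * (ev n * c n (fst z) * X n (snd z)))"
    by (intro utail_add utail_mult[OF S, of _ C] utail_mult[OF V, of _ 1]) (use C in auto)
  then have Q: "utail (A \<times> {0..l}) (\<lambda>n z. c n (fst z) * ((q (snd z) - ev n) * X n (snd z)))"
    by (simp add: algebra_simps)
  show ?thesis
  proof (rule utailI)
    fix \<epsilon> :: real assume "0 < \<epsilon>"
    then have e: "0 < \<epsilon> / l" using l_pos by simp
    obtain M where M: "\<And>m k z. M \<le> m \<Longrightarrow> m \<le> k \<Longrightarrow> z \<in> A \<times> {0..l} \<Longrightarrow>
        \<bar>\<Sum>n=m..<k. c n (fst z) * ((q (snd z) - ev n) * X n (snd z))\<bar> \<le> \<epsilon> / l"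
      by (rule utailD[OF Q e]) blast
    show "\<exists>M. \<forall>m k z. M \<le> m \<longrightarrow> m \<le> k \<longrightarrow> z \<in> A \<times> {0..l} \<longrightarrow> \<bar>\<Sum>n=m..<k. c n (fst z) * flux n (snd z)\<bar> \<le> \<epsilon>"
    proof (intro exI[of _ M] allI impI)
      fix m k z assume h: "M \<le> m" "m \<le> k" "z \<in> A \<times> {0..l}"
      have "\<bar>\<Sum>n=m..<k. c n (fst z) * flux n (snd z)\<bar> \<le> l * (\<epsilon> / l)"
      proof (rule flux_sum_bound)
        show "\<bar>\<Sum>n=m..<k. c n (fst z) * ((q x - ev n) * X n x)\<bar> \<le> \<epsilon> / l" if "x \<in> {0..l}" for x
          using M[of m k "(fst z, x)"] h that by auto
      qed (use h in auto)
      then show "\<bar>\<Sum>n=m..<k. c n (fst z) * flux n (snd z)\<bar> \<le> \<epsilon>" using l_pos by simp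
    qed
  qed
qed

lemma utail_slice:
  assumes "utail (A \<times> {0..l}) (\<lambda>n z. F n (fst z) (snd z))" "t \<in> A"
  shows "utail {0..l} (\<lambda>n x. F n t x)"
proof (rule utailI)
  fix \<epsilon> :: real assume "0 < \<epsilon>"
  obtain M where M: "\<And>m k z. M \<le> m \<Longrightarrow> m \<le> k \<Longrightarrow> z \<in> A \<times> {0..l} \<Longrightarrow> \<bar>\<Sum>n=m..<k. F n (fst z) (snd z)\<bar> \<le> \<epsilon>"
    by (rule utailD[OF assms(1) \<open>0 < \<epsilon>\<close>]) blast
  have "\<bar>\<Sum>n=m..<k. F n t x\<bar> \<le> \<epsilon>" if "M \<le> m" "m \<le> k" "x \<in> {0..l}" for m k x
    using M[of m k "(t, x)"] that assms(2) by simp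
  then show "\<exists>M. \<forall>m k z. M \<le> m \<longrightarrow> m \<le> k \<longrightarrow> z \<in> {0..l} \<longrightarrow> \<bar>\<Sum>n=m..<k. F n t z\<bar> \<le> \<epsilon>"
    by blast
qed

text \<open>The second differentiation is applied to the flux instead of the first derivative, so
  that only the three series with uniform tails occur.\<close>

lemma eigen_series_deriv:
  assumes S: "utail {0..l} (\<lambda>n x. c n * X n x)" and V: "utail {0..l} (\<lambda>n x. ev n * c n * X n x)"
    and P: "utail {0..l} (\<lambda>n x. c n * flux n x)" and x: "x \<in> {0<..<l}"
  shows "((\<lambda>x. \<Sum>n. c n * X n x) has_real_derivative (\<Sum>n. c n * flux n x) / p x) (at x)"
    "((\<lambda>x. \<Sum>n. c n * flux n x) has_real_derivative q x * (\<Sum>n. c n * X n x) - (\<Sum>n. ev n * c n * X n x)) (at x)"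
proof -
  have sub: "{0<..<l} \<subseteq> {0..l}" and xi: "x \<in> interior {0<..<l}" and xl: "x \<in> {0..l}"
    using x by (auto simp: interior_open)
  have sS: "summable (\<lambda>n. c n * X n x)" and sV: "summable (\<lambda>n. ev n * c n * X n x)"
    and sP: "summable (\<lambda>n. c n * flux n x)"
    using utail_uniform_limit(2)[OF S xl] utail_uniform_limit(2)[OF V xl] utail_uniform_limit(2)[OF P xl] by auto
  have "compact ((\<lambda>x. 1 / p x) ` {0..l})"
    using p_nz by (intro compact_continuous_image continuous_intros p_cont) auto
  then obtain C where C: "\<And>x. x \<in> {0..l} \<Longrightarrow> \<bar>1 / p x\<bar> \<le> C"
    using compact_imp_bounded by (metis (mono_tags, lifting) bounded_iff image_eqI real_norm_def)
  have "utail {0..l} (\<lambda>n x. (1 / p x) * (c n * flux n x))" by (rule utail_mult[OF P C])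
  then have U1: "uniformly_convergent_on {0<..<l} (\<lambda>N x. \<Sum>n<N. (1 / p x) * (c n * flux n x))"
    using utail_uniform_limit(1)[OF utail_subset[OF _ sub]] by (blast intro: uniformly_convergentI)
  have d1: "((\<lambda>x. c n * X n x) has_real_derivative (1 / p y) * (c n * flux n y)) (at y within {0<..<l})"
    if "y \<in> {0<..<l}" for n y
    using DERIV_cmult[OF X_deriv[OF that, of n], of "c n"] by (simp add: has_field_derivative_at_within)
  have "((\<lambda>x. \<Sum>n. c n * X n x) has_real_derivative (\<Sum>n. (1 / p x) * (c n * flux n x))) (at x)"
    by (rule has_field_derivative_series'(2)[OF convex_real_interval(8) d1 U1 x sS xi])
  then show "((\<lambda>x. \<Sum>n. c n * X n x) has_real_derivative (\<Sum>n. c n * flux n x) / p x) (at x)"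
    using suminf_mult[OF sP, of "1 / p x"] by simp
  have "compact (q ` {0..l})" by (intro compact_continuous_image q_cont) auto
  then obtain C' where C': "\<And>x. x \<in> {0..l} \<Longrightarrow> \<bar>q x\<bar> \<le> C'"
    using compact_imp_bounded by (metis bounded_iff image_eqI real_norm_def)
  have "utail {0..l} (\<lambda>n x. q x * (c n * X n x) + (- 1) * (ev n * c n * X n x))"
    by (intro utail_add utail_mult[OF S, of _ C'] utail_mult[OF V, of _ 1]) (use C' in auto)
  then have U2: "uniformly_convergent_on {0<..<l} (\<lambda>N x. \<Sum>n<N. q x * (c n * X n x) + (- 1) * (ev n * c n * X n x))"
    using utail_uniform_limit(1)[OF utail_subset[OF _ sub]] by (blast intro: uniformly_convergentI)
  have d2: "((\<lambda>x. c n * flux n x) has_real_derivative q y * (c n * X n y) + (- 1) * (ev n * c n * X n y)) (at y within {0<..<l})"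
    if "y \<in> {0<..<l}" for n y
  proof -
    have "y \<in> {0..l}" using that by simp
    from DERIV_cmult[OF flux_deriv[OF this, of n], of "c n"]
    have "((\<lambda>x. c n * flux n x) has_real_derivative q y * (c n * X n y) + (- 1) * (ev n * c n * X n y)) (at y within {0..l})"
      by (simp add: algebra_simps)
    then show ?thesis by (rule DERIV_subset) (rule sub)
  qed
  have "((\<lambda>x. \<Sum>n. c n * flux n x) has_real_derivative (\<Sum>n. q x * (c n * X n x) + (- 1) * (ev n * c n * X n x))) (at x)"
    by (rule has_field_derivative_series'(2)[OF convex_real_interval(8) d2 U2 x sP xi])
  moreover have "(\<Sum>n. q x * (c n * X n x) + (- 1) * (ev n * c n * X n x)) = q x * (\<Sum>n. c n * X n x) - (\<Sum>n. ev n * c n * X n x)"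
    using suminf_add[OF summable_mult[OF sS, of "q x"] summable_mult[OF sV, of "-1"]]
      suminf_mult[OF sS, of "q x"] suminf_mult[OF sV, of "-1"] by simp
  ultimately show "((\<lambda>x. \<Sum>n. c n * flux n x) has_real_derivative q x * (\<Sum>n. c n * X n x) - (\<Sum>n. ev n * c n * X n x)) (at x)"
    by simp
qed

lemma integral_eigen_series:
  assumes S: "utail {0..l} (\<lambda>n x. c n * X n x)" and h: "continuous_on {0..l} h"
  shows "(\<lambda>n. c n * coeff h n) sums integral {0..l} (\<lambda>x. h x * (\<Sum>n. c n * X n x))"
proof -
  have "compact (h ` {0..l})" by (intro compact_continuous_image h) auto
  then obtain C where C: "\<And>x. x \<in> {0..l} \<Longrightarrow> \<bar>h x\<bar> \<le> C"
    using compact_imp_bounded by (metis bounded_iff image_eqI real_norm_def)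
  have U: "utail {0..l} (\<lambda>n x. h x * (c n * X n x))" by (rule utail_mult[OF S C])
  have ul: "uniform_limit {0..l} (\<lambda>N x. \<Sum>n<N. h x * (c n * X n x)) (\<lambda>x. \<Sum>n. h x * (c n * X n x)) sequentially"
    by (rule utail_uniform_limit(1)[OF U])
  have cN: "continuous_on {0..l} (\<lambda>x. \<Sum>n<N. h x * (c n * X n x))" for N
    by (intro continuous_intros h X_cont)
  obtain I J where I: "\<And>N. ((\<lambda>x. \<Sum>n<N. h x * (c n * X n x)) has_integral I N) {0..l}"
    and J: "((\<lambda>x. \<Sum>n. h x * (c n * X n x)) has_integral J) {0..l}" and lim: "I \<longlonglongrightarrow> J"
    by (rule uniform_limit_integral[OF ul cN]) auto
  have "I N = (\<Sum>n<N. c n * coeff h n)" for N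
  proof -
    have i: "(\<lambda>x. c n * (X n x * h x)) integrable_on {0..l}" for n
      by (intro integrable_continuous_real continuous_intros h X_cont)
    have "I N = integral {0..l} (\<lambda>x. \<Sum>n<N. c n * (X n x * h x))"
      using integral_unique[OF I[of N]] by (simp add: mult_ac)
    also have "\<dots> = (\<Sum>n<N. integral {0..l} (\<lambda>x. c n * (X n x * h x)))"
      using i by (intro integral_sum) auto
    finally show ?thesis by (simp add: coeff_def)
  qed
  then have "I = (\<lambda>N. \<Sum>n<N. c n * coeff h n)" by (rule ext)
  then have "(\<lambda>n. c n * coeff h n) sums J" using lim by (simp only: sums_def)
  moreover have "J = integral {0..l} (\<lambda>x. h x * (\<Sum>n. c n * X n x))"
  proof -
    have "(\<Sum>n. h x * (c n * X n x)) = h x * (\<Sum>n. c n * X n x)" if "x \<in> {0..l}" for x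
      using utail_uniform_limit(2)[OF S that] by (rule suminf_mult)
    then have "integral {0..l} (\<lambda>x. \<Sum>n. h x * (c n * X n x)) = integral {0..l} (\<lambda>x. h x * (\<Sum>n. c n * X n x))"
      by (intro Henstock_Kurzweil_Integration.integral_cong) auto
    then show ?thesis using integral_unique[OF J] by simp
  qed
  ultimately show ?thesis by simp
qed

text \<open>A one-point parameter set reduces the joint estimate to a statement in space.\<close>

lemma utail_coeff: "admissible v dv \<Longrightarrow> utail {0..l} (\<lambda>n x. coeff v n * X n x)"
  using utail_slice[OF utail_eigen[OF summable_coeff, of v dv "UNIV :: unit set" "\<lambda>_ _. 1" 1], of "()"] by simp

text \<open>Completeness in L^2 makes \<open>v\<close> vanish almost everywhere; continuity extends
  this to every point.\<close>

lemma complete: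
  assumes v: "continuous_on {0..l} v" and z: "\<And>n. coeff v n = 0" and x: "x \<in> {0..l}"
  shows "v x = 0"
proof -
  have m: "v \<in> borel_measurable (lebesgue_on {0..l})" using lebesgue_integral_continuous_Icc(1)[OF v] by auto
  have i2: "integrable (lebesgue_on {0..l}) (\<lambda>x. (v x)\<^sup>2)"
    by (intro lebesgue_integral_continuous_Icc continuous_intros v)
  have o: "(LINT x|lebesgue_on {0..l}. v x * X n x) = 0" for n
    using lebesgue_integral_continuous_Icc(2)[of 0 l "\<lambda>x. v x * X n x"] z[of n] v X_cont
    by (simp add: coeff_def continuous_on_mult mult.commute)
  have "complete_orthonormal_L2 l X" using eigensystem by (simp add: SL_eigensystem_def)
  then have ae: "AE x in lebesgue_on {0..l}. v x = 0"
    using m i2 o unfolding complete_orthonormal_L2_def by blast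
  have "(LINT x|lebesgue_on {0..l}. (v x)\<^sup>2) = 0"
    by (rule integral_eq_zero_AE) (use ae in eventually_elim, simp)
  then have "integral {0..l} (\<lambda>x. (v x)\<^sup>2) = 0"
    using lebesgue_integral_continuous_Icc(2)[of 0 l "\<lambda>x. (v x)\<^sup>2"] v by (simp add: continuous_on_power)
  then have "\<forall>x\<in>{0..l}. (v x)\<^sup>2 = 0"
    using integral_eq_0_iff[of 0 l "\<lambda>x. (v x)\<^sup>2"] v l_pos by (simp add: continuous_on_power)
  then show ?thesis using x by simp
qed

text \<open>The series converges uniformly to a continuous function with the same coefficients as
  \<open>v\<close>; completeness, applied to the continuous difference, identifies the two at every
  point.\<close>

lemma eigen_expansion:
  assumes v: "admissible v dv" and x: "x \<in> {0..l}"
  shows "(\<lambda>n. coeff v n * X n x) sums v x"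
proof -
  let ?s = "\<lambda>x. \<Sum>n. coeff v n * X n x"
  have U: "utail {0..l} (\<lambda>n x. coeff v n * X n x)" by (rule utail_coeff[OF v])
  have vc: "continuous_on {0..l} v" using v by (simp add: admissible_def)
  have sc: "continuous_on {0..l} ?s" by (intro utail_continuous[OF U] continuous_intros X_cont)
  have "coeff ?s m = coeff v m" for m
  proof -
    have cX: "coeff (X m) n = (if n = m then 1 else 0)" for n using orthonormal[of n m] by (simp add: coeff_def)
    have "(\<lambda>n. coeff v n * coeff (X m) n) sums integral {0..l} (\<lambda>x. X m x * ?s x)"
      by (rule integral_eigen_series[OF U X_cont])
    moreover have "(\<lambda>n. coeff v n * coeff (X m) n) = (\<lambda>n. if n = m then coeff v n else 0)"
      by (auto simp: cX)
    ultimately have "(\<lambda>n. if n = m then coeff v n else 0) sums coeff ?s m" by (simp add: coeff_def)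
    then show ?thesis using sums_single[of m "coeff v"] sums_unique2 by blast
  qed
  then have "coeff (\<lambda>x. v x - ?s x) n = 0" for n using coeff_diff[OF vc sc] by simp
  then have "v x - ?s x = 0" by (rule complete[of "\<lambda>x. v x - ?s x", OF continuous_on_diff[OF vc sc] _ x])
  then show ?thesis using utail_uniform_limit(2)[OF U x] by (simp add: sums_iff)
qed

lemma parseval:
  assumes v: "admissible v dv" and h: "continuous_on {0..l} h"
  shows "(\<lambda>n. coeff v n * coeff h n) sums integral {0..l} (\<lambda>x. h x * v x)"
proof -
  have "integral {0..l} (\<lambda>x. h x * (\<Sum>n. coeff v n * X n x)) = integral {0..l} (\<lambda>x. h x * v x)"
    using eigen_expansion[OF v] by (intro Henstock_Kurzweil_Integration.integral_cong) (auto simp: sums_iff)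
  then show ?thesis using integral_eigen_series[OF utail_coeff[OF v] h] by simp
qed

end

subsection \<open>The maximum principle for the Caputo derivative\<close>

text \<open>\<open>deriv v\<close> is an unspecified number where \<open>v\<close> is not
  differentiable, and the Caputo integral is taken over \<open>lebesgue\<close>. Equality almost
  everywhere with a Borel function transfers it to \<open>lborel\<close>, over which
  \<open>cnv\<close> integrates.\<close>

lemma integrable_lebesgue_AE_eq:
  fixes h G :: "real \<Rightarrow> real"
  assumes G: "integrable lborel G" and ae: "AE x in lebesgue. h x = G x"
  shows "integrable lebesgue h" "(LINT x|lebesgue. h x) = (LINT x|lborel. G x)"
proof -
  have Gm: "G \<in> borel_measurable lborel" using G by auto
  have Gl: "integrable lebesgue G" using G integrable_completion[OF Gm] by simp
  obtain N where N: "\<And>x. x \<in> space lebesgue - N \<Longrightarrow> h x = G x" "N \<in> null_sets lebesgue"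
    by (rule AE_E3[OF ae]) blast
  have "G absolutely_integrable_on UNIV" using Gl by (simp add: set_integrable_def)
  then have "h absolutely_integrable_on UNIV"
    by (rule absolutely_integrable_spike[where S = N and f = G]) (use N in \<open>auto simp: negligible_iff_null_sets\<close>)
  then show hi: "integrable lebesgue h" by (simp add: set_integrable_def)
  have "(LINT x|lebesgue. h x) = (LINT x|lebesgue. G x)"
    using hi Gl ae by (intro integral_cong_AE) auto
  then show "(LINT x|lebesgue. h x) = (LINT x|lborel. G x)" using integral_completion[OF Gm] by simp
qed

lemma AE_lebesgue_neq: "AE x in lebesgue. x \<noteq> (c::real)"
  by (rule AE_completion) (rule AE_lborel_singleton)

lemma AE_lborel_iff_lebesgue: "(AE x in lborel. P x) \<longleftrightarrow> (AE x in lebesgue. P x)"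
  by (simp add: AE_completion_iff)

lemma cnv_one_diff:
  assumes W: "causal_loc W" and "0 \<le> u" "u \<le> v" "v \<le> T"
  shows "cnv unit_step W v - cnv unit_step W u = (LINT y:{u..v}|lborel. truncate_at T W y)"
proof -
  have e: "cnv unit_step W x = (LINT s:{0..x}|lborel. truncate_at T W s)" if "x \<le> T" for x
    unfolding cnv_one_set_integral[OF W] set_lebesgue_integral_def
    by (rule Bochner_Integration.integral_cong) (use that in \<open>auto simp: truncate_at_def indicator_def\<close>)
  show ?thesis
    using e[of u] e[of v] set_integral_split_Icc[OF causal_loc_integrable[OF W, of T], of 0 u v] assms by simp
qed

lemma abs_continuous_causal:
  assumes "0 < T" "abs_continuous_on 0 T f"
  obtains w where "causal_loc w" "\<And>t. t \<in> {0..T} \<Longrightarrow> f t = f 0 + cnv unit_step w t"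
proof -
  obtain w0 where w0: "integrable lborel w0" "\<And>x. x \<in> {0..T} \<Longrightarrow> f x = f 0 + (LINT s:{0..x}|lborel. w0 s)"
    by (rule abs_continuous_density[OF assms]) blast
  define w where "w s = (if 0 < s then w0 s else 0)" for s
  have [measurable]: "w0 \<in> borel_measurable borel" using w0 by auto
  have wm[measurable]: "w \<in> borel_measurable borel" unfolding w_def[abs_def] by measurable
  have wi: "integrable lborel w"
    by (rule Bochner_Integration.integrable_bound[OF w0(1)]) (auto simp: w_def)
  have w: "causal_loc w"
    by (rule causal_locI[OF wm _ integrable_truncate_at[OF wi]]) (simp add: w_def)
  have "f t = f 0 + cnv unit_step w t" if "t \<in> {0..T}" for t
  proof -
    have "(LINT s:{0..t}|lborel. w0 s) = (LINT s:{0..t}|lborel. w s)"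
      unfolding set_lebesgue_integral_def
      by (rule integral_cong_AE) (use AE_lborel_singleton[of 0] in \<open>auto simp: w_def indicator_def elim!: eventually_mono\<close>)
    then show ?thesis using w0(2)[OF that] cnv_one_set_integral[OF w, of t] by simp
  qed
  with w that show thesis by blast
qed

lemma abs_continuous_cnv_one:
  assumes W: "causal_loc W" and f: "\<And>t. t \<in> {a..b} \<Longrightarrow> f t = c + cnv unit_step W t" and "0 \<le> a"
  shows "abs_continuous_on a b f"
proof (rule abs_continuous_indefinite_integral[OF causal_loc_integrable[OF W, of b]])
  fix u v assume "a \<le> u" "u \<le> v" "v \<le> b"
  then show "f v - f u = (LINT y:{u..v}|lborel. truncate_at b W y)"
    using f[of u] f[of v] cnv_one_diff[OF W, of u v b] \<open>0 \<le> a\<close> by simp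
qed

lemma deriv_cnv_one_AE:
  assumes W: "causal_loc W" and v: "\<And>s. s \<in> {0<..<t} \<Longrightarrow> v s = c + cnv unit_step W s"
  shows "AE x in lebesgue. 0 < x \<and> x < t \<longrightarrow> deriv v x = W x"
proof -
  have "AE x in lebesgue. 0 < x \<and> x < t \<longrightarrow> (v has_real_derivative truncate_at t W x) (at x)"
  proof (rule indefinite_integral_derivative_AE[OF causal_loc_integrable[OF W]])
    fix x y :: real assume h: "0 < x" "x \<le> y" "y < t"
    then have "v y - v x = cnv unit_step W y - cnv unit_step W x" using v[of x] v[of y] by simp
    also have "\<dots> = (LINT s:{x..y}|lborel. truncate_at t W s)" using h by (intro cnv_one_diff W) auto
    finally show "v y - v x = (LINT s:{x..y}|lborel. truncate_at t W s)" .
  qed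
  then show ?thesis by eventually_elim (auto simp: truncate_at_def dest: DERIV_imp_deriv)
qed

text \<open>The derivative of an indefinite integral is its density almost everywhere, so the
  singular integral of \<open>deriv v\<close> is a convolution with the Abel kernel.\<close>

lemma caputo_cnv:
  assumes \<alpha>: "0 < \<alpha>" "\<alpha> < 1" and W: "causal_loc W" and "0 < t"
    and v: "\<And>s. s \<in> {0<..t} \<Longrightarrow> v s = c + cnv unit_step W s" and ex: "cnv_exists (gk (1 - \<alpha>)) W t"
  shows "caputo_exists \<alpha> v t" "caputo \<alpha> v t = cnv (gk (1 - \<alpha>)) W t"
proof -
  have G: "0 < Gamma (1 - \<alpha>)" using \<alpha> by (intro Gamma_real_pos) simp
  let ?h = "\<lambda>\<tau>. (t - \<tau>) powr (1 - \<alpha> - 1) * deriv v \<tau>"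
  let ?G = "\<lambda>\<tau>. Gamma (1 - \<alpha>) * (gk (1 - \<alpha>) (t - \<tau>) * W \<tau>)"
  have d: "AE x in lebesgue. 0 < x \<and> x < t \<longrightarrow> deriv v x = W x"
    by (rule deriv_cnv_one_AE[OF W]) (use v in auto)
  have ae: "AE \<tau> in lebesgue. indicator {0..t} \<tau> *\<^sub>R ?h \<tau> = ?G \<tau>"
    using d AE_lebesgue_neq[of 0] AE_lebesgue_neq[of t]
  proof eventually_elim
    case (elim \<tau>)
    consider "\<tau> < 0" | "t < \<tau>" | "0 < \<tau>" "\<tau> < t" using elim by linarith
    then show ?case by cases (use elim G causal_loc_nonpos[OF W] in \<open>auto simp: gk_def\<close>)
  qed
  have Gi: "integrable lborel ?G" using ex by (simp add: cnv_exists_def)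
  note i = integrable_lebesgue_AE_eq[OF Gi ae]
  have "integrable (lebesgue_on {0..t}) ?h" using i(1) by (subst integrable_restrict_space) auto
  moreover have "abs_continuous_on s t v" if "s \<in> {0<..<t}" for s
    by (rule abs_continuous_cnv_one[OF W]) (use v that in auto)
  ultimately show "caputo_exists \<alpha> v t" by (simp add: caputo_exists_def RL_integrable_def)
  have "(LINT \<tau>|lebesgue_on {0..t}. ?h \<tau>) = (LINT \<tau>|lborel. ?G \<tau>)"
    using i(2) by (subst integral_restrict_space) auto
  also have "\<dots> = Gamma (1 - \<alpha>) * cnv (gk (1 - \<alpha>)) W t" by (simp add: cnv_def)
  finally show "caputo \<alpha> v t = cnv (gk (1 - \<alpha>)) W t"
    using G by (simp add: caputo_def RL_integral_def)
qed

text \<open>The weight (t - \<tau>) powr (- \<alpha>) is at least t powr (- \<alpha>), so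
  convergence of the Caputo integral makes \<open>deriv v\<close> integrable down to 0. Local
  absolute continuity then yields the representation away from 0, and continuity of \<open>v\<close>
  carries it to 0.\<close>

lemma caputo_exists_density:
  assumes \<alpha>: "0 < \<alpha>" "\<alpha> < 1" and "0 < t" and ex: "caputo_exists \<alpha> v t" and cont: "continuous_on {0..t} v"
  obtains W where "causal_loc W" "\<And>s. s \<in> {0..t} \<Longrightarrow> v s = v 0 + cnv unit_step W s"
    "cnv_exists (gk (1 - \<alpha>)) W t" "caputo \<alpha> v t = cnv (gk (1 - \<alpha>)) W t"
proof -
  have G: "0 < Gamma (1 - \<alpha>)" using \<alpha> by (intro Gamma_real_pos) simp
  define F where "F \<tau> = indicator {0..t} \<tau> *\<^sub>R ((t - \<tau>) powr (1 - \<alpha> - 1) * deriv v \<tau>)" for \<tau>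
  have "integrable lebesgue F"
    using ex unfolding caputo_exists_def RL_integrable_def F_def[abs_def]
    by (subst (asm) integrable_restrict_space) auto
  then obtain F' where F': "F' \<in> borel_measurable lborel" "AE x in lborel. F x = F' x"
    using completion_ex_borel_measurable_real[of F lborel] by auto
  have aeF: "AE x in lebesgue. F' x = F x" using F'(2) unfolding AE_lborel_iff_lebesgue by eventually_elim simp
  have "integrable lebesgue F'"
    using \<open>integrable lebesgue F\<close> aeF F'(1) by (subst integrable_cong_AE[OF _ _ aeF]) (auto simp: measurable_completion)
  then have F'i: "integrable lborel F'" using integrable_completion[OF F'(1)] by simp
  \<comment> \<open>Multiplying by (t - \<tau>) powr \<alpha> removes the singular weight; this
    factor is bounded by t powr \<alpha>, so W stays integrable.\<close>
  define W where "W \<tau> = (if 0 < \<tau> \<and> \<tau> < t then (t - \<tau>) powr \<alpha> * F' \<tau> else 0)" for \<tau>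
  have [measurable]: "F' \<in> borel_measurable borel" using F' by simp
  have Wm[measurable]: "W \<in> borel_measurable borel" unfolding W_def[abs_def] by measurable
  have Wi: "integrable lborel W"
  proof (rule Bochner_Integration.integrable_bound)
    show "integrable lborel (\<lambda>\<tau>. t powr \<alpha> * F' \<tau>)" using F'i by simp
    have "\<bar>W \<tau>\<bar> \<le> \<bar>t powr \<alpha> * F' \<tau>\<bar>" for \<tau>
    proof (cases "0 < \<tau> \<and> \<tau> < t")
      case True
      then have "(t - \<tau>) powr \<alpha> \<le> t powr \<alpha>" using \<alpha> by (intro powr_mono2) auto
      then show ?thesis using True by (simp add: W_def abs_mult mult_right_mono)
    qed (auto simp: W_def)
    then show "AE \<tau> in lborel. norm (W \<tau>) \<le> norm (t powr \<alpha> * F' \<tau>)" by simp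
  qed simp
  have W: "causal_loc W"
    by (rule causal_locI[OF Wm _ integrable_truncate_at[OF Wi]]) (simp add: W_def)
  have Wd: "AE x in lebesgue. 0 < x \<and> x < t \<longrightarrow> deriv v x = W x"
    using aeF
  proof eventually_elim
    case (elim x)
    show ?case
    proof
      assume x: "0 < x \<and> x < t"
      then have "W x = ((t - x) powr \<alpha> * (t - x) powr (- \<alpha>)) * deriv v x" using elim by (simp add: W_def F_def)
      also have "(t - x) powr \<alpha> * (t - x) powr (- \<alpha>) = 1" using x by (simp add: powr_add[symmetric])
      finally show "deriv v x = W x" by simp
    qed
  qed
  have diff: "v s' - v s = cnv unit_step W s' - cnv unit_step W s" if s: "0 < s" "s \<le> s'" "s' \<le> t" for s s'
  proof (cases "s = s'")
    case False
    then have st: "s < t" using s by simp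
    have "abs_continuous_on s t v" using ex s st by (auto simp: caputo_exists_def)
    then obtain w where w: "integrable lborel w" "\<And>x. x \<in> {s..t} \<Longrightarrow> v x = v s + (LINT y:{s..x}|lborel. w y)"
      using abs_continuous_density[OF st, of v] by metis
    have [measurable]: "w \<in> borel_measurable borel" using w by auto
    have wd: "AE x in lebesgue. s < x \<and> x < t \<longrightarrow> (v has_real_derivative w x) (at x)"
    proof (rule indefinite_integral_derivative_AE[OF w(1)])
      fix x y assume "s < x" "x \<le> y" "y < t"
      then show "v y - v x = (LINT z:{x..y}|lborel. w z)"
        using w(2)[of x] w(2)[of y] set_integral_split_Icc[OF w(1), of s x y] by simp
    qed
    have ae: "AE x in lborel. s < x \<and> x < t \<longrightarrow> w x = W x"
      unfolding AE_lborel_iff_lebesgue using wd Wd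
    proof eventually_elim
      case (elim x) then show ?case using s DERIV_imp_deriv[of v "w x" x] by auto
    qed
    have "v s' - v s = (LINT y:{s..s'}|lborel. w y)" using w(2)[of s'] s by simp
    also have "\<dots> = (LINT y:{s..s'}|lborel. truncate_at t W y)"
      unfolding set_lebesgue_integral_def
    proof (rule integral_cong_AE)
      show "AE y in lborel. indicator {s..s'} y *\<^sub>R w y = indicator {s..s'} y *\<^sub>R truncate_at t W y"
        using ae AE_lborel_singleton[of s] AE_lborel_singleton[of t]
        by eventually_elim (use s in \<open>auto simp: indicator_def truncate_at_def\<close>)
    qed auto
    also have "\<dots> = cnv unit_step W s' - cnv unit_step W s" using s by (intro cnv_one_diff[symmetric] W) auto
    finally show ?thesis .
  qed simp
  have cc: "continuous_on {0..t} (cnv W unit_step)"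
  proof (rule continuous_on_cnv[OF W, where B = 1])
    show "continuous_on {0<..t} unit_step" by (rule continuous_on_eq[of _ "\<lambda>_. 1"]) (auto simp: unit_step_def)
  qed (use causal_loc_measurable[OF causal_loc_one] in \<open>auto simp: unit_step_def\<close>)
  have cl: "closure {0<..t} = {0..t}" using \<open>0 < t\<close> by (rule closure_greaterThanAtMost)
  \<comment> \<open>On the half-open interval the two functions differ by a constant; continuity up
    to 0, where the integral vanishes, fixes it as \<open>v 0\<close>.\<close>
  have const: "v s - cnv W unit_step s = v t - cnv W unit_step t" if "s \<in> {0..t}" for s
  proof (rule continuous_constant_on_closure[of "{0<..t}" "\<lambda>s. v s - cnv W unit_step s"])
    show "continuous_on (closure {0<..t}) (\<lambda>s. v s - cnv W unit_step s)" unfolding cl by (intro continuous_intros cont cc)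
    show "v s - cnv W unit_step s = v t - cnv W unit_step t" if "s \<in> {0<..t}" for s
      using diff[of s t] that by (simp add: cnv_commute[of W])
  qed (use that cl in simp)
  have "cnv W unit_step 0 = 0" by (rule cnv_zero) (auto simp: unit_step_def W_def)
  then have rep: "v s = v 0 + cnv unit_step W s" if "s \<in> {0..t}" for s
    using const[OF that] const[of 0] \<open>0 < t\<close> by (simp add: cnv_commute[of W])
  have gW: "gk (1 - \<alpha>) (t - \<tau>) * W \<tau> = 1 / Gamma (1 - \<alpha>) * (indicator {0<..<t} \<tau> * F' \<tau>)" for \<tau>
  proof (cases "0 < \<tau> \<and> \<tau> < t")
    case True
    have "(t - \<tau>) powr (- \<alpha>) * (t - \<tau>) powr \<alpha> = 1" using True by (simp add: powr_add[symmetric])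
    then have "(t - \<tau>) powr (- \<alpha>) * ((t - \<tau>) powr \<alpha> * F' \<tau>) = F' \<tau>" by (simp only: mult.assoc[symmetric])
    then show ?thesis using True by (simp add: gk_def W_def)
  qed (auto simp: W_def)
  have exW: "cnv_exists (gk (1 - \<alpha>)) W t"
    unfolding cnv_exists_def gW
    using integrable_mult_indicator[of "{0<..<t}" lborel F'] F'i by simp
  have "caputo \<alpha> v t = cnv (gk (1 - \<alpha>)) W t"
  proof (rule caputo_cnv(2)[OF \<alpha> W \<open>0 < t\<close> _ exW])
    show "v s = v 0 + cnv unit_step W s" if "s \<in> {0<..t}" for s by (rule rep) (use that in simp)
  qed
  with W rep exW show thesis by (rule that)
qed

text \<open>Writing \<open>(t - \<tau>) powr (-\<alpha>)\<close> as \<open>t powr (-\<alpha>)\<close> plus an integral over \<open>(0, \<tau>)\<close> and exchanging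
  the integrals leaves a nonnegative remainder at a maximum.\<close>

lemma extremum_principle:
  assumes \<alpha>: "0 < \<alpha>" "\<alpha> < 1" and "0 < t" and W: "causal_loc W" and ex: "cnv_exists (gk (1 - \<alpha>)) W t"
    and max: "\<And>s. 0 < s \<Longrightarrow> s < t \<Longrightarrow> cnv unit_step W s \<le> cnv unit_step W t"
  shows "t powr (- \<alpha>) / Gamma (1 - \<alpha>) * cnv unit_step W t \<le> cnv (gk (1 - \<alpha>)) W t"
proof -
  let ?G = "Gamma (1 - \<alpha>)"
  have G: "0 < ?G" using \<alpha> by (intro Gamma_real_pos) simp
  \<comment> \<open>On (0, t) this is the derivative in r of (t - r) powr (- \<alpha>) / Gamma (1 -
    \<alpha>), so integrating it over (0, \<tau>) gives the kernel at \<tau> minus its value at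
    0.\<close>
  define k where "k r = (if 0 < r \<and> r < t then \<alpha> * (t - r) powr (- \<alpha> - 1) / ?G else 0)" for r
  have [measurable]: "W \<in> borel_measurable borel" using W by (simp add: causal_loc_def)
  have km[measurable]: "k \<in> borel_measurable borel" unfolding k_def[abs_def] by measurable
  have k0: "0 \<le> k r" for r using \<alpha> G by (simp add: k_def)
  let ?H = "\<lambda>(\<tau>, r). (if r < \<tau> \<and> \<tau> < t then k r * W \<tau> else 0)"
  have Hm: "?H \<in> borel_measurable (lborel \<Otimes>\<^sub>M lborel)" by measurable
  have inner: "has_bochner_integral lborel (\<lambda>r. if r < \<tau> then k r else 0) (((t - \<tau>) powr (- \<alpha>) - t powr (- \<alpha>)) / ?G)"
    if \<tau>: "0 < \<tau>" "\<tau> < t" for \<tau>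
  proof -
    have "has_bochner_integral lborel (\<lambda>r. (\<alpha> * (t - r) powr (- \<alpha> - 1) / ?G) * indicator {0..\<tau>} r)
      ((t - \<tau>) powr (- \<alpha>) / ?G - (t - 0) powr (- \<alpha>) / ?G)"
    proof (rule has_bochner_integral_FTC_Icc_real)
      show "((\<lambda>r. (t - r) powr (- \<alpha>) / ?G) has_real_derivative \<alpha> * (t - x) powr (- \<alpha> - 1) / ?G) (at x)"
        if "0 \<le> x" "x \<le> \<tau>" for x
        using that \<tau> G by (auto intro!: derivative_eq_intros dest: less_imp_neq)
      show "isCont (\<lambda>r. \<alpha> * (t - r) powr (- \<alpha> - 1) / ?G) x" if "0 \<le> x" "x \<le> \<tau>" for x
        using that \<tau> G by (intro continuous_intros) auto
    qed (use \<tau> in simp)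
    moreover have "AE r in lborel. (\<alpha> * (t - r) powr (- \<alpha> - 1) / ?G) * indicator {0..\<tau>} r = (if r < \<tau> then k r else 0)"
      using AE_lborel_singleton[of 0] AE_lborel_singleton[of \<tau>]
      by eventually_elim (use \<tau> in \<open>auto simp: k_def indicator_def\<close>)
    ultimately have "has_bochner_integral lborel (\<lambda>r. if r < \<tau> then k r else 0) ((t - \<tau>) powr (- \<alpha>) / ?G - (t - 0) powr (- \<alpha>) / ?G)"
      by (subst (asm) has_bochner_integral_cong_AE) auto
    then show ?thesis by (simp add: diff_divide_distrib)
  qed
  have innerW: "has_bochner_integral lborel (\<lambda>r. ?H (\<tau>, r)) (gk (1 - \<alpha>) (t - \<tau>) * W \<tau> - t powr (- \<alpha>) / ?G * truncate_at t W \<tau>)"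
    if ne: "\<tau> \<noteq> t" for \<tau> :: real
  proof -
    consider "\<tau> \<le> 0" | "t < \<tau>" | "0 < \<tau>" "\<tau> < t" using ne by linarith
    then show ?thesis
    proof cases
      case 1
      then have "(\<lambda>r. ?H (\<tau>, r)) = (\<lambda>r. 0)" using causal_loc_nonpos[OF W] by auto
      then show ?thesis using 1 causal_loc_nonpos[OF W] by (simp add: truncate_at_def has_bochner_integral_zero)
    next
      case 2
      then have "(\<lambda>r. ?H (\<tau>, r)) = (\<lambda>r. 0)" by auto
      then show ?thesis using 2 by (simp add: truncate_at_def gk_def has_bochner_integral_zero)
    next
      case 3
      have e: "(\<lambda>r. ?H (\<tau>, r)) = (\<lambda>r. (if r < \<tau> then k r else 0) * W \<tau>)" using 3 by auto
      have "((t - \<tau>) powr (- \<alpha>) - t powr (- \<alpha>)) / ?G * W \<tau> = gk (1 - \<alpha>) (t - \<tau>) * W \<tau> - t powr (- \<alpha>) / ?G * truncate_at t W \<tau>"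
        using 3 by (simp add: gk_def truncate_at_def diff_divide_distrib left_diff_distrib)
      then show ?thesis unfolding e using has_bochner_integral_mult_left[OF inner[OF 3], of "W \<tau>"] by simp
    qed
  qed
  have iW: "integrable lborel (truncate_at t W)" by (rule causal_loc_integrable[OF W])
  have ig: "integrable lborel (\<lambda>\<tau>. gk (1 - \<alpha>) (t - \<tau>) * W \<tau>)" using ex by (simp add: cnv_exists_def)
  have aet: "AE \<tau> in lborel. \<tau> \<noteq> t" by (rule AE_lborel_singleton)
  have H: "integrable (lborel \<Otimes>\<^sub>M lborel) ?H"
  proof (rule lborel_pair.Fubini_integrable[OF Hm])
    show "AE \<tau> in lborel. integrable lborel (\<lambda>r. ?H (\<tau>, r))"
      using aet by eventually_elim (rule integrable.intros[OF innerW])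
    have "AE \<tau> in lborel. (LINT r|lborel. norm (?H (\<tau>, r))) = \<bar>gk (1 - \<alpha>) (t - \<tau>) * W \<tau> - t powr (- \<alpha>) / ?G * truncate_at t W \<tau>\<bar>"
      using aet
    proof eventually_elim
      case (elim \<tau>)
      \<comment> \<open>For fixed \<tau> the integrand has the sign of \<open>W \<tau>\<close>
        throughout, so its norm integrates to the absolute value of its integral, which is
        integrable in \<tau>.\<close>
      have "norm (?H (\<tau>, r)) = ?H (\<tau>, r) * sgn (W \<tau>)" for r
        using k0[of r] by (auto simp: abs_mult mult.assoc abs_sgn[symmetric] sgn_mult)
      then have "(LINT r|lborel. norm (?H (\<tau>, r))) = (LINT r|lborel. ?H (\<tau>, r)) * sgn (W \<tau>)" by simp
      then have e: "(LINT r|lborel. norm (?H (\<tau>, r))) = (gk (1 - \<alpha>) (t - \<tau>) * W \<tau> - t powr (- \<alpha>) / ?G * truncate_at t W \<tau>) * sgn (W \<tau>)"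
        using has_bochner_integral_integral_eq[OF innerW[OF elim]] by simp
      have nn: "0 \<le> (LINT r|lborel. norm (?H (\<tau>, r)))" by (rule integral_nonneg_AE) simp
      show ?case
      proof (cases "W \<tau> = 0")
        case True
        then have "(\<lambda>r. norm (?H (\<tau>, r))) = (\<lambda>r. 0)" by auto
        then have "(LINT r|lborel. norm (?H (\<tau>, r))) = 0" by (simp only: Bochner_Integration.integral_zero)
        then show ?thesis using True by (simp add: truncate_at_def)
      next
        case False
        then have "\<bar>sgn (W \<tau>)\<bar> = 1" by (simp add: abs_sgn_eq)
        then have "\<bar>(gk (1 - \<alpha>) (t - \<tau>) * W \<tau> - t powr (- \<alpha>) / ?G * truncate_at t W \<tau>) * sgn (W \<tau>)\<bar>
          = \<bar>gk (1 - \<alpha>) (t - \<tau>) * W \<tau> - t powr (- \<alpha>) / ?G * truncate_at t W \<tau>\<bar>"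
          by (simp only: abs_mult mult_1_right)
        then show ?thesis using e nn by simp
      qed
    qed
    moreover have "integrable lborel (\<lambda>\<tau>. \<bar>gk (1 - \<alpha>) (t - \<tau>) * W \<tau> - t powr (- \<alpha>) / ?G * truncate_at t W \<tau>\<bar>)"
      using iW ig by simp
    ultimately show "integrable lborel (\<lambda>\<tau>. LINT r|lborel. norm (?H (\<tau>, r)))"
      using Hm by (subst integrable_cong_AE) auto
  qed
  have "cnv (gk (1 - \<alpha>)) W t - t powr (- \<alpha>) / ?G * cnv unit_step W t
    = (LINT \<tau>|lborel. gk (1 - \<alpha>) (t - \<tau>) * W \<tau> - t powr (- \<alpha>) / ?G * truncate_at t W \<tau>)"
    unfolding cnv_one(1)[OF W] unfolding cnv_def[of "gk (1 - \<alpha>)"] using iW ig by simp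
  also have "\<dots> = (LINT \<tau>|lborel. LINT r|lborel. ?H (\<tau>, r))"
  proof (rule integral_cong_AE)
    show "AE \<tau> in lborel. gk (1 - \<alpha>) (t - \<tau>) * W \<tau> - t powr (- \<alpha>) / ?G * truncate_at t W \<tau> = (LINT r|lborel. ?H (\<tau>, r))"
      using aet by eventually_elim (rule has_bochner_integral_integral_eq[OF innerW, symmetric])
    show "(\<lambda>\<tau>. LINT r|lborel. ?H (\<tau>, r)) \<in> borel_measurable lborel" using lborel_pair.integrable_fst'[OF H] by auto
  qed (use iW ig in auto)
  also have "\<dots> = (LINT r|lborel. LINT \<tau>|lborel. ?H (\<tau>, r))"
    using lborel_pair.Fubini_integral[of "\<lambda>\<tau> r. if r < \<tau> \<and> \<tau> < t then k r * W \<tau> else 0"] H by simp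
  also have "0 \<le> \<dots>"
  proof (rule integral_nonneg_AE, rule AE_I2)
    fix r
    show "0 \<le> (LINT \<tau>|lborel. ?H (\<tau>, r))"
    proof (cases "0 < r \<and> r < t")
      case True
      \<comment> \<open>For fixed r the integral over \<tau> is \<open>k r\<close> times the
        increment of the function from r to t, which is nonnegative at a maximum.\<close>
      have "(LINT \<tau>|lborel. ?H (\<tau>, r)) = (LINT \<tau>|lborel. k r * (indicator {r..t} \<tau> *\<^sub>R truncate_at t W \<tau>))"
      proof (rule integral_cong_AE)
        show "AE \<tau> in lborel. ?H (\<tau>, r) = k r * (indicator {r..t} \<tau> *\<^sub>R truncate_at t W \<tau>)"
          using aet AE_lborel_singleton[of r] by eventually_elim (auto simp: indicator_def truncate_at_def)
      qed auto
      also have "\<dots> = k r * (LINT \<tau>:{r..t}|lborel. truncate_at t W \<tau>)" by (simp add: set_lebesgue_integral_def)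
      also have "(LINT \<tau>:{r..t}|lborel. truncate_at t W \<tau>) = cnv unit_step W t - cnv unit_step W r"
        using True by (intro cnv_one_diff[symmetric] W) auto
      finally show ?thesis using k0[of r] max[of r] True by simp
    next
      case False
      then have "k r = 0" by (auto simp: k_def)
      then have "(\<lambda>\<tau>. ?H (\<tau>, r)) = (\<lambda>\<tau>. 0)" by auto
      then show ?thesis by simp
    qed
  qed
  finally show ?thesis by simp
qed

text \<open>The second derivatives are given at \<open>x0\<close> only. If that of u - v were
  positive, the first derivative would be positive just to the right of \<open>x0\<close>, and the
  mean value theorem would produce a value above the maximum.\<close>

lemma max_derivative_conditions:
  fixes u v :: "real \<Rightarrow> real"
  assumes x0: "a < x0" "x0 < b"
    and u: "\<And>x. x \<in> {a<..<b} \<Longrightarrow> u field_differentiable at x" and du: "deriv u field_differentiable at x0"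
    and v: "\<And>x. x \<in> {a<..<b} \<Longrightarrow> v field_differentiable at x" and dv: "deriv v field_differentiable at x0"
    and max: "\<And>x. x \<in> {a<..<b} \<Longrightarrow> u x - v x \<le> u x0 - v x0"
  shows "deriv u x0 = deriv v x0" "deriv (deriv u) x0 \<le> deriv (deriv v) x0"
proof -
  have d1: "((\<lambda>x. u x - v x) has_real_derivative deriv u x - deriv v x) (at x)" if "x \<in> {a<..<b}" for x
    using u[OF that] v[OF that] by (intro DERIV_diff) (simp_all add: DERIV_deriv_iff_field_differentiable)
  have "deriv u x0 - deriv v x0 = 0"
  proof (rule DERIV_local_max[OF d1])
    show "0 < min (x0 - a) (b - x0)" using x0 by simp
    show "\<forall>y. \<bar>x0 - y\<bar> < min (x0 - a) (b - x0) \<longrightarrow> u y - v y \<le> u x0 - v x0"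
    proof (intro allI impI)
      fix y assume "\<bar>x0 - y\<bar> < min (x0 - a) (b - x0)"
      then have "y \<in> {a<..<b}" by (auto simp: abs_less_iff)
      then show "u y - v y \<le> u x0 - v x0" by (rule max)
    qed
  qed (use x0 in simp)
  then show e: "deriv u x0 = deriv v x0" by simp
  have d2: "((\<lambda>x. deriv u x - deriv v x) has_real_derivative deriv (deriv u) x0 - deriv (deriv v) x0) (at x0)"
    using du dv by (intro DERIV_diff) (simp_all add: DERIV_deriv_iff_field_differentiable)
  show "deriv (deriv u) x0 \<le> deriv (deriv v) x0"
  proof (rule ccontr)
    assume "\<not> deriv (deriv u) x0 \<le> deriv (deriv v) x0"
    then have "0 < deriv (deriv u) x0 - deriv (deriv v) x0" by simp
    from DERIV_pos_inc_right[OF d2 this]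
    obtain d where d: "0 < d" "\<And>h. 0 < h \<Longrightarrow> h < d \<Longrightarrow> 0 < deriv u (x0 + h) - deriv v (x0 + h)"
      using e by auto
    define h where "h = min d (b - x0) / 2"
    have "0 < h" "h \<le> d / 2" "h \<le> (b - x0) / 2" using d x0 by (auto simp: h_def)
    then have h: "0 < h" "h < d" "x0 + h < b" using d(1) x0(2) by (simp_all add: field_simps)
    obtain z where z: "x0 < z" "z < x0 + h"
      "(u (x0 + h) - v (x0 + h)) - (u x0 - v x0) = (x0 + h - x0) * (deriv u z - deriv v z)"
      using MVT2[of x0 "x0 + h" "\<lambda>x. u x - v x" "\<lambda>x. deriv u x - deriv v x"] d1 h x0 by auto
    have "0 < deriv u z - deriv v z" using d(2)[of "z - x0"] z h by simp
    then have "0 < (x0 + h - x0) * (deriv u z - deriv v z)" using h by simp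
    moreover have "u (x0 + h) - v (x0 + h) \<le> u x0 - v x0" using h x0 by (intro max) auto
    ultimately show False using z(3) by linarith
  qed
qed

text \<open>At a positive maximum of u - v the spatial terms are nonpositive, while the extremum
  principle makes the difference of the Caputo derivatives strictly positive. This difference is
  formed through the densities, since \<open>deriv\<close> of a difference is sure to split only
  where both functions are differentiable.\<close>

lemma ibvp_comparison:
  assumes \<alpha>: "0 < \<alpha>" "\<alpha> < 1" and T: "0 < T" and l: "0 < l"
    and p: "\<And>x. x \<in> {0<..<l} \<Longrightarrow> p field_differentiable at x" "\<And>x. x \<in> {0<..<l} \<Longrightarrow> 0 < p x"
    and q: "\<And>x. x \<in> {0<..<l} \<Longrightarrow> 0 \<le> q x"
    and u: "ibvp_solution \<alpha> T l p q \<phi> h f u" and v: "ibvp_solution \<alpha> T l p q \<phi> h f v"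
    and tx: "(t, x) \<in> Omega_closed T l"
  shows "u t x \<le> v t x"
proof (rule ccontr)
  assume neg: "\<not> u t x \<le> v t x"
  define d where "d z = u (fst z) (snd z) - v (fst z) (snd z)" for z
  have uc: "continuous_on (Omega_closed T l) (\<lambda>(t, x). u t x)" and vc: "continuous_on (Omega_closed T l) (\<lambda>(t, x). v t x)"
    using u v by (auto simp: ibvp_solution_def)
  have "continuous_on (Omega_closed T l) d"
    unfolding d_def[abs_def] using uc vc by (intro continuous_on_diff) (simp_all add: case_prod_unfold)
  moreover have "compact (Omega_closed T l)" unfolding Omega_closed_def by (intro compact_Times) auto
  ultimately obtain z0 where z0: "z0 \<in> Omega_closed T l" "\<And>z. z \<in> Omega_closed T l \<Longrightarrow> d z \<le> d z0"
    using continuous_attains_sup[of "Omega_closed T l" d] tx by blast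
  define t0 x0 where "t0 = fst z0" and "x0 = snd z0"
  define M where "M = u t0 x0 - v t0 x0"
  have max: "u s y - v s y \<le> M" if "s \<in> {0..T}" "y \<in> {0..l}" for s y
    using z0(2)[of "(s, y)"] that by (simp add: d_def M_def t0_def x0_def Omega_closed_def)
  have "0 < u t x - v t x" using neg by simp
  then have M: "0 < M" using max[of t x] tx by (simp add: Omega_closed_def)
  have tx0: "t0 \<in> {0..T}" "x0 \<in> {0..l}" using z0(1) by (auto simp: Omega_closed_def t0_def x0_def mem_Times_iff)
  have init: "u 0 y = v 0 y" if "y \<in> {0..l}" for y using u v that by (simp add: ibvp_solution_def)
  have bdry: "u s 0 = v s 0" "u s l = v s l" if "s \<in> {0..T}" for s using u v that by (simp_all add: ibvp_solution_def)
  have "t0 \<noteq> 0" using M init[OF tx0(2)] by (auto simp: M_def)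
  moreover have "x0 \<noteq> 0" "x0 \<noteq> l" using M bdry[OF tx0(1)] by (auto simp: M_def)
  ultimately have t0: "0 < t0" "t0 \<le> T" and x0: "0 < x0" "x0 < l" using tx0 by auto
  have Om: "(t0, y) \<in> Omega T l" if "y \<in> {0<..<l}" for y using t0 that by (simp add: Omega_def)
  have cont: "continuous_on {0..t0} (\<lambda>s. w s x0)" if "ibvp_solution \<alpha> T l p q \<phi> h f w" for w
  proof -
    have c: "continuous_on (Omega_closed T l) (\<lambda>z. w (fst z) (snd z))"
      using that by (simp add: ibvp_solution_def case_prod_unfold)
    have "continuous_on {0..t0} (\<lambda>s. (\<lambda>z. w (fst z) (snd z)) (s, x0))"
      by (rule continuous_on_compose2[OF c]) (use t0 x0 in \<open>auto simp: Omega_closed_def intro!: continuous_intros\<close>)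
    then show ?thesis by simp
  qed
  have cex: "caputo_exists \<alpha> (\<lambda>s. w s x0) t0" if "ibvp_solution \<alpha> T l p q \<phi> h f w" for w
    using that Om[of x0] x0 by (auto simp: ibvp_solution_def C_alpha_2_def)
  obtain W1 where W1: "causal_loc W1" "\<And>s. s \<in> {0..t0} \<Longrightarrow> u s x0 = u 0 x0 + cnv unit_step W1 s"
    "cnv_exists (gk (1 - \<alpha>)) W1 t0" "caputo \<alpha> (\<lambda>s. u s x0) t0 = cnv (gk (1 - \<alpha>)) W1 t0"
    by (rule caputo_exists_density[OF \<alpha> t0(1) cex[OF u] cont[OF u]]) blast
  obtain W2 where W2: "causal_loc W2" "\<And>s. s \<in> {0..t0} \<Longrightarrow> v s x0 = v 0 x0 + cnv unit_step W2 s"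
    "cnv_exists (gk (1 - \<alpha>)) W2 t0" "caputo \<alpha> (\<lambda>s. v s x0) t0 = cnv (gk (1 - \<alpha>)) W2 t0"
    by (rule caputo_exists_density[OF \<alpha> t0(1) cex[OF v] cont[OF v]]) blast
  let ?W = "\<lambda>s. W1 s - W2 s"
  have oneW: "cnv unit_step ?W s = cnv unit_step W1 s - cnv unit_step W2 s" for s
    by (intro cnv_diff_right cnv_one(2) W1 W2)
  have rep: "cnv unit_step ?W s = u s x0 - v s x0" if "s \<in> {0..t0}" for s
    using oneW W1(2)[OF that] W2(2)[OF that] init[OF tx0(2)] by simp
  have "t0 powr (- \<alpha>) / Gamma (1 - \<alpha>) * cnv unit_step ?W t0 \<le> cnv (gk (1 - \<alpha>)) ?W t0"
  proof (rule extremum_principle[OF \<alpha> t0(1) causal_loc_diff[OF W1(1) W2(1)]])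
    show "cnv_exists (gk (1 - \<alpha>)) ?W t0" by (intro cnv_diff_right W1 W2)
    show "cnv unit_step ?W s \<le> cnv unit_step ?W t0" if "0 < s" "s < t0" for s
      using rep[of s] rep[of t0] that t0 x0 max[of s x0] by (simp add: M_def)
  qed
  moreover have "cnv unit_step ?W t0 = M" using rep[of t0] t0 by (simp add: M_def)
  moreover have "0 < t0 powr (- \<alpha>) / Gamma (1 - \<alpha>) * M"
    using t0 M \<alpha> Gamma_real_pos[of "1 - \<alpha>"] by simp
  moreover have "cnv (gk (1 - \<alpha>)) ?W t0 = caputo \<alpha> (\<lambda>s. u s x0) t0 - caputo \<alpha> (\<lambda>s. v s x0) t0"
    using W1 W2 by (simp add: cnv_diff_right)
  ultimately have pos: "0 < caputo \<alpha> (\<lambda>s. u s x0) t0 - caputo \<alpha> (\<lambda>s. v s x0) t0" by simp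
  have fd: "w t0 field_differentiable at y" "deriv (w t0) field_differentiable at y"
    if "ibvp_solution \<alpha> T l p q \<phi> h f w" "y \<in> {0<..<l}" for w y
    using that Om[OF that(2)] by (auto simp: ibvp_solution_def C_alpha_2_def)
  have xi: "x0 \<in> {0<..<l}" using x0 by simp
  have maxx: "u t0 y - v t0 y \<le> u t0 x0 - v t0 x0" if "y \<in> {0<..<l}" for y
    using max[of t0 y] that t0 by (simp add: M_def)
  have d1: "deriv (u t0) x0 = deriv (v t0) x0"
    by (rule max_derivative_conditions(1)[of 0 x0 l]) (use x0 fd u v xi maxx in auto)
  have d2: "deriv (deriv (u t0)) x0 \<le> deriv (deriv (v t0)) x0"
    by (rule max_derivative_conditions(2)[of 0 x0 l]) (use x0 fd u v xi maxx in auto)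
  have fl: "deriv (\<lambda>y. p y * deriv (w t0) y) x0 = p x0 * deriv (deriv (w t0)) x0 + deriv p x0 * deriv (w t0) x0"
    if "ibvp_solution \<alpha> T l p q \<phi> h f w" for w
    using p(1)[OF xi] fd(2)[OF that xi] by (simp add: deriv_mult)
  have pde: "caputo \<alpha> (\<lambda>s. w s x0) t0 = deriv (\<lambda>y. p y * deriv (w t0) y) x0 - q x0 * w t0 x0 + f t0 * h x0"
    if "ibvp_solution \<alpha> T l p q \<phi> h f w" for w
    using that Om[OF xi] by (auto simp: ibvp_solution_def algebra_simps)
  have "caputo \<alpha> (\<lambda>s. u s x0) t0 - caputo \<alpha> (\<lambda>s. v s x0) t0
    = p x0 * (deriv (deriv (u t0)) x0 - deriv (deriv (v t0)) x0) - q x0 * M"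
    unfolding pde[OF u] pde[OF v] fl[OF u] fl[OF v] d1 by (simp add: M_def algebra_simps)
  moreover have "p x0 * (deriv (deriv (u t0)) x0 - deriv (deriv (v t0)) x0) \<le> 0"
    using p(2)[OF xi] d2 by (intro mult_nonneg_nonpos) auto
  moreover have "0 \<le> q x0 * M" using q[OF xi] M by simp
  ultimately show False using pos by linarith
qed

subsection \<open>The series solution\<close>

lemma utail_cong:
  assumes F: "utail A F" and eq: "\<And>n z. z \<in> A \<Longrightarrow> F n z = G n z"
  shows "utail A G"
proof (rule utailI)
  fix \<epsilon> :: real assume "0 < \<epsilon>"
  obtain M where M: "\<And>m k z. M \<le> m \<Longrightarrow> m \<le> k \<Longrightarrow> z \<in> A \<Longrightarrow> \<bar>\<Sum>n=m..<k. F n z\<bar> \<le> \<epsilon>"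
    by (rule utailD[OF F \<open>0 < \<epsilon>\<close>]) blast
  have "\<bar>\<Sum>n=m..<k. G n z\<bar> \<le> \<epsilon>" if "M \<le> m" "m \<le> k" "z \<in> A" for m k z
    using M[OF that] eq[OF that(3)] by simp
  then show "\<exists>M. \<forall>m k z. M \<le> m \<longrightarrow> m \<le> k \<longrightarrow> z \<in> A \<longrightarrow> \<bar>\<Sum>n=m..<k. G n z\<bar> \<le> \<epsilon>" by blast
qed

text \<open>The derivative series converge uniformly only away from t = 0. Continuity is local, so
  it is enough to know it for t >= t1 > 0.\<close>

lemma continuous_on_Omega:
  fixes g :: "real \<times> real \<Rightarrow> real"
  assumes g: "\<And>t1. 0 < t1 \<Longrightarrow> continuous_on ({t1..T} \<times> {0<..<l}) g"
  shows "continuous_on (Omega T l) g"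
  unfolding continuous_on_iff
proof (intro ballI allI impI)
  fix z \<epsilon> assume z: "z \<in> Omega T l" and "(0::real) < \<epsilon>"
  define t1 where "t1 = fst z / 2"
  have t1: "0 < t1" "t1 \<le> fst z" "fst z = t1 + t1" using z by (auto simp: t1_def Omega_def)
  have "z \<in> {t1..T} \<times> {0<..<l}" using z t1 by (auto simp: Omega_def mem_Times_iff)
  then obtain d where d: "0 < d" "\<And>z'. z' \<in> {t1..T} \<times> {0<..<l} \<Longrightarrow> dist z' z < d \<Longrightarrow> dist (g z') (g z) < \<epsilon>"
    using g[OF t1(1)] \<open>0 < \<epsilon>\<close> unfolding continuous_on_iff by meson
  show "\<exists>d>0. \<forall>z'\<in>Omega T l. dist z' z < d \<longrightarrow> dist (g z') (g z) < \<epsilon>"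
  proof (intro exI[of _ "min d t1"] conjI ballI impI)
    fix z' assume z': "z' \<in> Omega T l" "dist z' z < min d t1"
    have "\<bar>fst z' - fst z\<bar> < t1" using dist_fst_le[of z' z] z'(2) by (simp add: dist_real_def)
    then have "z' \<in> {t1..T} \<times> {0<..<l}" using z'(1) t1 by (auto simp: Omega_def mem_Times_iff)
    then show "dist (g z') (g z) < \<epsilon>" using d z' by simp
  qed (use d t1 in simp)
qed

locale ibvp_data = sturm_liouville +
  fixes \<alpha> T :: real and \<phi> d\<phi> h dh :: "real \<Rightarrow> real" and w :: "real \<Rightarrow> real" and f0 :: real
  assumes \<alpha>: "0 < \<alpha>" "\<alpha> < 1" and T_pos: "0 < T"
    and \<phi>_adm: "admissible \<phi> d\<phi>" and h_adm: "admissible h dh" and w: "causal_loc w"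
begin

definition src :: "real \<Rightarrow> real" where "src t = f0 * unit_step t + cnv unit_step w t"

abbreviation a where "a \<equiv> coeff \<phi>"
abbreviation b where "b \<equiv> coeff h"

definition dU :: "nat \<Rightarrow> real \<Rightarrow> real" where
  "dU n = mode_deriv \<alpha> (ev n) (a n) (b n) f0 w"

text \<open>The formula in \<open>mode\<close> gives 0 at t = 0, because \<open>ml0\<close> is
  causal; the integral form has the initial value \<open>a n\<close>, and its continuity on
  \<open>[0, T]\<close> is that of an indefinite integral.\<close>

definition U :: "nat \<Rightarrow> real \<Rightarrow> real" where
  "U n t = a n + cnv unit_step (dU n) t"

text \<open>The initial coefficient enters \<open>mode_deriv\<close> with a minus sign, so the
  negative one here makes all contributions nonnegative. This majorant of \<open>dU n\<close> is
  itself the density of a mode, and the mode formulas evaluate its convolutions.\<close>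

definition dU_abs :: "nat \<Rightarrow> real \<Rightarrow> real" where
  "dU_abs n = mode_deriv \<alpha> (ev n) (- \<bar>a n\<bar>) \<bar>b n\<bar> \<bar>f0\<bar> (\<lambda>s. \<bar>w s\<bar>)"

definition C :: "real \<Rightarrow> real" where "C t = \<bar>f0\<bar> + (LINT s|lborel. \<bar>truncate_at t w s\<bar>)"

lemma ev_nonneg: "0 \<le> ev n" using ev_pos[of n] by simp

lemma truncate_integral_mono:
  assumes "s \<le> t" shows "(LINT x|lborel. \<bar>truncate_at s w x\<bar>) \<le> (LINT x|lborel. \<bar>truncate_at t w x\<bar>)"
  by (rule integral_mono; (intro integrable_abs causal_loc_integrable w)?) (use assms in \<open>simp add: truncate_at_def\<close>)

lemma C_mono: "s \<le> t \<Longrightarrow> C s \<le> C t"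
  using truncate_integral_mono[of s t] by (simp add: C_def)

lemma C_nonneg: "0 \<le> C t"
  unfolding C_def by (intro add_nonneg_nonneg integral_nonneg_AE) auto

lemma src_bound: "\<bar>f0' * unit_step t + cnv unit_step v t\<bar> \<le> \<bar>f0'\<bar> + (LINT s|lborel. \<bar>truncate_at t v s\<bar>)"
  if "causal_loc v"
proof -
  have "\<bar>f0' * unit_step t\<bar> \<le> \<bar>f0'\<bar>" by (simp add: unit_step_def)
  then show ?thesis using cnv_one_bound[OF that, of t] abs_triangle_ineq[of "f0' * unit_step t" "cnv unit_step v t"] by linarith
qed

lemma source_bound: "\<bar>mode_source \<alpha> (ev n) f0' v t\<bar> \<le> \<bar>f0'\<bar> + (LINT s|lborel. \<bar>truncate_at t v s\<bar>)"
  if "causal_loc v"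
proof -
  have "\<bar>ml0 \<alpha> (ev n) t\<bar> \<le> 1"
    using ml0_nonneg[OF \<alpha> ev_nonneg, of n t] ml0_le_1[OF \<alpha> ev_nonneg, of n t] by simp
  then have "\<bar>f0'\<bar> * \<bar>ml0 \<alpha> (ev n) t\<bar> \<le> \<bar>f0'\<bar> * 1" by (rule mult_left_mono) simp
  then have "\<bar>f0' * ml0 \<alpha> (ev n) t\<bar> \<le> \<bar>f0'\<bar>" by (simp add: abs_mult)
  then show ?thesis
    using cnv_gk_cnv_ml(4)[OF \<alpha> ev_nonneg that, of n t]
      abs_triangle_ineq[of "f0' * ml0 \<alpha> (ev n) t" "cnv (ml0 \<alpha> (ev n)) v t"]
    unfolding mode_source_def[OF \<alpha> ev_nonneg] by linarith
qed

lemma src_le_C: "\<bar>src t\<bar> \<le> C t" "\<bar>mode_source \<alpha> (ev n) f0 w t\<bar> \<le> C t"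
  using src_bound[OF w] source_bound[OF w] by (simp_all add: src_def C_def)

lemma src_eq: "src = (\<lambda>t. f0 * unit_step t + cnv unit_step w t)" by (auto simp: src_def)

lemma U_eq: "0 < t \<Longrightarrow> U n t = a n * ml0 \<alpha> (ev n) t + b n * cnv (ml \<alpha> (ev n)) src t"
  using mode_eq_integral[OF \<alpha> ev_nonneg w src_eq, of t n "a n" "b n"]
  by (simp add: U_def dU_def mode_def[OF \<alpha> ev_nonneg])

lemma U_nonpos: "t \<le> 0 \<Longrightarrow> U n t = a n"
  unfolding U_def using cnv_zero[of t "dU n" unit_step]
    causal_loc_nonpos[OF causal_loc_mode_deriv[OF \<alpha> ev_nonneg w src_eq]] by (simp add: dU_def unit_step_def)

lemma ev_cnv_src: "ev n * cnv (ml \<alpha> (ev n)) src t = src t - mode_source \<alpha> (ev n) f0 w t"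
  by (rule cnv_ml_source(2)[OF \<alpha> ev_nonneg w src_eq])

lemma ev_cnv_src_bound: "\<bar>ev n * cnv (ml \<alpha> (ev n)) src t\<bar> \<le> 2 * C t"
  unfolding ev_cnv_src using src_le_C(1)[of t] src_le_C(2)[where n = n and t = t] by linarith

lemma cnv_src_bound: "\<bar>cnv (ml \<alpha> (ev n)) src t\<bar> \<le> 2 * C t / ev 0"
proof -
  have "ev 0 * \<bar>cnv (ml \<alpha> (ev n)) src t\<bar> \<le> ev n * \<bar>cnv (ml \<alpha> (ev n)) src t\<bar>"
    using ev_ge[of n] by (rule mult_right_mono) simp
  also have "\<dots> \<le> 2 * C t" using ev_cnv_src_bound[of n t] ev_pos[of n] by (simp add: abs_mult)
  finally show ?thesis using ev_pos[of 0] by (simp add: field_simps)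
qed

lemma causal_loc_dU: "causal_loc (dU n)"
  unfolding dU_def by (rule causal_loc_mode_deriv[OF \<alpha> ev_nonneg w src_eq])

lemma causal_loc_dU_abs: "causal_loc (dU_abs n)"
  unfolding dU_abs_def by (rule causal_loc_mode_deriv[OF \<alpha> ev_nonneg causal_loc_abs[OF w] refl])

lemma dU_le_abs: "\<bar>dU n s\<bar> \<le> dU_abs n s"
proof -
  let ?k = "ml \<alpha> (ev n)"
  have k: "0 \<le> ?k s" for s by (rule ml_nonneg[OF \<alpha> ev_nonneg])
  have "\<bar>cnv ?k w s\<bar> \<le> cnv ?k (\<lambda>s. \<bar>w s\<bar>) s" using cnv_abs_le[of ?k w s] k by simp
  moreover have "\<bar>f0 * ?k s\<bar> = \<bar>f0\<bar> * ?k s" using k by (simp add: abs_mult)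
  ultimately have "\<bar>f0 * ?k s + cnv ?k w s\<bar> \<le> \<bar>f0\<bar> * ?k s + cnv ?k (\<lambda>s. \<bar>w s\<bar>) s" by linarith
  then have "\<bar>b n\<bar> * \<bar>f0 * ?k s + cnv ?k w s\<bar> \<le> \<bar>b n\<bar> * (\<bar>f0\<bar> * ?k s + cnv ?k (\<lambda>s. \<bar>w s\<bar>) s)"
    by (rule mult_left_mono) simp
  moreover have "\<bar>(- a n * ev n) * ?k s\<bar> = (- (- \<bar>a n\<bar>) * ev n) * ?k s"
    using abs_of_nonneg[OF k[of s]] abs_of_nonneg[OF ev_nonneg[of n]] by (simp add: abs_mult)
  moreover have "\<bar>dU n s\<bar> \<le> \<bar>(- a n * ev n) * ?k s\<bar> + \<bar>b n\<bar> * \<bar>f0 * ?k s + cnv ?k w s\<bar>"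
    unfolding dU_def mode_deriv_def[OF \<alpha> ev_nonneg] abs_mult[of "b n", symmetric] by (rule abs_triangle_ineq)
  ultimately show ?thesis
    unfolding dU_abs_def mode_deriv_def[OF \<alpha> ev_nonneg] by linarith
qed

lemma cnv_one_dU_abs: "0 < t \<Longrightarrow> cnv unit_step (dU_abs n) t \<le> \<bar>a n\<bar> + \<bar>b n\<bar> * (2 * C t / ev 0)"
proof -
  assume t: "0 < t"
  let ?v = "\<lambda>s. \<bar>w s\<bar>" and ?k = "ml \<alpha> (ev n)"
  let ?s = "\<lambda>t. \<bar>f0\<bar> * unit_step t + cnv unit_step ?v t"
  note v = causal_loc_abs[OF w]
  have tr: "\<bar>truncate_at t ?v s\<bar> = \<bar>truncate_at t w s\<bar>" for s by (simp add: truncate_at_def)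
  have "cnv unit_step (dU_abs n) t = mode \<alpha> (ev n) (- \<bar>a n\<bar>) \<bar>b n\<bar> ?s t + \<bar>a n\<bar>"
    using mode_eq_integral[OF \<alpha> ev_nonneg v refl t] by (simp add: dU_abs_def)
  also have "mode \<alpha> (ev n) (- \<bar>a n\<bar>) \<bar>b n\<bar> ?s t = - \<bar>a n\<bar> * ml0 \<alpha> (ev n) t + \<bar>b n\<bar> * cnv ?k ?s t"
    by (simp add: mode_def[OF \<alpha> ev_nonneg])
  also have "- \<bar>a n\<bar> * ml0 \<alpha> (ev n) t \<le> 0" using ml0_nonneg[OF \<alpha> ev_nonneg, of n t] by simp
  also have "cnv ?k ?s t \<le> 2 * C t / ev 0"
  proof -
    have "ev n * cnv ?k ?s t = ?s t - mode_source \<alpha> (ev n) \<bar>f0\<bar> ?v t"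
      by (rule cnv_ml_source(2)[OF \<alpha> ev_nonneg v refl])
    also have "\<dots> \<le> 2 * C t"
      using src_bound[OF v, of "\<bar>f0\<bar>" t] source_bound[OF v, of n "\<bar>f0\<bar>" t] by (simp add: C_def tr)
    finally have a: "ev n * cnv ?k ?s t \<le> 2 * C t" .
    have "0 \<le> cnv ?k ?s t"
      by (rule cnv_nonneg) (auto intro!: ml_nonneg[OF \<alpha> ev_nonneg] add_nonneg_nonneg mult_nonneg_nonneg cnv_nonneg simp: unit_step_def)
    then have "ev 0 * cnv ?k ?s t \<le> ev n * cnv ?k ?s t" using ev_ge[of n] by (intro mult_right_mono) auto
    then show ?thesis using a ev_pos[of 0] by (simp add: field_simps)
  qed
  finally show ?thesis by (simp add: mult_left_mono)
qed

lemma cnv_gk_dU_abs: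
  assumes t: "0 < t"
  shows "cnv_exists (gk (1 - \<alpha>)) (dU_abs n) t"
    "cnv (gk (1 - \<alpha>)) (dU_abs n) t \<le> \<bar>a n\<bar> * (Gamma (\<alpha> + 1) * t powr (- \<alpha>)) + \<bar>b n\<bar> * C t"
proof -
  let ?v = "\<lambda>s. \<bar>w s\<bar>"
  note v = causal_loc_abs[OF w]
  have tr: "\<bar>truncate_at t ?v s\<bar> = \<bar>truncate_at t w s\<bar>" for s by (simp add: truncate_at_def)
  show "cnv_exists (gk (1 - \<alpha>)) (dU_abs n) t"
    unfolding dU_abs_def by (rule cnv_gk_mode_deriv(1)[OF \<alpha> ev_nonneg v refl])
  have "cnv (gk (1 - \<alpha>)) (dU_abs n) t = \<bar>a n\<bar> * (ev n * ml0 \<alpha> (ev n) t) + \<bar>b n\<bar> * mode_source \<alpha> (ev n) \<bar>f0\<bar> ?v t"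
    unfolding dU_abs_def by (subst cnv_gk_mode_deriv(2)[OF \<alpha> ev_nonneg v refl]) simp
  also have "\<dots> \<le> \<bar>a n\<bar> * (Gamma (\<alpha> + 1) * t powr (- \<alpha>)) + \<bar>b n\<bar> * C t"
  proof (intro add_mono mult_left_mono)
    show "ev n * ml0 \<alpha> (ev n) t \<le> Gamma (\<alpha> + 1) * t powr (- \<alpha>)" by (rule ml0_decay[OF \<alpha> ev_nonneg t])
    show "mode_source \<alpha> (ev n) \<bar>f0\<bar> ?v t \<le> C t"
      using source_bound[OF v, of n "\<bar>f0\<bar>" t] by (simp add: C_def tr)
  qed auto
  finally show "cnv (gk (1 - \<alpha>)) (dU_abs n) t \<le> \<bar>a n\<bar> * (Gamma (\<alpha> + 1) * t powr (- \<alpha>)) + \<bar>b n\<bar> * C t" .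
qed

lemma summable_a: "summable (\<lambda>n. ev n * (a n)\<^sup>2)" and summable_b: "summable (\<lambda>n. ev n * (b n)\<^sup>2)"
  using summable_coeff[OF \<phi>_adm] summable_coeff[OF h_adm] .

lemma summable_abs_X:
  assumes x: "x \<in> {0..l}"
  shows "summable (\<lambda>n. (\<bar>a n\<bar> * c1 + \<bar>b n\<bar> * c2) * \<bar>X n x\<bar>)"
proof -
  have "summable (\<lambda>n. \<bar>a n * 1 * X n x\<bar>)" "summable (\<lambda>n. \<bar>b n * 1 * X n x\<bar>)"
    using summable_eigen[OF summable_a, of "UNIV :: unit set" "\<lambda>_ _. 1" 1 "()" x]
      summable_eigen[OF summable_b, of "UNIV :: unit set" "\<lambda>_ _. 1" 1 "()" x] x by auto
  then have "summable (\<lambda>n. c1 * \<bar>a n * 1 * X n x\<bar> + c2 * \<bar>b n * 1 * X n x\<bar>)"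
    by (intro summable_add summable_mult)
  then show ?thesis by (simp add: abs_mult algebra_simps)
qed

text \<open>The density of \<open>u\<close> in time at fixed x in \<open>[0, l]\<close>. Its series
  converges in L^1 on bounded time intervals, hence almost everywhere, but not necessarily at every
  s.\<close>

definition D :: "real \<Rightarrow> real \<Rightarrow> real" where "D x s = (\<Sum>n. dU n s * X n x)"

text \<open>Both interchanges of sum and convolution use the majorant \<open>dU_abs\<close>. Against
  \<open>gk (1 - \<alpha>)\<close> the initial datum enters through \<open>ml0_decay\<close>, with
  the factor t powr (- \<alpha>).\<close>

lemma
  assumes x: "x \<in> {0..l}"
  shows causal_loc_D: "causal_loc (D x)"
    and cnv_one_D: "\<And>t. 0 < t \<Longrightarrow> (\<lambda>n. cnv unit_step (dU n) t * X n x) sums cnv unit_step (D x) t"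
    and cnv_gk_D_exists: "\<And>t. 0 < t \<Longrightarrow> cnv_exists (gk (1 - \<alpha>)) (D x) t"
    and cnv_gk_D: "\<And>t. 0 < t \<Longrightarrow> (\<lambda>n. cnv (gk (1 - \<alpha>)) (dU n) t * X n x) sums cnv (gk (1 - \<alpha>)) (D x) t"
proof -
  have [measurable]: "dU n \<in> borel_measurable borel" for n by (rule causal_loc_measurable[OF causal_loc_dU])
  have trD: "truncate_at t (D x) s = (\<Sum>n. truncate_at t (dU n) s * X n x)" for s t
    by (simp add: truncate_at_def D_def)
  have i: "integrable lborel (\<lambda>s. truncate_at t (dU n) s * X n x)" for t n
    using causal_loc_integrable[OF causal_loc_dU] by simp
  have s: "summable (\<lambda>n. LINT s|lborel. \<bar>truncate_at t (dU n) s * X n x\<bar>)" if t: "0 < t" for t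
  proof (rule summable_comparison_test'[OF summable_abs_X[OF x, of 1 "2 * C t / ev 0"]])
    fix n
    have "(LINT s|lborel. \<bar>truncate_at t (dU n) s\<bar>) \<le> (LINT s|lborel. truncate_at t (dU_abs n) s)"
    proof (rule integral_mono)
      show "\<bar>truncate_at t (dU n) s\<bar> \<le> truncate_at t (dU_abs n) s" for s
        using dU_le_abs[of n s] by (simp add: truncate_at_def)
    qed (intro integrable_abs causal_loc_integrable causal_loc_dU causal_loc_dU_abs)+
    also have "\<dots> \<le> \<bar>a n\<bar> * 1 + \<bar>b n\<bar> * (2 * C t / ev 0)"
      using cnv_one_dU_abs[OF t, of n] by (simp add: cnv_one(1)[OF causal_loc_dU_abs])
    finally have "(LINT s|lborel. \<bar>truncate_at t (dU n) s\<bar>) * \<bar>X n x\<bar> \<le> (\<bar>a n\<bar> * 1 + \<bar>b n\<bar> * (2 * C t / ev 0)) * \<bar>X n x\<bar>"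
      by (rule mult_right_mono) simp
    moreover have "0 \<le> (LINT s|lborel. \<bar>truncate_at t (dU n) s\<bar>) * \<bar>X n x\<bar>"
      by (intro mult_nonneg_nonneg integral_nonneg_AE) auto
    ultimately show "norm (LINT s|lborel. \<bar>truncate_at t (dU n) s * X n x\<bar>) \<le> (\<bar>a n\<bar> * 1 + \<bar>b n\<bar> * (2 * C t / ev 0)) * \<bar>X n x\<bar>"
      by (simp add: abs_mult)
  qed
  show D: "causal_loc (D x)"
  proof (rule causal_locI)
    show "D x \<in> borel_measurable borel" unfolding D_def[abs_def] by measurable
    show "D x t = 0" if "t \<le> 0" for t using causal_loc_nonpos[OF causal_loc_dU that] by (simp add: D_def)
    show "integrable lborel (truncate_at t (D x))" if "0 < t" for t
      using integrable_series(2)[of lborel, OF i s[OF that]] by (simp add: trD[abs_def])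
  qed
  show "(\<lambda>n. cnv unit_step (dU n) t * X n x) sums cnv unit_step (D x) t" if "0 < t" for t
    using integrable_series(3)[of lborel, OF i s[OF that]]
    by (simp add: trD[symmetric] cnv_one(1)[OF causal_loc_dU] cnv_one(1)[OF D])
  fix t :: real assume t: "0 < t"
  let ?g = "gk (1 - \<alpha>)"
  have g0: "0 \<le> ?g s" for s using \<alpha> by (intro gk_nonneg) simp
  have ex: "cnv_exists ?g (dU n) t" for n
    unfolding dU_def by (rule cnv_gk_mode_deriv(1)[OF \<alpha> ev_nonneg w src_eq])
  have i2: "integrable lborel (\<lambda>s. ?g (t - s) * (dU n s * X n x))" for n
    using ex[of n] unfolding cnv_exists_def by (simp add: mult.assoc[symmetric])
  have s2: "summable (\<lambda>n. LINT s|lborel. \<bar>?g (t - s) * (dU n s * X n x)\<bar>)"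
  proof (rule summable_comparison_test'[OF summable_abs_X[OF x, of "Gamma (\<alpha> + 1) * t powr (- \<alpha>)" "C t"]])
    fix n
    have "(LINT s|lborel. \<bar>?g (t - s) * dU n s\<bar>) \<le> cnv ?g (dU_abs n) t"
      unfolding cnv_def
    proof (rule integral_mono)
      show "integrable lborel (\<lambda>s. \<bar>?g (t - s) * dU n s\<bar>)" using ex[of n] by (simp add: cnv_exists_def)
      show "integrable lborel (\<lambda>s. ?g (t - s) * dU_abs n s)" using cnv_gk_dU_abs(1)[OF t, of n] by (simp add: cnv_exists_def)
      show "\<bar>?g (t - s) * dU n s\<bar> \<le> ?g (t - s) * dU_abs n s" for s
        using mult_left_mono[OF dU_le_abs[of n s] g0[of "t - s"]] g0[of "t - s"] by (simp add: abs_mult)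
    qed
    also have "\<dots> \<le> \<bar>a n\<bar> * (Gamma (\<alpha> + 1) * t powr (- \<alpha>)) + \<bar>b n\<bar> * C t" by (rule cnv_gk_dU_abs(2)[OF t])
    finally have "(LINT s|lborel. \<bar>?g (t - s) * dU n s\<bar>) * \<bar>X n x\<bar>
      \<le> (\<bar>a n\<bar> * (Gamma (\<alpha> + 1) * t powr (- \<alpha>)) + \<bar>b n\<bar> * C t) * \<bar>X n x\<bar>"
      by (rule mult_right_mono) simp
    moreover have "0 \<le> (LINT s|lborel. \<bar>?g (t - s) * dU n s\<bar>) * \<bar>X n x\<bar>"
      by (intro mult_nonneg_nonneg integral_nonneg_AE) auto
    moreover have "(LINT s|lborel. \<bar>?g (t - s) * (dU n s * X n x)\<bar>) = (LINT s|lborel. \<bar>?g (t - s) * dU n s\<bar>) * \<bar>X n x\<bar>"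
      by (simp only: mult.assoc[symmetric] abs_mult integral_mult_left_zero)
    ultimately show "norm (LINT s|lborel. \<bar>?g (t - s) * (dU n s * X n x)\<bar>)
      \<le> (\<bar>a n\<bar> * (Gamma (\<alpha> + 1) * t powr (- \<alpha>)) + \<bar>b n\<bar> * C t) * \<bar>X n x\<bar>"
      by simp
  qed
  note ser = integrable_series[of lborel, OF i2 s2]
  have ae: "AE s in lborel. (\<Sum>n. ?g (t - s) * (dU n s * X n x)) = ?g (t - s) * D x s"
    using ser(1)
  proof eventually_elim
    case (elim s)
    show ?case
    \<comment> \<open>For s >= t the kernel vanishes and the summability gives no information on the
      series of D; both sides are 0 there.\<close>
    proof (cases "?g (t - s) = 0")
      case False
      have "summable (\<lambda>n. ?g (t - s) * (dU n s * X n x))" by (rule summable_rabs_cancel[OF elim])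
      then have "summable (\<lambda>n. dU n s * X n x)" using False by (simp add: summable_cmult_iff)
      then show ?thesis unfolding D_def by (rule suminf_mult)
    qed simp
  qed
  have [measurable]: "D x \<in> borel_measurable borel" by (rule causal_loc_measurable[OF D])
  have m: "(\<lambda>s. \<Sum>n. ?g (t - s) * (dU n s * X n x)) \<in> borel_measurable lborel" by measurable
  show exD: "cnv_exists ?g (D x) t"
    unfolding cnv_exists_def using ser(2) integrable_cong_AE[OF m _ ae] by simp
  have "(LINT s|lborel. (\<Sum>n. ?g (t - s) * (dU n s * X n x))) = cnv ?g (D x) t"
    unfolding cnv_def by (rule integral_cong_AE[OF m _ ae]) simp
  moreover have "(LINT s|lborel. ?g (t - s) * (dU n s * X n x)) = cnv ?g (dU n) t * X n x" for n
    unfolding cnv_def by (simp only: mult.assoc[symmetric] integral_mult_left_zero)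
  ultimately show "(\<lambda>n. cnv ?g (dU n) t * X n x) sums cnv ?g (D x) t" using ser(3) by simp
qed

section \<open>The solution in space and time\<close>

definition u :: "real \<Rightarrow> real \<Rightarrow> real" where "u t x = (\<Sum>n. U n t * X n x)"
definition V :: "real \<Rightarrow> real \<Rightarrow> real" where "V t x = (\<Sum>n. ev n * U n t * X n x)"
definition P :: "real \<Rightarrow> real \<Rightarrow> real" where "P t x = (\<Sum>n. U n t * flux n x)"

lemma U_cont: "continuous_on {0..T} (U n)"
proof -
  have "continuous_on {0..T} (cnv (dU n) unit_step)"
  proof (rule continuous_on_cnv[OF causal_loc_dU, where B = 1])
    show "continuous_on {0<..T} unit_step" by (rule continuous_on_eq[of _ "\<lambda>_. 1"]) (auto simp: unit_step_def)
  qed (use causal_loc_measurable[OF causal_loc_one] in \<open>auto simp: unit_step_def\<close>)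
  then have "continuous_on {0..T} (\<lambda>t. a n + cnv (dU n) unit_step t)" by (intro continuous_intros)
  then show ?thesis unfolding U_def[abs_def] by (simp only: cnv_commute[of unit_step])
qed

lemma utail_U: "utail ({0..T} \<times> {0..l}) (\<lambda>n z. U n (fst z) * X n (snd z))"
proof -
  \<comment> \<open>At t = 0 the factor of \<open>a n\<close> has to be 1, whereas the causal
    \<open>ml0\<close> is 0 there.\<close>
  let ?B1 = "\<lambda>n t. if 0 < t then ml0 \<alpha> (ev n) t else 1"
  let ?B2 = "\<lambda>n t. if 0 < t then cnv (ml \<alpha> (ev n)) src t else 0"
  have e: "U n t = a n * ?B1 n t + b n * ?B2 n t" for n t
    using U_eq[of t n] U_nonpos[of t n] by simp
  have "utail ({0..T} \<times> {0..l}) (\<lambda>n z. a n * ?B1 n (fst z) * X n (snd z) + b n * ?B2 n (fst z) * X n (snd z))"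
  proof (intro utail_add)
    show "utail ({0..T} \<times> {0..l}) (\<lambda>n z. a n * ?B1 n (fst z) * X n (snd z))"
    proof (rule utail_eigen[OF summable_a])
      show "\<bar>?B1 n t\<bar> \<le> 1" for n t
        using ml0_nonneg[OF \<alpha> ev_nonneg, of n t] ml0_le_1[OF \<alpha> ev_nonneg, of n t] by simp
    qed
    show "utail ({0..T} \<times> {0..l}) (\<lambda>n z. b n * ?B2 n (fst z) * X n (snd z))"
    proof (rule utail_eigen[OF summable_b])
      show "\<bar>?B2 n t\<bar> \<le> 2 * C T / ev 0" if "t \<in> {0..T}" for n t
      proof -
        have "2 * C t / ev 0 \<le> 2 * C T / ev 0"
          using C_mono[of t T] that ev_pos[of 0] by (intro divide_right_mono) auto
        moreover have "0 \<le> 2 * C T / ev 0" using C_nonneg[of T] ev_pos[of 0] by simp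
        ultimately show ?thesis using cnv_src_bound[of n t] by simp
      qed
    qed
  qed
  then show ?thesis unfolding e by (simp only: distrib_right)
qed

text \<open>The initial datum lies only in the energy space, so \<open>ev n * a n\<close> is not
  controlled. The factor \<open>ev n\<close> is left to \<open>ml0\<close>, whose decay bounds it by
  t1 powr (- \<alpha>); for the source it is absorbed by \<open>ev_cnv_src_bound\<close>.\<close>

lemma utail_V:
  assumes t1: "0 < t1"
  shows "utail ({t1..T} \<times> {0..l}) (\<lambda>n z. ev n * U n (fst z) * X n (snd z))"
proof -
  let ?B1 = "\<lambda>n t. if 0 < t then ev n * ml0 \<alpha> (ev n) t else 0"
  let ?B2 = "\<lambda>n t. if 0 < t then ev n * cnv (ml \<alpha> (ev n)) src t else 0"
  have e: "ev n * U n t * X n x = a n * ?B1 n t * X n x + b n * ?B2 n t * X n x" if "0 < t" for n t x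
    using U_eq[OF that, of n] that by (simp add: algebra_simps)
  have "utail ({t1..T} \<times> {0..l}) (\<lambda>n z. a n * ?B1 n (fst z) * X n (snd z) + b n * ?B2 n (fst z) * X n (snd z))"
  proof (intro utail_add)
    show "utail ({t1..T} \<times> {0..l}) (\<lambda>n z. a n * ?B1 n (fst z) * X n (snd z))"
    proof (rule utail_eigen[OF summable_a])
      show "\<bar>?B1 n t\<bar> \<le> Gamma (\<alpha> + 1) * t1 powr (- \<alpha>)" if t: "t \<in> {t1..T}" for n t
      proof -
        have "0 < t" using t t1 by simp
        have "0 \<le> ev n * ml0 \<alpha> (ev n) t" using ml0_nonneg[OF \<alpha> ev_nonneg, of n t] ev_nonneg by simp
        moreover have "ev n * ml0 \<alpha> (ev n) t \<le> Gamma (\<alpha> + 1) * t powr (- \<alpha>)"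
          by (rule ml0_decay[OF \<alpha> ev_nonneg \<open>0 < t\<close>])
        moreover have "t powr (- \<alpha>) \<le> t1 powr (- \<alpha>)" using t t1 \<alpha> by (intro powr_mono2') auto
        moreover have "0 \<le> Gamma (\<alpha> + 1)" using \<alpha> Gamma_real_pos[of "\<alpha> + 1"] by simp
        ultimately show ?thesis using \<open>0 < t\<close> mult_left_mono[of "t powr (- \<alpha>)" "t1 powr (- \<alpha>)" "Gamma (\<alpha> + 1)"] by simp
      qed
    qed
    show "utail ({t1..T} \<times> {0..l}) (\<lambda>n z. b n * ?B2 n (fst z) * X n (snd z))"
    proof (rule utail_eigen[OF summable_b])
      show "\<bar>?B2 n t\<bar> \<le> 2 * C T" if "t \<in> {t1..T}" for n t
        using ev_cnv_src_bound[of n t] C_mono[of t T] that t1 by simp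
    qed
  qed
  then show ?thesis by (rule utail_cong) (use e t1 in auto)
qed

lemma utail_P:
  assumes t1: "0 < t1"
  shows "utail ({t1..T} \<times> {0..l}) (\<lambda>n z. U n (fst z) * flux n (snd z))"
proof (rule utail_flux[OF _ utail_V[OF t1]])
  show "utail ({t1..T} \<times> {0..l}) (\<lambda>n z. U n (fst z) * X n (snd z))"
    by (rule utail_subset[OF utail_U]) (use t1 in auto)
qed

lemma joint_cont:
  assumes "continuous_on A g" "continuous_on B k"
  shows "continuous_on (A \<times> B) (\<lambda>z. (g (fst z) :: real) * k (snd z))"
  by (intro continuous_on_mult continuous_on_compose2[OF assms(1)] continuous_on_compose2[OF assms(2)] continuous_on_fst continuous_on_snd continuous_on_id) auto

lemma u_cont: "continuous_on ({0..T} \<times> {0..l}) (\<lambda>z. u (fst z) (snd z))"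
  unfolding u_def by (rule utail_continuous[OF utail_U]) (rule joint_cont[OF U_cont X_cont])

lemma UV_cont: "0 < t1 \<Longrightarrow> continuous_on ({t1..T} \<times> {0..l}) (\<lambda>z. V (fst z) (snd z))"
  unfolding V_def
  by (rule utail_continuous[OF utail_V], assumption)
     (intro joint_cont[of _ "\<lambda>t. ev _ * U _ t"] X_cont continuous_on_mult_left continuous_on_subset[OF U_cont], auto)

lemma P_cont: "0 < t1 \<Longrightarrow> continuous_on ({t1..T} \<times> {0..l}) (\<lambda>z. P (fst z) (snd z))"
  unfolding P_def
  by (rule utail_continuous[OF utail_P], assumption)
     (intro joint_cont flux_cont continuous_on_subset[OF U_cont], auto)

lemma u_deriv:
  assumes t: "0 < t" "t \<le> T" and x: "x \<in> {0<..<l}"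
  shows "(u t has_real_derivative P t x / p x) (at x)"
    "(P t has_real_derivative q x * u t x - V t x) (at x)"
proof -
  have ti: "t \<in> {t..T}" "t \<in> {0..T}" using t by auto
  note S = utail_slice[OF utail_U ti(2)] and VV = utail_slice[OF utail_V[OF t(1)] ti(1)] and PP = utail_slice[OF utail_P[OF t(1)] ti(1)]
  show "(u t has_real_derivative P t x / p x) (at x)"
    "(P t has_real_derivative q x * u t x - V t x) (at x)"
    unfolding u_def[abs_def] V_def[abs_def] P_def[abs_def] by (rule eigen_series_deriv[OF S VV PP x])+
qed

lemma u_time:
  assumes x: "x \<in> {0..l}" and t: "0 < t" "t \<le> T"
  shows "u t x = \<phi> x + cnv unit_step (D x) t" "cnv (gk (1 - \<alpha>)) (D x) t = src t * h x - V t x"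
proof -
  have "(\<lambda>n. a n * X n x + cnv unit_step (dU n) t * X n x) sums (\<phi> x + cnv unit_step (D x) t)"
    by (rule sums_add[OF eigen_expansion[OF \<phi>_adm x] cnv_one_D[OF x t(1)]])
  then show "u t x = \<phi> x + cnv unit_step (D x) t" by (simp add: u_def U_def sums_iff distrib_right)
  have e: "cnv (gk (1 - \<alpha>)) (dU n) t = b n * src t - ev n * U n t" for n
    using cnv_gk_mode_deriv(3)[OF \<alpha> ev_nonneg w src_eq, of n "a n" "b n" t]
      mode_eq_integral[OF \<alpha> ev_nonneg w src_eq t(1), of n "a n" "b n"]
    by (simp add: dU_def U_def)
  have "(\<lambda>n. ev n * U n t * X n x) sums V t x"
    unfolding V_def
    using utail_uniform_limit(2)[OF utail_V[OF t(1)], of "(t, x)"] t x by (intro summable_sums) auto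
  then have "(\<lambda>n. src t * (b n * X n x) - ev n * U n t * X n x) sums (src t * h x - V t x)"
    by (intro sums_diff sums_mult eigen_expansion[OF h_adm x])
  then have "(\<lambda>n. cnv (gk (1 - \<alpha>)) (dU n) t * X n x) sums (src t * h x - V t x)"
    by (simp add: e algebra_simps)
  then show "cnv (gk (1 - \<alpha>)) (D x) t = src t * h x - V t x"
    using cnv_gk_D[OF x t(1)] sums_unique2 by blast
qed

lemma caputo_u:
  assumes x: "x \<in> {0<..<l}" and t: "0 < t" "t \<le> T"
  shows "caputo_exists \<alpha> (\<lambda>s. u s x) t" "caputo \<alpha> (\<lambda>s. u s x) t = src t * h x - V t x"
proof -
  have xi: "x \<in> {0..l}" using x by simp
  have rep: "u s x = \<phi> x + cnv unit_step (D x) s" if "s \<in> {0<..t}" for s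
    using u_time(1)[OF xi, of s] that t by simp
  note c = caputo_cnv[OF \<alpha> causal_loc_D[OF xi] t(1) rep cnv_gk_D_exists[OF xi t(1)]]
  show "caputo_exists \<alpha> (\<lambda>s. u s x) t" by (rule c(1))
  show "caputo \<alpha> (\<lambda>s. u s x) t = src t * h x - V t x" using c(2) u_time(2)[OF xi t] by simp
qed

lemma u_deriv2:
  assumes t: "0 < t" "t \<le> T" and x: "x \<in> {0<..<l}"
  shows "u t field_differentiable at x" "deriv (u t) field_differentiable at x"
    "deriv (\<lambda>y. p y * deriv (u t) y) x = q x * u t x - V t x"
    "deriv (deriv (u t)) x = ((q x * u t x - V t x) * p x - P t x * p' x) / (p x * p x)"
proof -
  have d: "deriv (u t) y = P t y / p y" if "y \<in> {0<..<l}" for y by (rule DERIV_imp_deriv[OF u_deriv(1)[OF t that]])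
  show "u t field_differentiable at x" using u_deriv(1)[OF t x] by (auto simp: field_differentiable_def)
  have px: "p x \<noteq> 0" using p_nz[of x] x by simp
  have "((\<lambda>y. P t y / p y) has_real_derivative ((q x * u t x - V t x) * p x - P t x * p' x) / (p x * p x)) (at x)"
    by (rule DERIV_divide[OF u_deriv(2)[OF t x] p_deriv_at[OF x] px])
  then have dd: "(deriv (u t) has_real_derivative ((q x * u t x - V t x) * p x - P t x * p' x) / (p x * p x)) (at x)"
    by (rule has_field_derivative_transform_within_open[of _ _ _ "{0<..<l}"]) (use x d in auto)
  then show "deriv (u t) field_differentiable at x"
    "deriv (deriv (u t)) x = ((q x * u t x - V t x) * p x - P t x * p' x) / (p x * p x)"
    by (auto simp: field_differentiable_def intro: DERIV_imp_deriv)
  have "((\<lambda>y. p y * deriv (u t) y) has_real_derivative q x * u t x - V t x) (at x)"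
  proof (rule has_field_derivative_transform_within_open[OF u_deriv(2)[OF t x], of "{0<..<l}"])
    show "P t y = p y * deriv (u t) y" if "y \<in> {0<..<l}" for y using d[OF that] p_nz[of y] that by simp
  qed (use x in auto)
  then show "deriv (\<lambda>y. p y * deriv (u t) y) x = q x * u t x - V t x" by (rule DERIV_imp_deriv)
qed

lemma snd_cont: "continuous_on {0..l} g \<Longrightarrow> continuous_on (A \<times> {0..l}) (\<lambda>z. g (snd z) :: real)"
  by (rule continuous_on_compose2[of "{0..l}" g]) (auto intro!: continuous_intros)

lemma src_cont: "continuous_on {0<..T} src"
proof -
  have "continuous_on {0..T} (cnv w unit_step)"
  proof (rule continuous_on_cnv[OF w, where B = 1])
    show "continuous_on {0<..T} unit_step" by (rule continuous_on_eq[of _ "\<lambda>_. 1"]) (auto simp: unit_step_def)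
  qed (use causal_loc_measurable[OF causal_loc_one] in \<open>auto simp: unit_step_def\<close>)
  then have "continuous_on {0<..T} (\<lambda>t. f0 + cnv w unit_step t)"
    by (intro continuous_intros) (auto elim: continuous_on_subset)
  then show ?thesis by (rule continuous_on_eq) (auto simp: src_def unit_step_def cnv_commute[of w])
qed

lemma u_ibvp:
  assumes f: "\<And>t. t \<in> {0<..T} \<Longrightarrow> f t = src t"
  shows "ibvp_solution \<alpha> T l p q \<phi> h f u"
proof -
  have hc: "continuous_on {0..l} h" using h_adm by (simp add: admissible_def)
  have sub: "{t1..T} \<times> {0<..<l} \<subseteq> {t1..T} \<times> {0..l}" for t1 by auto
  have uc: "continuous_on ({t1..T} \<times> {0..l}) (\<lambda>z. u (fst z) (snd z))" if "0 < t1" for t1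
    by (rule continuous_on_subset[OF u_cont]) (use that in auto)
  have "continuous_on (Omega T l) (\<lambda>z. u (fst z) (snd z))"
    by (rule continuous_on_Omega) (rule continuous_on_subset[OF uc sub])
  then have c1: "continuous_on (Omega T l) (\<lambda>(t, x). u t x)" by (simp add: case_prod_unfold)
  have "continuous_on (Omega T l) (\<lambda>z. src (fst z) * h (snd z) - V (fst z) (snd z))"
  proof (rule continuous_on_Omega, rule continuous_on_subset[OF _ sub])
    fix t1 :: real assume "0 < t1"
    then have "{t1..T} \<subseteq> {0<..T}" by auto
    then show "continuous_on ({t1..T} \<times> {0..l}) (\<lambda>z. src (fst z) * h (snd z) - V (fst z) (snd z))"
      by (intro continuous_on_diff joint_cont UV_cont hc continuous_on_subset[OF src_cont] \<open>0 < t1\<close>)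
  qed
  then have c2: "continuous_on (Omega T l) (\<lambda>(t, x). caputo \<alpha> (\<lambda>s. u s x) t)"
    by (rule continuous_on_eq) (auto simp: Omega_def caputo_u)
  have "continuous_on (Omega T l) (\<lambda>z. ((q (snd z) * u (fst z) (snd z) - V (fst z) (snd z)) * p (snd z) - P (fst z) (snd z) * p' (snd z)) / (p (snd z) * p (snd z)))"
  proof (rule continuous_on_Omega, rule continuous_on_subset[OF _ sub])
    fix t1 :: real assume "0 < t1"
    then show "continuous_on ({t1..T} \<times> {0..l}) (\<lambda>z. ((q (snd z) * u (fst z) (snd z) - V (fst z) (snd z)) * p (snd z) - P (fst z) (snd z) * p' (snd z)) / (p (snd z) * p (snd z)))"
      by (intro continuous_on_divide continuous_on_diff continuous_on_mult uc UV_cont P_cont snd_cont q_cont p_cont p'_cont)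
         (use p_nz in auto)
  qed
  then have c3: "continuous_on (Omega T l) (\<lambda>(t, x). deriv (deriv (u t)) x)"
    by (rule continuous_on_eq) (auto simp: Omega_def u_deriv2)
  have C: "C_alpha_2 \<alpha> T l u"
    unfolding C_alpha_2_def using c1 c2 c3 caputo_u(1) u_deriv2(1,2) by (auto simp: Omega_def)
  have pde: "caputo \<alpha> (\<lambda>s. u s x) t - deriv (\<lambda>y. p y * deriv (u t) y) x + q x * u t x = f t * h x"
    if "0 < t" "t \<le> T" "0 < x" "x < l" for t x
    using caputo_u(2)[of x t] u_deriv2(3)[of t x] f[of t] that by simp
  have init: "u 0 x = \<phi> x" if "x \<in> {0..l}" for x
    using eigen_expansion[OF \<phi>_adm that] by (simp add: u_def U_nonpos sums_iff)
  have bdry: "u t 0 = 0" "u t l = 0" for t by (simp_all add: u_def X_0 X_l)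
  show ?thesis
    unfolding ibvp_solution_def
    using C u_cont pde init bdry by (auto simp: Omega_def Omega_closed_def case_prod_unfold)
qed

lemma u_overdetermination:
  assumes t: "t \<in> {0..T}"
  shows "(\<lambda>n. U n t * b n) sums (\<integral>x. h x * u t x \<partial>lebesgue_on {0..l})"
proof -
  have hc: "continuous_on {0..l} h" using h_adm by (simp add: admissible_def)
  have uc: "continuous_on {0..l} (u t)"
  proof -
    have "continuous_on {0..l} (\<lambda>x. (\<lambda>z. u (fst z) (snd z)) (t, x))"
      by (rule continuous_on_compose2[OF u_cont]) (use t in \<open>auto intro!: continuous_intros\<close>)
    then show ?thesis by simp
  qed
  have "(\<integral>x. h x * u t x \<partial>lebesgue_on {0..l}) = integral {0..l} (\<lambda>x. h x * u t x)"
    by (intro lebesgue_integral_continuous_Icc continuous_on_mult hc uc)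
  then show ?thesis
    using integral_eigen_series[OF utail_slice[OF utail_U t] hc] by (simp add: u_def)
qed

lemma ibvp_unique:
  assumes v: "ibvp_solution \<alpha> T l p q \<phi> h f v" and v': "ibvp_solution \<alpha> T l p q \<phi> h f v'"
    and tx: "(t, x) \<in> Omega_closed T l"
  shows "v t x = v' t x"
proof -
  have p1: "p field_differentiable at x" if "x \<in> {0<..<l}" for x
    using p_deriv_at[OF that] by (auto simp: field_differentiable_def)
  have pq: "0 < p x" "0 \<le> q x" if "x \<in> {0<..<l}" for x using p_pos[of x] q_nonneg[of x] that by auto
  show ?thesis
    using ibvp_comparison[OF \<alpha> T_pos l_pos p1 pq(1) pq(2) v v' tx]
      ibvp_comparison[OF \<alpha> T_pos l_pos p1 pq(1) pq(2) v' v tx] by auto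
qed

end

subsection \<open>The integral equation for the source\<close>

lemma continuous_AE_zero:
  fixes d :: "real \<Rightarrow> real"
  assumes "0 < T" and c: "continuous_on {0..T} d" and ae: "AE t in lborel. 0 < t \<and> t < T \<longrightarrow> d t = 0" and t: "t \<in> {0..T}"
  shows "d t = 0"
proof -
  have "AE t in lebesgue. 0 < t \<and> t < T \<longrightarrow> d t = 0" using ae unfolding AE_lborel_iff_lebesgue .
  then have "AE t in lebesgue. indicator {0..T} t *\<^sub>R (d t)\<^sup>2 = 0"
    using AE_lebesgue_neq[of 0] AE_lebesgue_neq[of T] by eventually_elim (auto simp: indicator_def)
  then have "(LINT t|lebesgue. indicator {0..T} t *\<^sub>R (d t)\<^sup>2) = 0" by (rule integral_eq_zero_AE)
  then have "(LINT t|lebesgue_on {0..T}. (d t)\<^sup>2) = 0" by (subst integral_restrict_space) auto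
  then have "integral {0..T} (\<lambda>t. (d t)\<^sup>2) = 0"
    using lebesgue_integral_continuous_Icc(2)[of 0 T "\<lambda>x. (d x)\<^sup>2"] c by (simp add: continuous_on_power)
  then have "\<forall>x\<in>{0..T}. (d x)\<^sup>2 = 0"
    using integral_eq_0_iff[of 0 T "\<lambda>x. (d x)\<^sup>2"] c \<open>0 < T\<close> by (simp add: continuous_on_power)
  then show ?thesis using t by simp
qed

lemma causal_loc_series:
  assumes f: "\<And>n. causal_loc (f n)" and s: "\<And>t. 0 < t \<Longrightarrow> summable (\<lambda>n. LINT s|lborel. \<bar>truncate_at t (f n) s\<bar>)"
  shows "causal_loc (\<lambda>s. \<Sum>n. f n s)" "0 < t \<Longrightarrow> (\<lambda>n. cnv unit_step (f n) t) sums cnv unit_step (\<lambda>s. \<Sum>n. f n s) t"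
proof -
  have [measurable]: "f n \<in> borel_measurable borel" for n by (rule causal_loc_measurable[OF f])
  have tr: "truncate_at t (\<lambda>s. \<Sum>n. f n s) s = (\<Sum>n. truncate_at t (f n) s)" for s t
    by (simp add: truncate_at_def)
  note ser = integrable_series[of lborel, OF causal_loc_integrable[OF f] s]
  show c: "causal_loc (\<lambda>s. \<Sum>n. f n s)"
  proof (rule causal_locI)
    show "(\<Sum>n. f n t) = 0" if "t \<le> 0" for t using causal_loc_nonpos[OF f that] by simp
    show "integrable lborel (truncate_at t (\<lambda>s. \<Sum>n. f n s))" if "0 < t" for t
      using ser(2)[OF that] by (simp add: tr[abs_def])
  qed simp
  show "(\<lambda>n. cnv unit_step (f n) t) sums cnv unit_step (\<lambda>s. \<Sum>n. f n s) t" if "0 < t"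
    using ser(3)[OF that] by (simp add: tr cnv_one(1)[OF f] cnv_one(1)[OF c])
qed

lemma cnv_one_commute:
  assumes "causal_loc b" "causal_loc c"
  shows "cnv b (cnv unit_step c) t = cnv unit_step (cnv b c) t"
proof -
  have e: "cnv b c = cnv c b" "cnv unit_step c = cnv c unit_step" by (auto intro: cnv_commute)
  have "cnv b (cnv unit_step c) t = cnv (cnv unit_step c) b t" by (rule cnv_commute)
  also have "\<dots> = cnv unit_step (cnv c b) t" by (rule cnv_one_assoc[symmetric]) (rule assms)+
  finally show ?thesis by (simp only: e)
qed

lemma causal_loc_cong_upto:
  assumes "causal_loc x" "causal_loc y" "\<And>s. 0 < s \<Longrightarrow> s \<le> T \<Longrightarrow> x s = y s" "t \<le> T" "causal_loc a"
  shows "cnv a x t = cnv a y t"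
  by (rule cnv_cong(1)) (use assms in \<open>auto simp: causal_loc_nonpos\<close>)

lemma cnv_AE_cong:
  assumes a: "causal_loc a" and x: "causal_loc x" and y: "causal_loc y"
    and ae: "AE s in lborel. s \<le> T \<longrightarrow> x s = y s" and t: "t \<le> T"
  shows "cnv a x t = cnv a y t"
  unfolding cnv_def
proof (rule integral_cong_AE)
  have [measurable]: "a \<in> borel_measurable borel" "x \<in> borel_measurable borel" "y \<in> borel_measurable borel"
    using a x y by (auto simp: causal_loc_def)
  show "(\<lambda>s. a (t - s) * x s) \<in> borel_measurable lborel" "(\<lambda>s. a (t - s) * y s) \<in> borel_measurable lborel" by measurable
  show "AE s in lborel. a (t - s) * x s = a (t - s) * y s"
    using ae
  proof eventually_elim
    case (elim s)
    then show ?case using causal_loc_nonpos[OF a, of "t - s"] t by (cases "s \<le> T") auto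
  qed
qed

text \<open>Here \<open>g1\<close> stands for g' and \<open>w2\<close> for the density of g'', so
  \<open>g_rep\<close> is the AC^2 representation of g in convolution form.\<close>

locale inverse_data = sturm_liouville +
  fixes \<alpha> T :: real and \<phi> d\<phi> h dh g g1 :: "real \<Rightarrow> real" and w2 :: "real \<Rightarrow> real"
  assumes \<alpha>: "0 < \<alpha>" "\<alpha> < 1" and T_pos: "0 < T"
    and \<phi>_adm: "admissible \<phi> d\<phi>" and h_adm: "admissible h dh"
    and h_nz: "\<exists>x\<in>{0..l}. h x \<noteq> 0" and w2: "causal_loc w2"
    and g_rep: "\<And>t. t \<in> {0..T} \<Longrightarrow> g t = g 0 + cnv unit_step (\<lambda>s. g1 0 * unit_step s + cnv unit_step w2 s) t"
    and compat: "(\<lambda>n. coeff \<phi> n * coeff h n) sums g 0"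
begin

abbreviation a where "a \<equiv> coeff \<phi>"
abbreviation b where "b \<equiv> coeff h"

lemma ev_nonneg: "0 \<le> ev n" using ev_pos[of n] by simp

lemma ibvp_data: "causal_loc w \<Longrightarrow> ibvp_data l p p' q ev X \<alpha> T \<phi> d\<phi> h dh w"
  by unfold_locales (auto simp: \<alpha> T_pos \<phi>_adm h_adm)

lemma summable_ev_bb: "summable (\<lambda>n. \<bar>ev n * (b n)\<^sup>2\<bar>)"
  using summable_coeff[OF h_adm] ev_nonneg by (simp add: abs_mult)

lemma summable_ev_ab: "summable (\<lambda>n. \<bar>ev n * (a n * b n)\<bar>)"
proof (rule summable_comparison_test')
  show "summable (\<lambda>n. ev n * (a n)\<^sup>2 + ev n * (b n)\<^sup>2)"
    by (intro summable_add summable_coeff[OF \<phi>_adm] summable_coeff[OF h_adm])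
  fix n
  have "0 \<le> (\<bar>a n\<bar> - \<bar>b n\<bar>)\<^sup>2" by simp
  then have "2 * (\<bar>a n\<bar> * \<bar>b n\<bar>) \<le> (a n)\<^sup>2 + (b n)\<^sup>2" by (simp add: power2_diff)
  moreover have "0 \<le> \<bar>a n\<bar> * \<bar>b n\<bar>" by simp
  ultimately have "\<bar>a n\<bar> * \<bar>b n\<bar> \<le> (a n)\<^sup>2 + (b n)\<^sup>2" by linarith
  then have "ev n * (\<bar>a n\<bar> * \<bar>b n\<bar>) \<le> ev n * ((a n)\<^sup>2 + (b n)\<^sup>2)" by (rule mult_left_mono) (rule ev_nonneg)
  then show "norm \<bar>ev n * (a n * b n)\<bar> \<le> ev n * (a n)\<^sup>2 + ev n * (b n)\<^sup>2"
    using ev_nonneg[of n] by (simp add: abs_mult distrib_left)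
qed

lemma summable_drop_ev:
  assumes "summable (\<lambda>n. \<bar>ev n * c n\<bar>)" shows "summable (\<lambda>n. \<bar>c n\<bar>)"
proof (rule summable_comparison_test')
  show "summable (\<lambda>n. 1 / ev 0 * \<bar>ev n * c n\<bar>)" by (rule summable_mult[OF assms])
  fix n
  have "ev 0 * \<bar>c n\<bar> \<le> ev n * \<bar>c n\<bar>" using ev_ge[of n] by (rule mult_right_mono) simp
  then show "norm \<bar>c n\<bar> \<le> 1 / ev 0 * \<bar>ev n * c n\<bar>"
    using ev_pos[of 0] ev_nonneg[of n] by (simp add: abs_mult field_simps)
qed

lemmas summable_bb = summable_drop_ev[OF summable_ev_bb] and summable_ab = summable_drop_ev[OF summable_ev_ab]

definition kern :: "(nat \<Rightarrow> real) \<Rightarrow> real \<Rightarrow> real" where "kern c t = (\<Sum>n. c n * ml \<alpha> (ev n) t)"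

lemma ml_bounds: "0 \<le> ml \<alpha> (ev n) t" "ml \<alpha> (ev n) t \<le> gk \<alpha> t" "\<bar>ml \<alpha> (ev n) t\<bar> \<le> gk \<alpha> t"
  using ml_nonneg[OF \<alpha> ev_nonneg, of n t] ml_le_gk[OF \<alpha> ev_nonneg, of n t] by auto

lemma borel_measurable_ml' [measurable]: "ml \<alpha> (ev n) \<in> borel_measurable borel"
  by (rule borel_measurable_ml[OF \<alpha> ev_nonneg])

lemma summable_kern:
  assumes "summable (\<lambda>n. \<bar>c n\<bar>)" shows "summable (\<lambda>n. c n * ml \<alpha> (ev n) t)"
proof (rule summable_comparison_test'[OF summable_mult2[OF assms, of "gk \<alpha> t"]])
  show "norm (c n * ml \<alpha> (ev n) t) \<le> \<bar>c n\<bar> * gk \<alpha> t" for n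
    using ml_bounds(3)[of n t] by (simp add: abs_mult mult_left_mono)
qed

text \<open>Every kernel of this kind is dominated by a multiple of \<open>gk \<alpha>\<close>, so
  existence of the convolution with \<open>gk \<alpha>\<close> serves all modes and all coefficient
  sequences.\<close>

lemma
  assumes c: "summable (\<lambda>n. \<bar>c n\<bar>)"
  shows causal_loc_kern: "causal_loc (kern c)"
    and cnv_kern: "\<And>x t. x \<in> borel_measurable borel \<Longrightarrow> cnv_exists (gk \<alpha>) x t \<Longrightarrow>
      (\<lambda>n. c n * cnv (ml \<alpha> (ev n)) x t) sums cnv (kern c) x t"
    and cnv_exists_kern: "\<And>x t. x \<in> borel_measurable borel \<Longrightarrow> cnv_exists (gk \<alpha>) x t \<Longrightarrow> cnv_exists (kern c) x t"
proof -
  have [measurable]: "kern c \<in> borel_measurable borel" unfolding kern_def[abs_def] by measurable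
  have bd: "\<bar>kern c t\<bar> \<le> \<bar>(\<Sum>n. \<bar>c n\<bar>) * gk \<alpha> t\<bar>" for t
  proof -
    have s: "summable (\<lambda>n. \<bar>c n\<bar> * gk \<alpha> t)" by (rule summable_mult2[OF c])
    have le: "\<bar>c n * ml \<alpha> (ev n) t\<bar> \<le> \<bar>c n\<bar> * gk \<alpha> t" for n
      using ml_bounds(3)[of n t] by (simp add: abs_mult mult_left_mono)
    have sa: "summable (\<lambda>n. \<bar>c n * ml \<alpha> (ev n) t\<bar>)"
      by (rule summable_comparison_test'[OF s]) (use le in simp)
    have "\<bar>kern c t\<bar> \<le> (\<Sum>n. \<bar>c n * ml \<alpha> (ev n) t\<bar>)" unfolding kern_def by (rule summable_rabs[OF sa])
    also have "\<dots> \<le> (\<Sum>n. \<bar>c n\<bar> * gk \<alpha> t)" by (rule suminf_le[OF le sa s])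
    also have "\<dots> = (\<Sum>n. \<bar>c n\<bar>) * gk \<alpha> t" by (rule suminf_mult2[OF c, symmetric])
    finally show ?thesis by simp
  qed
  show "causal_loc (kern c)"
  proof (rule causal_loc_bound[OF causal_loc_cmult[OF causal_loc_gk[OF \<alpha>(1)], of "\<Sum>n. \<bar>c n\<bar>"]])
    show "kern c t = 0" if "t \<le> 0" for t using ml_nonpos[OF \<alpha> ev_nonneg that] by (simp add: kern_def)
  qed (use bd in auto)
  fix x t assume [measurable]: "x \<in> borel_measurable borel" and ex: "cnv_exists (gk \<alpha>) x t"
  have ig: "integrable lborel (\<lambda>s. \<bar>gk \<alpha> (t - s) * x s\<bar>)" using ex by (simp add: cnv_exists_def)
  have le: "\<bar>c n * (ml \<alpha> (ev n) (t - s) * x s)\<bar> \<le> \<bar>c n\<bar> * \<bar>gk \<alpha> (t - s) * x s\<bar>" for n s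
  proof -
    have "\<bar>ml \<alpha> (ev n) (t - s)\<bar> * \<bar>x s\<bar> \<le> \<bar>gk \<alpha> (t - s)\<bar> * \<bar>x s\<bar>"
      using ml_bounds(3)[of n "t - s"] by (intro mult_right_mono) auto
    then show ?thesis by (simp add: abs_mult mult_left_mono)
  qed
  have i: "integrable lborel (\<lambda>s. c n * (ml \<alpha> (ev n) (t - s) * x s))" for n
    by (rule Bochner_Integration.integrable_bound[OF integrable_mult_right[OF ig, of "\<bar>c n\<bar>"]]) (use le in auto)
  have s: "summable (\<lambda>n. LINT s|lborel. \<bar>c n * (ml \<alpha> (ev n) (t - s) * x s)\<bar>)"
  proof (rule summable_comparison_test'[OF summable_mult2[OF c, of "LINT s|lborel. \<bar>gk \<alpha> (t - s) * x s\<bar>"]])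
    fix n
    have "(LINT s|lborel. \<bar>c n * (ml \<alpha> (ev n) (t - s) * x s)\<bar>) \<le> (LINT s|lborel. \<bar>c n\<bar> * \<bar>gk \<alpha> (t - s) * x s\<bar>)"
      by (rule integral_mono) (use i ig le in auto)
    then show "norm (LINT s|lborel. \<bar>c n * (ml \<alpha> (ev n) (t - s) * x s)\<bar>) \<le> \<bar>c n\<bar> * (LINT s|lborel. \<bar>gk \<alpha> (t - s) * x s\<bar>)"
      by (simp add: integral_nonneg_AE)
  qed
  note ser = integrable_series[of lborel, OF i s]
  have e: "(\<Sum>n. c n * (ml \<alpha> (ev n) (t - s) * x s)) = kern c (t - s) * x s" for s
    unfolding kern_def using suminf_mult2[OF summable_kern[OF c], of "t - s" "x s"] by (simp add: mult.assoc)
  show "cnv_exists (kern c) x t" using ser(2) by (simp add: cnv_exists_def e)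
  show "(\<lambda>n. c n * cnv (ml \<alpha> (ev n)) x t) sums cnv (kern c) x t" using ser(3) by (simp add: cnv_def e)
qed

text \<open>The overdetermination condition is \<open>Z + K * f = g\<close>; convolution with \<open>gk (1 - \<alpha>)\<close> turns \<open>K\<close>
  into \<open>N - 1 * L\<close>, where \<open>N = \<parallel>h\<parallel>\<^sup>2\<close>.\<close>

definition K where "K = kern (\<lambda>n. (b n)\<^sup>2)"
definition L where "L = kern (\<lambda>n. ev n * (b n)\<^sup>2)"
definition Lab where "Lab = kern (\<lambda>n. ev n * (a n * b n))"
definition Z where "Z t = (\<Sum>n. a n * b n * ml0 \<alpha> (ev n) t)"
definition N where "N = (\<Sum>n. (b n)\<^sup>2)"
definition A0 where "A0 = (\<Sum>n. ev n * (a n * b n))"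

lemmas causal_loc_K = causal_loc_kern[OF summable_bb, folded K_def]
  and causal_loc_L = causal_loc_kern[OF summable_ev_bb, folded L_def]
  and causal_loc_Lab = causal_loc_kern[OF summable_ev_ab, folded Lab_def]

lemma N_pos: "0 < N"
proof -
  have hc: "continuous_on {0..l} h" using h_adm by (simp add: admissible_def)
  have "(\<lambda>n. b n * b n) sums integral {0..l} (\<lambda>x. h x * h x)" by (rule parseval[OF h_adm hc])
  then have "N = integral {0..l} (\<lambda>x. h x * h x)" by (simp add: N_def sums_iff power2_eq_square)
  moreover have "integral {0..l} (\<lambda>x. h x * h x) \<noteq> 0"
    using integral_eq_0_iff[of 0 l "\<lambda>x. h x * h x"] hc l_pos h_nz by (auto simp: continuous_on_mult)
  moreover have "0 \<le> N" unfolding N_def using summable_bb by (intro suminf_nonneg) (auto simp: power_abs[symmetric])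
  ultimately show ?thesis by simp
qed

lemma ml0_eq': "ml0 \<alpha> (ev n) t = unit_step t - ev n * cnv unit_step (ml \<alpha> (ev n)) t"
  by (rule ml0_eq[OF \<alpha> ev_nonneg])

text \<open>Summed over the modes, \<open>ml0_eq\<close> splits off the constant
  \<open>\<Sum>n. c n\<close>; what remains is an integral whose kernel has one more factor
  \<open>ev n\<close>.\<close>

lemma cnv_gk_kern:
  assumes c: "summable (\<lambda>n. \<bar>ev n * c n\<bar>)"
  shows "cnv (gk (1 - \<alpha>)) (kern c) t = (\<Sum>n. c n) * unit_step t - cnv unit_step (kern (\<lambda>n. ev n * c n)) t"
proof -
  have c': "summable (\<lambda>n. \<bar>c n\<bar>)" by (rule summable_drop_ev[OF c])
  have p: "0 < 1 - \<alpha>" using \<alpha> by simp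
  have ex1: "cnv_exists (gk \<alpha>) (gk (1 - \<alpha>)) t" by (rule cnv_gk(1)[OF \<alpha>(1) p])
  have ex2: "cnv_exists (gk \<alpha>) unit_step t" using cnv_gk(1)[of \<alpha> 1 t] \<alpha> by (simp add: gk_one)
  have m: "unit_step \<in> borel_measurable borel" by (rule causal_loc_measurable[OF causal_loc_one])
  have s1: "(\<lambda>n. c n * ml0 \<alpha> (ev n) t) sums cnv (gk (1 - \<alpha>)) (kern c) t"
    using cnv_kern[OF c' borel_measurable_gk ex1] by (simp add: ml0_def cnv_commute[of _ "gk (1 - \<alpha>)"])
  have s2: "(\<lambda>n. ev n * c n * cnv unit_step (ml \<alpha> (ev n)) t) sums cnv unit_step (kern (\<lambda>n. ev n * c n)) t"
    using cnv_kern[OF c m ex2] by (simp add: cnv_commute[of _ unit_step])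
  have "(\<lambda>n. c n * unit_step t - ev n * c n * cnv unit_step (ml \<alpha> (ev n)) t) sums
    ((\<Sum>n. c n) * unit_step t - cnv unit_step (kern (\<lambda>n. ev n * c n)) t)"
    by (rule sums_diff[OF sums_mult2[OF summable_sums[OF summable_rabs_cancel[OF c']]] s2])
  moreover have "c n * unit_step t - ev n * c n * cnv unit_step (ml \<alpha> (ev n)) t = c n * ml0 \<alpha> (ev n) t" for n
    by (simp add: ml0_eq' algebra_simps)
  ultimately have "(\<lambda>n. c n * ml0 \<alpha> (ev n) t) sums
    ((\<Sum>n. c n) * unit_step t - cnv unit_step (kern (\<lambda>n. ev n * c n)) t)" by simp
  from sums_unique2[OF s1 this] show ?thesis .
qed

lemma cnv_gk_K: "cnv (gk (1 - \<alpha>)) K t = N * unit_step t - cnv unit_step L t"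
  unfolding K_def L_def N_def by (rule cnv_gk_kern[OF summable_ev_bb])

text \<open>The mode \<open>a\<^sub>n b\<^sub>n\<close> contributes \<open>a\<^sub>n b\<^sub>n (1 - ml0)\<close>, the integral of \<open>\<lambda>\<^sub>n a\<^sub>n b\<^sub>n ml\<close>.\<close>

lemma Z_eq: "0 < t \<Longrightarrow> Z t = g 0 - cnv unit_step Lab t"
proof -
  assume t: "0 < t"
  have m: "unit_step \<in> borel_measurable borel" by (rule causal_loc_measurable[OF causal_loc_one])
  have ex2: "cnv_exists (gk \<alpha>) unit_step t" using cnv_gk(1)[of \<alpha> 1 t] \<alpha> by (simp add: gk_one)
  have s2: "(\<lambda>n. ev n * (a n * b n) * cnv unit_step (ml \<alpha> (ev n)) t) sums cnv unit_step Lab t"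
    using cnv_kern[OF summable_ev_ab m ex2] by (simp add: Lab_def cnv_commute[of _ unit_step])
  have "(\<lambda>n. a n * b n - ev n * (a n * b n) * cnv unit_step (ml \<alpha> (ev n)) t) sums (g 0 - cnv unit_step Lab t)"
    by (rule sums_diff[OF compat s2])
  moreover have "a n * b n - ev n * (a n * b n) * cnv unit_step (ml \<alpha> (ev n)) t = a n * b n * ml0 \<alpha> (ev n) t" for n
    using t by (simp add: ml0_eq' unit_step_def algebra_simps)
  ultimately show ?thesis by (simp add: Z_def sums_iff)
qed

text \<open>The function \<open>src\<close>, with its initial value and its density as arguments,
  because the uniqueness proof compares two sources.\<close>

definition source :: "real \<Rightarrow> (real \<Rightarrow> real) \<Rightarrow> real \<Rightarrow> real" where
  "source f0 w t = f0 * unit_step t + cnv unit_step w t"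

lemma causal_loc_source: "causal_loc w \<Longrightarrow> causal_loc (source f0 w)"
  unfolding source_def[abs_def] by (intro causal_loc_add causal_loc_cmult causal_loc_one causal_loc_cnv)

lemma source_bound: "causal_loc w \<Longrightarrow> t \<le> T \<Longrightarrow> \<bar>source f0 w t\<bar> \<le> \<bar>f0\<bar> + (LINT s|lborel. \<bar>truncate_at T w s\<bar>)"
proof -
  assume w: "causal_loc w" and t: "t \<le> T"
  interpret I: ibvp_data l p p' q ev X \<alpha> T \<phi> d\<phi> h dh w f0 by (rule ibvp_data[OF w])
  show ?thesis using I.src_le_C(1)[of t] I.C_mono[OF t] by (simp add: I.src_def source_def I.C_def)
qed

lemma source_cont: "causal_loc w \<Longrightarrow> continuous_on {0<..T} (source f0 w)"
proof -
  assume w: "causal_loc w"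
  interpret I: ibvp_data l p p' q ev X \<alpha> T \<phi> d\<phi> h dh w f0 by (rule ibvp_data[OF w])
  show ?thesis using I.src_cont by (simp add: I.src_def[abs_def] source_def[abs_def])
qed

lemma cnv_exists_source: "causal_loc w \<Longrightarrow> causal_loc k \<Longrightarrow> cnv_exists k (source f0 w) t"
proof -
  assume w: "causal_loc w" and k: "causal_loc k"
  interpret I: ibvp_data l p p' q ev X \<alpha> T \<phi> d\<phi> h dh w f0 by (rule ibvp_data[OF w])
  show ?thesis
  proof (rule cnv_exists_bounded(1)[OF k, where B = "I.C t"])
    show "\<bar>source f0 w s\<bar> \<le> I.C t" if "0 < s" "s < t" for s
      using I.src_le_C(1)[of s] I.C_mono[of s t] that by (simp add: I.src_def source_def)
  qed (use causal_loc_source[OF w] in \<open>auto simp: causal_loc_def\<close>)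
qed

text \<open>The uniqueness clause allows any solution that occurs in the inverse problem to be
  replaced by the series, for which the overdetermination integral is explicit.\<close>

lemma series_solution:
  assumes w: "causal_loc w" and f: "\<And>t. t \<in> {0<..T} \<Longrightarrow> f t = source f0 w t"
  obtains u where "ibvp_solution \<alpha> T l p q \<phi> h f u"
    "\<And>v. ibvp_solution \<alpha> T l p q \<phi> h f v \<Longrightarrow> \<forall>(t, x)\<in>Omega_closed T l. v t x = u t x"
    "\<And>t. t \<in> {0<..T} \<Longrightarrow> (\<integral>x. h x * u t x \<partial>lebesgue_on {0..l}) = Z t + cnv K (source f0 w) t"
    "(\<integral>x. h x * u 0 x \<partial>lebesgue_on {0..l}) = g 0"
proof -
  interpret I: ibvp_data l p p' q ev X \<alpha> T \<phi> d\<phi> h dh w f0 by (rule ibvp_data[OF w])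
  have src: "I.src = source f0 w" by (simp add: fun_eq_iff I.src_def source_def)
  have sol: "ibvp_solution \<alpha> T l p q \<phi> h f I.u" by (rule I.u_ibvp) (use f src in simp)
  have un: "\<forall>(t, x)\<in>Omega_closed T l. v t x = I.u t x" if "ibvp_solution \<alpha> T l p q \<phi> h f v" for v
    using I.ibvp_unique[OF that sol] by blast
  have od: "(\<integral>x. h x * I.u t x \<partial>lebesgue_on {0..l}) = Z t + cnv K (source f0 w) t" if t: "t \<in> {0<..T}" for t
  proof -
    have t0: "0 < t" and ti: "t \<in> {0..T}" using t by auto
    have m: "source f0 w \<in> borel_measurable borel" by (rule causal_loc_measurable[OF causal_loc_source[OF w]])
    have sK: "(\<lambda>n. (b n)\<^sup>2 * cnv (ml \<alpha> (ev n)) (source f0 w) t) sums cnv K (source f0 w) t"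
      unfolding K_def by (rule cnv_kern[OF summable_bb m cnv_exists_source[OF w causal_loc_gk[OF \<alpha>(1)]]])
    have "summable (\<lambda>n. a n * b n * ml0 \<alpha> (ev n) t)"
    proof (rule summable_comparison_test'[OF summable_ab])
      have "\<bar>ml0 \<alpha> (ev n) t\<bar> \<le> 1" for n
        using ml0_nonneg[OF \<alpha> ev_nonneg, of n t] ml0_le_1[OF \<alpha> ev_nonneg, of n t] by simp
      then show "norm (a n * b n * ml0 \<alpha> (ev n) t) \<le> \<bar>a n * b n\<bar>" for n
        using mult_left_mono[of "\<bar>ml0 \<alpha> (ev n) t\<bar>" 1 "\<bar>a n * b n\<bar>"] by (simp add: abs_mult)
    qed
    then have sZ: "(\<lambda>n. a n * b n * ml0 \<alpha> (ev n) t) sums Z t" unfolding Z_def by (rule summable_sums)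
    have "(\<lambda>n. a n * b n * ml0 \<alpha> (ev n) t + (b n)\<^sup>2 * cnv (ml \<alpha> (ev n)) (source f0 w) t) sums (Z t + cnv K (source f0 w) t)"
      by (rule sums_add[OF sZ sK])
    moreover have "a n * b n * ml0 \<alpha> (ev n) t + (b n)\<^sup>2 * cnv (ml \<alpha> (ev n)) (source f0 w) t = I.U n t * b n" for n
      unfolding I.U_eq[OF t0] src by (simp add: algebra_simps power2_eq_square)
    ultimately show ?thesis using I.u_overdetermination[OF ti] sums_unique2 by auto
  qed
  \<comment> \<open>At t = 0 causality makes both terms of the formula 0, so the value is taken from
    the compatibility condition instead.\<close>
  have z: "(\<integral>x. h x * I.u 0 x \<partial>lebesgue_on {0..l}) = g 0"
    using I.u_overdetermination[of 0] compat T_pos sums_unique2 by (simp add: I.U_nonpos) blast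
  show thesis by (rule that[OF sol un od z])
qed

text \<open>Convolution with the Abel kernel turns the first-kind operator into the integral of a
  second-kind operator, whose leading coefficient \<open>N\<close> is positive.\<close>

lemma cnv_gk_cnv_K:
  assumes x: "causal_loc x" and ex: "\<And>k. causal_loc k \<Longrightarrow> cnv_exists k (\<lambda>s. \<bar>x s\<bar>) t"
  shows "cnv (gk (1 - \<alpha>)) (cnv K x) t = cnv unit_step (\<lambda>s. N * x s - cnv L x s) t"
proof -
  have p: "0 < 1 - \<alpha>" using \<alpha> by simp
  note lg = causal_loc_gk[OF p]
  have "cnv (gk (1 - \<alpha>)) (cnv K x) t = cnv (cnv (gk (1 - \<alpha>)) K) x t"
    by (rule cnv_assoc_rev(1)[OF lg causal_loc_K x ex]) (intro causal_loc_cnv causal_loc_abs lg causal_loc_K)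
  also have "cnv (gk (1 - \<alpha>)) K = (\<lambda>s. N * unit_step s - cnv unit_step L s)" by (auto simp: cnv_gk_K)
  also have "cnv (\<lambda>s. N * unit_step s - cnv unit_step L s) x t = cnv x (\<lambda>s. N * unit_step s - cnv unit_step L s) t" by (rule cnv_commute)
  also have "\<dots> = N * cnv x unit_step t - cnv x (cnv unit_step L) t"
  proof (subst cnv_diff_right(1))
    have "cnv_exists (cnv unit_step L) (\<lambda>s. \<bar>x s\<bar>) t" by (intro ex causal_loc_cnv causal_loc_one causal_loc_L)
    from cnv_exists_bound[OF this causal_loc_measurable causal_loc_measurable, of "cnv unit_step L" x]
    have "cnv_exists (cnv unit_step L) x t"
      using x causal_loc_L by (auto intro: causal_loc_cnv causal_loc_one simp: abs_mult)
    then show "cnv_exists x (cnv unit_step L) t" by (rule cnv_exists_commute)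
    show "cnv_exists x (\<lambda>s. N * unit_step s) t"
      by (intro cnv_exists_cmult_right cnv_exists_commute[OF cnv_one(2)[OF x]])
  qed (simp add: cnv_cmult_right)
  also have "\<dots> = N * cnv unit_step x t - cnv unit_step (cnv L x) t"
  proof -
    have "cnv x L = cnv L x" by (rule ext) (rule cnv_commute)
    then have "cnv x (cnv unit_step L) t = cnv unit_step (cnv L x) t" using cnv_one_commute[OF x causal_loc_L, of t] by simp
    then show ?thesis using cnv_commute[of x unit_step t] by simp
  qed
  also have "\<dots> = cnv unit_step (\<lambda>s. N * x s - cnv L x s) t"
  proof -
    have "cnv unit_step (\<lambda>s. N * x s - cnv L x s) t = cnv unit_step (\<lambda>s. N * x s) t - cnv unit_step (cnv L x) t"
      by (rule cnv_diff_right(1)[OF cnv_one(2)[OF causal_loc_cmult[OF x]] cnv_one(2)[OF causal_loc_cnv[OF causal_loc_L x]]])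
    then show ?thesis by (simp add: cnv_cmult_right)
  qed
  finally show ?thesis .
qed

section \<open>Uniqueness of the source\<close>

lemma cnv_exists_source_abs: "causal_loc w \<Longrightarrow> causal_loc k \<Longrightarrow> cnv_exists k (\<lambda>s. \<bar>source f0 w s\<bar>) t"
proof -
  assume w: "causal_loc w" and k: "causal_loc k"
  have [measurable]: "source f0 w \<in> borel_measurable borel" "k \<in> borel_measurable borel"
    using causal_loc_source[OF w] k by (auto simp: causal_loc_def)
  have [measurable]: "(\<lambda>s. \<bar>source f0 w s\<bar>) \<in> borel_measurable borel" by measurable
  show ?thesis
    by (rule cnv_exists_bound[OF cnv_exists_source[OF w k, of f0 t]]) simp_all
qed

text \<open>The difference of the two sources satisfies a homogeneous second-kind equation with
  kernel \<open>1 / N * L\<close>, almost everywhere at first.\<close>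

lemma source_unique:
  assumes w: "causal_loc w" and v: "causal_loc v"
    and eq: "\<And>t. t \<in> {0<..T} \<Longrightarrow> cnv K (source f0 w) t = cnv K (source f1 v) t"
    and t: "t \<in> {0<..T}"
  shows "source f0 w t = source f1 v t"
proof -
  define u where "u s = w s - v s" for s
  define c where "c = f0 - f1"
  have u: "causal_loc u" unfolding u_def[abs_def] by (rule causal_loc_diff[OF w v])
  have d: "source c u = (\<lambda>s. source f0 w s - source f1 v s)"
  proof
    fix s
    have "cnv unit_step u s = cnv unit_step w s - cnv unit_step v s"
      unfolding u_def[abs_def] by (intro cnv_diff_right cnv_one(2) w v)
    then show "source c u s = source f0 w s - source f1 v s" by (simp add: source_def c_def algebra_simps)
  qed
  let ?d = "source c u"
  note ld = causal_loc_source[OF u, of c]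
  have Kd: "cnv K ?d t = 0" if "t \<in> {0<..T}" for t
    unfolding d using eq[OF that]
    by (subst cnv_diff_right(1)) (auto intro: cnv_exists_source w v causal_loc_K)
  have "cnv unit_step (\<lambda>s. N * ?d s - cnv L ?d s) t = 0" if t: "0 < t" "t \<le> T" for t
  proof -
    have "cnv (gk (1 - \<alpha>)) (cnv K ?d) t = 0"
    proof -
      have "cnv (gk (1 - \<alpha>)) (cnv K ?d) t = cnv (gk (1 - \<alpha>)) (\<lambda>s. 0) t"
        by (rule cnv_cong(1))
           (use t Kd causal_loc_nonpos[OF causal_loc_cnv[OF causal_loc_K ld]] in \<open>auto simp: gk_def\<close>)
      then show ?thesis by (simp add: cnv_def)
    qed
    then show ?thesis using cnv_gk_cnv_K[OF ld cnv_exists_source_abs[OF u], of t] by simp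
  qed
  then have ae: "AE t in lborel. t < T \<longrightarrow> N * ?d t - cnv L ?d t = 0"
    by (intro cnv_one_eq_zero_AE causal_loc_diff causal_loc_cmult causal_loc_cnv causal_loc_L ld) auto
  \<comment> \<open>The right-hand side \<open>e\<close> of the equation agrees with the difference
    almost everywhere and hence satisfies the equation at every point up to \<open>T\<close>, as
    \<open>volterra_unique\<close> demands.\<close>
  define e where "e = cnv (\<lambda>s. 1 / N * L s) ?d"
  have lL: "causal_loc (\<lambda>s. 1 / N * L s)" by (rule causal_loc_cmult[OF causal_loc_L])
  have le: "causal_loc e" unfolding e_def by (rule causal_loc_cnv[OF lL ld])
  have e_eq: "e s = 1 / N * cnv L ?d s" for s
    unfolding e_def cnv_commute[of _ ?d] by (rule cnv_cmult_right)
  have aed: "AE t in lborel. t \<le> T \<longrightarrow> ?d t = e t"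
    using ae AE_lborel_singleton[of T]
  proof eventually_elim
    case (elim t)
    then show ?case using N_pos by (auto simp: e_eq field_simps)
  qed
  have fix_e: "e t = cnv (\<lambda>s. 1 / N * L s) e t" if "t \<le> T" for t
    unfolding e_def[THEN fun_cong, of t] by (rule cnv_AE_cong[OF lL ld le aed that])
  define B where "B = (\<bar>c\<bar> + (LINT s|lborel. \<bar>truncate_at T u s\<bar>)) * (LINT s|lborel. \<bar>truncate_at T (\<lambda>s. 1 / N * L s) s\<bar>)"
  have e_bd: "\<bar>e t\<bar> \<le> B" if t: "0 < t" "t \<le> T" for t
  proof -
    have nn: "0 \<le> \<bar>c\<bar> + (LINT s|lborel. \<bar>truncate_at T u s\<bar>)" by (intro add_nonneg_nonneg integral_nonneg_AE) auto
    have "\<bar>e t\<bar> \<le> (\<bar>c\<bar> + (LINT s|lborel. \<bar>truncate_at T u s\<bar>)) * (LINT s|lborel. \<bar>truncate_at t (\<lambda>s. 1 / N * L s) s\<bar>)"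
      unfolding e_def
    proof (rule cnv_exists_bounded(2)[OF lL causal_loc_measurable[OF ld] causal_loc_nonpos[OF ld]])
      show "\<bar>?d s\<bar> \<le> \<bar>c\<bar> + (LINT s|lborel. \<bar>truncate_at T u s\<bar>)" if "0 < s" "s < t" for s
        using source_bound[OF u, of s c] that t by simp
    qed
    also have "\<dots> \<le> B" unfolding B_def
    proof (rule mult_left_mono[OF _ nn])
      show "(LINT s|lborel. \<bar>truncate_at t (\<lambda>s. 1 / N * L s) s\<bar>) \<le> (LINT s|lborel. \<bar>truncate_at T (\<lambda>s. 1 / N * L s) s\<bar>)"
        by (rule integral_mono; (intro integrable_abs causal_loc_integrable lL)?) (use t in \<open>simp add: truncate_at_def\<close>)
    qed
    finally show ?thesis .
  qed
  have ez: "e t = 0" if "0 < t" "t \<le> T" for t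
    by (rule volterra_unique[OF lL causal_loc_measurable[OF le] causal_loc_nonpos[OF le] e_bd fix_e that]) auto
  have ed: "AE t in lborel. 0 < t \<and> t < T \<longrightarrow> c + cnv u unit_step t = 0"
    using aed
  proof eventually_elim
    case (elim t)
    then show ?case using ez[of t] by (auto simp: source_def unit_step_def cnv_commute[of u])
  qed
  have "continuous_on {0..T} (cnv u unit_step)"
  proof (rule continuous_on_cnv[OF u, where B = 1])
    show "continuous_on {0<..T} unit_step" by (rule continuous_on_eq[of _ "\<lambda>_. 1"]) (auto simp: unit_step_def)
  qed (use causal_loc_measurable[OF causal_loc_one] in \<open>auto simp: unit_step_def\<close>)
  then have "c + cnv u unit_step t = 0"
    by (intro continuous_AE_zero[OF T_pos _ ed] continuous_intros) (use t in auto)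
  then have "?d t = 0" using t by (simp add: source_def unit_step_def cnv_commute[of u])
  then show ?thesis by (simp add: d)
qed

text \<open>\<open>Y\<close> is the derivative of \<open>g - Z\<close>, and \<open>\<Phi>\<close> is the derivative of \<open>(\<partial>\<^sup>\<alpha> g + \<Sum>n. \<lambda>\<^sub>n \<phi>\<^sub>n h\<^sub>n E\<^sub>n) / N\<close>.\<close>

definition G1 where "G1 s = g1 0 * unit_step s + cnv unit_step w2 s"
definition Y where "Y s = G1 s + Lab s"
definition M2 where "M2 s = (\<Sum>n. ev n * (ev n * (a n * b n)) * ml \<alpha> (ev n) s)"

lemma causal_loc_G1: "causal_loc G1"
  unfolding G1_def[abs_def] by (intro causal_loc_add causal_loc_cmult causal_loc_one causal_loc_cnv w2)

lemma causal_loc_Y: "causal_loc Y"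
  unfolding Y_def[abs_def] by (intro causal_loc_add causal_loc_G1 causal_loc_Lab)

text \<open>The numbers \<open>ev n * (ev n * (a n * b n))\<close> need not be summable. One factor
  \<open>ev n\<close> is absorbed by \<open>cnv_one_ml_bound\<close>, so the L^1 norms are at most
  \<open>\<bar>ev n * (a n * b n)\<bar>\<close>.\<close>

lemma
  shows causal_loc_M2: "causal_loc M2"
    and cnv_one_M2: "0 < t \<Longrightarrow> (\<lambda>n. ev n * (ev n * (a n * b n)) * cnv unit_step (ml \<alpha> (ev n)) t) sums cnv unit_step M2 t"
proof -
  let ?f = "\<lambda>n s. ev n * (ev n * (a n * b n)) * ml \<alpha> (ev n) s"
  note lm = causal_loc_ml[OF \<alpha> ev_nonneg]
  have f: "causal_loc (?f n)" for n by (rule causal_loc_cmult[OF lm])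
  have s: "summable (\<lambda>n. LINT s|lborel. \<bar>truncate_at t (?f n) s\<bar>)" for t
  proof (rule summable_comparison_test'[OF summable_ev_ab])
    fix n
    have "\<bar>truncate_at t (?f n) s\<bar> = \<bar>ev n * (a n * b n)\<bar> * (ev n * truncate_at t (ml \<alpha> (ev n)) s)" for s
      using ev_nonneg[of n] ml_bounds(1)[of n s] by (simp add: truncate_at_def abs_mult)
    then have "(LINT s|lborel. \<bar>truncate_at t (?f n) s\<bar>) = \<bar>ev n * (a n * b n)\<bar> * (ev n * cnv unit_step (ml \<alpha> (ev n)) t)"
      by (simp add: cnv_one(1)[OF lm])
    also have "\<dots> \<le> \<bar>ev n * (a n * b n)\<bar> * 1"
      by (intro mult_left_mono cnv_one_ml_bound[OF \<alpha> ev_nonneg]) simp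
    finally show "norm (LINT s|lborel. \<bar>truncate_at t (?f n) s\<bar>) \<le> \<bar>ev n * (a n * b n)\<bar>"
      by (simp add: integral_nonneg_AE)
  qed
  note ser = causal_loc_series[OF f s]
  show "causal_loc M2" using ser(1) by (simp add: M2_def[abs_def])
  show "0 < t \<Longrightarrow> (\<lambda>n. ev n * (ev n * (a n * b n)) * cnv unit_step (ml \<alpha> (ev n)) t) sums cnv unit_step M2 t"
    using ser(2)[of t] by (simp add: M2_def[abs_def] cnv_cmult_right)
qed

definition \<Phi> where "\<Phi> s = 1 / N * (g1 0 * gk (1 - \<alpha>) s + cnv (gk (1 - \<alpha>)) w2 s - M2 s)"

lemma causal_loc_\<Phi>: "causal_loc \<Phi>"
  unfolding \<Phi>_def[abs_def] using \<alpha>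
  by (intro causal_loc_cmult causal_loc_diff causal_loc_add causal_loc_gk causal_loc_cnv w2 causal_loc_M2) auto

text \<open>Convolving Y with the Abel kernel gives the fractional derivative of g plus the sum of
  \<open>ev n * (a n * b n) * ml0 \<alpha> (ev n) t\<close>. As t tends to 0 the first part vanishes
  and \<open>ml0\<close> tends to 1, whence the constant \<open>A0\<close>.\<close>

lemma Phi_integral: "0 < t \<Longrightarrow> N * (A0 / N * unit_step t + cnv unit_step \<Phi> t) = cnv (gk (1 - \<alpha>)) Y t"
proof -
  assume t: "0 < t"
  let ?g = "gk (1 - \<alpha>)"
  have p: "0 < 1 - \<alpha>" using \<alpha> by simp
  note lg = causal_loc_gk[OF p]
  have "cnv unit_step \<Phi> t = 1 / N * cnv unit_step (\<lambda>s. (g1 0 * ?g s + cnv ?g w2 s) - M2 s) t"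
    unfolding \<Phi>_def[abs_def] by (rule cnv_cmult_right)
  also have "cnv unit_step (\<lambda>s. (g1 0 * ?g s + cnv ?g w2 s) - M2 s) t = cnv unit_step (\<lambda>s. g1 0 * ?g s + cnv ?g w2 s) t - cnv unit_step M2 t"
    by (intro cnv_diff_right cnv_one(2) causal_loc_add causal_loc_cmult causal_loc_cnv lg w2 causal_loc_M2)
  also have "cnv unit_step (\<lambda>s. g1 0 * ?g s + cnv ?g w2 s) t = g1 0 * cnv unit_step ?g t + cnv unit_step (cnv ?g w2) t"
    by (subst cnv_add_right(1))
       (intro cnv_one(2) causal_loc_cmult lg, intro cnv_one(2) causal_loc_cnv lg w2, simp add: cnv_cmult_right)
  finally have e1: "N * cnv unit_step \<Phi> t = g1 0 * cnv unit_step ?g t + cnv unit_step (cnv ?g w2) t - cnv unit_step M2 t" using N_pos by simp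
  have exG: "cnv_exists ?g G1 t"
  proof -
    have "cnv_exists ?g (source (g1 0) w2) t" by (rule cnv_exists_source[OF w2 lg])
    then show ?thesis by (simp add: source_def[abs_def] G1_def[abs_def])
  qed
  have exO: "cnv_exists ?g (\<lambda>s. g1 0 * unit_step s) t"
    by (intro cnv_exists_cmult_right cnv_exists_commute[OF cnv_one(2)[OF lg]])
  have exw: "cnv_exists ?g (cnv unit_step w2) t"
    using cnv_exists_source[OF w2 lg, of 0] by (simp add: source_def[abs_def])
  have exL: "cnv_exists ?g Lab t"
    unfolding Lab_def
    by (intro cnv_exists_commute[OF cnv_exists_kern[OF summable_ev_ab]] cnv_gk \<alpha> p) simp
  have "cnv ?g Y t = cnv ?g G1 t + cnv ?g Lab t"
    unfolding Y_def[abs_def] by (rule cnv_add_right(1)[OF exG exL])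
  also have "cnv ?g G1 t = g1 0 * cnv ?g unit_step t + cnv ?g (cnv unit_step w2) t"
    unfolding G1_def[abs_def] by (subst cnv_add_right(1)[OF exO exw]) (simp add: cnv_cmult_right)
  also have "cnv ?g unit_step t = cnv unit_step ?g t" by (rule cnv_commute)
  also have "cnv ?g (cnv unit_step w2) t = cnv unit_step (cnv ?g w2) t" by (rule cnv_one_commute[OF lg w2])
  also have "cnv ?g Lab t = A0 * unit_step t - cnv unit_step M2 t"
  proof -
    have ex1: "cnv_exists (gk \<alpha>) ?g t" by (rule cnv_gk(1)[OF \<alpha>(1) p])
    have s1: "(\<lambda>n. ev n * (a n * b n) * ml0 \<alpha> (ev n) t) sums cnv ?g Lab t"
      using cnv_kern[OF summable_ev_ab borel_measurable_gk ex1] by (simp add: Lab_def ml0_def cnv_commute[of _ ?g])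
    have "(\<lambda>n. ev n * (a n * b n) * unit_step t - ev n * (ev n * (a n * b n)) * cnv unit_step (ml \<alpha> (ev n)) t) sums (A0 * unit_step t - cnv unit_step M2 t)"
      unfolding A0_def
      by (intro sums_diff sums_mult2 cnv_one_M2[OF t] summable_sums summable_rabs_cancel[OF summable_ev_ab])
    moreover have "ev n * (a n * b n) * unit_step t - ev n * (ev n * (a n * b n)) * cnv unit_step (ml \<alpha> (ev n)) t = ev n * (a n * b n) * ml0 \<alpha> (ev n) t" for n
      by (simp add: ml0_eq' algebra_simps)
    ultimately show ?thesis using s1 sums_unique2 by auto
  qed
  finally have "cnv ?g Y t = g1 0 * cnv unit_step ?g t + cnv unit_step (cnv ?g w2) t + (A0 * unit_step t - cnv unit_step M2 t)" .
  moreover have "N * (A0 / N * unit_step t + cnv unit_step \<Phi> t) = A0 * unit_step t + N * cnv unit_step \<Phi> t"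
    using N_pos by (simp add: distrib_left)
  ultimately show ?thesis using e1 by simp
qed

text \<open>The second-kind equation is solved for the density \<open>w\<close>, so that the source
  is absolutely continuous by construction. The way back to the first-kind equation is convolution
  with \<open>gk \<alpha>\<close>, which undoes \<open>gk (1 - \<alpha>)\<close> up to one
  integration.\<close>

lemma source_exists:
  obtains w where "causal_loc w" "\<And>t. t \<in> {0<..T} \<Longrightarrow> cnv K (source (A0 / N) w) t = cnv unit_step Y t"
proof -
  let ?k = "\<lambda>s. 1 / N * L s" and ?c = "A0 / N"
  have lk: "causal_loc ?k" by (rule causal_loc_cmult[OF causal_loc_L])
  have lb: "causal_loc (\<lambda>s. \<Phi> s + ?c * ?k s)" by (intro causal_loc_add causal_loc_\<Phi> causal_loc_cmult[OF lk])
  \<comment> \<open>With c = \<open>A0 / N\<close> and 1 the unit step, this is the derivative of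
    the equation c + 1 * w = c + 1 * \<Phi> + k * (c + 1 * w), the products of functions being
    convolutions.\<close>
  obtain w where w: "causal_loc w" "AE t in lborel. t \<le> T \<longrightarrow> w t = (\<Phi> t + ?c * ?k t) + cnv ?k w t"
    by (rule volterra_exists[OF lk lb]) blast
  let ?s = "source ?c w"
  note ls = causal_loc_source[OF w(1), of ?c]
  have eq: "?s t = ?c * unit_step t + cnv unit_step \<Phi> t + cnv ?k ?s t" if "t \<le> T" for t
  proof -
    have "cnv unit_step w t = cnv unit_step (\<lambda>t. (\<Phi> t + ?c * ?k t) + cnv ?k w t) t"
      by (rule cnv_AE_cong[OF causal_loc_one w(1) causal_loc_add[OF lb causal_loc_cnv[OF lk w(1)]] w(2) that])
    also have "\<dots> = cnv unit_step (\<lambda>t. \<Phi> t + ?c * ?k t) t + cnv unit_step (cnv ?k w) t"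
      by (intro cnv_add_right cnv_one(2) lb causal_loc_cnv lk w)
    also have "cnv unit_step (\<lambda>t. \<Phi> t + ?c * ?k t) t = cnv unit_step \<Phi> t + cnv unit_step (\<lambda>t. ?c * ?k t) t"
      by (intro cnv_add_right cnv_one(2) causal_loc_\<Phi> causal_loc_cmult[OF lk])
    also have "cnv unit_step (\<lambda>t. ?c * ?k t) t = ?c * cnv ?k unit_step t"
      using cnv_cmult_right[of unit_step ?c ?k t] by (simp only: cnv_commute[of unit_step ?k t])
    also have "cnv unit_step (cnv ?k w) t = cnv ?k (cnv unit_step w) t" by (rule cnv_one_commute[OF lk w(1), symmetric])
    finally have e: "cnv unit_step w t = cnv unit_step \<Phi> t + (?c * cnv ?k unit_step t + cnv ?k (cnv unit_step w) t)" by simp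
    have ex1: "cnv_exists ?k (\<lambda>s. ?c * unit_step s) t"
      by (intro cnv_exists_cmult_right cnv_exists_commute[OF cnv_one(2)[OF lk]])
    have ex2: "cnv_exists ?k (cnv unit_step w) t"
      using cnv_exists_source[OF w(1) lk, of 0] by (simp add: source_def[abs_def])
    have "cnv ?k ?s t = ?c * cnv ?k unit_step t + cnv ?k (cnv unit_step w) t"
      unfolding source_def[abs_def] cnv_add_right(1)[OF ex1 ex2] by (simp only: cnv_cmult_right)
    then show ?thesis using e by (simp add: source_def)
  qed
  have eq2: "N * ?s t - cnv L ?s t = cnv (gk (1 - \<alpha>)) Y t" if t: "0 < t" "t \<le> T" for t
  proof -
    have "cnv ?k ?s t = 1 / N * cnv L ?s t"
      unfolding cnv_commute[of _ ?s] by (rule cnv_cmult_right)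
    then have "N * cnv ?k ?s t = cnv L ?s t" using N_pos by simp
    moreover have "N * ?s t = N * (?c * unit_step t + cnv unit_step \<Phi> t) + N * cnv ?k ?s t"
      using eq[OF t(2)] by (simp only: distrib_left)
    ultimately show ?thesis using Phi_integral[OF t(1)] by simp
  qed
  have p: "0 < 1 - \<alpha>" using \<alpha> by simp
  note lg = causal_loc_gk[OF p]
  \<comment> \<open>The residual of the first-kind equation, to be shown 0 almost everywhere and
    then, by continuity, everywhere.\<close>
  let ?\<psi> = "\<lambda>t. cnv K ?s t - cnv unit_step Y t"
  have lKs: "causal_loc (cnv K ?s)" by (rule causal_loc_cnv[OF causal_loc_K ls])
  have lY: "causal_loc (cnv unit_step Y)" by (rule causal_loc_cnv[OF causal_loc_one causal_loc_Y])
  have l\<psi>: "causal_loc ?\<psi>" by (rule causal_loc_diff[OF lKs lY])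
  have abs: "(\<lambda>s. \<bar>gk \<beta> s\<bar>) = gk \<beta>" if "0 < \<beta>" for \<beta> using gk_nonneg[OF that] by auto
  have gg: "cnv (gk \<alpha>) (gk (1 - \<alpha>)) = unit_step"
  proof
    show "cnv (gk \<alpha>) (gk (1 - \<alpha>)) x = unit_step x" for x using cnv_gk(2)[of \<alpha> "1 - \<alpha>" x] \<alpha> by (simp add: gk_one)
  qed
  have z1: "cnv (gk (1 - \<alpha>)) ?\<psi> t = 0" if t: "0 < t" "t \<le> T" for t
  proof -
    have exK: "cnv_exists (gk (1 - \<alpha>)) (cnv K ?s) t"
      by (rule cnv_assoc_rev(2)[OF lg causal_loc_K ls cnv_exists_source_abs[OF w(1)]])
         (intro causal_loc_cnv causal_loc_abs lg causal_loc_K)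
    have exY: "cnv_exists (gk (1 - \<alpha>)) (cnv unit_step Y) t"
      using cnv_exists_source[OF causal_loc_Y lg, of 0] by (simp add: source_def[abs_def])
    have "cnv (gk (1 - \<alpha>)) ?\<psi> t = cnv (gk (1 - \<alpha>)) (cnv K ?s) t - cnv (gk (1 - \<alpha>)) (cnv unit_step Y) t"
      by (rule cnv_diff_right(1)[OF exK exY])
    also have "cnv (gk (1 - \<alpha>)) (cnv K ?s) t = cnv unit_step (\<lambda>s. N * ?s s - cnv L ?s s) t"
      by (rule cnv_gk_cnv_K[OF ls cnv_exists_source_abs[OF w(1)]])
    also have "\<dots> = cnv unit_step (cnv (gk (1 - \<alpha>)) Y) t"
    proof (rule causal_loc_cong_upto[OF _ _ eq2 t(2) causal_loc_one])
      show "causal_loc (\<lambda>s. N * ?s s - cnv L ?s s)"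
        by (intro causal_loc_diff causal_loc_cmult causal_loc_cnv ls causal_loc_L)
      show "causal_loc (cnv (gk (1 - \<alpha>)) Y)" by (rule causal_loc_cnv[OF lg causal_loc_Y])
    qed
    also have "\<dots> = cnv (gk (1 - \<alpha>)) (cnv unit_step Y) t" by (rule cnv_one_commute[OF lg causal_loc_Y, symmetric])
    finally show ?thesis by simp
  qed
  have z2: "cnv unit_step ?\<psi> t = 0" if t: "0 < t" "t \<le> T" for t
  proof -
    have "cnv_exists (cnv (\<lambda>s. \<bar>gk \<alpha> s\<bar>) (\<lambda>s. \<bar>gk (1 - \<alpha>) s\<bar>)) (\<lambda>s. \<bar>?\<psi> s\<bar>) t"
      unfolding abs[OF \<alpha>(1)] abs[OF p] gg by (rule cnv_one(2)[OF causal_loc_abs[OF l\<psi>]])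
    from cnv_assoc_rev(1)[OF causal_loc_gk[OF \<alpha>(1)] lg l\<psi> this]
    have "cnv unit_step ?\<psi> t = cnv (gk \<alpha>) (cnv (gk (1 - \<alpha>)) ?\<psi>) t" by (simp add: gg)
    also have "\<dots> = cnv (gk \<alpha>) (\<lambda>s. 0) t"
      by (rule cnv_cong(1))
         (use t z1 causal_loc_nonpos[OF causal_loc_cnv[OF lg l\<psi>]] in \<open>auto simp: gk_def\<close>)
    finally show ?thesis by (simp add: cnv_def)
  qed
  have "AE t in lborel. t < T \<longrightarrow> ?\<psi> t = 0" by (rule cnv_one_eq_zero_AE[OF l\<psi> z2])
  then have ae: "AE t in lborel. 0 < t \<and> t < T \<longrightarrow> ?\<psi> t = 0" by eventually_elim simp
  have c1: "continuous_on {0..T} (cnv K ?s)"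
    by (rule continuous_on_cnv[OF causal_loc_K causal_loc_measurable[OF ls] causal_loc_nonpos[OF ls] source_bound[OF w(1)] source_cont[OF w(1)]])
  have "continuous_on {0..T} (cnv Y unit_step)"
  proof (rule continuous_on_cnv[OF causal_loc_Y, where B = 1])
    show "continuous_on {0<..T} unit_step" by (rule continuous_on_eq[of _ "\<lambda>_. 1"]) (auto simp: unit_step_def)
  qed (use causal_loc_measurable[OF causal_loc_one] in \<open>auto simp: unit_step_def\<close>)
  moreover have "cnv Y unit_step = cnv unit_step Y" by (rule ext) (rule cnv_commute)
  ultimately have "continuous_on {0..T} ?\<psi>" by (intro continuous_on_diff c1) simp
  then have "?\<psi> t = 0" if "t \<in> {0<..T}" for t
    by (rule continuous_AE_zero[OF T_pos _ ae]) (use that in auto)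
  then have "\<And>t. t \<in> {0<..T} \<Longrightarrow> cnv K ?s t = cnv unit_step Y t" by simp
  with w(1) show thesis by (rule that)
qed

section \<open>The inverse problem\<close>

lemma g_eq: "t \<in> {0<..T} \<Longrightarrow> g t = Z t + cnv unit_step Y t"
proof -
  assume t: "t \<in> {0<..T}"
  have "cnv unit_step Y t = cnv unit_step G1 t + cnv unit_step Lab t"
    unfolding Y_def[abs_def] by (intro cnv_add_right cnv_one(2) causal_loc_G1 causal_loc_Lab)
  then show ?thesis using g_rep[of t] Z_eq[of t] t by (simp add: G1_def[abs_def])
qed

lemma inverse_problem_unique_solution:
  "\<exists>!f. f \<in> extensional {0..T} \<and> abs_continuous_on 0 T f \<and> solves_inverse_problem \<alpha> T l p q \<phi> h g f"
proof (rule ex_ex1I)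
  obtain w where w: "causal_loc w" "\<And>t. t \<in> {0<..T} \<Longrightarrow> cnv K (source (A0 / N) w) t = cnv unit_step Y t"
    by (rule source_exists) blast
  \<comment> \<open>Uniqueness is claimed for functions on \<open>[0, T]\<close>, so the values
    outside are fixed by the convention of \<open>extensional\<close>.\<close>
  define f where "f = restrict (\<lambda>t. A0 / N + cnv unit_step w t) {0..T}"
  have fs: "f t = source (A0 / N) w t" if "t \<in> {0<..T}" for t
    using that by (simp add: f_def source_def unit_step_def)
  obtain u where u: "ibvp_solution \<alpha> T l p q \<phi> h f u"
    "\<And>v. ibvp_solution \<alpha> T l p q \<phi> h f v \<Longrightarrow> \<forall>(t, x)\<in>Omega_closed T l. v t x = u t x"
    "\<And>t. t \<in> {0<..T} \<Longrightarrow> (\<integral>x. h x * u t x \<partial>lebesgue_on {0..l}) = Z t + cnv K (source (A0 / N) w) t"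
    "(\<integral>x. h x * u 0 x \<partial>lebesgue_on {0..l}) = g 0"
    by (rule series_solution[OF w(1) fs that])
  have od: "(\<integral>x. h x * u t x \<partial>lebesgue_on {0..l}) = g t" if "t \<in> {0..T}" for t
  proof (cases "t = 0")
    case False
    then have t: "t \<in> {0<..T}" using that by auto
    show ?thesis using u(3)[OF t] w(2)[OF t] g_eq[OF t] by simp
  qed (use u(4) in simp)
  have "solves_inverse_problem \<alpha> T l p q \<phi> h g f"
    unfolding solves_inverse_problem_def using u(1,2) od by blast
  moreover have "abs_continuous_on 0 T f"
    by (rule abs_continuous_cnv_one[OF w(1)]) (simp_all add: f_def)
  ultimately show "\<exists>f. f \<in> extensional {0..T} \<and> abs_continuous_on 0 T f \<and> solves_inverse_problem \<alpha> T l p q \<phi> h g f"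
    using f_def by (intro exI[of _ f]) simp
next
  \<comment> \<open>The solution supplied by \<open>solves_inverse_problem\<close> coincides with
    the series solution, so any such f satisfies the first-kind equation.\<close>
  have key: "\<exists>w. causal_loc w \<and> (\<forall>t\<in>{0..T}. f t = f 0 + cnv unit_step w t) \<and>
      (\<forall>t\<in>{0<..T}. cnv K (source (f 0) w) t = cnv unit_step Y t)"
    if ac: "abs_continuous_on 0 T f" and sol: "solves_inverse_problem \<alpha> T l p q \<phi> h g f" for f
  proof -
    obtain w where w: "causal_loc w" "\<And>t. t \<in> {0..T} \<Longrightarrow> f t = f 0 + cnv unit_step w t"
      by (rule abs_continuous_causal[OF T_pos ac]) blast
    have fs: "f t = source (f 0) w t" if "t \<in> {0<..T}" for t
    proof -
      have "f t = f 0 + cnv unit_step w t" by (rule w(2)) (use that in simp)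
      then show ?thesis using that by (simp add: source_def unit_step_def)
    qed
    obtain u where u: "ibvp_solution \<alpha> T l p q \<phi> h f u"
      "\<And>v. ibvp_solution \<alpha> T l p q \<phi> h f v \<Longrightarrow> \<forall>(t, x)\<in>Omega_closed T l. v t x = u t x"
      "\<And>t. t \<in> {0<..T} \<Longrightarrow> (\<integral>x. h x * u t x \<partial>lebesgue_on {0..l}) = Z t + cnv K (source (f 0) w) t"
      by (rule series_solution[OF w(1) fs that])
    obtain v where v: "ibvp_solution \<alpha> T l p q \<phi> h f v"
      "\<And>t. t \<in> {0..T} \<Longrightarrow> (\<integral>x. h x * v t x \<partial>lebesgue_on {0..l}) = g t"
      using sol unfolding solves_inverse_problem_def by blast
    have "cnv K (source (f 0) w) t = cnv unit_step Y t" if t: "t \<in> {0<..T}" for t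
    proof -
      have "(\<integral>x. h x * v t x \<partial>lebesgue_on {0..l}) = (\<integral>x. h x * u t x \<partial>lebesgue_on {0..l})"
      proof (rule Bochner_Integration.integral_cong[OF refl])
        fix x assume "x \<in> space (lebesgue_on {0..l})"
        then have "(t, x) \<in> Omega_closed T l" using t by (simp add: Omega_closed_def)
        then show "h x * v t x = h x * u t x" using u(2)[OF v(1)] by fastforce
      qed
      then show ?thesis using u(3)[OF t] v(2)[of t] g_eq[OF t] t by simp
    qed
    with w show ?thesis by blast
  qed
  fix f f' assume f: "f \<in> extensional {0..T} \<and> abs_continuous_on 0 T f \<and> solves_inverse_problem \<alpha> T l p q \<phi> h g f"
    and f': "f' \<in> extensional {0..T} \<and> abs_continuous_on 0 T f' \<and> solves_inverse_problem \<alpha> T l p q \<phi> h g f'"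
  obtain w where w: "causal_loc w" "\<And>t. t \<in> {0..T} \<Longrightarrow> f t = f 0 + cnv unit_step w t"
    "\<And>t. t \<in> {0<..T} \<Longrightarrow> cnv K (source (f 0) w) t = cnv unit_step Y t" using key f by blast
  obtain w' where w': "causal_loc w'" "\<And>t. t \<in> {0..T} \<Longrightarrow> f' t = f' 0 + cnv unit_step w' t"
    "\<And>t. t \<in> {0<..T} \<Longrightarrow> cnv K (source (f' 0) w') t = cnv unit_step Y t" using key f' by blast
  have eq: "f t = f' t" if t: "t \<in> {0<..T}" for t
  proof -
    have "source (f 0) w t = source (f' 0) w' t"
      by (rule source_unique[OF w(1) w'(1) _ t]) (simp add: w(3) w'(3))
    moreover have "f t = f 0 + cnv unit_step w t" "f' t = f' 0 + cnv unit_step w' t"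
      by (rule w(2) w'(2), use t in simp)+
    ultimately show ?thesis using t by (simp add: source_def unit_step_def)
  qed
  \<comment> \<open>So far the two functions agree for t > 0; the value at 0 follows by
    continuity.\<close>
  have fc: "continuous_on {0..T} (\<lambda>t. f t - f' t)"
    using f f' by (intro continuous_on_diff abs_continuous_on_continuous) auto
  have eq0: "f t - f' t = 0" if "t \<in> {0..T}" for t
    by (rule continuous_AE_zero[OF T_pos fc _ that]) (simp add: eq)
  show "f = f'"
  proof (rule extensionalityI[of f "{0..T}"])
    show "f t = f' t" if "t \<in> {0..T}" for t using eq0[OF that] by simp
  qed (use f f' in auto)
qed

end

theorem theorem2:
  fixes T l \<alpha> :: real
    and p q \<phi> h g :: "real \<Rightarrow> real"
    and ev :: "nat \<Rightarrow> real"
    and X :: "nat \<Rightarrow> real \<Rightarrow> real"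
  assumes "0 < T" and "0 < l" and "0 < \<alpha>" and "\<alpha> < 1"
    and "Ck_on 1 0 l p" and "\<forall>x\<in>{0..l}. 0 < p x"
    and "continuous_on {0..l} q" and "\<forall>x\<in>{0..l}. 0 \<le> q x"
    and "Ck_on 1 0 l \<phi>" and "\<phi> 0 = 0" and "\<phi> l = 0"
    and "Ck_on 1 0 l h" and "h 0 = 0" and "h l = 0" and "\<exists>x\<in>{0..l}. h x \<noteq> 0"
    and "ACn_on 2 0 T g"
    and "SL_eigensystem l p q ev X"
    and "(\<integral>x. \<phi> x * h x \<partial>lebesgue_on {0..l}) = g 0"
    and "(\<lambda>n. (\<integral>x. h x * X n x \<partial>lebesgue_on {0..l}) * (\<integral>x. \<phi> x * X n x \<partial>lebesgue_on {0..l})) sums g 0"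
  shows "\<exists>!f. f \<in> extensional {0..T} \<and> abs_continuous_on 0 T f \<and>
              solves_inverse_problem \<alpha> T l p q \<phi> h g f"
proof -
  obtain p' where p': "\<And>x. x \<in> {0..l} \<Longrightarrow> (p has_real_derivative p' x) (at x within {0..l})" "continuous_on {0..l} p'"
    by (rule Ck_on_1D[OF assms(5)]) blast
  interpret sturm_liouville l p p' q ev X
    by unfold_locales (use assms p' in auto)
  have adm: "\<exists>dv. admissible v dv" if v: "Ck_on 1 0 l v" "v 0 = 0" "v l = 0" for v
  proof -
    obtain dv where dv: "\<And>x. x \<in> {0..l} \<Longrightarrow> (v has_real_derivative dv x) (at x within {0..l})" "continuous_on {0..l} dv"
      by (rule Ck_on_1D[OF v(1)]) blast
    have "(v has_real_derivative dv x) (at x)" if "x \<in> {0<..<l}" for x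
      using dv(1)[of x] at_within_Icc_at[of 0 x l] that by simp
    then have "admissible v dv"
      unfolding admissible_def using dv(2) DERIV_continuous_on[OF dv(1)] v by blast
    then show ?thesis by blast
  qed
  obtain d\<phi> where d\<phi>: "admissible \<phi> d\<phi>" using adm assms by blast
  obtain dh where dh: "admissible h dh" using adm assms by blast
  obtain F where F: "\<forall>x\<in>{0..T}. F 0 x = g x"
    "\<forall>x\<in>{0..T}. (F 0 has_real_derivative F (Suc 0) x) (at x within {0..T})" "abs_continuous_on 0 T (F (Suc 0))"
    using assms(16) by (auto simp: ACn_on_def derivatives_on_def)
  obtain w2 where w2: "causal_loc w2" "\<And>t. t \<in> {0..T} \<Longrightarrow> F (Suc 0) t = F (Suc 0) 0 + cnv unit_step w2 t"
    by (rule abs_continuous_causal[OF assms(1) F(3)]) blast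
  let ?G1 = "\<lambda>s. F (Suc 0) 0 * unit_step s + cnv unit_step w2 s"
  have lG: "causal_loc ?G1"
    by (intro causal_loc_add causal_loc_cmult causal_loc_one causal_loc_cnv w2(1))
  have g_rep: "g t = g 0 + cnv unit_step ?G1 t" if t: "t \<in> {0..T}" for t
  proof -
    have "(F (Suc 0) has_integral F 0 t - F 0 0) {0..t}"
    proof (rule fundamental_theorem_of_calculus)
      fix x assume "x \<in> {0..t}"
      then have "(F 0 has_real_derivative F (Suc 0) x) (at x within {0..T})" using F(2) t by auto
      then have "(F 0 has_real_derivative F (Suc 0) x) (at x within {0..t})"
        by (rule DERIV_subset) (use t in auto)
      then show "(F 0 has_vector_derivative F (Suc 0) x) (at x within {0..t})"
        by (simp add: has_real_derivative_iff_has_vector_derivative)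
    qed (use t in simp)
    \<comment> \<open>At 0 the causal function vanishes while \<open>F (Suc 0) 0\<close> need not,
      so this point is exempted.\<close>
    then have "(?G1 has_integral F 0 t - F 0 0) {0..t}"
    proof (rule has_integral_spike_finite[of "{0}", rotated 2])
      fix x assume "x \<in> {0..t} - {0}"
      then have x: "x \<in> {0..T}" "0 < x" using t by auto
      show "?G1 x = F (Suc 0) x" using w2(2)[OF x(1)] x(2) by (simp add: unit_step_def)
    qed simp
    then have hk: "integral {0..t} ?G1 = g t - g 0" using F(1) t assms(1) by (simp add: integral_unique)
    have "set_integrable lborel {0..t} ?G1"
    proof -
      have "set_integrable lborel {0..t} (truncate_at t ?G1)"
        by (rule set_integrable_lborel[OF causal_loc_integrable[OF lG]]) simp
      moreover have "(\<lambda>s. indicator {0..t} s *\<^sub>R truncate_at t ?G1 s) = (\<lambda>s. indicator {0..t} s *\<^sub>R ?G1 s)"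
        by (auto simp: truncate_at_def indicator_def)
      ultimately show ?thesis unfolding set_integrable_def by simp
    qed
    then have "(LINT s:{0..t}|lborel. ?G1 s) = integral {0..t} ?G1" by (rule set_borel_integral_eq_integral(2))
    then show ?thesis using hk cnv_one_set_integral[OF lG, of t] by simp
  qed
  have co: "(\<integral>x. v x * X n x \<partial>lebesgue_on {0..l}) = coeff v n" if "admissible v dv" for v dv n
    using lebesgue_integral_continuous_Icc(2)[of 0 l "\<lambda>x. v x * X n x"] that X_cont
    by (simp add: coeff_def admissible_def continuous_on_mult mult.commute)
  have compat: "(\<lambda>n. coeff \<phi> n * coeff h n) sums g 0"
    using assms(19) by (simp add: co[OF d\<phi>] co[OF dh] mult.commute)
  interpret inverse_data l p p' q ev X \<alpha> T \<phi> d\<phi> h dh g "F (Suc 0)" w2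
    by unfold_locales (fact assms d\<phi> dh w2(1) g_rep compat)+
  show ?thesis by (rule inverse_problem_unique_solution)
qed

end
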